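(* Let $q\in[0,1)$, let $\{X_t\}_{t\ge0}$ be the canonical $q$-Brownian motion on the $q$-Fock space, with associated non-commutative probability space $(\mathcal{A},\varphi)$, let $\mathbb{X}^{2,S}$ be the Stratonovich product Lévy area above $X$ and $\mathbb{X}^S:=(X,\mathbb{X}^{2,S})$. Fix $\gamma\in(1/3,1/2)$. For all $0\le s<t$ and every adapted controlled biprocess $\mathbf{U}\in\mathbf{Q}_X([s,t])$, the rough integral satisfies $$\int_s^t\mathbf{U}_u\sharp\mathrm{d}\mathbb{X}^S_u=\lim_{|\Delta|\to0}\sum_{(t_i)\in\Delta}\frac12\big(\mathbf{U}_{t_i}+\mathbf{U}_{t_{i+1}}\big)\sharp\delta X_{t_it_{i+1}}\qquad\text{in }L^2(\varphi),$$ for any subdivision $\Delta$ of $[s,t]$ whose mesh $|\Delta|$ tends to $0$.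
   Context: Canonical $q$-Brownian motion: on the $q$-Fock space over $L^2(\mathbb{R}_+;\mathbb{C})$ (completion of $\mathbb{C}\Omega\oplus\bigoplus_{n\ge1}H^{\otimes n}$, $H=L^2(\mathbb{R}_+;\mathbb{C})$, for $\langle f_1\otimes\cdots\otimes f_n,g_1\otimes\cdots\otimes g_m\rangle_q=\mathbf{1}_{n=m}\sum_{\sigma\in S_n}q^{\mathrm{inv}(\sigma)}\prod_i\langle f_i,g_{\sigma(i)}\rangle$, where $\mathrm{inv}(\sigma)$ is the number of inversions), $X_t:=a(\mathbf{1}_{[0,t]})+a^\ast(\mathbf{1}_{[0,t]})$ with $a^\ast(f)$ the left creation operator and $a(f)$ its adjoint; $\mathcal{A}$ is the von Neumann algebra generated by $\{X_t\}_{t\ge0}$ and $\varphi=\langle\Omega,\cdot\,\Omega\rangle_q$ is the (faithful, tracial) vacuum state. $\|\cdot\|$ is the operator norm; $L^2(\varphi)$ is the completion of $\mathcal{A}$ for $\langle U,V\rangle=\varphi(UV^\ast)$. Notation: $\delta g_{st}:=g_t-g_s$. $\mathcal{A}_t$ is the operator-norm closure of the unital algebra generated by $\{X_s\}_{s\le t}$. $\hat\otimes$ is the projective tensor product (with projective norm, also denoted $\|\cdot\|$), $\mathcal{A}^{\hat\otimes3}=\mathcal{A}\hat\otimes\mathcal{A}\hat\otimes\mathcal{A}$. The symbol $\sharp$ denotes the continuous linear extensions of $(U_1\otimes U_2)\sharp Y:=U_1YU_2$, $\ Y\sharp(U_1\otimes U_2\otimes U_3):=(U_1YU_2)\otimes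 U_3$, $\ (U_1\otimes U_2\otimes U_3)\sharp Y:=U_1\otimes(U_2YU_3)$. A biprocess (resp. triprocess) is a map from an interval to $\mathcal{A}\hat\otimes\mathcal{A}$ (resp. $\mathcal{A}^{\hat\otimes3}$); it is adapted if its value at time $u$ lies in $\mathcal{A}_u\hat\otimes\mathcal{A}_u$ (resp. $\mathcal{A}_u^{\hat\otimes3}$). Hölder spaces, for $V=\mathcal{A}^{\hat\otimes n}$: $\mathcal{C}_1^\alpha(I;V)$ is the set of continuous $h:I\to V$ with $\sup_{u<v}\|\delta h_{uv}\|/|v-u|^\alpha<\infty$; $\mathcal{C}_2^\alpha(I;V)$ is the set of continuous $h:\{(u,v)\in I^2:u\le v\}\to V$ vanishing on the diagonal with $\sup_{u<v}\|h_{uv}\|/|v-u|^\alpha<\infty$. Adapted controlled biprocess: $\mathbf{Q}_X(I)$ is the set of adapted biprocesses $\mathbf{U}\in\mathcal{C}_1^\gamma(I;\mathcal{A}\hat\otimes\mathcal{A})$ with increments $\delta\mathbf{U}_{uv}=\delta X_{uv}\sharp\mathcal{U}^{X,1}_u+\mathcal{U}^{X,2}_u\sharp\delta X_{uv}+\mathbf{U}^\flat_{uv}$, $u<v\in I$, for some adapted triprocesses $\mathcal{U}^{X,1},\mathcal{U}^{X,2}\in\mathcal{C}_1^\gamma(I;\mathcal{A}^{\hat\otimes3})$ and some $\mathbf{U}^\flat\in\mathcal{C}_2^{2\gamma}(I;\mathcal{A}\hat\otimes\mathcal{A})$. Stratonovich product Lévy area: with $X^n$ the linear interpolation of $X$ along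 the dyadic points $i/2^n$, $i\ge0$, and $\mathbb{X}^{2,n}_{st}[\mathbf{U}]:=\int_s^t(\mathbf{U}\sharp\delta X^n_{su})\,\mathrm{d}X^n_u$ (Lebesgue integral), $\mathbb{X}^{2,S}_{st}[\mathbf{U}]:=\lim_n\mathbb{X}^{2,n}_{st}[\mathbf{U}]$ in operator norm for $\mathbf{U}\in\mathcal{A}_s\hat\otimes\mathcal{A}_s$. It is known that the limit exists, that for every $T>0$ and $\gamma'\in(0,1/2)$ one has $\sup_{0\le s<t\le T}\sup_{\mathbf{U}\neq0}\|\mathbb{X}^{2,n}_{st}[\mathbf{U}]-\mathbb{X}^{2,S}_{st}[\mathbf{U}]\|/(|t-s|^{2\gamma'}\|\mathbf{U}\|)\to0$, that $\|\mathbb{X}^{2,S}_{st}[\mathbf{U}]\|\le c_{\gamma',T}|t-s|^{2\gamma'}\|\mathbf{U}\|$ for $\mathbf{U}\in\mathcal{A}_s\hat\otimes\mathcal{A}_s$, $0\le s<t\le T$, with $\mathbb{X}^{2,S}_{st}[\mathbf{U}]\in\mathcal{A}_t$, and that for $s<u<t$, $\mathbb{X}^{2,S}_{st}[\mathbf{U}]-\mathbb{X}^{2,S}_{su}[\mathbf{U}]-\mathbb{X}^{2,S}_{ut}[\mathbf{U}]=(\mathbf{U}\sharp\delta X_{su})\,\delta X_{ut}$. Rough integral: for $\mathbf{U}\in\mathbf{Q}_X([s,t])$ with increments $\delta\mathbf{U}_{uv}=\delta X_{uv}\sharp\mathcal{U}^{X,1}_u+\mathcal{U}^{X,2}_u\sharp\delta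 X_{uv}+\mathbf{U}^\flat_{uv}$, $s\le u<v\le t$ (where $\mathcal{U}^{X,1},\mathcal{U}^{X,2}\in\mathcal{C}_1^\gamma([s,t];\mathcal{A}^{\hat\otimes3})$ are adapted triprocesses and $\mathbf{U}^\flat\in\mathcal{C}_2^{2\gamma}([s,t];\mathcal{A}\hat\otimes\mathcal{A})$), $\int_s^t\mathbf{U}_u\sharp\mathrm{d}\mathbb{X}^S_u$ is the limit in $\mathcal{A}$ (operator norm), which is known to exist, of the corrected Riemann sums $$\sum_{t_i\in\Delta}\Big\{\mathbf{U}_{t_i}\sharp\delta X_{t_it_{i+1}}+[\mathbb{X}^{2,S}_{t_it_{i+1}}\times\mathrm{Id}](\mathcal{U}^{X,1}_{t_i})+[\mathrm{Id}\times\mathbb{X}^{2,S,\ast}_{t_it_{i+1}}](\mathcal{U}^{X,2}_{t_i})\Big\}$$ as the mesh of the subdivision $\Delta$ of $[s,t]$ tends to $0$, where $[\mathbb{X}^{2,S}_{uv}\times\mathrm{Id}](U_1\otimes U_2\otimes U_3):=\mathbb{X}^{2,S}_{uv}[U_1\otimes U_2]\,U_3$, $\ [\mathrm{Id}\times\mathbb{X}^{2,S,\ast}_{uv}](U_1\otimes U_2\otimes U_3):=U_1\,\mathbb{X}^{2,S,\ast}_{uv}[U_2\otimes U_3]$ and $\mathbb{X}^{2,S,\ast}_{uv}[U\otimes V]:=\big(\mathbb{X}^{2,S}_{uv}[V^\ast\otimes U^\ast]\big)^\ast$ (extended by linearity and continuity). *)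

theory Defs
  imports "HOL-Analysis.Analysis" "HOL-Library.Function_Algebras"
begin

section \<open>Complex Hilbert spaces and operators\<close>

text \<open>Inner products are antilinear in the first and linear in the second argument, so that
  \<open>U \<mapsto> \<langle>\<Omega>, U \<Omega>\<rangle>\<close> is linear.  The norm is the one inherited from \<^class>\<open>real_inner\<close>.\<close>

class complex_hilbert_space = real_inner + complete_space +
  fixes scaleC :: "complex \<Rightarrow> 'a \<Rightarrow> 'a" (infixr "*\<^sub>C" 75)
    and cinner :: "'a \<Rightarrow> 'a \<Rightarrow> complex"
  assumes scaleC_add_right: "c *\<^sub>C (x + y) = c *\<^sub>C x + c *\<^sub>C y"
    and scaleC_add_left: "(c + d) *\<^sub>C x = c *\<^sub>C x + d *\<^sub>C x"
    and scaleC_scaleC: "c *\<^sub>C d *\<^sub>C x = (c * d) *\<^sub>C x"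
    and scaleC_of_real: "complex_of_real r *\<^sub>C x = r *\<^sub>R x"
    and cinner_add_right: "cinner x (y + z) = cinner x y + cinner x z"
    and cinner_scaleC_right: "cinner x (c *\<^sub>C y) = c * cinner x y"
    and cinner_cnj: "cinner y x = cnj (cinner x y)"
    and Re_cinner: "Re (cinner x y) = inner x y"
begin

subclass banach ..

end

instantiation complex :: complex_hilbert_space
begin

definition "scaleC (c::complex) (x::complex) = c * x"
definition "cinner (x::complex) (y::complex) = cnj x * y"

instance
  by standard (simp_all add: scaleC_complex_def cinner_complex_def algebra_simps
      scaleR_conv_of_real inner_complex_def)

end

lemma cinner_self: "cinner x x = complex_of_real ((norm x)\<^sup>2)"
  for x :: "'h::complex_hilbert_space"
proof (rule complex_eqI)
  show "Re (cinner x x) = Re (complex_of_real ((norm x)\<^sup>2))"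
    by (simp add: Re_cinner power2_norm_eq_inner)
  have "Im (cinner x x) = - Im (cinner x x)"
    by (subst cinner_cnj) simp
  then show "Im (cinner x x) = Im (complex_of_real ((norm x)\<^sup>2))"
    by simp
qed

lemma cinner_scaleC_left: "cinner (c *\<^sub>C x) y = cnj c * cinner x y"
  for x :: "'h::complex_hilbert_space"
  by (metis cinner_cnj cinner_scaleC_right complex_cnj_mult)

lemma norm_scaleC: "norm (c *\<^sub>C x) = cmod c * norm x"
  for x :: "'h::complex_hilbert_space"
proof -
  have "complex_of_real ((norm (c *\<^sub>C x))\<^sup>2) = cinner (c *\<^sub>C x) (c *\<^sub>C x)"
    by (rule cinner_self[symmetric])
  also have "\<dots> = (c * cnj c) * cinner x x"
    by (simp add: cinner_scaleC_left cinner_scaleC_right)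
  also have "\<dots> = complex_of_real ((cmod c * norm x)\<^sup>2)"
    by (simp add: cinner_self complex_norm_square[symmetric] power_mult_distrib)
  finally have "(norm (c *\<^sub>C x))\<^sup>2 = (cmod c * norm x)\<^sup>2"
    by (simp only: of_real_eq_iff)
  then show ?thesis
    by (simp add: power2_eq_iff_nonneg)
qed

text \<open>Library bounded operators are only real-linear; the complex-linear ones form \<open>cops\<close>.
  The norm is the operator norm.\<close>

type_synonym 'h oper = "'h \<Rightarrow>\<^sub>L 'h"

definition cops :: "'h::complex_hilbert_space oper set" where
  "cops = {T. \<forall>c x. blinfun_apply T (c *\<^sub>C x) = c *\<^sub>C blinfun_apply T x}"

lift_definition op_scaleC :: "complex \<Rightarrow> 'h::complex_hilbert_space oper \<Rightarrow> 'h oper"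
  is "\<lambda>c T x. c *\<^sub>C T x"
proof -
  fix c :: complex and T :: "'h \<Rightarrow> 'h"
  assume "bounded_linear T"
  moreover have "bounded_linear (\<lambda>x::'h. c *\<^sub>C x)"
  proof (rule bounded_linear_intro)
    show "c *\<^sub>C (x + y) = c *\<^sub>C x + c *\<^sub>C y" for x y :: 'h
      by (rule scaleC_add_right)
    show "c *\<^sub>C (r *\<^sub>R x) = r *\<^sub>R (c *\<^sub>C x)" for r and x :: 'h
      by (simp add: scaleC_of_real[symmetric] scaleC_scaleC mult.commute)
    show "norm (c *\<^sub>C x) \<le> norm x * cmod c" for x :: 'h
      by (simp add: norm_scaleC mult.commute)
  qed
  ultimately show "bounded_linear (\<lambda>x. c *\<^sub>C T x)"
    by (rule bounded_linear_compose[rotated])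
qed

definition adj :: "'h::complex_hilbert_space oper \<Rightarrow> 'h oper" where
  "adj T = (THE S. \<forall>x y. cinner (blinfun_apply T x) y = cinner x (blinfun_apply S y))"

definition commutant :: "'h::complex_hilbert_space oper set \<Rightarrow> 'h oper set" where
  "commutant M = {T \<in> cops. \<forall>S\<in>M. T o\<^sub>L S = S o\<^sub>L T}"

definition von_neumann_algebra :: "'h::complex_hilbert_space oper set \<Rightarrow> bool" where
  "von_neumann_algebra M \<longleftrightarrow> M \<subseteq> cops \<and> adj ` M \<subseteq> M \<and> commutant (commutant M) = M"

definition generated_von_neumann_algebra ::
    "'h::complex_hilbert_space oper set \<Rightarrow> 'h oper set" where
  "generated_von_neumann_algebra S = \<Inter> {M. von_neumann_algebra M \<and> S \<subseteq> M}"

inductive_set generated_algebra ::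
    "'h::complex_hilbert_space oper set \<Rightarrow> 'h oper set" for S where
  unit: "id_blinfun \<in> generated_algebra S"
| gen: "T \<in> S \<Longrightarrow> T \<in> generated_algebra S"
| add: "T \<in> generated_algebra S \<Longrightarrow> R \<in> generated_algebra S \<Longrightarrow> T + R \<in> generated_algebra S"
| scale: "T \<in> generated_algebra S \<Longrightarrow> op_scaleC c T \<in> generated_algebra S"
| comp: "T \<in> generated_algebra S \<Longrightarrow> R \<in> generated_algebra S \<Longrightarrow> T o\<^sub>L R \<in> generated_algebra S"


section \<open>The q-Fock space and the canonical q-Brownian motion\<close>

abbreviation half_line :: "real measure" where
  "half_line \<equiv> restrict_space lborel {0..}"

definition L2_half_line :: "(real \<Rightarrow> complex) set" where
  "L2_half_line =
     {f \<in> borel_measurable half_line. integrable half_line (\<lambda>x. (cmod (f x))\<^sup>2)}"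

definition L2_inner :: "(real \<Rightarrow> complex) \<Rightarrow> (real \<Rightarrow> complex) \<Rightarrow> complex" where
  "L2_inner f g = (\<integral>x. cnj (f x) * g x \<partial>half_line)"

definition inversions :: "nat \<Rightarrow> (nat \<Rightarrow> nat) \<Rightarrow> nat" where
  "inversions n \<sigma> = card {(i, j). i < j \<and> j < n \<and> \<sigma> j < \<sigma> i}"

definition q_inner ::
    "real \<Rightarrow> (real \<Rightarrow> complex) list \<Rightarrow> (real \<Rightarrow> complex) list \<Rightarrow> complex" where
  "q_inner q fs gs =
     (if length fs = length gs
      then \<Sum>\<sigma> | \<sigma> permutes {..<length fs}.
             complex_of_real (q ^ inversions (length fs) \<sigma>) *
             (\<Prod>i<length fs. L2_inner (fs ! i) (gs ! \<sigma> i))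
      else 0)"

text \<open>A Hilbert space completion is determined up to unitary equivalence, so instead of fixing a
  model we say when a Hilbert space \<open>'h\<close>, with \<open>tens [f1, \<dots>, fn]\<close> in the role of
  \<open>f1 \<otimes> \<dots> \<otimes> fn\<close> and \<open>tens []\<close> in that of \<open>\<Omega>\<close>, is the completion of the linear span of the
  tensors for \<open>\<langle>_, _\<rangle>_q\<close>.  Multilinearity of \<open>tens\<close> and its independence of the
  representatives of L2-classes are consequences of the inner product formula.  Such a space
  exists for every \<open>q\<close> with \<open>- 1 < q < 1\<close>, the form being positive (Bozejko and Speicher).\<close>

definition q_fock_space ::
    "real \<Rightarrow> ((real \<Rightarrow> complex) list \<Rightarrow> 'h::complex_hilbert_space) \<Rightarrow> bool" where
  "q_fock_space q tens \<longleftrightarrow>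
     (\<forall>fs\<in>lists L2_half_line. \<forall>gs\<in>lists L2_half_line.
        cinner (tens fs) (tens gs) = q_inner q fs gs) \<and>
     closure {\<Sum>fs\<in>F. c fs *\<^sub>C tens fs | F c. finite F \<and> F \<subseteq> lists L2_half_line} = UNIV"

definition creation ::
    "((real \<Rightarrow> complex) list \<Rightarrow> 'h::complex_hilbert_space) \<Rightarrow> (real \<Rightarrow> complex) \<Rightarrow> 'h oper" where
  "creation tens f = (THE T. T \<in> cops \<and>
     (\<forall>fs\<in>lists L2_half_line. blinfun_apply T (tens fs) = tens (f # fs)))"

definition annihilation ::
    "((real \<Rightarrow> complex) list \<Rightarrow> 'h::complex_hilbert_space) \<Rightarrow> (real \<Rightarrow> complex) \<Rightarrow> 'h oper" where
  "annihilation tens f = adj (creation tens f)"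

definition q_brownian ::
    "((real \<Rightarrow> complex) list \<Rightarrow> 'h::complex_hilbert_space) \<Rightarrow> real \<Rightarrow> 'h oper" where
  "q_brownian tens t = annihilation tens (indicator {0..t}) + creation tens (indicator {0..t})"

definition vacuum_state ::
    "((real \<Rightarrow> complex) list \<Rightarrow> 'h::complex_hilbert_space) \<Rightarrow> 'h oper \<Rightarrow> complex" where
  "vacuum_state tens T = cinner (tens []) (blinfun_apply T (tens []))"

definition L2_state_norm ::
    "('h::complex_hilbert_space oper \<Rightarrow> complex) \<Rightarrow> 'h oper \<Rightarrow> real" where
  "L2_state_norm \<phi> T = sqrt (Re (\<phi> (T o\<^sub>L adj T)))"

definition algebra_of :: "(real \<Rightarrow> 'h::complex_hilbert_space oper) \<Rightarrow> 'h oper set" where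
  "algebra_of X = generated_von_neumann_algebra (X ` {0..})"

definition filtration :: "(real \<Rightarrow> 'h::complex_hilbert_space oper) \<Rightarrow> real \<Rightarrow> 'h oper set" where
  "filtration X t = closure (generated_algebra (X ` {0..t}))"


section \<open>Projective tensor powers\<close>

text \<open>Let \<open>A\<close> be a closed complex subspace of operators.  The dual of the \<open>n\<close>-fold projective
  tensor power of \<open>A\<close> is the space of bounded \<open>n\<close>-linear forms on \<open>A\<close>, and each of its elements
  is the sum of a series of elementary tensors with \<open>\<Sum>k. \<parallel>a 1 k\<parallel> \<cdots> \<parallel>a n k\<parallel> < \<infinity>\<close>, the projective
  norm being the infimum of these sums over all such representations.  Accordingly, a tensor is
  the functional \<open>\<beta> \<mapsto> \<Sum>k. \<beta> [a 1 k, \<dots>, a n k]\<close> on these forms (and, by convention, 0 at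
  anything that is not such a form); two series represent the same tensor iff the functionals
  coincide.\<close>

type_synonym 'h tensor = "('h oper list \<Rightarrow> complex) \<Rightarrow> complex"

definition multilinear_form ::
    "'h::complex_hilbert_space oper set \<Rightarrow> nat \<Rightarrow> ('h oper list \<Rightarrow> complex) \<Rightarrow> bool" where
  "multilinear_form A n \<beta> \<longleftrightarrow>
     (\<forall>as bs. \<forall>a\<in>A. \<forall>b\<in>A. \<forall>c.
        set as \<subseteq> A \<and> set bs \<subseteq> A \<and> length as + 1 + length bs = n \<longrightarrow>
        \<beta> (as @ (a + op_scaleC c b) # bs) = \<beta> (as @ a # bs) + c * \<beta> (as @ b # bs)) \<and>
     (\<exists>C. \<forall>as. set as \<subseteq> A \<and> length as = n \<longrightarrow> cmod (\<beta> as) \<le> C * prod_list (map norm as))"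

definition elementary ::
    "'h::complex_hilbert_space oper set \<Rightarrow> 'h oper list \<Rightarrow> 'h tensor" where
  "elementary A as = (\<lambda>\<beta>. if multilinear_form A (length as) \<beta> then \<beta> as else 0)"

definition tensor_series ::
    "'h::complex_hilbert_space oper set \<Rightarrow> nat \<Rightarrow> (nat \<Rightarrow> 'h oper list) \<Rightarrow> bool" where
  "tensor_series B n a \<longleftrightarrow>
     (\<forall>k. length (a k) = n \<and> set (a k) \<subseteq> B) \<and> summable (\<lambda>k. prod_list (map norm (a k)))"

definition series_tensor ::
    "'h::complex_hilbert_space oper set \<Rightarrow> (nat \<Rightarrow> 'h oper list) \<Rightarrow> 'h tensor" where
  "series_tensor A a = (\<lambda>\<beta>. \<Sum>k. elementary A (a k) \<beta>)"

text \<open>The canonical image in the \<open>n\<close>-th projective tensor power of \<open>A\<close> of that of a closed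
  subspace \<open>B \<subseteq> A\<close>; for \<open>B = A\<close> this is the whole tensor power.\<close>

definition tensor_power_of ::
    "'h::complex_hilbert_space oper set \<Rightarrow> 'h oper set \<Rightarrow> nat \<Rightarrow> 'h tensor set" where
  "tensor_power_of A B n = {series_tensor A a | a. tensor_series B n a}"

definition proj_norm :: "'h::complex_hilbert_space oper set \<Rightarrow> nat \<Rightarrow> 'h tensor \<Rightarrow> real" where
  "proj_norm A n z =
     Inf {\<Sum>k. prod_list (map norm (a k)) | a. tensor_series A n a \<and> series_tensor A a = z}"

text \<open>Value at \<open>z\<close> of the continuous linear extension to the tensor power of \<open>B\<close> of the map
  \<open>b1 \<otimes> \<dots> \<otimes> bn \<mapsto> m [b1, \<dots>, bn]\<close>.  The target is either the space of operators or, with pointwise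
  (hence, for the absolutely convergent series at hand, norm) sums, that of tensors.\<close>

definition extend_linearly ::
    "'h::complex_hilbert_space oper set \<Rightarrow> 'h oper set \<Rightarrow> nat \<Rightarrow>
     ('h oper list \<Rightarrow> 'c::{topological_space, comm_monoid_add}) \<Rightarrow> 'h tensor \<Rightarrow> 'c" where
  "extend_linearly A B n m z =
     (THE y. \<forall>a. tensor_series B n a \<and> series_tensor A a = z \<longrightarrow> (\<lambda>k. m (a k)) sums y)"

text \<open>\<open>(U1 \<otimes> U2) \<sharp> Y\<close>, \<open>Y \<sharp> (U1 \<otimes> U2 \<otimes> U3)\<close> and \<open>(U1 \<otimes> U2 \<otimes> U3) \<sharp> Y\<close>, respectively.\<close>

definition sharp ::
    "'h::complex_hilbert_space oper set \<Rightarrow> 'h tensor \<Rightarrow> 'h oper \<Rightarrow> 'h oper" where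
  "sharp A z Y = extend_linearly A A 2 (\<lambda>as. (as ! 0) o\<^sub>L Y o\<^sub>L (as ! 1)) z"

definition sharp_left ::
    "'h::complex_hilbert_space oper set \<Rightarrow> 'h oper \<Rightarrow> 'h tensor \<Rightarrow> 'h tensor" where
  "sharp_left A Y z =
     extend_linearly A A 3 (\<lambda>as. elementary A [(as ! 0) o\<^sub>L Y o\<^sub>L (as ! 1), as ! 2]) z"

definition sharp_right ::
    "'h::complex_hilbert_space oper set \<Rightarrow> 'h tensor \<Rightarrow> 'h oper \<Rightarrow> 'h tensor" where
  "sharp_right A z Y =
     extend_linearly A A 3 (\<lambda>as. elementary A [as ! 0, (as ! 1) o\<^sub>L Y o\<^sub>L (as ! 2)]) z"


section \<open>Controlled biprocesses\<close>

definition holder1 ::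
    "'h::complex_hilbert_space oper set \<Rightarrow> nat \<Rightarrow> real \<Rightarrow> real set \<Rightarrow> (real \<Rightarrow> 'h tensor) \<Rightarrow> bool"
  where
  "holder1 A n \<alpha> I h \<longleftrightarrow>
     (\<forall>u\<in>I. h u \<in> tensor_power_of A A n) \<and>
     (\<forall>u\<in>I. ((\<lambda>v. proj_norm A n (h v - h u)) \<longlongrightarrow> 0) (at u within I)) \<and>
     bdd_above {proj_norm A n (h v - h u) / \<bar>v - u\<bar> powr \<alpha> | u v. u \<in> I \<and> v \<in> I \<and> u < v}"

definition holder2 ::
    "'h::complex_hilbert_space oper set \<Rightarrow> nat \<Rightarrow> real \<Rightarrow> real set \<Rightarrow>
     (real \<times> real \<Rightarrow> 'h tensor) \<Rightarrow> bool" where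
  "holder2 A n \<alpha> I h \<longleftrightarrow>
     (let D = {(u, v). u \<in> I \<and> v \<in> I \<and> u \<le> v} in
     (\<forall>p\<in>D. h p \<in> tensor_power_of A A n) \<and>
     (\<forall>p\<in>D. ((\<lambda>p'. proj_norm A n (h p' - h p)) \<longlongrightarrow> 0) (at p within D)) \<and>
     (\<forall>u\<in>I. h (u, u) = 0) \<and>
     bdd_above {proj_norm A n (h (u, v)) / \<bar>v - u\<bar> powr \<alpha> | u v. u \<in> I \<and> v \<in> I \<and> u < v})"

definition adapted ::
    "(real \<Rightarrow> 'h::complex_hilbert_space oper) \<Rightarrow> nat \<Rightarrow> real set \<Rightarrow> (real \<Rightarrow> 'h tensor) \<Rightarrow> bool" where
  "adapted X n I h \<longleftrightarrow> (\<forall>u\<in>I. h u \<in> tensor_power_of (algebra_of X) (filtration X u) n)"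

text \<open>\<open>U\<close> is an adapted controlled biprocess, the remaining arguments witnessing the expansion of
  its increments.\<close>

definition controlled_biprocess ::
    "(real \<Rightarrow> 'h::complex_hilbert_space oper) \<Rightarrow> real \<Rightarrow> real set \<Rightarrow> (real \<Rightarrow> 'h tensor) \<Rightarrow>
     (real \<Rightarrow> 'h tensor) \<Rightarrow> (real \<Rightarrow> 'h tensor) \<Rightarrow> (real \<times> real \<Rightarrow> 'h tensor) \<Rightarrow> bool" where
  "controlled_biprocess X \<gamma> I U U1 U2 Ub \<longleftrightarrow>
     holder1 (algebra_of X) 2 \<gamma> I U \<and> adapted X 2 I U \<and>
     holder1 (algebra_of X) 3 \<gamma> I U1 \<and> adapted X 3 I U1 \<and>
     holder1 (algebra_of X) 3 \<gamma> I U2 \<and> adapted X 3 I U2 \<and>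
     holder2 (algebra_of X) 2 (2 * \<gamma>) I Ub \<and>
     (\<forall>u\<in>I. \<forall>v\<in>I. u < v \<longrightarrow>
        U v - U u = sharp_left (algebra_of X) (X v - X u) (U1 u)
                  + sharp_right (algebra_of X) (U2 u) (X v - X u) + Ub (u, v))"


section \<open>The Stratonovich product Levy area and the rough integral\<close>

definition dyadic_interpolation ::
    "(real \<Rightarrow> 'b::real_vector) \<Rightarrow> nat \<Rightarrow> real \<Rightarrow> 'b" where
  "dyadic_interpolation X n u =
     (let i = of_int \<lfloor>2 ^ n * u\<rfloor> in
      X (i / 2 ^ n) + (2 ^ n * u - i) *\<^sub>R (X ((i + 1) / 2 ^ n) - X (i / 2 ^ n)))"

text \<open>The integrand is piecewise continuous (the derivative being meaningless only at
  dyadic points), so that the Henstock-Kurzweil integral is the Lebesgue integral.\<close>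

definition approx_area ::
    "(real \<Rightarrow> 'h::complex_hilbert_space oper) \<Rightarrow> nat \<Rightarrow> real \<Rightarrow> real \<Rightarrow> 'h tensor \<Rightarrow> 'h oper" where
  "approx_area X n s t z =
     (let Xn = dyadic_interpolation X n in
      integral {s..t} (\<lambda>u. sharp (algebra_of X) z (Xn u - Xn s) o\<^sub>L vector_derivative Xn (at u)))"

definition strat_area ::
    "(real \<Rightarrow> 'h::complex_hilbert_space oper) \<Rightarrow> real \<Rightarrow> real \<Rightarrow> 'h tensor \<Rightarrow> 'h oper" where
  "strat_area X s t z = lim (\<lambda>n. approx_area X n s t z)"

definition area_times_id ::
    "(real \<Rightarrow> 'h::complex_hilbert_space oper) \<Rightarrow> real \<Rightarrow> real \<Rightarrow> 'h tensor \<Rightarrow> 'h oper" where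
  "area_times_id X u v z =
     extend_linearly (algebra_of X) (filtration X u) 3
       (\<lambda>as. strat_area X u v (elementary (algebra_of X) [as ! 0, as ! 1]) o\<^sub>L (as ! 2)) z"

definition id_times_area_star ::
    "(real \<Rightarrow> 'h::complex_hilbert_space oper) \<Rightarrow> real \<Rightarrow> real \<Rightarrow> 'h tensor \<Rightarrow> 'h oper" where
  "id_times_area_star X u v z =
     extend_linearly (algebra_of X) (filtration X u) 3
       (\<lambda>as. (as ! 0) o\<^sub>L
          adj (strat_area X u v (elementary (algebra_of X) [adj (as ! 2), adj (as ! 1)]))) z"

definition subdivisions :: "real \<Rightarrow> real \<Rightarrow> real list set" where
  "subdivisions s t = {\<Delta>. \<Delta> \<noteq> [] \<and> sorted_wrt (<) \<Delta> \<and> hd \<Delta> = s \<and> last \<Delta> = t}"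

definition mesh :: "real list \<Rightarrow> real" where
  "mesh \<Delta> = Max {\<Delta> ! Suc i - \<Delta> ! i | i. Suc i < length \<Delta>}"

definition mesh_to_0 :: "real \<Rightarrow> real \<Rightarrow> real list filter" where
  "mesh_to_0 s t = inf (filtercomap mesh (at_right 0)) (principal (subdivisions s t))"

definition corrected_sum ::
    "(real \<Rightarrow> 'h::complex_hilbert_space oper) \<Rightarrow> (real \<Rightarrow> 'h tensor) \<Rightarrow> (real \<Rightarrow> 'h tensor) \<Rightarrow>
     (real \<Rightarrow> 'h tensor) \<Rightarrow> real list \<Rightarrow> 'h oper" where
  "corrected_sum X U U1 U2 \<Delta> =
     (\<Sum>i | Suc i < length \<Delta>. let u = \<Delta> ! i; v = \<Delta> ! Suc i in
        sharp (algebra_of X) (U u) (X v - X u)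
        + area_times_id X u v (U1 u) + id_times_area_star X u v (U2 u))"

definition rough_integral ::
    "(real \<Rightarrow> 'h::complex_hilbert_space oper) \<Rightarrow> real \<Rightarrow> real \<Rightarrow> (real \<Rightarrow> 'h tensor) \<Rightarrow>
     (real \<Rightarrow> 'h tensor) \<Rightarrow> (real \<Rightarrow> 'h tensor) \<Rightarrow> 'h oper" where
  "rough_integral X s t U U1 U2 = Lim (mesh_to_0 s t) (corrected_sum X U U1 U2)"

definition trapezoidal_sum ::
    "(real \<Rightarrow> 'h::complex_hilbert_space oper) \<Rightarrow> (real \<Rightarrow> 'h tensor) \<Rightarrow> real list \<Rightarrow> 'h oper" where
  "trapezoidal_sum X U \<Delta> =
     (\<Sum>i | Suc i < length \<Delta>. let u = \<Delta> ! i; v = \<Delta> ! Suc i in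
        (1 / 2) *\<^sub>R sharp (algebra_of X) (U u + U v) (X v - X u))"

end

theory Submission
  imports Defs
begin

text \<open>The Levy area of \<open>b\<close> differs from \<open>1/2 \<delta>X b \<delta>X\<close> by a series over dyadic levels of
  antisymmetric sums \<open>\<Sum> (\<delta>X' b \<delta>X'' - \<delta>X'' b \<delta>X')\<close> over neighbouring intervals.  A Haagerup
  type inequality bounds each of them in operator norm by \<open>\<parallel>b\<parallel>\<close> times the square root of the sum of
  the products of the lengths, so that the difference is of order \<open>\<parallel>b\<parallel> \<bar>t - s\<bar>\<^sup>3\<^sup>/\<^sup>4\<close>; and it has
  conditional expectation zero given the past.  Chen's relation and sewing then give the rough
  integral as the limit in operator norm of the corrected sums.  By the expansion of \<open>\<delta>U\<close>,
  trapezoidal and corrected sums differ on each interval by a remainder of order \<open>2 \<gamma> + 1/2 > 1\<close> and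
  by a centred term of order \<open>3/4\<close>.  Applied (after taking adjoints) to the vacuum, the latter are
  orthogonal for different intervals, so their sum is of order \<open>1/4\<close> in the mesh.\<close>

text \<open>The obstacle is uniformity in \<open>b\<close>: the area must be bounded by the operator
  norm of \<open>b\<close>, whatever its degree as a polynomial in the process. Written with
  creation and annihilation operators, a sum of terms \<delta>X' b \<delta>X'' splits into four
  sums. Three of them are rows of creation operators or adjoints of such rows, and are bounded as
  such. In the fourth, annihilation operators stand to the left of \<open>b\<close> and creation
  operators to the right. The increments being orthogonal to the letters of \<open>b\<close>, moving
  them through a Wick product of degree n gives the factor \<open>q ^ (n + 1)\<close>, which beats
  the growth in n of the Haagerup constants. The result depends on \<open>b\<close> only through b
  \<Omega>, so that it makes sense for every bounded \<open>b\<close>. This is what allows the area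
  to be inserted into tensors, whose equality is tested on forms over the whole algebra and not only
  over the past. The exponent 3/4 is the order 1 of the area minus a quarter traded for geometric
  decay over the dyadic levels. As \<gamma> > 1/3, an exponent 2/3 would already make the sewing
  defect superlinear.\<close>

section \<open>Inner products and complex scalars in a Hilbert space\<close>

lemma cinner_add_left: "cinner (x + y) z = cinner x z + cinner y z"
  for x :: "'h::complex_hilbert_space"
  by (metis cinner_add_right cinner_cnj complex_cnj_add)

lemma cinner_zero [simp]: "cinner x 0 = 0" "cinner 0 x = 0"
  for x :: "'h::complex_hilbert_space"
  using cinner_add_right[of x 0 0] cinner_add_left[of 0 0 x] by simp_all

lemma cinner_scaleR: "cinner x (r *\<^sub>R y) = r *\<^sub>R cinner x y" "cinner (r *\<^sub>R x) y = r *\<^sub>R cinner x y"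
  for x y :: "'h::complex_hilbert_space"
  by (simp_all add: scaleC_of_real[symmetric, where 'a='h] cinner_scaleC_right cinner_scaleC_left scaleR_conv_of_real)

lemma cinner_minus: "cinner x (- y) = - cinner x y" "cinner (- x) y = - cinner x y"
  for x y :: "'h::complex_hilbert_space"
  using cinner_add_right[of x y "- y"] cinner_add_left[of x "- x" y] by (simp_all add: eq_neg_iff_add_eq_0 add.commute)

lemma cinner_diff: "cinner x (y - z) = cinner x y - cinner x z" "cinner (y - z) x = cinner y x - cinner z x"
  for x y z :: "'h::complex_hilbert_space"
  using cinner_add_right[of x y "- z"] cinner_add_left[of y "- z" x] by (simp_all add: cinner_minus)

lemma cinner_sum_right: "cinner x (\<Sum>i\<in>I. f i) = (\<Sum>i\<in>I. cinner x (f i))"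
  for x :: "'h::complex_hilbert_space"
  by (induction I rule: infinite_finite_induct) (simp_all add: cinner_add_right)

lemma cinner_sum_list_right: "cinner x (\<Sum>i\<leftarrow>xs. f i) = (\<Sum>i\<leftarrow>xs. cinner x (f i))"
  for x :: "'h::complex_hilbert_space"
  by (induction xs) (simp_all add: cinner_add_right)

lemma cinner_sum_list_left: "cinner (\<Sum>i\<leftarrow>xs. f i) x = (\<Sum>i\<leftarrow>xs. cinner (f i) x)"
  for x :: "'h::complex_hilbert_space"
  by (induction xs) (simp_all add: cinner_add_left)

lemma norm_sq_cinner: "(norm x)\<^sup>2 = Re (cinner x x)" for x :: "'h::complex_hilbert_space"
  by (simp add: cinner_self)

lemma cmod_cinner_le: "cmod (cinner x y) \<le> norm x * norm y" for x y :: "'h::complex_hilbert_space"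
proof (cases "cinner x y = 0")
  case False
  define c where "c = sgn (cinner x y)"
  have c: "cmod c = 1" using False by (simp add: c_def norm_sgn)
  have "cinner (c *\<^sub>C x) y = of_real (cmod (cinner x y))"
    using False by (simp add: c_def cinner_scaleC_left sgn_eq complex_norm_square[symmetric]
      field_simps power2_eq_square)
  then have "cmod (cinner x y) = inner (c *\<^sub>C x) y" by (metis Re_cinner Re_complex_of_real)
  also have "\<dots> \<le> norm (c *\<^sub>C x) * norm y" by (rule norm_cauchy_schwarz)
  finally show ?thesis by (simp add: norm_scaleC c)
qed simp

lemma scaleC_zero [simp]: "c *\<^sub>C 0 = 0" "0 *\<^sub>C x = 0" for x :: "'h::complex_hilbert_space"
  using scaleC_add_right[of c 0 0] scaleC_of_real[of 0 x] by simp_all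

lemma scaleC_one [simp]: "1 *\<^sub>C x = x" for x :: "'h::complex_hilbert_space"
  using scaleC_of_real[of 1 x] by simp

lemma scaleC_scaleR: "c *\<^sub>C (r *\<^sub>R x) = r *\<^sub>R (c *\<^sub>C x)" "(r *\<^sub>R c) *\<^sub>C x = r *\<^sub>R (c *\<^sub>C x)"
  for x :: "'h::complex_hilbert_space"
  by (simp_all add: scaleC_of_real[symmetric, where 'a='h] scaleC_scaleC mult.commute scaleR_conv_of_real)

lemma scaleC_minus: "c *\<^sub>C (- x) = - (c *\<^sub>C x)" "(- c) *\<^sub>C x = - (c *\<^sub>C x)" for x :: "'h::complex_hilbert_space"
  using scaleC_add_right[of c x "-x"] scaleC_add_left[of c "-c" x]
  by (simp_all add: eq_neg_iff_add_eq_0 add.commute)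

lemma scaleC_sum_list: "c *\<^sub>C (\<Sum>i\<leftarrow>xs. f i) = (\<Sum>i\<leftarrow>xs. c *\<^sub>C f i)"
  for f :: "'i \<Rightarrow> 'h::complex_hilbert_space"
  by (induction xs) (simp_all add: scaleC_add_right)

lemma scaleC_sum: "c *\<^sub>C (\<Sum>i\<in>xs. f i) = (\<Sum>i\<in>xs. c *\<^sub>C f i)"
  for f :: "'i \<Rightarrow> 'h::complex_hilbert_space"
  by (induction xs rule: infinite_finite_induct) (simp_all add: scaleC_add_right)

lemma scaleC_sum_left: "(\<Sum>i\<in>xs. f i) *\<^sub>C x = (\<Sum>i\<in>xs. f i *\<^sub>C x)"
  for x :: "'h::complex_hilbert_space"
  by (induction xs rule: infinite_finite_induct) (simp_all add: scaleC_add_left)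

lemma bounded_bilinear_cinner: "bounded_bilinear (cinner :: 'h::complex_hilbert_space \<Rightarrow> _)"
  by unfold_locales
    (auto simp: cinner_add_left cinner_add_right cinner_scaleR intro!: exI[of _ 1] cmod_cinner_le)

lemma bounded_bilinear_scaleC: "bounded_bilinear (scaleC :: complex \<Rightarrow> 'h::complex_hilbert_space \<Rightarrow> _)"
  by unfold_locales
    (auto simp: scaleC_add_left scaleC_add_right scaleC_scaleR norm_scaleC intro!: exI[of _ 1])

lemma bounded_linear_scaleC: "bounded_linear (\<lambda>x::'h::complex_hilbert_space. c *\<^sub>C x)"
  by (rule bounded_bilinear.bounded_linear_right[OF bounded_bilinear_scaleC])

lemmas tendsto_cinner = bounded_bilinear.tendsto[OF bounded_bilinear_cinner]
lemmas tendsto_scaleC = bounded_bilinear.tendsto[OF bounded_bilinear_scaleC]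

text \<open>Approximating \<open>x - y\<close> itself by the test vectors shows that it is
  orthogonal to itself.\<close>

lemma cinner_eqI:
  fixes x y :: "'h::complex_hilbert_space"
  assumes "closure {z. \<exists>w. z = w \<and> P w} = UNIV" "\<And>z. P z \<Longrightarrow> cinner z x = cinner z y"
  shows "x = y"
proof -
  obtain s where s: "\<And>n. P (s n)" "s \<longlonglongrightarrow> x - y"
    using assms(1) closure_sequential[of "x - y" "{z. \<exists>w. z = w \<and> P w}"] by auto
  have "(\<lambda>n. cinner (s n) (x - y)) \<longlonglongrightarrow> cinner (x - y) (x - y)"
    by (intro tendsto_cinner s tendsto_const)
  moreover have "(\<lambda>n. cinner (s n) (x - y)) = (\<lambda>n. 0)"
    using s assms(2) by (simp add: cinner_diff)
  ultimately have "cinner (x - y) (x - y) = 0" by (metis LIMSEQ_unique tendsto_const)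
  then show ?thesis by (simp add: cinner_self)
qed

lemma cinner_ext: "(\<And>z. cinner z x = cinner z y) \<Longrightarrow> x = y" for x y :: "'h::complex_hilbert_space"
  by (rule cinner_eqI[where P="\<lambda>_. True"]) auto

subsection \<open>Riesz representation and adjoints\<close>

text \<open>Variational proof: \<open>g x = |x|^2 - 2 f x\<close> is bounded below, the
  parallelogram law makes a minimising sequence Cauchy, and the first variation of \<open>g\<close>
  at its limit identifies the representing vector. The functional is only real-linear here; complex
  linearity enters with the adjoint.\<close>

lemma riesz_representation:
  fixes f :: "'a::{real_inner, complete_space} \<Rightarrow> real"
  assumes "bounded_linear f"
  shows "\<exists>z. \<forall>x. f x = inner z x"
proof -
  interpret bounded_linear f by fact
  define g where "g x = (norm x)\<^sup>2 - 2 * f x" for x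
  obtain K where K: "\<And>x. \<bar>f x\<bar> \<le> norm x * K" using bounded by auto
  have "g x \<ge> - K\<^sup>2" for x
  proof -
    have "0 \<le> (norm x - K)\<^sup>2" by simp
    moreover have "f x \<le> norm x * K" using K[of x] by simp
    ultimately show ?thesis unfolding g_def by (simp add: power2_diff)
  qed
  then have bdd: "bdd_below (range g)" by (auto intro!: bdd_belowI[of _ "- K\<^sup>2"])
  define m where "m = Inf (range g)"
  have m: "m \<le> g x" for x unfolding m_def by (rule cInf_lower[OF _ bdd]) simp
  have "\<exists>x. g x < m + inverse (real (Suc n))" for n
    using cInf_lessD[of "range g" "m + inverse (real (Suc n))"] unfolding m_def by auto
  then obtain s where s: "\<And>n. g (s n) < m + inverse (real (Suc n))" by metis
  have par: "(norm (x - y))\<^sup>2 \<le> 2 * (g x - m) + 2 * (g y - m)" for x y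
  proof -
    have "(norm (x - y))\<^sup>2 = 2 * (norm x)\<^sup>2 + 2 * (norm y)\<^sup>2 - 4 * (norm ((1/2) *\<^sub>R (x + y)))\<^sup>2"
      by (simp only: power2_norm_eq_inner inner_simps) (simp add: inner_commute field_simps)
    also have "\<dots> = 2 * g x + 2 * g y - 4 * g ((1/2) *\<^sub>R (x + y))"
      by (simp only: g_def add scaleR real_scaleR_def) (simp add: field_simps)
    also have "\<dots> \<le> 2 * (g x - m) + 2 * (g y - m)" using m[of "(1/2) *\<^sub>R (x + y)"] by simp
    finally show ?thesis .
  qed
  have "Cauchy s"
  proof (rule metric_CauchyI)
    fix e :: real assume e: "0 < e"
    obtain N where N: "inverse (real (Suc N)) < e\<^sup>2 / 4" using reals_Archimedean[of "e\<^sup>2/4"] e by auto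
    have "dist (s a) (s b) < e" if "a \<ge> N" "b \<ge> N" for a b
    proof -
      define i where "i n = inverse (real (Suc n))" for n
      have "i a \<le> i N" "i b \<le> i N"
        unfolding i_def using that by (auto intro!: le_imp_inverse_le)
      moreover have "g (s a) < m + i a" "g (s b) < m + i b" "i N < e\<^sup>2 / 4"
        using s N unfolding i_def by blast+
      ultimately have "(norm (s a - s b))\<^sup>2 < e\<^sup>2"
        using par[of "s a" "s b"] by argo
      then show ?thesis using e by (simp add: dist_norm power2_less_imp_less)
    qed
    then show "\<exists>N. \<forall>a\<ge>N. \<forall>b\<ge>N. dist (s a) (s b) < e" by blast
  qed
  then obtain z where z: "s \<longlonglongrightarrow> z" using Cauchy_convergent convergent_def by blast
  have "(\<lambda>n. g (s n)) \<longlonglongrightarrow> g z"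
    unfolding g_def by (intro tendsto_intros z tendsto)
  moreover have "(\<lambda>n. m + inverse (real (Suc n))) \<longlonglongrightarrow> m + 0"
    by (intro tendsto_intros LIMSEQ_inverse_real_of_nat)
  ultimately have "g z \<le> m + 0" by (rule LIMSEQ_le) (use less_imp_le[OF s] in blast)
  then have "g z \<le> m" by simp
  have "f x = inner z x" for x
  proof (rule ccontr)
    assume ne: "f x \<noteq> inner z x"
    define d where "d = inner z x - f x"
    have ineq: "0 \<le> 2 * t * d + t\<^sup>2 * (norm x)\<^sup>2" for t
    proof -
      have "g z \<le> g (z + t *\<^sub>R x)" using m \<open>g z \<le> m\<close> order_trans by blast
      also have "\<dots> = g z + 2 * t * d + t\<^sup>2 * (norm x)\<^sup>2"
        unfolding g_def d_def
        by (simp only: power2_norm_eq_inner inner_simps add scaleR) (simp add: algebra_simps power2_eq_square inner_commute)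
      finally show ?thesis by simp
    qed
    have "d \<noteq> 0" using ne d_def by simp
    \<comment> \<open>The optimal t divides by the squared norm of \<open>x\<close>. The added 1
      keeps the divisor positive at x = 0, and \<open>t = - d / n2\<close> still makes the quadratic
      of \<open>ineq\<close> at most \<open>- d^2 / n2\<close>.\<close>
    define n2 where "n2 = 1 + (norm x)\<^sup>2"
    have n2: "n2 > 0" unfolding n2_def by (smt (verit) zero_le_power2)
    have "0 \<le> 2 * (- d / n2) * d + (- d / n2)\<^sup>2 * (norm x)\<^sup>2" by (rule ineq)
    also have "\<dots> \<le> 2 * (- d / n2) * d + (- d / n2)\<^sup>2 * n2" unfolding n2_def by (intro add_left_mono mult_left_mono) auto
    also have "\<dots> = - (d\<^sup>2 / n2)" using n2 by (simp add: power2_eq_square field_simps)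
    finally have "d\<^sup>2 / n2 \<le> 0" by simp
    moreover have "d\<^sup>2 / n2 > 0" using n2 \<open>d \<noteq> 0\<close> by simp
    ultimately show False by simp
  qed
  then show ?thesis by blast
qed

section \<open>Complex-linear bounded operators and their adjoints\<close>

lemma copsD: "T \<in> cops \<Longrightarrow> blinfun_apply T (c *\<^sub>C x) = c *\<^sub>C blinfun_apply T x"
  by (simp add: cops_def)

lemma copsI: "(\<And>c x. blinfun_apply T (c *\<^sub>C x) = c *\<^sub>C blinfun_apply T x) \<Longrightarrow> T \<in> cops"
  by (simp add: cops_def)

text \<open>The Riesz theorem yields an adjoint for the real inner product, which is the real part
  of the complex one. The imaginary part follows on replacing \<open>x\<close> by
  \<open>\<i> *\<^sub>C x\<close>; this is where complex linearity of \<open>T\<close> is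
  used.\<close>

lemma adj_ex:
  fixes T :: "'h::complex_hilbert_space oper"
  assumes T: "T \<in> cops"
  shows "\<exists>S. \<forall>x y. cinner (blinfun_apply T x) y = cinner x (blinfun_apply S y)"
proof -
  have "\<exists>z. \<forall>x. inner y (T x) = inner z x" for y
    by (rule riesz_representation)
      (intro bounded_linear_compose[OF bounded_linear_inner_right] blinfun.bounded_linear_right)
  then obtain S where S: "\<And>y x. inner y (T x) = inner (S y) x" by metis
  have S2: "cinner y (T x) = cinner (S y) x" for x y
  proof (rule complex_eqI)
    show "Re (cinner y (T x)) = Re (cinner (S y) x)" using S by (simp add: Re_cinner)
    have "Re (cinner y (T (\<i> *\<^sub>C x))) = Re (cinner (S y) (\<i> *\<^sub>C x))"
      using S by (simp add: Re_cinner)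
    then show "Im (cinner y (T x)) = Im (cinner (S y) x)"
      by (simp add: copsD[OF T] cinner_scaleC_right)
  qed
  have S3: "cinner (T x) y = cinner x (S y)" for x y
    by (metis S2 cinner_cnj)
  have nS: "norm (S y) \<le> norm y * norm T" for y
  proof -
    have "norm (S y) * norm (S y) = inner (S y) (S y)" by (simp add: power2_norm_eq_inner[symmetric] power2_eq_square)
    also have "\<dots> = inner y (T (S y))" by (simp add: S)
    also have "\<dots> \<le> norm y * (norm T * norm (S y))"
      by (meson norm_blinfun norm_cauchy_schwarz norm_ge_zero mult_left_mono order_trans)
    finally have "norm (S y) * norm (S y) \<le> (norm y * norm T) * norm (S y)" by (simp add: mult_ac)
    then show ?thesis
      by (cases "norm (S y) = 0") simp_all
  qed
  have "bounded_linear S"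
  proof (rule bounded_linear_intro)
    show "S (x + y) = S x + S y" for x y
      by (rule cinner_ext) (simp add: cinner_add_right S3[symmetric])
    show "S (r *\<^sub>R x) = r *\<^sub>R S x" for r x
      by (rule cinner_ext) (simp add: cinner_scaleR S3[symmetric])
    show "norm (S x) \<le> norm x * norm T" for x by (rule nS)
  qed
  then show ?thesis using S3 by (metis bounded_linear_Blinfun_apply)
qed

lemma adj_eqI:
  fixes T :: "'h::complex_hilbert_space oper"
  assumes "\<And>x y. cinner (blinfun_apply T x) y = cinner x (blinfun_apply S y)"
  shows "adj T = S"
  unfolding adj_def
proof (rule the_equality)
  show "\<forall>x y. cinner (T x) y = cinner x (S y)" using assms by simp
  fix R assume "\<forall>x y. cinner (T x) y = cinner x (blinfun_apply R y)"
  then have "cinner x (R y) = cinner x (S y)" for x y using assms[of x y] by simp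
  then show "R = S" by (rule blinfun_eqI[OF cinner_ext])
qed

lemma adj_cinner: "T \<in> cops \<Longrightarrow> cinner (blinfun_apply T x) y = cinner x (blinfun_apply (adj T) y)"
  using adj_ex[of T] adj_eqI[of T] by blast

lemma adj_cinner': "T \<in> cops \<Longrightarrow> cinner (blinfun_apply (adj T) x) y = cinner x (blinfun_apply T y)"
  using arg_cong[OF adj_cinner[of T y x], of cnj] by (simp add: cinner_cnj[symmetric])

lemma adj_cops: "T \<in> cops \<Longrightarrow> adj T \<in> cops"
  by (rule copsI, rule cinner_ext) (simp add: adj_cinner[symmetric] cinner_scaleC_right)

lemma adj_adj: "T \<in> cops \<Longrightarrow> adj (adj T) = T"
  by (rule adj_eqI) (simp add: adj_cinner')

lemma op_scaleC_apply: "blinfun_apply (op_scaleC c T) x = c *\<^sub>C blinfun_apply T x"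
  by (simp add: op_scaleC.rep_eq)

lemma norm_op_scaleC: "norm (op_scaleC c T) = cmod c * norm T"
proof -
  have le: "norm (op_scaleC c T) \<le> cmod c * norm T" for c and T :: "'a oper"
    by (rule norm_blinfun_bound)
      (auto simp: op_scaleC_apply norm_scaleC mult.assoc intro!: mult_left_mono norm_blinfun)
  show ?thesis
  proof (cases "c = 0")
    case True
    then show ?thesis using le[of c T] by simp
  next
    case False
    have "op_scaleC (inverse c) (op_scaleC c T) = T"
      using False by (intro blinfun_eqI) (simp add: op_scaleC_apply scaleC_scaleC)
    then have "norm T \<le> cmod (inverse c) * norm (op_scaleC c T)" using le by metis
    then have "cmod c * norm T \<le> norm (op_scaleC c T)" using False by (simp add: norm_divide field_simps)
    then show ?thesis using le[of c T] by simp
  qed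
qed

lemma op_scaleC_simps:
  "op_scaleC c (T + S) = op_scaleC c T + op_scaleC c S"
  "op_scaleC (c + d) T = op_scaleC c T + op_scaleC d T"
  "op_scaleC c (op_scaleC d T) = op_scaleC (c * d) T"
  "op_scaleC 1 T = T" "op_scaleC 0 T = 0" "op_scaleC c 0 = 0"
  "op_scaleC (complex_of_real r) T = r *\<^sub>R T"
  "op_scaleC c (r *\<^sub>R T) = r *\<^sub>R op_scaleC c T"
  "op_scaleC c (T - S) = op_scaleC c T - op_scaleC c S"
  "op_scaleC (- c) T = - op_scaleC c T"
  by (rule blinfun_eqI; simp add: op_scaleC_apply scaleC_add_right scaleC_add_left scaleC_scaleC
      blinfun.bilinear_simps scaleC_of_real scaleC_scaleR scaleC_minus diff_conv_add_uminus del: add_uminus_conv_diff)+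

lemma op_scaleC_comp:
  "op_scaleC c T o\<^sub>L S = op_scaleC c (T o\<^sub>L S)"
  "T \<in> cops \<Longrightarrow> T o\<^sub>L op_scaleC c S = op_scaleC c (T o\<^sub>L S)"
  by (rule blinfun_eqI; simp add: op_scaleC_apply copsD)+

lemma bounded_linear_op_scaleC: "bounded_linear (op_scaleC c)"
  by (rule bounded_linear_intro[where K="cmod c"]) (auto simp: op_scaleC_simps norm_op_scaleC)

lemma op_scaleC_sum: "op_scaleC c (\<Sum>i\<in>I. f i) = (\<Sum>i\<in>I. op_scaleC c (f i))"
  by (rule linear_sum[OF bounded_linear.linear[OF bounded_linear_op_scaleC]])

lemma cops_intros [intro, simp]:
  "0 \<in> cops" "id_blinfun \<in> cops"
  "T \<in> cops \<Longrightarrow> S \<in> cops \<Longrightarrow> T + S \<in> cops"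
  "T \<in> cops \<Longrightarrow> S \<in> cops \<Longrightarrow> T - S \<in> cops"
  "T \<in> cops \<Longrightarrow> - T \<in> cops"
  "T \<in> cops \<Longrightarrow> r *\<^sub>R T \<in> cops"
  "T \<in> cops \<Longrightarrow> op_scaleC c T \<in> cops"
  "T \<in> cops \<Longrightarrow> S \<in> cops \<Longrightarrow> T o\<^sub>L S \<in> cops"
  by (auto intro!: copsI simp: copsD blinfun.bilinear_simps scaleC_add_right scaleC_minus scaleC_scaleR
      op_scaleC_apply scaleC_scaleC mult.commute diff_conv_add_uminus simp del: add_uminus_conv_diff)

lemma cops_sum [intro]: "(\<And>i. i \<in> I \<Longrightarrow> f i \<in> cops) \<Longrightarrow> (\<Sum>i\<in>I. f i) \<in> cops"
  by (induction I rule: infinite_finite_induct) auto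

lemma closed_cops: "closed (cops :: 'h::complex_hilbert_space oper set)"
proof -
  have "cops = (\<Inter>c. \<Inter>x. {T :: 'h oper. blinfun_apply T (c *\<^sub>C x) = c *\<^sub>C blinfun_apply T x})"
    by (auto simp: cops_def)
  also have "closed \<dots>"
    by (intro closed_INT ballI closed_Collect_eq continuous_intros
      linear_continuous_on[OF bounded_linear_compose[OF bounded_linear_scaleC]] blinfun.bounded_linear_left)
  finally show ?thesis .
qed

lemma adj_simps:
  assumes T: "T \<in> cops" and S: "S \<in> cops"
  shows "adj (T + S) = adj T + adj S" "adj (T - S) = adj T - adj S" "adj (r *\<^sub>R T) = r *\<^sub>R adj T"
    "adj (op_scaleC c T) = op_scaleC (cnj c) (adj T)" "adj (T o\<^sub>L S) = adj S o\<^sub>L adj T"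
  by (rule adj_eqI; simp add: blinfun.bilinear_simps cinner_add_left cinner_add_right cinner_diff
      adj_cinner[OF T] adj_cinner[OF S] cinner_scaleR op_scaleC_apply cinner_scaleC_left cinner_scaleC_right)+

lemma adj_zero [simp]: "adj 0 = 0" by (rule adj_eqI) simp
lemma adj_id [simp]: "adj id_blinfun = id_blinfun" by (rule adj_eqI) simp

lemma adj_sum: "(\<And>i. i \<in> I \<Longrightarrow> f i \<in> cops) \<Longrightarrow> adj (\<Sum>i\<in>I. f i) = (\<Sum>i\<in>I. adj (f i))"
  by (induction I rule: infinite_finite_induct) (simp_all add: adj_simps cops_sum)

lemma norm_adj: 
  assumes "T \<in> cops" shows "norm (adj T) = norm T"
proof -
  have le: "norm (adj T) \<le> norm T" if T: "T \<in> cops" for T :: "'a oper"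
  proof (rule norm_blinfun_bound)
    fix x
    have "(norm (adj T x))\<^sup>2 = Re (cinner x (T (adj T x)))"
      unfolding norm_sq_cinner by (subst adj_cinner'[OF T]) simp
    also have "\<dots> \<le> norm x * (norm T * norm (adj T x))"
      by (meson complex_Re_le_cmod cmod_cinner_le norm_blinfun norm_ge_zero mult_left_mono order_trans)
    finally have "norm (adj T x) * norm (adj T x) \<le> (norm T * norm x) * norm (adj T x)"
      by (simp add: mult_ac power2_eq_square)
    then show "norm (adj T x) \<le> norm T * norm x"
    by (cases "norm (adj T x) = 0") simp_all
  qed simp
  show ?thesis using le[of T] le[of "adj T"] assms by (simp add: adj_adj adj_cops order_antisym)
qed

lemma tendsto_adj:
  assumes "(f \<longlongrightarrow> T) F" "\<And>x. f x \<in> cops" "T \<in> cops"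
  shows "((\<lambda>x. adj (f x)) \<longlongrightarrow> adj T) F"
proof -
  have "((\<lambda>x. norm (f x - T)) \<longlongrightarrow> 0) F" using assms(1) LIM_zero tendsto_norm_zero by blast
  moreover have "norm (f x - T) = norm (adj (f x) - adj T)" for x
    using norm_adj[of "f x - T"] assms by (simp add: adj_simps)
  ultimately show ?thesis by (simp add: tendsto_norm_zero_iff LIM_zero_iff)
qed

subsection \<open>Gram-Schmidt and extension by continuity\<close>

text \<open>Orthonormal bases of finitely generated subspaces suffice, since all estimates concern
  finite sums of words and pass to the limit afterwards. The vectors of \<open>V\<close> may be
  dependent. The basis vectors are also expanded in \<open>V\<close>, so that they remain
  combinations of the given words and can be turned back into operators.\<close>

lemma gram_schmidt:
  fixes V :: "'h::complex_hilbert_space set"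
  assumes "finite V"
  shows "\<exists>B. finite B \<and> (\<forall>x\<in>B. \<forall>y\<in>B. cinner x y = (if x = y then 1 else 0)) \<and>
    (\<forall>x\<in>B. \<exists>d. x = (\<Sum>v\<in>V. d v *\<^sub>C v)) \<and> (\<forall>v\<in>V. v = (\<Sum>x\<in>B. cinner x v *\<^sub>C x))"
  using assms
proof induction
  case empty
  then show ?case by (intro exI[of _ "{}"]) simp
next
  case (insert v V)
  obtain B where B': "finite B \<and> (\<forall>x\<in>B. \<forall>y\<in>B. cinner x y = (if x = y then 1 else 0)) \<and>
    (\<forall>x\<in>B. \<exists>d. x = (\<Sum>v\<in>V. d v *\<^sub>C v)) \<and> (\<forall>v\<in>V. v = (\<Sum>x\<in>B. cinner x v *\<^sub>C x))"
    using insert.IH by (rule exE)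
  have B: "finite B" "\<And>x y. x \<in> B \<Longrightarrow> y \<in> B \<Longrightarrow> cinner x y = (if x = y then 1 else 0)"
    "\<And>x. x \<in> B \<Longrightarrow> \<exists>d. x = (\<Sum>v\<in>V. d v *\<^sub>C v)" "\<And>v. v \<in> V \<Longrightarrow> v = (\<Sum>x\<in>B. cinner x v *\<^sub>C x)"
  proof -
    show "finite B" using B' by (rule conjunct1)
    show "cinner x y = (if x = y then 1 else 0)" if "x \<in> B" "y \<in> B" for x y
      by (rule B'[THEN conjunct2, THEN conjunct1, THEN bspec[OF _ that(1)], THEN bspec[OF _ that(2)]])
    show "\<exists>d. x = (\<Sum>v\<in>V. d v *\<^sub>C v)" if "x \<in> B" for x
      by (rule B'[THEN conjunct2, THEN conjunct2, THEN conjunct1, THEN bspec[OF _ that(1)]])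
    show "v = (\<Sum>x\<in>B. cinner x v *\<^sub>C x)" if "v \<in> V" for v
      by (rule B'[THEN conjunct2, THEN conjunct2, THEN conjunct2, THEN bspec[OF _ that(1)]])
  qed
  have span: "\<exists>d'. x = (\<Sum>v\<in>insert v V. d' v *\<^sub>C v)" if "x = e *\<^sub>C v + (\<Sum>v\<in>V. d v *\<^sub>C v)" for x d e
  proof (intro exI)
    have "(\<Sum>w\<in>insert v V. (d(v := e)) w *\<^sub>C w) = e *\<^sub>C v + (\<Sum>w\<in>V. (d(v := e)) w *\<^sub>C w)"
      using insert.hyps by simp
    also have "(\<Sum>w\<in>V. (d(v := e)) w *\<^sub>C w) = (\<Sum>w\<in>V. d w *\<^sub>C w)"
      using insert.hyps by (intro sum.cong) auto
    finally show "x = (\<Sum>w\<in>insert v V. (d(v := e)) w *\<^sub>C w)" using that by simp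
  qed
  have span0: "\<exists>d'. x = (\<Sum>v\<in>insert v V. d' v *\<^sub>C v)" if xB: "x \<in> B" for x
  proof -
    obtain d where "x = (\<Sum>v\<in>V. d v *\<^sub>C v)" using B(3)[OF xB] by (rule exE)
    then show ?thesis using span[where e=0 and d=d and x=x] by simp
  qed
  define r where "r = v - (\<Sum>x\<in>B. cinner x v *\<^sub>C x)"
  show ?case
  proof (cases "r = 0")
    case True
    then show ?thesis using B span0 by (intro exI[of _ B]) (auto simp: r_def)
  next
    case False
    define u where "u = complex_of_real (1 / norm r) *\<^sub>C r"
    have orr: "cinner x r = 0" if "x \<in> B" for x
    proof -
      have "cinner x (\<Sum>y\<in>B. cinner y v *\<^sub>C y) = (\<Sum>y\<in>B. if y = x then cinner y v else 0)"
        unfolding cinner_sum_right using B(2) that by (intro sum.cong) (auto simp: cinner_scaleC_right)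
      also have "\<dots> = cinner x v" using B(1) that by simp
      finally show ?thesis by (simp add: r_def cinner_diff)
    qed
    then have orr': "cinner r x = 0" if "x \<in> B" for x using that cinner_cnj[of r x] by simp
    have uu: "cinner u u = 1"
      using False by (simp add: u_def cinner_self norm_scaleC norm_divide)
    have xu: "cinner x u = 0" "cinner u x = 0" if "x \<in> B" for x
      using orr[OF that] orr'[OF that] by (simp_all add: u_def cinner_scaleC_left cinner_scaleC_right)
    have uO: "u \<notin> B" using xu uu by force
    have uV: "cinner u w = 0" if "w \<in> V" for w
      by (subst B(4)[OF that]) (simp add: cinner_sum_right cinner_scaleC_right xu)
    have r_u: "r = complex_of_real (norm r) *\<^sub>C u" using False by (simp add: u_def scaleC_scaleC)
    have uv: "cinner u v = complex_of_real (norm r)"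
    proof -
      have "cinner u v = cinner u (r + (\<Sum>x\<in>B. cinner x v *\<^sub>C x))" by (simp add: r_def)
      also have "\<dots> = cinner u r" by (simp add: cinner_add_right cinner_sum_right cinner_scaleC_right xu)
      also have "\<dots> = complex_of_real (norm r)" by (subst r_u) (simp add: cinner_scaleC_right uu)
      finally show ?thesis .
    qed
    have spanu: "\<exists>d'. u = (\<Sum>v\<in>insert v V. d' v *\<^sub>C v)"
    proof -
      have "\<forall>x\<in>B. \<exists>d. x = (\<Sum>v\<in>V. d v *\<^sub>C v)" using B(3) by (rule ballI)
      then obtain d where d: "\<forall>x\<in>B. x = (\<Sum>v\<in>V. d x v *\<^sub>C v)" by (rule bchoice[THEN exE])
      have "(\<Sum>x\<in>B. cinner x v *\<^sub>C x) = (\<Sum>x\<in>B. cinner x v *\<^sub>C (\<Sum>w\<in>V. d x w *\<^sub>C w))"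
        by (rule sum.cong[OF refl]) (rule arg_cong[OF bspec[OF d]])
      also have "\<dots> = (\<Sum>w\<in>V. (\<Sum>x\<in>B. cinner x v * d x w) *\<^sub>C w)"
        by (simp add: scaleC_sum scaleC_scaleC scaleC_sum_left) (rule sum.swap)
      finally have "u = complex_of_real (1 / norm r) *\<^sub>C v +
         (\<Sum>w\<in>V. (- complex_of_real (1 / norm r) * (\<Sum>x\<in>B. cinner x v * d x w)) *\<^sub>C w)"
        by (simp add: u_def r_def diff_conv_add_uminus scaleC_add_right scaleC_minus scaleC_sum scaleC_scaleC
            sum_negf del: add_uminus_conv_diff)
      then show ?thesis by (rule span)
    qed
    show ?thesis
    proof (intro exI[of _ "insert u B"] conjI ballI)
      show "finite (insert u B)" using B by simp
      show "cinner x y = (if x = y then 1 else 0)" if "x \<in> insert u B" "y \<in> insert u B" for x y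
        using that B(2) uu xu uO by auto
      show "\<exists>d. x = (\<Sum>v\<in>insert v V. d v *\<^sub>C v)" if "x \<in> insert u B" for x
        using that by (elim insertE) (simp only: spanu, rule span0)
      show "w = (\<Sum>x\<in>insert u B. cinner x w *\<^sub>C x)" if "w \<in> insert v V" for w
      proof (cases "w = v")
        case True
        have "r = cinner u v *\<^sub>C u" unfolding uv by (rule r_u)
        then have "v = cinner u v *\<^sub>C u + (\<Sum>x\<in>B. cinner x v *\<^sub>C x)" unfolding r_def by (simp add: algebra_simps)
        also have "\<dots> = (\<Sum>x\<in>insert u B. cinner x v *\<^sub>C x)" using B(1) uO by simp
        finally show ?thesis unfolding True .
      next
        case False
        then have w: "w \<in> V" using that by simp
        have "(\<Sum>x\<in>insert u B. cinner x w *\<^sub>C x) = (\<Sum>x\<in>B. cinner x w *\<^sub>C x)"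
          using B(1) uO uV[OF w] by simp
        then show ?thesis using B(4)[OF w] by (rule trans[OF _ sym, rotated])
      qed
    qed
  qed
qed

text \<open>The inequality for all finite sums includes well-definedness: applied to a difference it
  shows that sums with equal \<open>G\<close> side have equal \<open>H\<close> side. Closure of the
  index set under real scalars makes these sums a subspace. Complex coefficients are meant to be
  part of the index, so that the target may be a space of vectors or of operators.\<close>

lemma bounded_extension:
  fixes G :: "'i \<Rightarrow> 'a::real_normed_vector" and H :: "'i \<Rightarrow> 'b::banach"
  assumes bound: "\<And>xs. set xs \<subseteq> I \<Longrightarrow> norm (\<Sum>i\<leftarrow>xs. H i) \<le> C * norm (\<Sum>i\<leftarrow>xs. G i)"
    and scale: "\<And>i r. i \<in> I \<Longrightarrow> \<exists>j\<in>I. G j = r *\<^sub>R G i \<and> H j = r *\<^sub>R H i"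
    and dense: "closure {\<Sum>i\<leftarrow>xs. G i | xs. set xs \<subseteq> I} = UNIV" and C: "0 \<le> C"
  shows "\<exists>T. norm T \<le> C \<and> (\<forall>i\<in>I. blinfun_apply T (G i) = H i)"
proof -
  define S where "S = {\<Sum>i\<leftarrow>xs. G i | xs. set xs \<subseteq> I}"
  define sc where "sc r i = (SOME j. j \<in> I \<and> G j = r *\<^sub>R G i \<and> H j = r *\<^sub>R H i)" for r i
  have sc: "sc r i \<in> I \<and> G (sc r i) = r *\<^sub>R G i \<and> H (sc r i) = r *\<^sub>R H i" if "i \<in> I" for i r
    unfolding sc_def using someI_ex[OF scale[OF that, of r, unfolded Bex_def]] .
  have scl: "(\<Sum>i\<leftarrow>map (sc r) xs. G i) = r *\<^sub>R (\<Sum>i\<leftarrow>xs. G i) \<and>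
      (\<Sum>i\<leftarrow>map (sc r) xs. H i) = r *\<^sub>R (\<Sum>i\<leftarrow>xs. H i) \<and> set (map (sc r) xs) \<subseteq> I"
    if "set xs \<subseteq> I" for r xs
    using that sc by (induction xs) (auto simp: scaleR_add_right)
  define ch where "ch v = (SOME xs. set xs \<subseteq> I \<and> (\<Sum>i\<leftarrow>xs. G i) = v)" for v
  define f where "f v = (\<Sum>i\<leftarrow>ch v. H i)" for v
  \<comment> \<open>Three lists with real coefficients at once: the coefficients (1, 1, -1), (r, -1,
    0) and (1, -1, 0) give additivity, homogeneity and the Lipschitz bound.\<close>
  have lip: "norm (a *\<^sub>R (\<Sum>i\<leftarrow>xs. H i) + b *\<^sub>R (\<Sum>i\<leftarrow>ys. H i) + c *\<^sub>R (\<Sum>i\<leftarrow>zs. H i)) \<le>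
      C * norm (a *\<^sub>R (\<Sum>i\<leftarrow>xs. G i) + b *\<^sub>R (\<Sum>i\<leftarrow>ys. G i) + c *\<^sub>R (\<Sum>i\<leftarrow>zs. G i))"
    if "set xs \<subseteq> I" "set ys \<subseteq> I" "set zs \<subseteq> I" for xs ys zs a b c
    using bound[of "map (sc a) xs @ map (sc b) ys @ map (sc c) zs"] scl[OF that(1), of a] scl[OF that(2), of b]
      scl[OF that(3), of c]
    by (simp add: add.assoc)
  have ch: "set (ch v) \<subseteq> I \<and> (\<Sum>i\<leftarrow>ch v. G i) = v" if "v \<in> S" for v
  proof -
    have "\<exists>xs. set xs \<subseteq> I \<and> (\<Sum>i\<leftarrow>xs. G i) = v" using that unfolding S_def by blast
    then show ?thesis unfolding ch_def by (rule someI_ex)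
  qed
  have f_eq: "f (\<Sum>i\<leftarrow>xs. G i) = (\<Sum>i\<leftarrow>xs. H i)" if "set xs \<subseteq> I" for xs
  proof -
    have m: "(\<Sum>i\<leftarrow>xs. G i) \<in> S" using that S_def by blast
    show ?thesis using lip[of xs "ch (\<Sum>i\<leftarrow>xs. G i)" "[]" 1 "- 1" 0] ch[OF m] that by (simp add: f_def)
  qed
  have fC: "norm (a *\<^sub>R f x + b *\<^sub>R f y + c *\<^sub>R f z) \<le> C * norm (a *\<^sub>R x + b *\<^sub>R y + c *\<^sub>R z)"
    if "x \<in> S" "y \<in> S" "z \<in> S" for x y z a b c
    using lip[of "ch x" "ch y" "ch z" a b c] ch that unfolding f_def by simp
  have S_ops: "x + y \<in> S" "r *\<^sub>R x \<in> S" if xy: "x \<in> S" "y \<in> S" for x y r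
  proof -
    obtain xs ys where xs: "set xs \<subseteq> I" "set ys \<subseteq> I" "x = (\<Sum>i\<leftarrow>xs. G i)" "y = (\<Sum>i\<leftarrow>ys. G i)"
      using xy S_def by auto
    then have "set (xs @ ys) \<subseteq> I" "x + y = (\<Sum>i\<leftarrow>xs @ ys. G i)" by auto
    then show "x + y \<in> S" unfolding S_def by blast
    have "r *\<^sub>R x = (\<Sum>i\<leftarrow>map (sc r) xs. G i)" "set (map (sc r) xs) \<subseteq> I" using scl[OF xs(1), of r] xs(3) by simp_all
    then show "r *\<^sub>R x \<in> S" unfolding S_def by blast
  qed
  have add: "f (x + y) = f x + f y" if "x \<in> S" "y \<in> S" for x y
    using fC[of x y "x + y" 1 1 "- 1"] S_ops[OF that] that by simp
  have smul: "f (r *\<^sub>R x) = r *\<^sub>R f x" if "x \<in> S" for x r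
    using fC[of x "r *\<^sub>R x" x r "- 1" 0] S_ops[OF that that] that by simp
  have ext: "uniformly_continuous_on S f"
    unfolding uniformly_continuous_on_def
  proof (intro allI impI)
    fix e :: real assume e: "0 < e"
    show "\<exists>d>0. \<forall>x\<in>S. \<forall>x'\<in>S. dist x' x < d \<longrightarrow> dist (f x') (f x) < e"
    proof (intro exI[of _ "e / (C + 1)"] conjI ballI impI)
      show "e / (C + 1) > 0" using e C by simp
      fix x x' assume x: "x \<in> S" "x' \<in> S" "dist x' x < e / (C + 1)"
      have "dist (f x') (f x) \<le> C * dist x' x" using fC[of x' x x 1 "- 1" 0] x by (simp add: dist_norm)
      also have "\<dots> \<le> (C + 1) * dist x' x" by (intro mult_right_mono) auto
      also have "\<dots> < e" using x C by (simp add: field_simps)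
      finally show "dist (f x') (f x) < e" .
    qed
  qed
  obtain g where g: "uniformly_continuous_on (closure S) g" "\<And>x. x \<in> S \<Longrightarrow> f x = g x"
    using uniformly_continuous_on_extension_on_closure[OF ext] by metis
  have cl: "closure S = UNIV" using dense S_def by simp
  have cont: "isCont g x" for x
    using uniformly_continuous_imp_continuous[OF g(1)] cl by (simp add: continuous_on_eq_continuous_at)
  have seq: "\<exists>s. (\<forall>n. s n \<in> S) \<and> s \<longlonglongrightarrow> x" for x using cl closure_sequential[of x S] by auto
  have "bounded_linear g"
  proof (rule bounded_linear_intro)
    fix x y
    obtain s t where s: "\<And>n. s n \<in> S" "s \<longlonglongrightarrow> x" and t: "\<And>n. t n \<in> S" "t \<longlonglongrightarrow> y" using seq by metis
    have "(\<lambda>n. g (s n + t n)) \<longlonglongrightarrow> g (x + y)" by (intro isCont_tendsto_compose[OF cont] tendsto_add s t)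
    moreover have "(\<lambda>n. g (s n) + g (t n)) \<longlonglongrightarrow> g x + g y"
      by (intro tendsto_add isCont_tendsto_compose[OF cont] s t)
    moreover have "(\<lambda>n. g (s n + t n)) = (\<lambda>n. g (s n) + g (t n))"
      using add[OF s(1) t(1)] g(2)[OF s(1)] g(2)[OF t(1)] g(2)[OF S_ops(1)[OF s(1) t(1)]] by simp
    ultimately show "g (x + y) = g x + g y" by (metis LIMSEQ_unique)
    fix r
    have "(\<lambda>n. g (r *\<^sub>R s n)) \<longlonglongrightarrow> g (r *\<^sub>R x)" by (intro isCont_tendsto_compose[OF cont] tendsto_intros s)
    moreover have "(\<lambda>n. r *\<^sub>R g (s n)) \<longlonglongrightarrow> r *\<^sub>R g x"
      by (intro tendsto_intros isCont_tendsto_compose[OF cont] s)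
    moreover have "(\<lambda>n. g (r *\<^sub>R s n)) = (\<lambda>n. r *\<^sub>R g (s n))"
      using smul[OF s(1)] g(2)[OF s(1)] g(2)[OF S_ops(2)[OF s(1) s(1)]] by simp
    ultimately show "g (r *\<^sub>R x) = r *\<^sub>R g x" by (metis LIMSEQ_unique)
    have "norm (g (s n)) \<le> norm (s n) * C" for n
      using fC[of "s n" "s n" "s n" 1 0 0] s(1) g(2)[OF s(1)] by (simp add: mult.commute)
    moreover have "(\<lambda>n. norm (g (s n))) \<longlonglongrightarrow> norm (g x)"
      by (intro tendsto_intros isCont_tendsto_compose[OF cont] s)
    moreover have "(\<lambda>n. norm (s n) * C) \<longlonglongrightarrow> norm x * C" by (intro tendsto_intros s)
    ultimately show "norm (g x) \<le> norm x * C" by (intro LIMSEQ_le) auto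
  qed
  note bl = this
  have "norm (g x) \<le> C * norm x" for x
  proof -
    obtain s where s: "\<And>n. s n \<in> S" "s \<longlonglongrightarrow> x" using seq by metis
    have "norm (g (s n)) \<le> C * norm (s n)" for n
      using fC[of "s n" "s n" "s n" 1 0 0] s(1) g(2)[OF s(1)] by simp
    moreover have "(\<lambda>n. norm (g (s n))) \<longlonglongrightarrow> norm (g x)"
      by (intro tendsto_intros isCont_tendsto_compose[OF cont] s)
    moreover have "(\<lambda>n. C * norm (s n)) \<longlonglongrightarrow> C * norm x" by (intro tendsto_intros s)
    ultimately show ?thesis by (intro LIMSEQ_le) auto
  qed
  then have "norm (Blinfun g) \<le> C" by (intro norm_blinfun_bound C) (simp add: bounded_linear_Blinfun_apply[OF bl])
  moreover have "blinfun_apply (Blinfun g) (G i) = H i" if "i \<in> I" for i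
  proof -
    have "G i \<in> S" unfolding S_def using that by (intro CollectI exI[of _ "[i]"]) simp
    then show ?thesis using f_eq[of "[i]"] that g(2) by (simp add: bounded_linear_Blinfun_apply[OF bl])
  qed
  ultimately show ?thesis by blast
qed

subsection \<open>Square integrable functions\<close>

lemma L2_half_line_iff: "f \<in> L2_half_line \<longleftrightarrow>
    f \<in> borel_measurable half_line \<and> integrable half_line (\<lambda>x. (cmod (f x))\<^sup>2)"
  by (simp add: L2_half_line_def)

lemma L2_integrable:
  assumes "f \<in> L2_half_line" "g \<in> L2_half_line"
  shows "integrable half_line (\<lambda>x. cnj (f x) * g x)"
proof (rule Bochner_Integration.integrable_bound)
  show "integrable half_line (\<lambda>x. (cmod (f x))\<^sup>2 + (cmod (g x))\<^sup>2)"
    using assms by (auto simp: L2_half_line_iff)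
  have m [measurable]: "f \<in> borel_measurable half_line" "g \<in> borel_measurable half_line"
    using assms by (auto simp: L2_half_line_iff)
  have "(\<lambda>x. cnj (f x)) \<in> borel_measurable half_line"
    by (rule borel_measurable_continuous_on[of cnj, OF _ m(1)]) (intro continuous_intros)
  then show "(\<lambda>x. cnj (f x) * g x) \<in> borel_measurable half_line" by measurable
  have "a * b \<le> a\<^sup>2 + b\<^sup>2" for a b :: real
  proof -
    have "0 \<le> (a - b)\<^sup>2 + a\<^sup>2 + b\<^sup>2" by simp
    then show ?thesis by (simp add: power2_diff)
  qed
  then show "AE x in half_line. norm (cnj (f x) * g x) \<le> norm ((cmod (f x))\<^sup>2 + (cmod (g x))\<^sup>2)"
    by (simp add: norm_mult)
qed

lemma L2_add:
  assumes "f \<in> L2_half_line" "g \<in> L2_half_line"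
  shows "(\<lambda>x. f x + g x) \<in> L2_half_line"
  unfolding L2_half_line_iff
proof
  have [measurable]: "f \<in> borel_measurable half_line" "g \<in> borel_measurable half_line"
    using assms by (auto simp: L2_half_line_iff)
  show "(\<lambda>x. f x + g x) \<in> borel_measurable half_line" by measurable
  show "integrable half_line (\<lambda>x. (cmod (f x + g x))\<^sup>2)"
  proof (rule Bochner_Integration.integrable_bound)
    show "integrable half_line (\<lambda>x. 2 * (cmod (f x))\<^sup>2 + 2 * (cmod (g x))\<^sup>2)"
      using assms by (auto simp: L2_half_line_iff)
    show "(\<lambda>x. (cmod (f x + g x))\<^sup>2) \<in> borel_measurable half_line" by measurable
    have "(cmod (a + b))\<^sup>2 \<le> 2 * (cmod a)\<^sup>2 + 2 * (cmod b)\<^sup>2" for a b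
    proof -
      have "(cmod (a + b))\<^sup>2 \<le> (cmod a + cmod b)\<^sup>2" by (intro power_mono norm_triangle_ineq) simp
      also have "\<dots> \<le> (cmod a + cmod b)\<^sup>2 + (cmod a - cmod b)\<^sup>2" by simp
      also have "\<dots> = 2 * (cmod a)\<^sup>2 + 2 * (cmod b)\<^sup>2" by (simp add: power2_sum power2_diff)
      finally show ?thesis .
    qed
    then show "AE x in half_line. norm ((cmod (f x + g x))\<^sup>2) \<le> norm (2 * (cmod (f x))\<^sup>2 + 2 * (cmod (g x))\<^sup>2)"
      by simp
  qed
qed

lemma L2_inner_add_right:
  assumes "f \<in> L2_half_line" "g \<in> L2_half_line" "h \<in> L2_half_line"
  shows "L2_inner h (\<lambda>x. f x + g x) = L2_inner h f + L2_inner h g"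
  unfolding L2_inner_def distrib_left
  by (rule Bochner_Integration.integral_add) (use assms in \<open>auto intro: L2_integrable\<close>)

text \<open>Annihilation operators are antilinear in their argument, whereas a Wick product has to
  be linear in each letter. A letter \<open>h\<close> is therefore annihilated by
  \<open>an (conj_fun h)\<close>.\<close>

definition conj_fun :: "(real \<Rightarrow> complex) \<Rightarrow> real \<Rightarrow> complex" where
  "conj_fun f x = cnj (f x)"

lemma L2_conj_fun: "f \<in> L2_half_line \<Longrightarrow> conj_fun f \<in> L2_half_line"
  unfolding L2_half_line_iff conj_fun_def[abs_def]
  by (auto intro!: borel_measurable_continuous_on[of cnj] continuous_intros)

lemma L2_inner_conj_fun: "L2_inner (conj_fun f) (conj_fun g) = cnj (L2_inner f g)"
  unfolding L2_inner_def conj_fun_def by (subst Bochner_Integration.integral_cnj[symmetric]) simp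

lemma L2_inner_cnj: "L2_inner g f = cnj (L2_inner f g)"
  unfolding L2_inner_def by (subst Bochner_Integration.integral_cnj[symmetric]) (simp add: mult.commute)

lemma L2_interval: 
  assumes "A \<in> sets borel" "A \<subseteq> {a..b}"
  shows "indicator A \<in> L2_half_line"
  unfolding L2_half_line_iff
proof
  show "indicator A \<in> borel_measurable half_line"
    by (rule measurable_restrict_space1) (use assms in measurable)
  have eq: "(\<lambda>x. (cmod (indicator A x))\<^sup>2) = indicator A" by (auto simp: indicator_def)
  have "emeasure lborel A \<le> emeasure lborel {a..b}" using assms by (intro emeasure_mono) auto
  also have "\<dots> < \<infinity>" by (simp add: emeasure_lborel_Icc_eq)
  finally have "integrable lborel (indicator A :: real \<Rightarrow> real)" using assms
    by (intro integrable_real_indicator) auto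
  then have "integrable lborel (\<lambda>x. indicator {0..} x *\<^sub>R (indicator A x :: real))"
    by (intro integrable_mult_indicator) auto
  then show "integrable half_line (\<lambda>x. (cmod (indicator A x))\<^sup>2)"
    unfolding eq by (subst integrable_restrict_space) auto
qed

lemma L2_inner_interval:
  assumes "0 \<le> a" "a \<le> b"
  shows "L2_inner (indicator {a<..b}) (indicator {a<..b}) = complex_of_real (b - a)"
proof -
  have "L2_inner (indicator {a<..b}) (indicator {a<..b}) =
      (\<integral>x. complex_of_real (indicator {a<..b} x) \<partial>half_line)"
    unfolding L2_inner_def by (intro Bochner_Integration.integral_cong) (auto simp: indicator_def)
  also have "\<dots> = complex_of_real (\<integral>x. indicator {a<..b} x \<partial>half_line)" by simp
  also have "(\<integral>x. indicator {a<..b} x \<partial>half_line) = (\<integral>x. indicator {0..} x *\<^sub>R (indicator {a<..b} x :: real) \<partial>lborel)"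
    by (subst integral_restrict_space) auto
  also have "\<dots> = (\<integral>x. indicator {a<..b} x \<partial>lborel)"
    using assms by (intro Bochner_Integration.integral_cong) (auto simp: indicator_def)
  also have "\<dots> = b - a" using assms by simp
  finally show ?thesis .
qed

lemma L2_inner_disjoint: "(\<And>x. f x = 0 \<or> g x = 0) \<Longrightarrow> L2_inner f g = 0"
  unfolding L2_inner_def by (subst Bochner_Integration.integral_cong[of _ _ _ "\<lambda>x. 0"]) auto

subsection \<open>Inversions and the recursive structure of the deformed inner product\<close>

text \<open>\<open>skip p\<close> enumerates the numbers different from \<open>p\<close> in
  increasing order and \<open>unskip p\<close> inverts it. Together with \<open>extend_perm\<close>
  they identify a permutation of n + 1 points with the image \<open>p\<close> of 0 and a permutation
  of n points.\<close>

definition skip :: "nat \<Rightarrow> nat \<Rightarrow> nat" where "skip p j = (if j < p then j else Suc j)"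
definition unskip :: "nat \<Rightarrow> nat \<Rightarrow> nat" where "unskip p j = (if j < p then j else j - 1)"
definition extend_perm :: "nat \<Rightarrow> (nat \<Rightarrow> nat) \<Rightarrow> nat \<Rightarrow> nat" where
  "extend_perm p \<tau> k = (case k of 0 \<Rightarrow> p | Suc j \<Rightarrow> skip p (\<tau> j))"

lemma extend_perm_simps [simp]: "extend_perm p \<tau> 0 = p" "extend_perm p \<tau> (Suc j) = skip p (\<tau> j)"
  by (simp_all add: extend_perm_def)

lemma extend_perm_permutes:
  assumes "\<tau> permutes {..<n}" "p < Suc n"
  shows "extend_perm p \<tau> permutes {..<Suc n}"
proof (rule bij_imp_permutes)
  have inj: "inj_on (extend_perm p \<tau>) {..<Suc n}"
  proof (rule inj_onI)
    fix x y assume "x \<in> {..<Suc n}" "y \<in> {..<Suc n}" "extend_perm p \<tau> x = extend_perm p \<tau> y"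
    then show "x = y"
      using permutes_inj[OF assms(1), THEN injD, of "x - 1" "y - 1"]
      by (cases x; cases y) (auto simp: skip_def split: if_splits)
  qed
  have "extend_perm p \<tau> ` {..<Suc n} \<subseteq> {..<Suc n}"
  proof
    fix y assume "y \<in> extend_perm p \<tau> ` {..<Suc n}"
    then obtain x where "x < Suc n" "y = extend_perm p \<tau> x" by auto
    then show "y \<in> {..<Suc n}" using assms permutes_in_image[OF assms(1), of "x - 1"]
      by (cases x) (auto simp: skip_def)
  qed
  then show "bij_betw (extend_perm p \<tau>) {..<Suc n} {..<Suc n}"
    using inj by (simp add: bij_betw_def endo_inj_surj)
  show "extend_perm p \<tau> x = x" if "x \<notin> {..<Suc n}" for x
    using that assms(2) permutes_not_in[OF assms(1), of "x - 1"] by (cases x) (auto simp: skip_def)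
qed

lemma restrict_perm_permutes:
  assumes "\<sigma> permutes {..<Suc n}"
  shows "(\<lambda>k. unskip (\<sigma> 0) (\<sigma> (Suc k))) permutes {..<n}"
proof (rule bij_imp_permutes)
  have ne: "\<sigma> (Suc x) \<noteq> \<sigma> 0" for x using permutes_inj[OF assms] by (auto dest: injD)
  have lt: "\<sigma> 0 < Suc n" using permutes_in_image[OF assms, of 0] by simp
  have inj: "inj_on (\<lambda>k. unskip (\<sigma> 0) (\<sigma> (Suc k))) {..<n}"
  proof (rule inj_onI)
    fix x y assume "unskip (\<sigma> 0) (\<sigma> (Suc x)) = unskip (\<sigma> 0) (\<sigma> (Suc y))"
    then have "\<sigma> (Suc x) = \<sigma> (Suc y)" using ne[of x] ne[of y] by (auto simp: unskip_def split: if_splits)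
    then show "x = y" using permutes_inj[OF assms] by (auto dest: injD)
  qed
  have "(\<lambda>k. unskip (\<sigma> 0) (\<sigma> (Suc k))) ` {..<n} \<subseteq> {..<n}"
  proof
    fix y assume "y \<in> (\<lambda>k. unskip (\<sigma> 0) (\<sigma> (Suc k))) ` {..<n}"
    then obtain x where "x < n" "y = unskip (\<sigma> 0) (\<sigma> (Suc x))" by auto
    then show "y \<in> {..<n}" using ne[of x] lt permutes_in_image[OF assms, of "Suc x"]
      by (auto simp: unskip_def)
  qed
  then show "bij_betw (\<lambda>k. unskip (\<sigma> 0) (\<sigma> (Suc k))) {..<n} {..<n}"
    using inj by (simp add: bij_betw_def endo_inj_surj)
  show "unskip (\<sigma> 0) (\<sigma> (Suc x)) = x" if "x \<notin> {..<n}" for x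
    using that lt permutes_not_in[OF assms, of "Suc x"] by (auto simp: unskip_def)
qed

text \<open>An inversion involving 0 corresponds to a value below \<open>p\<close>, and there are
  \<open>p\<close> of these; all other pairs keep their order because \<open>skip p\<close> is
  increasing.\<close>

lemma inversions_extend_perm:
  assumes "\<tau> permutes {..<n}" "p < Suc n"
  shows "inversions (Suc n) (extend_perm p \<tau>) = p + inversions n \<tau>"
proof -
  let ?A = "(\<lambda>j. (0::nat, Suc j)) ` {j \<in> {..<n}. \<tau> j < p}"
  let ?B = "(\<lambda>(i, j). (Suc i, Suc j)) ` {(i, j). i < j \<and> j < n \<and> \<tau> j < \<tau> i}"
  have fin: "finite {(i, j). i < j \<and> j < n \<and> \<tau> j < \<tau> i}"
    by (rule finite_subset[of _ "{..<n} \<times> {..<n}"]) auto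
  have "{(i, j). i < j \<and> j < Suc n \<and> extend_perm p \<tau> j < extend_perm p \<tau> i} = ?A \<union> ?B"
  proof (rule set_eqI, clarify)
    fix i j
    show "((i, j) \<in> {(i, j). i < j \<and> j < Suc n \<and> extend_perm p \<tau> j < extend_perm p \<tau> i}) =
        ((i, j) \<in> ?A \<union> ?B)"
      by (cases i; cases j) (auto simp: skip_def image_iff)
  qed
  then have "inversions (Suc n) (extend_perm p \<tau>) = card (?A \<union> ?B)" by (simp add: inversions_def)
  also have "\<dots> = card ?A + card ?B" using fin by (intro card_Un_disjoint) auto
  also have "card ?B = inversions n \<tau>" unfolding inversions_def by (intro card_image inj_onI) auto
  also have "card ?A = card {j \<in> {..<n}. \<tau> j < p}" by (intro card_image inj_onI) auto
  also have "\<dots> = card (\<tau> ` {j \<in> {..<n}. \<tau> j < p})"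
    by (rule card_image[symmetric]) (meson assms(1) inj_on_subset permutes_inj subset_UNIV)
  also have "\<tau> ` {j \<in> {..<n}. \<tau> j < p} = {..<p}"
  proof
    show "{..<p} \<subseteq> \<tau> ` {j \<in> {..<n}. \<tau> j < p}"
    proof
      fix y assume y: "y \<in> {..<p}"
      then have "y \<in> \<tau> ` {..<n}" using permutes_image[OF assms(1)] assms(2) by auto
      then show "y \<in> \<tau> ` {j \<in> {..<n}. \<tau> j < p}" using y by auto
    qed
  qed auto
  finally show ?thesis by simp
qed

text \<open>The q-permanent of the matrix \<open>G\<close>, which interpolates between the
  determinant at q = -1 and the permanent at q = 1.\<close>

definition perm_sum :: "real \<Rightarrow> nat \<Rightarrow> (nat \<Rightarrow> nat \<Rightarrow> complex) \<Rightarrow> complex" where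
  "perm_sum q n G = (\<Sum>\<sigma> | \<sigma> permutes {..<n}. complex_of_real (q ^ inversions n \<sigma>) * (\<Prod>i<n. G i (\<sigma> i)))"

text \<open>Expansion along the first row: a permutation splits into the image p of 0 and the
  induced permutation of the remaining points, and the inversions that involve 0 account for
  \<open>q ^ p\<close>.\<close>

lemma perm_sum_Suc:
  "perm_sum q (Suc n) G =
    (\<Sum>p<Suc n. complex_of_real (q ^ p) * G 0 p * perm_sum q n (\<lambda>i j. G (Suc i) (skip p j)))"
proof -
  have "perm_sum q (Suc n) G = (\<Sum>(p, \<tau>)\<in>{..<Suc n} \<times> {\<tau>. \<tau> permutes {..<n}}.
      complex_of_real (q ^ p) * G 0 p * (complex_of_real (q ^ inversions n \<tau>) * (\<Prod>i<n. G (Suc i) (skip p (\<tau> i)))))"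
    unfolding perm_sum_def
  proof (rule sum.reindex_bij_witness[where i="\<lambda>(p, \<tau>). extend_perm p \<tau>"
        and j="\<lambda>\<sigma>. (\<sigma> 0, \<lambda>k. unskip (\<sigma> 0) (\<sigma> (Suc k)))"])
    fix \<sigma> assume "\<sigma> \<in> {\<sigma>. \<sigma> permutes {..<Suc n}}"
    then have \<sigma>: "\<sigma> permutes {..<Suc n}" by simp
    let ?\<tau> = "\<lambda>k. unskip (\<sigma> 0) (\<sigma> (Suc k))"
    have ne: "\<sigma> (Suc x) \<noteq> \<sigma> 0" for x using permutes_inj[OF \<sigma>] by (auto dest: injD)
    have lt: "\<sigma> 0 < Suc n" using permutes_in_image[OF \<sigma>, of 0] by simp
    have ext: "extend_perm (\<sigma> 0) ?\<tau> = \<sigma>"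
    proof
      fix k show "extend_perm (\<sigma> 0) ?\<tau> k = \<sigma> k"
        using ne[of "k - 1"] by (cases k) (auto simp: skip_def unskip_def)
    qed
    show "(case (\<sigma> 0, ?\<tau>) of (p, \<tau>) \<Rightarrow> extend_perm p \<tau>) = \<sigma>" using ext by simp
    show "(\<sigma> 0, ?\<tau>) \<in> {..<Suc n} \<times> {\<tau>. \<tau> permutes {..<n}}"
      using restrict_perm_permutes[OF \<sigma>] lt by simp
    have "inversions (Suc n) \<sigma> = \<sigma> 0 + inversions n ?\<tau>"
      using inversions_extend_perm[OF restrict_perm_permutes[OF \<sigma>] lt] ext by simp
    moreover have "(\<Prod>i<Suc n. G i (\<sigma> i)) = G 0 (\<sigma> 0) * (\<Prod>i<n. G (Suc i) (skip (\<sigma> 0) (?\<tau> i)))"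
      by (subst prod.lessThan_Suc_shift, subst (2) ext[symmetric]) (simp only: extend_perm_simps)
    ultimately show "(case (\<sigma> 0, ?\<tau>) of (p, \<tau>) \<Rightarrow> complex_of_real (q ^ p) * G 0 p *
        (complex_of_real (q ^ inversions n \<tau>) * (\<Prod>i<n. G (Suc i) (skip p (\<tau> i))))) =
        complex_of_real (q ^ inversions (Suc n) \<sigma>) * (\<Prod>i<Suc n. G i (\<sigma> i))"
      by (simp add: power_add mult_ac)
  next
    fix b assume "b \<in> {..<Suc n} \<times> {\<tau>. \<tau> permutes {..<n}}"
    then obtain p \<tau> where b: "b = (p, \<tau>)" "p < Suc n" "\<tau> permutes {..<n}" by auto
    have "unskip p (skip p (\<tau> k)) = \<tau> k" for k by (simp add: skip_def unskip_def)
    then show "((case b of (p, \<tau>) \<Rightarrow> extend_perm p \<tau>) 0, \<lambda>k. unskip ((case b of (p, \<tau>) \<Rightarrow> extend_perm p \<tau>) 0)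
        ((case b of (p, \<tau>) \<Rightarrow> extend_perm p \<tau>) (Suc k))) = b"
      using b by simp
    show "(case b of (p, \<tau>) \<Rightarrow> extend_perm p \<tau>) \<in> {\<sigma>. \<sigma> permutes {..<Suc n}}"
      using b extend_perm_permutes by simp
  qed
  also have "\<dots> = (\<Sum>p<Suc n. \<Sum>\<tau> | \<tau> permutes {..<n}. complex_of_real (q ^ p) * G 0 p *
      (complex_of_real (q ^ inversions n \<tau>) * (\<Prod>i<n. G (Suc i) (skip p (\<tau> i)))))"
    by (rule sum.cartesian_product[symmetric])
  finally show ?thesis by (simp only: perm_sum_def sum_distrib_left)
qed

text \<open>Entries are a weight, an extracted letter and the remaining word. The extracted letter
  pays q for every letter it passes on its way to the front, as under the annihilation
  operator.\<close>

fun split_letter :: "real \<Rightarrow> 'a list \<Rightarrow> (real \<times> 'a \<times> 'a list) list" where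
  "split_letter q [] = []"
| "split_letter q (h # w) = (1, h, w) # map (\<lambda>(c, g, w'). (q * c, g, h # w')) (split_letter q w)"

lemma sum_split_letter:
  "(\<Sum>(c, g, w')\<leftarrow>split_letter q w. F c g w') =
    (\<Sum>p<length w. F (q ^ p) (w ! p) (take p w @ drop (Suc p) w))"
proof (induction w arbitrary: F)
  case (Cons h w)
  have "(\<Sum>(c, g, w')\<leftarrow>split_letter q (h # w). F c g w') =
      F 1 h w + (\<Sum>(c, g, w')\<leftarrow>split_letter q w. F (q * c) g (h # w'))"
    by (simp add: comp_def case_prod_unfold)
  also have "\<dots> = F 1 h w + (\<Sum>p<length w. F (q * q ^ p) (w ! p) (h # take p w @ drop (Suc p) w))"
    by (simp add: Cons.IH)
  also have "\<dots> = (\<Sum>p<length (h # w). F (q ^ p) ((h # w) ! p) (take p (h # w) @ drop (Suc p) (h # w)))"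
    by (simp add: sum.lessThan_Suc_shift del: sum.lessThan_Suc)
  finally show ?case .
qed simp

lemma q_inner_eq: "q_inner q fs gs = (if length fs = length gs
    then perm_sum q (length fs) (\<lambda>i j. L2_inner (fs ! i) (gs ! j)) else 0)"
  by (simp add: q_inner_def perm_sum_def)

lemma q_inner_Cons:
  "q_inner q (f # u) w =
    (\<Sum>(c, g, w')\<leftarrow>split_letter q w. complex_of_real c * L2_inner f g * q_inner q u w')"
proof (cases "length w = Suc (length u)")
  case True
  have "q_inner q (f # u) w = (\<Sum>p<Suc (length u). complex_of_real (q ^ p) * L2_inner f (w ! p) *
      perm_sum q (length u) (\<lambda>i j. L2_inner (u ! i) (w ! skip p j)))"
    using True by (simp only: q_inner_eq list.size add_0_right add_Suc_right simp_thms if_True perm_sum_Suc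
      nth_Cons_0 nth_Cons_Suc)
  also have "\<dots> = (\<Sum>p<length w. complex_of_real (q ^ p) * L2_inner f (w ! p) *
      q_inner q u (take p w @ drop (Suc p) w))"
  proof (rule sum.cong)
    fix p assume "p \<in> {..<length w}"
    then have p: "p \<le> length u" using True by simp
    have "perm_sum q (length u) (\<lambda>i j. L2_inner (u ! i) (w ! skip p j)) =
       perm_sum q (length u) (\<lambda>i j. L2_inner (u ! i) ((take p w @ drop (Suc p) w) ! j))"
      unfolding perm_sum_def
    proof (intro sum.cong refl arg_cong2[of _ _ _ _ "(*)"] prod.cong)
      fix \<sigma> i assume "\<sigma> \<in> {\<sigma>. \<sigma> permutes {..<length u}}" "i \<in> {..<length u}"
      then have "\<sigma> i < length u" using permutes_in_image[of \<sigma> "{..<length u}" i] by simp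
      then show "L2_inner (u ! i) (w ! skip p (\<sigma> i)) = L2_inner (u ! i) ((take p w @ drop (Suc p) w) ! \<sigma> i)"
        using p True by (simp add: skip_def nth_append)
    qed
    then show "complex_of_real (q ^ p) * L2_inner f (w ! p) * perm_sum q (length u) (\<lambda>i j. L2_inner (u ! i) (w ! skip p j)) =
       complex_of_real (q ^ p) * L2_inner f (w ! p) * q_inner q u (take p w @ drop (Suc p) w)"
      using p True by (simp add: q_inner_eq)
  qed (use True in simp)
  finally show ?thesis by (simp add: sum_split_letter)
next
  case False
  then have "q_inner q u (take p w @ drop (Suc p) w) = 0" if "p < length w" for p
    using that by (auto simp: q_inner_eq)
  then show ?thesis using False by (simp add: sum_split_letter q_inner_eq)
qed

lemma q_inner_conj_fun: "q_inner q (map conj_fun u) (map conj_fun v) = cnj (q_inner q u v)"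
proof (cases "length u = length v")
  case True
  have "perm_sum q (length v) (\<lambda>i j. L2_inner (map conj_fun u ! i) (map conj_fun v ! j)) =
      perm_sum q (length v) (\<lambda>i j. cnj (L2_inner (u ! i) (v ! j)))"
    unfolding perm_sum_def
  proof (intro sum.cong refl arg_cong2[of _ _ _ _ "(*)"] prod.cong)
    fix \<sigma> i assume "\<sigma> \<in> {\<sigma>. \<sigma> permutes {..<length v}}" "i \<in> {..<length v}"
    then have "\<sigma> i < length v" using permutes_in_image[of \<sigma> "{..<length v}" i] by simp
    then show "L2_inner (map conj_fun u ! i) (map conj_fun v ! \<sigma> i) = cnj (L2_inner (u ! i) (v ! \<sigma> i))"
      using True \<open>i \<in> _\<close> by (simp add: L2_inner_conj_fun)
  qed
  also have "\<dots> = cnj (perm_sum q (length v) (\<lambda>i j. L2_inner (u ! i) (v ! j)))"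
    by (simp add: perm_sum_def)
  finally show ?thesis using True by (simp add: q_inner_eq)
qed (simp add: q_inner_eq)

text \<open>Reversing both words conjugates the permutation by the order reversal \<open>r\<close>,
  and (i, j) is an inversion of the conjugate exactly when (r j, r i) is one of the original.
  Reversals arise from adjoints of products.\<close>

lemma q_inner_rev: "q_inner q (rev u) (rev v) = q_inner q u v"
proof (cases "length u = length v")
  case True
  define n where "n = length v"
  define r where "r i = (if i < n then n - 1 - i else i)" for i
  have rr: "r (r i) = i" for i by (auto simp: r_def)
  have rlt: "r i < n \<longleftrightarrow> i < n" for i by (auto simp: r_def)
  have r_less: "r i < r j \<longleftrightarrow> j < i" if "i < n" "j < n" for i j using that by (auto simp: r_def)
  have rp: "r permutes {..<n}"
    by (rule bij_imp_permutes) (auto intro!: bij_betw_byWitness[where f'=r] simp: rr rlt, auto simp: r_def)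
  have inv: "inversions n (r \<circ> \<sigma> \<circ> r) = inversions n \<sigma>" if \<sigma>: "\<sigma> permutes {..<n}" for \<sigma>
    unfolding inversions_def
  proof (rule bij_betw_same_card[where f="\<lambda>(i, j). (r j, r i)"],
      rule bij_betw_byWitness[where f'="\<lambda>(i, j). (r j, r i)"])
    have \<sigma>lt: "\<sigma> i < n" if "i < n" for i using permutes_in_image[OF \<sigma>, of i] that by simp
    show "(\<lambda>(i, j). (r j, r i)) ` {(i, j). i < j \<and> j < n \<and> (r \<circ> \<sigma> \<circ> r) j < (r \<circ> \<sigma> \<circ> r) i}
        \<subseteq> {(i, j). i < j \<and> j < n \<and> \<sigma> j < \<sigma> i}"
      by (auto simp: r_less rlt \<sigma>lt)
    show "(\<lambda>(i, j). (r j, r i)) ` {(i, j). i < j \<and> j < n \<and> \<sigma> j < \<sigma> i}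
       \<subseteq> {(i, j). i < j \<and> j < n \<and> (r \<circ> \<sigma> \<circ> r) j < (r \<circ> \<sigma> \<circ> r) i}"
      by (auto simp: r_less rlt \<sigma>lt rr)
  qed (auto simp: rr)
  have "perm_sum q n (\<lambda>i j. L2_inner (rev u ! i) (rev v ! j)) =
      (\<Sum>\<sigma> | \<sigma> permutes {..<n}. complex_of_real (q ^ inversions n \<sigma>) * (\<Prod>i<n. L2_inner (u ! i) (v ! \<sigma> i)))"
    unfolding perm_sum_def
  proof (rule sum.reindex_bij_witness[where i="\<lambda>\<sigma>. r \<circ> \<sigma> \<circ> r" and j="\<lambda>\<sigma>. r \<circ> \<sigma> \<circ> r"])
    fix \<sigma> assume "\<sigma> \<in> {\<sigma>. \<sigma> permutes {..<n}}"
    then have \<sigma>: "\<sigma> permutes {..<n}" by simp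
    show "r \<circ> (r \<circ> \<sigma> \<circ> r) \<circ> r = \<sigma>" by (simp add: fun_eq_iff rr)
    show "r \<circ> \<sigma> \<circ> r \<in> {\<sigma>. \<sigma> permutes {..<n}}" using \<sigma> rp by (simp add: permutes_compose)
    then have p: "r \<circ> \<sigma> \<circ> r permutes {..<n}" by simp
    have \<sigma>lt: "\<sigma> i < n" if "i < n" for i using permutes_in_image[OF \<sigma>, of i] that by simp
    have "(\<Prod>i<n. L2_inner (u ! i) (v ! (r \<circ> \<sigma> \<circ> r) i)) = (\<Prod>i<n. L2_inner (u ! r i) (v ! (r \<circ> \<sigma> \<circ> r) (r i)))"
      by (rule prod.reindex_bij_betw[symmetric, where h=r]) (rule permutes_imp_bij[OF rp])
    also have "\<dots> = (\<Prod>i<n. L2_inner (rev u ! i) (rev v ! \<sigma> i))"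
    proof (rule prod.cong[OF refl])
      fix i assume "i \<in> {..<n}"
      then show "L2_inner (u ! r i) (v ! (r \<circ> \<sigma> \<circ> r) (r i)) = L2_inner (rev u ! i) (rev v ! \<sigma> i)"
        using True \<sigma>lt[of i] by (simp add: rr rev_nth) (simp add: r_def rev_nth n_def)
    qed
    finally show "complex_of_real (q ^ inversions n (r \<circ> \<sigma> \<circ> r)) * (\<Prod>i<n. L2_inner (u ! i) (v ! (r \<circ> \<sigma> \<circ> r) i)) =
        complex_of_real (q ^ inversions n \<sigma>) * (\<Prod>i<n. L2_inner (rev u ! i) (rev v ! \<sigma> i))"
      using inv[OF \<sigma>] by simp
  next
    fix \<sigma> assume "\<sigma> \<in> {\<sigma>. \<sigma> permutes {..<n}}"
    then have \<sigma>: "\<sigma> permutes {..<n}" by simp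
    show "r \<circ> (r \<circ> \<sigma> \<circ> r) \<circ> r = \<sigma>" by (simp add: fun_eq_iff rr)
    show "r \<circ> \<sigma> \<circ> r \<in> {\<sigma>. \<sigma> permutes {..<n}}" using \<sigma> rp by (simp add: permutes_compose)
  qed
  then show ?thesis using True by (simp add: q_inner_eq n_def perm_sum_def)
qed (simp add: q_inner_eq)

text \<open>All splittings of a word into a subword \<open>u\<close> of length \<open>k\<close> and
  the complementary subword \<open>v\<close>. The weight counts the pairs in which a letter of
  \<open>v\<close> precedes a letter of \<open>u\<close>: a letter put into \<open>v\<close> while
  \<open>k\<close> letters of \<open>u\<close> are still to come pays \<open>q ^ k\<close>.\<close>

fun unshuffle :: "real \<Rightarrow> nat \<Rightarrow> 'a list \<Rightarrow> (real \<times> 'a list \<times> 'a list) list" where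
  "unshuffle q k [] = (if k = 0 then [(1, [], [])] else [])"
| "unshuffle q k (h # w) =
    (case k of 0 \<Rightarrow> [] | Suc k' \<Rightarrow> map (\<lambda>(c, u, v). (c, h # u, v)) (unshuffle q k' w)) @
    map (\<lambda>(c, u, v). (q ^ k * c, u, h # v)) (unshuffle q k w)"

lemma unshuffle_0: "unshuffle q 0 w = [(1, [], w)]"
  by (induction w) simp_all

lemma unshuffle_props:
  assumes "(c, u, v) \<in> set (unshuffle q k w)" "0 \<le> q"
  shows "length u = k" "length u + length v = length w" "set u \<subseteq> set w" "set v \<subseteq> set w" "0 \<le> c"
  using assms
proof (induction w arbitrary: k c u v)
  case Nil
  { case 1 then show ?case using Nil by (auto split: if_splits) }
  { case 2 then show ?case using Nil by (auto split: if_splits) }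
  { case 3 then show ?case using Nil by (auto split: if_splits) }
  { case 4 then show ?case using Nil by (auto split: if_splits) }
  { case 5 then show ?case using Nil by (auto split: if_splits) }
next
  case (Cons h w)
  { case 1 then show ?case using Cons.IH(1) by (fastforce split: nat.splits) }
  { case 2 then show ?case using Cons.IH(2) by (fastforce split: nat.splits) }
  { case 3 then show ?case using Cons.IH(3) by (fastforce split: nat.splits) }
  { case 4 then show ?case using Cons.IH(4) by (fastforce split: nat.splits) }
  { case 5 then show ?case using Cons.IH(5) by (fastforce split: nat.splits) }
qed

text \<open>The reciprocal of the q-Pochhammer symbol \<open>(q; q)_k\<close>. It bounds the
  Gaussian binomial coefficients "n choose k" uniformly in n.\<close>

fun q_const :: "real \<Rightarrow> nat \<Rightarrow> real" where
  "q_const q 0 = 1"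
| "q_const q (Suc k) = q_const q k / (1 - q ^ Suc k)"

lemma power_Suc_less_1: "0 \<le> q \<Longrightarrow> q < 1 \<Longrightarrow> q ^ Suc k < (1::real)"
  using power_Suc_less_one[of q k] by (cases "q = 0") auto

lemma q_const_bounds:
  assumes "0 \<le> q" "q < 1"
  shows "1 \<le> q_const q k" "q_const q k \<le> q_const q (Suc k)"
proof -
  have step: "c \<le> c / (1 - q ^ Suc k)" if "1 \<le> c" for c k
  proof -
    have "0 \<le> q ^ Suc k" "q ^ Suc k < 1" using assms power_Suc_less_1 by simp_all
    moreover from this have "c * (1 - q ^ Suc k) \<le> c * 1" using that by (intro mult_left_mono) auto
    ultimately show ?thesis by (subst pos_le_divide_eq) auto
  qed
  show 1: "1 \<le> q_const q k"
  proof (induction k)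
    case (Suc k)
    then show ?case using step[of "q_const q k" k] by simp
  qed simp
  then show "q_const q k \<le> q_const q (Suc k)" using step[of "q_const q k" k] by simp
qed

lemma q_const_mono: "0 \<le> q \<Longrightarrow> q < 1 \<Longrightarrow> k \<le> n \<Longrightarrow> q_const q k \<le> q_const q n"
  by (rule lift_Suc_mono_le[where f="q_const q"]) (auto simp: q_const_bounds simp del: q_const.simps)

text \<open>The total weight of the unshufflings is a Gaussian binomial coefficient.\<close>

lemma sum_unshuffle_le:
  assumes "0 \<le> q" "q < 1"
  shows "(\<Sum>(c, u, v)\<leftarrow>unshuffle q k w. c) \<le> q_const q k"
proof (induction w arbitrary: k)
  case Nil
  then show ?case using q_const_bounds(1)[OF assms, of k] by simp
next
  case (Cons h w)
  show ?case
  proof (cases k)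
    case 0
    then show ?thesis by (simp add: unshuffle_0)
  next
    case (Suc k')
    have q: "0 \<le> q ^ k" "q ^ k < 1" using assms power_Suc_less_1[of q k'] unfolding Suc by simp_all
    have "(\<Sum>(c, u, v)\<leftarrow>unshuffle q k (h # w). c) =
        (\<Sum>(c, u, v)\<leftarrow>unshuffle q k' w. c) + q ^ k * (\<Sum>(c, u, v)\<leftarrow>unshuffle q k w. c)"
      unfolding Suc by (simp add: comp_def case_prod_unfold sum_list_const_mult)
    also have "\<dots> \<le> q_const q k' + q ^ k * q_const q k"
      by (rule add_mono[OF Cons.IH mult_left_mono[OF Cons.IH q(1)]])
    also have "q_const q k' = (1 - q ^ k) * q_const q k" using q Suc by simp
    finally show ?thesis by (simp add: algebra_simps)
  qed
qed

text \<open>Coassociativity. Both sides run over the divisions of \<open>w\<close> into a letter, a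
  subword of length \<open>k\<close> and a rest, and the exponent of q counts the same crossings:
  the letter over everything before it, and the subword over the rest. Homogeneity of
  \<open>F\<close> lets the partial weights be collected in either order.\<close>

lemma split_letter_unshuffle:
  fixes F :: "real \<Rightarrow> 'a \<Rightarrow> 'a list \<Rightarrow> 'a list \<Rightarrow> complex"
  assumes F: "\<And>a c g x y. F (a * c) g x y = of_real a * F c g x y"
  shows "(\<Sum>(c, g, w')\<leftarrow>split_letter q w. \<Sum>(d, x, y)\<leftarrow>unshuffle q k w'. F (c * d) g x y) =
    (\<Sum>(d, x, y)\<leftarrow>unshuffle q (Suc k) w. \<Sum>(c, g, x')\<leftarrow>split_letter q x. F (c * d) g x' y)"
  using F
proof (induction w arbitrary: k F)
  case (Cons h w)
  note F = Cons.prems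
  have "(\<Sum>(c, g, w')\<leftarrow>split_letter q (h # w). \<Sum>(d, x, y)\<leftarrow>unshuffle q k w'. F (c * d) g x y) =
      (\<Sum>(d, x, y)\<leftarrow>unshuffle q k w. F d h x y) +
      (\<Sum>(c, g, w')\<leftarrow>split_letter q w. \<Sum>(d, x, y)\<leftarrow>unshuffle q k (h # w'). F (q * (c * d)) g x y)"
    by (simp add: comp_def case_prod_unfold mult.assoc)
  also have "(\<Sum>(c, g, w')\<leftarrow>split_letter q w. \<Sum>(d, x, y)\<leftarrow>unshuffle q k (h # w'). F (q * (c * d)) g x y) =
      (case k of 0 \<Rightarrow> 0 | Suc k' \<Rightarrow>
        (\<Sum>(c, g, w')\<leftarrow>split_letter q w. \<Sum>(d, x, y)\<leftarrow>unshuffle q k' w'. F (q * (c * d)) g (h # x) y)) +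
      (\<Sum>(c, g, w')\<leftarrow>split_letter q w. \<Sum>(d, x, y)\<leftarrow>unshuffle q k w'. F (q * (q ^ k * (c * d))) g x (h # y))"
    by (simp add: comp_def case_prod_unfold sum_list_addf mult.left_commute split: nat.split)
  also have "(case k of 0 \<Rightarrow> 0 | Suc k' \<Rightarrow>
        (\<Sum>(c, g, w')\<leftarrow>split_letter q w. \<Sum>(d, x, y)\<leftarrow>unshuffle q k' w'. F (q * (c * d)) g (h # x) y)) =
      (\<Sum>(d, x, y)\<leftarrow>unshuffle q k w. \<Sum>(c, g, x')\<leftarrow>split_letter q x. F (q * (c * d)) g (h # x') y)"
  proof (cases k)
    case 0
    then show ?thesis by (simp add: unshuffle_0)
  next
    case (Suc k')
    have "F (q * (a * c)) g (h # x) y = of_real a * F (q * c) g (h # x) y" for a c g x y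
      by (subst mult.left_commute) (rule F)
    then show ?thesis unfolding Suc nat.case by (rule Cons.IH[of "\<lambda>c g x y. F (q * c) g (h # x) y" k'])
  qed
  also have "(\<Sum>(c, g, w')\<leftarrow>split_letter q w. \<Sum>(d, x, y)\<leftarrow>unshuffle q k w'. F (q * (q ^ k * (c * d))) g x (h # y)) =
      (\<Sum>(d, x, y)\<leftarrow>unshuffle q (Suc k) w. \<Sum>(c, g, x')\<leftarrow>split_letter q x. F (q * (q ^ k * (c * d))) g x' (h # y))"
    by (rule Cons.IH[of "\<lambda>c g x y. F (q * (q ^ k * c)) g x (h # y)" k])
      (subst mult.left_commute[of "q ^ k"], subst mult.left_commute[of q], rule F)
  finally show ?case
    by (simp add: comp_def case_prod_unfold sum_list_addf mult_ac)
qed simp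

lemma sum_list_concat_map: "(\<Sum>y\<leftarrow>concat (map g xs). F y) = (\<Sum>x\<leftarrow>xs. \<Sum>y\<leftarrow>g x. F y)"
  for F :: "'b \<Rightarrow> 'c::comm_monoid_add"
  by (induction xs) simp_all

lemma sum_list_swap2: "(\<Sum>x\<leftarrow>xs. \<Sum>y\<leftarrow>ys. F x y) = (\<Sum>y\<leftarrow>ys. \<Sum>x\<leftarrow>xs. F x y)"
  for F :: "'a \<Rightarrow> 'b \<Rightarrow> 'c::comm_monoid_add"
  by (induction xs) (simp_all add: sum_list_addf)

lemma sum_list_cong2: "(\<And>x. x \<in> set xs \<Longrightarrow> f x = g x) \<Longrightarrow> (\<Sum>x\<leftarrow>xs. f x) = (\<Sum>x\<leftarrow>xs. g x)"
  by (metis map_cong)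

lemma norm_sum_list_le: "norm (\<Sum>x\<leftarrow>xs. f x) \<le> (\<Sum>x\<leftarrow>xs. norm (f x))"
  for f :: "'a \<Rightarrow> 'b::real_normed_vector"
  by (induction xs) (auto intro: norm_triangle_le)

lemma cnj_sum_list: "cnj (\<Sum>x\<leftarrow>xs. f x) = (\<Sum>x\<leftarrow>xs. cnj (f x))"
  by (induction xs) simp_all

text \<open>Laplace expansion of the q-permanent along its first \<open>k\<close> rows. In operator
  terms, the deformed symmetriser of a given degree factors through the symmetrisers of the two
  parts and the sum of the unshufflings.\<close>

lemma q_inner_append:
  assumes "length u = k"
  shows "q_inner q (u @ v) w =
    (\<Sum>(c, x, y)\<leftarrow>unshuffle q k w. complex_of_real c * q_inner q u x * q_inner q v y)"
  using assms
proof (induction u arbitrary: w k)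
  case Nil
  have "perm_sum q 0 G = 1" for G by (simp add: perm_sum_def inversions_def)
  then show ?case using Nil by (simp add: unshuffle_0 q_inner_eq)
next
  case (Cons f u)
  define F where "F c g x y = complex_of_real c * L2_inner f g * q_inner q u x * q_inner q v y" for c g x y
  have k: "k = Suc (length u)" using Cons.prems by simp
  have "q_inner q ((f # u) @ v) w =
      (\<Sum>(c, g, w')\<leftarrow>split_letter q w. \<Sum>(d, x, y)\<leftarrow>unshuffle q (length u) w'. F (c * d) g x y)"
    by (simp add: q_inner_Cons Cons.IH[OF refl] F_def case_prod_unfold mult_ac flip: sum_list_const_mult)
  also have "\<dots> = (\<Sum>(d, x, y)\<leftarrow>unshuffle q k w. \<Sum>(c, g, x')\<leftarrow>split_letter q x. F (c * d) g x' y)"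
    unfolding k by (rule split_letter_unshuffle) (simp add: F_def)
  also have "\<dots> = (\<Sum>(d, x, y)\<leftarrow>unshuffle q k w. complex_of_real d * q_inner q (f # u) x * q_inner q v y)"
    by (simp add: q_inner_Cons F_def case_prod_unfold mult_ac flip: sum_list_const_mult)
  finally show ?case .
qed

section \<open>The q-Fock space as the closed span of words\<close>

locale q_fock =
  fixes q :: real and tens :: "(real \<Rightarrow> complex) list \<Rightarrow> 'h::complex_hilbert_space"
  assumes q_nonneg: "0 \<le> q" and q_less_1: "q < 1" and fock: "q_fock_space q tens"
begin

abbreviation "words \<equiv> lists L2_half_line"

lemma cinner_tens: "u \<in> words \<Longrightarrow> v \<in> words \<Longrightarrow> cinner (tens u) (tens v) = q_inner q u v"
  using fock by (auto simp: q_fock_space_def)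

lemma dense_span:
  "closure {\<Sum>(c, w)\<leftarrow>xs. c *\<^sub>C tens w | xs. set xs \<subseteq> UNIV \<times> words} = UNIV"
proof -
  have "{\<Sum>w\<in>F. c w *\<^sub>C tens w | F c. finite F \<and> F \<subseteq> words} \<subseteq>
      {\<Sum>(c, w)\<leftarrow>xs. c *\<^sub>C tens w | xs. set xs \<subseteq> UNIV \<times> words}"
  proof safe
    fix F and c :: "_ \<Rightarrow> complex" assume F: "finite F" "F \<subseteq> words"
    then obtain fs where fs: "set fs = F" "distinct fs" using finite_distinct_list by blast
    show "\<exists>xs. (\<Sum>w\<in>F. c w *\<^sub>C tens w) = (\<Sum>(c, w)\<leftarrow>xs. c *\<^sub>C tens w) \<and> set xs \<subseteq> UNIV \<times> words"
      using F fs by (intro exI[of _ "map (\<lambda>w. (c w, w)) fs"])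
        (auto simp: comp_def sum_list_distinct_conv_sum_set)
  qed
  then show ?thesis using closure_mono fock unfolding q_fock_space_def by blast
qed

lemma tens_ext:
  assumes "\<And>u. u \<in> words \<Longrightarrow> cinner (tens u) x = cinner (tens u) y"
  shows "x = y"
proof (rule cinner_eqI)
  show "closure {z. \<exists>w. z = w \<and> (\<exists>xs. w = (\<Sum>(c, w)\<leftarrow>xs. c *\<^sub>C tens w) \<and> set xs \<subseteq> UNIV \<times> words)} = UNIV"
    using dense_span by (simp add: Collect_conj_eq)
  fix z assume "\<exists>xs. z = (\<Sum>(c, w)\<leftarrow>xs. c *\<^sub>C tens w) \<and> set xs \<subseteq> UNIV \<times> words"
  then obtain xs where xs: "z = (\<Sum>(c, w)\<leftarrow>xs. c *\<^sub>C tens w)" "set xs \<subseteq> UNIV \<times> words" by blast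
  show "cinner z x = cinner z y"
    unfolding xs(1) cinner_sum_list_left
  proof (rule sum_list_cong2, clarify)
    fix c w assume "(c, w) \<in> set xs"
    then have "w \<in> words" using xs(2) by blast
    then show "cinner (c *\<^sub>C tens w) x = cinner (c *\<^sub>C tens w) y" by (simp add: cinner_scaleC_left assms)
  qed
qed

text \<open>The scalar has to be part of the test vector because these maps are only
  real-linear.\<close>

lemma blinfun_tens_eqI:
  fixes S T :: "'h \<Rightarrow>\<^sub>L 'b::real_normed_vector"
  assumes "\<And>c w. w \<in> words \<Longrightarrow> blinfun_apply S (c *\<^sub>C tens w) = blinfun_apply T (c *\<^sub>C tens w)"
  shows "S = T"
proof (rule blinfun_eqI)
  fix x
  have "closed {x. blinfun_apply S x = blinfun_apply T x}" by (intro closed_Collect_eq continuous_intros)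
  moreover have "{\<Sum>(c, w)\<leftarrow>xs. c *\<^sub>C tens w | xs. set xs \<subseteq> UNIV \<times> words} \<subseteq>
      {x. blinfun_apply S x = blinfun_apply T x}"
  proof safe
    fix xs :: "(complex \<times> _) list" assume "set xs \<subseteq> UNIV \<times> words"
    then show "blinfun_apply S (\<Sum>(c, w)\<leftarrow>xs. c *\<^sub>C tens w) = blinfun_apply T (\<Sum>(c, w)\<leftarrow>xs. c *\<^sub>C tens w)"
      using assms by (induction xs) (auto simp: blinfun.bilinear_simps)
  qed
  ultimately have "UNIV \<subseteq> {x. blinfun_apply S x = blinfun_apply T x}"
    unfolding dense_span[symmetric] by (rule closure_minimal[rotated])
  then show "blinfun_apply S x = blinfun_apply T x" by auto
qed

lemma cops_tens_eqI:
  assumes "S \<in> cops" "T \<in> cops" "\<And>w. w \<in> words \<Longrightarrow> blinfun_apply S (tens w) = blinfun_apply T (tens w)"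
  shows "S = T"
  by (rule blinfun_tens_eqI) (simp add: assms copsD)

subsection \<open>The basic norm inequality\<close>

text \<open>The inner product of the Hilbert space tensor square of the Fock space, carried by
  formal sums of pairs of words so that the tensor square itself is not constructed.
  \<open>pair_vec\<close> is the concatenation map from it to the Fock space.\<close>

definition pair_form where
  "pair_form x y = (\<Sum>(c, u, v)\<leftarrow>x. \<Sum>(c', u', v')\<leftarrow>y. cnj c * c' * q_inner q u u' * q_inner q v v')"

definition pair_vec where
  "pair_vec x = (\<Sum>(c, u, v)\<leftarrow>x. c *\<^sub>C tens (u @ v))"

text \<open>For the concatenation map V = \<open>pair_vec\<close> and its adjoint V', this
  represents V' V on sums of pairs whose first word has length \<open>k\<close>.\<close>

definition reshuffle where
  "reshuffle k x = concat (map (\<lambda>(c, u, v). map (\<lambda>(d, u', v'). (c * complex_of_real d, u', v'))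
      (unshuffle q k (u @ v))) x)"

definition pairs where
  "pairs k = {x. \<forall>(c::complex, u, v)\<in>set x. length u = k \<and> u \<in> words \<and> v \<in> words}"

lemma pair_form_Nil [simp]: "pair_form [] y = 0" "pair_form x [] = 0"
  by (simp_all add: pair_form_def case_prod_unfold)

lemma pair_form_append: "pair_form (x @ x') y = pair_form x y + pair_form x' y"
  "pair_form y (x @ x') = pair_form y x + pair_form y x'"
  by (simp_all add: pair_form_def case_prod_unfold sum_list_addf)

lemma pairsD:
  assumes "x \<in> pairs k" "(c, u, v) \<in> set x"
  shows "length u = k" "u \<in> words" "v \<in> words"
  using bspec[OF assms(1)[unfolded pairs_def mem_Collect_eq] assms(2)] by simp_all

lemma sum_pairs_cong:
  assumes "x \<in> pairs k" "y \<in> pairs l"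
    and "\<And>c u v c' u' v'. length u = k \<Longrightarrow> u \<in> words \<Longrightarrow> v \<in> words \<Longrightarrow> u' \<in> words \<Longrightarrow> v' \<in> words \<Longrightarrow>
      F c u v c' u' v' = G c u v c' u' v'"
  shows "(\<Sum>(c, u, v)\<leftarrow>x. \<Sum>(c', u', v')\<leftarrow>y. F c u v c' u' v') = (\<Sum>(c, u, v)\<leftarrow>x. \<Sum>(c', u', v')\<leftarrow>y. G c u v c' u' v')"
proof (intro sum_list_cong2, clarify, intro sum_list_cong2, clarify)
  fix c u v c' u' v' assume *: "(c, u, v) \<in> set x" "(c', u', v') \<in> set y"
  show "F c u v c' u' v' = G c u v c' u' v'"
    by (rule assms(3); rule pairsD[OF assms(1) *(1)] pairsD[OF assms(2) *(2)])
qed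

lemma pair_form_eq:
  assumes "x \<in> pairs k" "y \<in> pairs l"
  shows "pair_form x y = (\<Sum>(c, u, v)\<leftarrow>x. \<Sum>(c', u', v')\<leftarrow>y.
      cnj c * c' * cinner (tens u) (tens u') * cinner (tens v) (tens v'))"
  unfolding pair_form_def by (rule sum_pairs_cong[OF assms]) (simp add: cinner_tens)

lemma reshuffle_pairs: "x \<in> pairs l \<Longrightarrow> reshuffle k x \<in> pairs k"
  using unshuffle_props[OF _ q_nonneg] by (fastforce simp: pairs_def reshuffle_def in_lists_conv_set)

lemma cinner_pair_vec:
  assumes "x \<in> pairs k" "y \<in> pairs l"
  shows "cinner (pair_vec x) (pair_vec y) = pair_form x (reshuffle k y)"
proof -
  have "cinner (pair_vec x) (pair_vec y) = (\<Sum>(c, u, v)\<leftarrow>x. \<Sum>(c', u', v')\<leftarrow>y.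
      cnj c * (c' * cinner (tens (u @ v)) (tens (u' @ v'))))"
    unfolding pair_vec_def cinner_sum_list_left cinner_sum_list_right case_prod_unfold
      cinner_scaleC_left cinner_scaleC_right
    by (subst sum_list_swap2) (simp add: mult_ac flip: sum_list_const_mult)
  also have "\<dots> = (\<Sum>(c, u, v)\<leftarrow>x. \<Sum>(c', u', v')\<leftarrow>y. cnj c * c' * q_inner q (u @ v) (u' @ v'))"
    by (rule sum_pairs_cong[OF assms]) (simp add: cinner_tens append_in_lists_conv)
  also have "\<dots> = (\<Sum>(c, u, v)\<leftarrow>x. \<Sum>(c', u', v')\<leftarrow>y. cnj c * c' *
      (\<Sum>(d, a, b)\<leftarrow>unshuffle q k (u' @ v'). complex_of_real d * q_inner q u a * q_inner q v b))"
    by (rule sum_pairs_cong[OF assms]) (simp add: q_inner_append)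
  also have "\<dots> = pair_form x (reshuffle k y)"
    unfolding pair_form_def reshuffle_def
    by (simp add: sum_list_concat_map case_prod_unfold comp_def mult_ac flip: sum_list_const_mult)
  finally show ?thesis .
qed

text \<open>Tensor products of positive forms are positive: expanding the first words in an
  orthonormal basis turns \<open>pair_form\<close> into a finite sum of ordinary inner products, to
  which the Cauchy-Schwarz inequality applies.\<close>

lemma pair_form_cauchy_schwarz:
  assumes x: "x \<in> pairs k" and y: "y \<in> pairs k"
  shows "(cmod (pair_form x y))\<^sup>2 \<le> cmod (pair_form x x) * cmod (pair_form y y)"
    and "cmod (pair_form x x) = Re (pair_form x x)"
proof -
  define V where "V = (\<lambda>(c, u, v). tens u) ` (set x \<union> set y)"
  have "finite V" by (simp add: V_def)
  then obtain B where B: "finite B \<and> (\<forall>x\<in>B. \<forall>y\<in>B. cinner x y = (if x = y then 1 else 0)) \<and>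
    (\<forall>x\<in>B. \<exists>d. x = (\<Sum>v\<in>V. d v *\<^sub>C v)) \<and> (\<forall>v\<in>V. v = (\<Sum>x\<in>B. cinner x v *\<^sub>C x))"
    by (rule exE[OF gram_schmidt])
  have parseval: "(\<Sum>b\<in>B. cinner a b * cinner b a') = cinner a a'" if "a' \<in> V" for a a'
  proof -
    have "a' = (\<Sum>x\<in>B. cinner x a' *\<^sub>C x)" using B that by blast
    then have "cinner a a' = cinner a (\<Sum>x\<in>B. cinner x a' *\<^sub>C x)" by (rule arg_cong)
    then show ?thesis by (simp add: cinner_sum_right cinner_scaleC_right mult.commute)
  qed
  define co where "co z b = (\<Sum>(c, u, v)\<leftarrow>z. (c * cinner b (tens u)) *\<^sub>C tens v)" for z b
  have form: "pair_form z z' = (\<Sum>b\<in>B. cinner (co z b) (co z' b))"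
    if z: "z \<in> pairs k" "z' \<in> pairs k" "set z' \<subseteq> set x \<union> set y" for z z'
  proof -
    have "(\<Sum>b\<in>B. cinner (co z b) (co z' b)) = (\<Sum>b\<in>B. \<Sum>(c, u, v)\<leftarrow>z. \<Sum>(c', u', v')\<leftarrow>z'.
       cnj c * c' * (cinner (tens u) b * cinner b (tens u')) * cinner (tens v) (tens v'))"
      unfolding co_def cinner_sum_list_left cinner_sum_list_right case_prod_unfold
        cinner_scaleC_left cinner_scaleC_right complex_cnj_mult cinner_cnj[symmetric]
      by (subst sum_list_swap2) (simp add: mult_ac flip: sum_list_const_mult)
    also have "\<dots> = (\<Sum>(c, u, v)\<leftarrow>z. \<Sum>(c', u', v')\<leftarrow>z'. \<Sum>b\<in>B.
       cnj c * c' * (cinner (tens u) b * cinner b (tens u')) * cinner (tens v) (tens v'))"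
      by (induction B rule: infinite_finite_induct) (simp_all add: sum_list_addf case_prod_unfold)
    also have "\<dots> = (\<Sum>(c, u, v)\<leftarrow>z. \<Sum>(c', u', v')\<leftarrow>z'.
       cnj c * c' * cinner (tens u) (tens u') * cinner (tens v) (tens v'))"
    proof (intro sum_list_cong2, clarify, intro sum_list_cong2, clarify)
      fix c u v c' u' v' assume "(c', u', v') \<in> set z'"
      then have "tens u' \<in> V" using z(3) by (force simp: V_def)
      then show "(\<Sum>b\<in>B. cnj c * c' * (cinner (tens u) b * cinner b (tens u')) * cinner (tens v) (tens v')) =
          cnj c * c' * cinner (tens u) (tens u') * cinner (tens v) (tens v')"
        using parseval[of "tens u'" "tens u"] by (simp flip: sum_distrib_left sum_distrib_right)
    qed
    also have "\<dots> = pair_form z z'" using pair_form_eq[OF z(1,2)] by simp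
    finally show ?thesis by simp
  qed
  have sq: "pair_form z z = complex_of_real (\<Sum>b\<in>B. (norm (co z b))\<^sup>2)"
    if "z \<in> pairs k" "set z \<subseteq> set x \<union> set y" for z
    using form[OF that(1,1,2)] by (simp add: cinner_self)
  have cm: "cmod (pair_form z z) = (\<Sum>b\<in>B. (norm (co z b))\<^sup>2)"
    if "z \<in> pairs k" "set z \<subseteq> set x \<union> set y" for z
    unfolding sq[OF that] norm_of_real by (simp add: sum_nonneg)
  show "cmod (pair_form x x) = Re (pair_form x x)" using cm[OF x] sq[OF x] by simp
  have "cmod (pair_form x y) \<le> (\<Sum>b\<in>B. norm (co x b) * norm (co y b))"
    unfolding form[OF x y Un_upper2] by (rule sum_norm_le) (rule cmod_cinner_le)
  then have "(cmod (pair_form x y))\<^sup>2 \<le> (\<Sum>b\<in>B. norm (co x b) * norm (co y b))\<^sup>2"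
    by (intro power_mono) auto
  also have "\<dots> \<le> (\<Sum>b\<in>B. (norm (co x b))\<^sup>2) * (\<Sum>b\<in>B. (norm (co y b))\<^sup>2)"
    by (rule Cauchy_Schwarz_ineq_sum)
  finally show "(cmod (pair_form x y))\<^sup>2 \<le> cmod (pair_form x x) * cmod (pair_form y y)"
    using cm[OF x] cm[OF y] by simp
qed

text \<open>Both sides are the inner product of the two concatenated vectors, one of them read
  through Hermitian symmetry.\<close>

lemma pair_form_reshuffle:
  assumes "x \<in> pairs k" "y \<in> pairs k"
  shows "pair_form x (reshuffle k y) = pair_form (reshuffle k x) y"
proof -
  have "pair_form a b = cnj (pair_form b a)" if "a \<in> pairs k" "b \<in> pairs k" for a b
  proof -
    have "cnj (pair_form b a) = (\<Sum>(c, u, v)\<leftarrow>b. \<Sum>(c', u', v')\<leftarrow>a.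
      cnj c' * c * cinner (tens u') (tens u) * cinner (tens v') (tens v))"
      unfolding pair_form_eq[OF that(2,1)]
      by (simp add: cnj_sum_list case_prod_unfold cinner_cnj[symmetric] mult_ac)
    also have "\<dots> = pair_form a b"
      unfolding pair_form_eq[OF that] case_prod_unfold by (subst sum_list_swap2) (rule refl)
    finally show ?thesis by simp
  qed
  then have "pair_form (reshuffle k x) y = cnj (pair_form y (reshuffle k x))"
    using assms reshuffle_pairs by blast
  also have "\<dots> = cnj (cinner (pair_vec y) (pair_vec x))" using cinner_pair_vec[OF assms(2,1)] by simp
  also have "\<dots> = pair_form x (reshuffle k y)"
    using cinner_pair_vec[OF assms] by (simp add: cinner_cnj[symmetric])
  finally show ?thesis by simp
qed

definition pair_mass where "pair_mass x = (\<Sum>(c, u, v)\<leftarrow>x. cmod c)"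

lemma pair_mass_reshuffle: "pair_mass (reshuffle k x) \<le> q_const q k * pair_mass x"
proof (induction x)
  case (Cons a x)
  obtain c u v where a: "a = (c, u, v)" by (cases a)
  have "pair_mass (reshuffle k (a # x)) = cmod c * (\<Sum>(d, u', v')\<leftarrow>unshuffle q k (u @ v). \<bar>d\<bar>) + pair_mass (reshuffle k x)"
    by (simp add: pair_mass_def reshuffle_def a comp_def case_prod_unfold norm_mult sum_list_const_mult)
  also have "(\<Sum>(d, u', v')\<leftarrow>unshuffle q k (u @ v). \<bar>d\<bar>) = (\<Sum>(d, u', v')\<leftarrow>unshuffle q k (u @ v). d)"
    using unshuffle_props(5)[OF _ q_nonneg] by (intro sum_list_cong2) force
  also have "cmod c * \<dots> + pair_mass (reshuffle k x) \<le> cmod c * q_const q k + q_const q k * pair_mass x"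
    by (intro add_mono mult_left_mono sum_unshuffle_le q_nonneg q_less_1 Cons.IH) simp
  also have "\<dots> = q_const q k * pair_mass (a # x)" by (simp add: pair_mass_def a algebra_simps)
  finally show ?case .
qed (simp add: pair_mass_def reshuffle_def)

lemma pair_form_mass_bound:
  assumes "\<And>c u v c' u' v'. (c, u, v) \<in> set x \<Longrightarrow> (c', u', v') \<in> set y \<Longrightarrow>
      cmod (q_inner q u u') \<le> M \<and> cmod (q_inner q v v') \<le> M"
  shows "cmod (pair_form x y) \<le> M\<^sup>2 * pair_mass x * pair_mass y"
proof -
  have "cmod (pair_form x y) \<le> (\<Sum>(c, u, v)\<leftarrow>x. \<Sum>(c', u', v')\<leftarrow>y. M\<^sup>2 * (cmod c * cmod c'))"
    unfolding pair_form_def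
  proof (rule order_trans[OF norm_sum_list_le sum_list_mono], clarify,
      rule order_trans[OF norm_sum_list_le sum_list_mono], clarify)
    fix c u v c' u' v' assume *: "(c, u, v) \<in> set x" "(c', u', v') \<in> set y"
    have "cmod (q_inner q u u') * cmod (q_inner q v v') \<le> M * M"
      using assms[OF *] by (intro mult_mono) (auto intro: order_trans[OF norm_ge_zero])
    then have "(cmod c * cmod c') * (cmod (q_inner q u u') * cmod (q_inner q v v')) \<le> (cmod c * cmod c') * (M * M)"
      by (intro mult_left_mono) auto
    then show "cmod (cnj c * c' * q_inner q u u' * q_inner q v v') \<le> M\<^sup>2 * (cmod c * cmod c')"
      by (simp add: norm_mult power2_eq_square mult_ac)
  qed
  also have "\<dots> = M\<^sup>2 * pair_mass x * pair_mass y"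
    by (simp add: pair_mass_def case_prod_unfold sum_list_const_mult sum_list_mult_const mult_ac)
  finally show ?thesis .
qed

text \<open>The form \<open>(x, y) \<mapsto> pair_form x (reshuffle k y)\<close> is the Gram form of the concatenated words, and
  \<open>reshuffle k\<close> is self-adjoint for \<open>pair_form\<close>.  Hence its norm is its spectral radius, which
  the growth of the total mass of the coefficients bounds by \<open>q_const q k\<close>.\<close>

lemma norm_pair_vec_le:
  assumes x: "x \<in> pairs k"
  shows "(norm (pair_vec x))\<^sup>2 \<le> q_const q k * Re (pair_form x x)"
proof -
  define y where "y j = (reshuffle k ^^ j) x" for j
  define a where "a j = cmod (pair_form x (y j))" for j
  have yp: "y j \<in> pairs k" for j unfolding y_def by (induction j) (auto simp: x reshuffle_pairs)
  have move: "pair_form (y i) (y (j + l)) = pair_form (y (i + j)) (y l)" for i j l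
  proof (induction j arbitrary: i)
    case (Suc j)
    have "pair_form (y i) (y (Suc j + l)) = pair_form (reshuffle k (y i)) (y (j + l))"
      using pair_form_reshuffle[OF yp yp] by (simp add: y_def)
    also have "\<dots> = pair_form (y (Suc i)) (y (j + l))" by (simp add: y_def)
    finally show ?case using Suc.IH[of "Suc i"] by simp
  qed simp
  \<comment> \<open>Iterating this bounds the power \<open>2 ^ m\<close> of the ratio
    \<open>a 1 / a 0\<close> by \<open>a (2 ^ m) / a 0\<close>, so that only the exponential growth
    rate of \<open>a\<close> matters and constants disappear.\<close>
  have double: "(a j)\<^sup>2 \<le> a 0 * a (2 * j)" for j
  proof -
    have "(a j)\<^sup>2 \<le> cmod (pair_form x x) * cmod (pair_form (y j) (y j))"
      unfolding a_def by (rule pair_form_cauchy_schwarz(1)[OF x yp])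
    also have "pair_form (y j) (y j) = pair_form (y 0) (y (2 * j))"
      using move[of 0 j j] by (simp add: mult_2)
    finally show ?thesis by (simp add: a_def y_def)
  qed
  have a_nn: "0 \<le> a j" for j by (simp add: a_def)
  define \<beta> where "\<beta> = q_const q k"
  have \<beta>: "1 \<le> \<beta>" using q_const_bounds(1)[OF q_nonneg q_less_1] by (simp add: \<beta>_def)
  \<comment> \<open>Unshuffling only rearranges letters, so all words occurring in the iterates
    \<open>y j\<close> lie in one finite set \<open>Z\<close>. A single constant \<open>M\<close>
    bounds their inner products, and the growth of \<open>a\<close> is that of the
    coefficients.\<close>
  define S where "S = (\<Union>(c, u, v)\<in>set x. set u \<union> set v)"
  define L where "L = (\<Sum>(c, u, v)\<leftarrow>x. length u + length v)"
  have L: "length u + length v \<le> L" if "(c, u, v) \<in> set x" for c u v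
    unfolding L_def using that member_le_sum_list[of "length u + length v" "map (\<lambda>(c, u, v). length u + length v) x"]
    by force
  have ywords: "\<forall>(c, u, v)\<in>set (y j). set u \<subseteq> S \<and> set v \<subseteq> S \<and> length u + length v \<le> L" for j
  proof (induction j)
    case 0
    then show ?case using L by (fastforce simp: y_def S_def)
  next
    case (Suc j)
    show ?case
    proof clarify
      fix c u v assume "(c, u, v) \<in> set (y (Suc j))"
      then obtain c' u' v' d where *: "(c', u', v') \<in> set (y j)" "(d, u, v) \<in> set (unshuffle q k (u' @ v'))"
        by (auto simp: y_def reshuffle_def)
      show "set u \<subseteq> S \<and> set v \<subseteq> S \<and> length u + length v \<le> L"
        using unshuffle_props[OF *(2) q_nonneg] Suc.IH *(1) by fastforce
    qed
  qed
  define Z where "Z = {w. set w \<subseteq> S \<and> length w \<le> L}"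
  have "finite S" by (auto simp: S_def)
  then have finZ: "finite Z" unfolding Z_def by (rule finite_lists_length_le)
  define M where "M = (\<Sum>(u, v)\<in>Z \<times> Z. cmod (q_inner q u v))"
  have M: "cmod (q_inner q u v) \<le> M" if "u \<in> Z" "v \<in> Z" for u v
    unfolding M_def using that finZ member_le_sum[of "(u, v)" "Z \<times> Z" "\<lambda>(u, v). cmod (q_inner q u v)"] by auto
  have yZ: "u \<in> Z \<and> v \<in> Z" if "(c, u, v) \<in> set (y j)" for c u v j
    using ywords[of j] that by (fastforce simp: Z_def)
  have mass: "pair_mass (y j) \<le> \<beta> ^ j * pair_mass x" for j
  proof (induction j)
    case (Suc j)
    have "pair_mass (y (Suc j)) \<le> \<beta> * pair_mass (y j)"
      using pair_mass_reshuffle by (simp add: y_def \<beta>_def)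
    also have "\<dots> \<le> \<beta> * (\<beta> ^ j * pair_mass x)" using Suc \<beta> by (intro mult_left_mono) auto
    finally show ?case by simp
  qed (simp add: y_def)
  have mass_nn: "0 \<le> pair_mass z" for z :: "(complex \<times> (real \<Rightarrow> complex) list \<times> (real \<Rightarrow> complex) list) list"
    unfolding pair_mass_def by (rule sum_list_nonneg) auto
  define D where "D = M\<^sup>2 * pair_mass x * pair_mass x"
  have aD: "a j \<le> D * \<beta> ^ j" for j
  proof -
    have "a j \<le> M\<^sup>2 * pair_mass x * pair_mass (y j)"
      unfolding a_def
    proof (rule pair_form_mass_bound)
      fix c u v c' u' v' assume "(c, u, v) \<in> set x" "(c', u', v') \<in> set (y j)"
      then show "cmod (q_inner q u u') \<le> M \<and> cmod (q_inner q v v') \<le> M"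
        using M yZ[of c u v 0] yZ[of c' u' v' j] by (simp add: y_def)
    qed
    also have "\<dots> \<le> M\<^sup>2 * pair_mass x * (\<beta> ^ j * pair_mass x)"
      by (intro mult_left_mono mass mult_nonneg_nonneg mass_nn) simp
    finally show ?thesis by (simp add: D_def mult_ac)
  qed
  have "a 1 \<le> \<beta> * a 0"
  proof (cases "a 0 = 0")
    case True
    then show ?thesis using double[of 1] by simp
  next
    case False
    then have a0: "0 < a 0" using a_nn[of 0] by simp
    have pw: "(a 1 / a 0) ^ (2 ^ m) \<le> a (2 ^ m) / a 0" for m
    proof (induction m)
      case (Suc m)
      have "(a 1 / a 0) ^ (2 ^ Suc m) = ((a 1 / a 0) ^ (2 ^ m))\<^sup>2" by (simp add: power_mult[symmetric] mult.commute)
      also have "\<dots> \<le> (a (2 ^ m) / a 0)\<^sup>2" using Suc a_nn by (intro power_mono) auto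
      also have "\<dots> = (a (2 ^ m))\<^sup>2 / (a 0)\<^sup>2" by (simp add: power_divide)
      also have "\<dots> \<le> (a 0 * a (2 ^ Suc m)) / (a 0)\<^sup>2" using double[of "2 ^ m"] by (intro divide_right_mono) auto
      also have "\<dots> = a (2 ^ Suc m) / a 0" using a0 by (simp add: power2_eq_square)
      finally show ?case .
    qed simp
    show ?thesis
    proof (rule ccontr)
      assume "\<not> a 1 \<le> \<beta> * a 0"
      then have r: "1 < a 1 / (a 0 * \<beta>)" using a0 \<beta> by (simp add: field_simps)
      obtain n where n: "D / a 0 < (a 1 / (a 0 * \<beta>)) ^ n" using real_arch_pow[OF r] by blast
      have "(a 1 / (a 0 * \<beta>)) ^ n \<le> (a 1 / (a 0 * \<beta>)) ^ (2 ^ n)"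
        using r by (intro power_increasing) (auto simp: less_imp_le)
      also have "\<dots> = (a 1 / a 0) ^ (2 ^ n) / \<beta> ^ (2 ^ n)" by (simp add: power_divide power_mult_distrib)
      also have "\<dots> \<le> (a (2 ^ n) / a 0) / \<beta> ^ (2 ^ n)" using pw \<beta> by (intro divide_right_mono) auto
      also have "\<dots> \<le> (D * \<beta> ^ (2 ^ n) / a 0) / \<beta> ^ (2 ^ n)"
        using aD a0 \<beta> by (intro divide_right_mono) auto
      also have "\<dots> = D / a 0" using \<beta> by simp
      finally show False using n by simp
    qed
  qed
  moreover have "a 1 = (norm (pair_vec x))\<^sup>2"
  proof -
    have "a 1 = cmod (cinner (pair_vec x) (pair_vec x))" by (simp add: a_def y_def cinner_pair_vec[OF x x])
    also have "\<dots> = \<bar>(norm (pair_vec x))\<^sup>2\<bar>" unfolding cinner_self norm_of_real ..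
    finally show ?thesis by simp
  qed
  moreover have "a 0 = Re (pair_form x x)" using pair_form_cauchy_schwarz(2)[OF x x] by (simp add: a_def y_def)
  ultimately show ?thesis by (simp add: \<beta>_def)
qed

end

lemma split_letter_mem:
  "(c, g, w') \<in> set (split_letter q w) \<Longrightarrow> g \<in> set w \<and> set w' \<subseteq> set w"
  by (induction w arbitrary: c g w') fastforce+

lemma blinfun_sum_list_left: "blinfun_apply (\<Sum>x\<leftarrow>xs. f x) v = (\<Sum>x\<leftarrow>xs. blinfun_apply (f x) v)"
  by (induction xs) (simp_all add: blinfun.bilinear_simps)

lemma blinfun_sum_list_right: "blinfun_apply T (\<Sum>x\<leftarrow>xs. f x) = (\<Sum>x\<leftarrow>xs. blinfun_apply T (f x))"
  by (induction xs) (simp_all add: blinfun.bilinear_simps)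

lemma cops_sum_list: "(\<And>x. x \<in> set xs \<Longrightarrow> f x \<in> cops) \<Longrightarrow> (\<Sum>x\<leftarrow>xs. f x) \<in> cops"
  by (induction xs) auto

lemma q_inner_Nil: "q_inner q [] [] = 1"
  by (simp add: q_inner_eq perm_sum_def inversions_def)

context q_fock
begin

section \<open>Formal linear combinations of words and their vectors\<close>

abbreviation "vacuum \<equiv> tens []"

definition vec :: "(complex \<times> (real \<Rightarrow> complex) list) list \<Rightarrow> 'h" where
  "vec xs = (\<Sum>(c, w)\<leftarrow>xs. c *\<^sub>C tens w)"

abbreviation "formal \<equiv> {xs :: (complex \<times> (real \<Rightarrow> complex) list) list. set xs \<subseteq> UNIV \<times> words}"

lemma vec_simps [simp]: "vec [] = 0" "vec ((c, w) # xs) = c *\<^sub>C tens w + vec xs" "vec (xs @ ys) = vec xs + vec ys"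
  by (simp_all add: vec_def)

lemma dense_vec: "\<exists>s. (\<forall>n. s n \<in> formal) \<and> (\<lambda>n. vec (s n)) \<longlonglongrightarrow> x"
proof -
  have "x \<in> closure {\<Sum>(c, w)\<leftarrow>xs. c *\<^sub>C tens w | xs. set xs \<subseteq> UNIV \<times> words}" using dense_span by simp
  then obtain t where t: "\<And>n. t n \<in> {\<Sum>(c, w)\<leftarrow>xs. c *\<^sub>C tens w | xs. set xs \<subseteq> UNIV \<times> words}" "t \<longlonglongrightarrow> x"
    unfolding closure_sequential by blast
  have "\<forall>n. \<exists>xs. xs \<in> formal \<and> t n = vec xs" using t(1) unfolding vec_def by blast
  then obtain s where "\<forall>n. s n \<in> formal \<and> t n = vec (s n)" by (rule choice[THEN exE])
  then have "\<forall>n. s n \<in> formal" "t = (\<lambda>n. vec (s n))" by auto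
  then show ?thesis using t(2) by blast
qed

lemma formalD: "xs \<in> formal \<Longrightarrow> (c, w) \<in> set xs \<Longrightarrow> w \<in> words"
  by blast

lemma cinner_vec:
  assumes "xs \<in> formal" "ys \<in> formal"
  shows "cinner (vec xs) (vec ys) = (\<Sum>(c, w)\<leftarrow>xs. \<Sum>(c', w')\<leftarrow>ys. cnj c * c' * q_inner q w w')"
proof -
  have "cinner (vec xs) (vec ys) = (\<Sum>(c, w)\<leftarrow>xs. \<Sum>(c', w')\<leftarrow>ys. cnj c * c' * cinner (tens w) (tens w'))"
    unfolding vec_def cinner_sum_list_left cinner_sum_list_right case_prod_unfold
      cinner_scaleC_left cinner_scaleC_right
    by (subst sum_list_swap2) (simp add: mult_ac flip: sum_list_const_mult)
  also have "\<dots> = (\<Sum>(c, w)\<leftarrow>xs. \<Sum>(c', w')\<leftarrow>ys. cnj c * c' * q_inner q w w')"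
  proof (intro sum_list_cong2, clarify, intro sum_list_cong2, clarify)
    fix c w c' w' assume "(c, w) \<in> set xs" "(c', w') \<in> set ys"
    then have "w \<in> words" "w' \<in> words" using assms by blast+
    then show "cnj c * c' * cinner (tens w) (tens w') = cnj c * c' * q_inner q w w'" by (simp add: cinner_tens)
  qed
  finally show ?thesis .
qed

definition pair_product where
  "pair_product us ys = concat (map (\<lambda>(d, u). map (\<lambda>(c, v). (d * c, u, v)) ys) us)"
  for us ys :: "(complex \<times> (real \<Rightarrow> complex) list) list"

lemma pair_form_product:
  assumes "us \<in> formal" "ys \<in> formal" "us' \<in> formal" "ys' \<in> formal"
  shows "pair_form (pair_product us ys) (pair_product us' ys') = cinner (vec us) (vec us') * cinner (vec ys) (vec ys')"
proof -
  have "pair_form (pair_product us ys) (pair_product us' ys') =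
      (\<Sum>(d, u)\<leftarrow>us. \<Sum>(c, v)\<leftarrow>ys. \<Sum>(d', u')\<leftarrow>us'. \<Sum>(c', v')\<leftarrow>ys'.
        (cnj d * d' * q_inner q u u') * (cnj c * c' * q_inner q v v'))"
    by (simp add: pair_form_def pair_product_def sum_list_concat_map case_prod_unfold comp_def mult_ac)
  also have "\<dots> = (\<Sum>(d, u)\<leftarrow>us. \<Sum>(d', u')\<leftarrow>us'. \<Sum>(c, v)\<leftarrow>ys. \<Sum>(c', v')\<leftarrow>ys'.
        (cnj d * d' * q_inner q u u') * (cnj c * c' * q_inner q v v'))"
    unfolding case_prod_unfold by (intro sum_list_cong2 sum_list_swap2)
  also have "\<dots> = cinner (vec us) (vec us') * cinner (vec ys) (vec ys')"
    unfolding cinner_vec[OF assms(1,3)] cinner_vec[OF assms(2,4)]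
    by (simp add: case_prod_unfold sum_list_const_mult flip: sum_list_mult_const)
  finally show ?thesis .
qed

lemma pair_form_concat:
  "pair_form (concat (map f as)) y = (\<Sum>a\<leftarrow>as. pair_form (f a) y)"
  "pair_form y (concat (map f as)) = (\<Sum>a\<leftarrow>as. pair_form y (f a))"
  by (induction as) (simp_all add: pair_form_append)

lemma pair_product_pairs:
  assumes "ys \<in> formal" "set us \<subseteq> UNIV \<times> {u \<in> words. length u = k}"
  shows "pair_product us ys \<in> pairs k"
  unfolding pairs_def mem_Collect_eq
proof clarify
  fix c u v assume "(c, u, v) \<in> set (pair_product us ys)"
  then obtain d c' where "(d, u) \<in> set us" "(c', v) \<in> set ys" by (auto simp: pair_product_def)
  then show "length u = k \<and> u \<in> words \<and> v \<in> words" using assms by blast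
qed

subsection \<open>Creation and annihilation operators\<close>

lemma norm_tens_letter: 
  assumes "f \<in> L2_half_line"
  shows "(norm (tens [f]))\<^sup>2 = Re (L2_inner f f)"
  using assms by (simp add: norm_sq_cinner cinner_tens q_inner_Cons q_inner_Nil)

text \<open>The concatenation estimate with a single letter in front; its constant is
  \<open>q_const q 1 = 1 / (1 - q)\<close>.\<close>

lemma creation_ex:
  assumes f: "f \<in> L2_half_line"
  shows "\<exists>T. norm T \<le> norm (tens [f]) / sqrt (1 - q) \<and> T \<in> cops \<and> (\<forall>w\<in>words. blinfun_apply T (tens w) = tens (f # w))"
proof -
  have q1: "0 < 1 - q" using q_less_1 by simp
  have "\<exists>T. norm T \<le> norm (tens [f]) / sqrt (1 - q) \<and>
      (\<forall>i\<in>UNIV \<times> words. blinfun_apply T ((\<lambda>(c, w). c *\<^sub>C tens w) i) = (\<lambda>(c, w). c *\<^sub>C tens (f # w)) i)"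
  proof (rule bounded_extension)
    fix xs :: "(complex \<times> (real \<Rightarrow> complex) list) list" assume xs: "set xs \<subseteq> UNIV \<times> words"
    have xs': "xs \<in> formal" using xs by simp
    have us: "set [(1::complex, [f])] \<subseteq> UNIV \<times> {u \<in> words. length u = 1}" using f by simp
    have pv: "pair_vec (pair_product [(1, [f])] xs) = (\<Sum>(c, w)\<leftarrow>xs. c *\<^sub>C tens (f # w))"
      by (simp add: pair_vec_def pair_product_def case_prod_unfold comp_def)
    have "(norm (\<Sum>(c, w)\<leftarrow>xs. c *\<^sub>C tens (f # w)))\<^sup>2 \<le>
        q_const q 1 * Re (pair_form (pair_product [(1, [f])] xs) (pair_product [(1, [f])] xs))"
      unfolding pv[symmetric] by (rule norm_pair_vec_le[OF pair_product_pairs[OF xs' us]])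
    also have "pair_form (pair_product [(1, [f])] xs) (pair_product [(1, [f])] xs) =
        complex_of_real ((norm (tens [f]))\<^sup>2 * (norm (vec xs))\<^sup>2)"
      using f xs by (subst pair_form_product) (simp_all add: cinner_self)
    also have "q_const q 1 * Re (complex_of_real ((norm (tens [f]))\<^sup>2 * (norm (vec xs))\<^sup>2)) =
        (norm (tens [f]) / sqrt (1 - q) * norm (vec xs))\<^sup>2"
      using q1 by (simp add: power_mult_distrib power_divide)
    finally show "norm (\<Sum>(c, w)\<leftarrow>xs. c *\<^sub>C tens (f # w)) \<le>
        norm (tens [f]) / sqrt (1 - q) * norm (\<Sum>(c, w)\<leftarrow>xs. c *\<^sub>C tens w)"
      unfolding vec_def[symmetric] using q1 by (intro power2_le_imp_le[OF _ mult_nonneg_nonneg]) auto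
  next
    fix i :: "complex \<times> (real \<Rightarrow> complex) list" and r assume "i \<in> UNIV \<times> words"
    then show "\<exists>j\<in>UNIV \<times> words. (\<lambda>(c, w). c *\<^sub>C tens w) j = r *\<^sub>R (\<lambda>(c, w). c *\<^sub>C tens w) i \<and>
        (\<lambda>(c, w). c *\<^sub>C tens (f # w)) j = r *\<^sub>R (\<lambda>(c, w). c *\<^sub>C tens (f # w)) i"
      by (intro bexI[of _ "(r *\<^sub>R fst i, snd i)"]) (auto simp: scaleC_scaleR)
  next
    show "closure {\<Sum>(c, w)\<leftarrow>xs. c *\<^sub>C tens w | xs. set xs \<subseteq> UNIV \<times> words} = UNIV" by (rule dense_span)
    show "0 \<le> norm (tens [f]) / sqrt (1 - q)" using q1 by simp
  qed
  then obtain T where T: "norm T \<le> norm (tens [f]) / sqrt (1 - q)"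
    "\<And>c w. w \<in> words \<Longrightarrow> blinfun_apply T (c *\<^sub>C tens w) = c *\<^sub>C tens (f # w)" by auto
  \<comment> \<open>The extension is a priori only real-linear. Composition of \<open>T\<close> with
    a complex scalar on either side gives two bounded operators, which agree on all multiples of
    words.\<close>
  have "T \<in> cops"
  proof -
    have "T o\<^sub>L op_scaleC c id_blinfun = op_scaleC c T" for c
      by (rule blinfun_tens_eqI) (simp add: op_scaleC_apply T scaleC_scaleC)
    then have "blinfun_apply (T o\<^sub>L op_scaleC c id_blinfun) x = blinfun_apply (op_scaleC c T) x" for c x by simp
    then show ?thesis by (intro copsI) (simp add: op_scaleC_apply)
  qed
  then show ?thesis using T(1) T(2)[of _ 1] by auto
qed

abbreviation "cr \<equiv> creation tens"
abbreviation "an \<equiv> annihilation tens"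

lemma creation:
  assumes f: "f \<in> L2_half_line"
  shows "cr f \<in> cops" "w \<in> words \<Longrightarrow> blinfun_apply (cr f) (tens w) = tens (f # w)"
    "norm (cr f) \<le> norm (tens [f]) / sqrt (1 - q)"
proof -
  obtain T where T: "norm T \<le> norm (tens [f]) / sqrt (1 - q)" "T \<in> cops"
    "\<forall>w\<in>words. blinfun_apply T (tens w) = tens (f # w)" using creation_ex[OF f] by blast
  have "cr f = T" unfolding creation_def
  proof (rule the_equality)
    fix S assume "S \<in> cops \<and> (\<forall>w\<in>words. blinfun_apply S (tens w) = tens (f # w))"
    then show "S = T" using T by (intro cops_tens_eqI) auto
  qed (use T in blast)
  then show "cr f \<in> cops" "w \<in> words \<Longrightarrow> blinfun_apply (cr f) (tens w) = tens (f # w)"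
    "norm (cr f) \<le> norm (tens [f]) / sqrt (1 - q)" using T by auto
qed

lemma annihilation:
  assumes f: "f \<in> L2_half_line"
  shows "an f \<in> cops" "norm (an f) \<le> norm (tens [f]) / sqrt (1 - q)"
    "cinner (blinfun_apply (an f) x) y = cinner x (blinfun_apply (cr f) y)"
    "cinner (blinfun_apply (cr f) x) y = cinner x (blinfun_apply (an f) y)"
  unfolding annihilation_def
  by (rule adj_cops[OF creation(1)[OF f]], simp add: norm_adj creation f,
      rule adj_cinner'[OF creation(1)[OF f]], rule adj_cinner[OF creation(1)[OF f]])

lemma adj_cr: "f \<in> L2_half_line \<Longrightarrow> adj (cr f) = an f" "f \<in> L2_half_line \<Longrightarrow> adj (an f) = cr f"
  by (simp_all add: annihilation_def adj_adj creation)

lemma annihilation_tens: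
  assumes f: "f \<in> L2_half_line" and w: "w \<in> words"
  shows "blinfun_apply (an f) (tens w) = (\<Sum>(c, g, w')\<leftarrow>split_letter q w. (complex_of_real c * L2_inner f g) *\<^sub>C tens w')"
proof (rule tens_ext)
  fix u assume u: "u \<in> words"
  have "cinner (tens u) (blinfun_apply (an f) (tens w)) = q_inner q (f # u) w"
    using f u w by (simp add: annihilation(4)[symmetric] creation cinner_tens)
  also have "\<dots> = (\<Sum>(c, g, w')\<leftarrow>split_letter q w. complex_of_real c * L2_inner f g * q_inner q u w')"
    by (rule q_inner_Cons)
  also have "\<dots> = (\<Sum>(c, g, w')\<leftarrow>split_letter q w. complex_of_real c * L2_inner f g * cinner (tens u) (tens w'))"
  proof (rule sum_list_cong2, clarify)
    fix c g w' assume "(c, g, w') \<in> set (split_letter q w)"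
    then have "w' \<in> words" using split_letter_mem[of c g w' q w] w by (auto simp: in_lists_conv_set)
    then show "complex_of_real c * L2_inner f g * q_inner q u w' = complex_of_real c * L2_inner f g * cinner (tens u) (tens w')"
      using u by (simp add: cinner_tens)
  qed
  finally show "cinner (tens u) (blinfun_apply (an f) (tens w)) =
      cinner (tens u) (\<Sum>(c, g, w')\<leftarrow>split_letter q w. (complex_of_real c * L2_inner f g) *\<^sub>C tens w')"
    by (simp add: cinner_sum_list_right case_prod_unfold cinner_scaleC_right)
qed

lemma annihilation_vacuum: "f \<in> L2_half_line \<Longrightarrow> blinfun_apply (an f) vacuum = 0"
  by (simp add: annihilation_tens)

lemma norm_vacuum: "norm vacuum = 1"
proof -
  have "(norm vacuum)\<^sup>2 = 1\<^sup>2" by (simp add: norm_sq_cinner cinner_tens q_inner_Nil)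
  then show ?thesis by (rule power2_eq_imp_eq) auto
qed

text \<open>This is the recursion of \<open>split_letter\<close>: contracting the head letter gives
  the scalar, and contracting any other letter costs one more factor q for passing
  \<open>h\<close>.\<close>

lemma q_commutation:
  assumes f: "f \<in> L2_half_line" and h: "h \<in> L2_half_line"
  shows "an f o\<^sub>L cr h = q *\<^sub>R (cr h o\<^sub>L an f) + op_scaleC (L2_inner f h) id_blinfun"
proof (rule cops_tens_eqI)
  fix w assume w: "w \<in> words"
  have "blinfun_apply (cr h) (\<Sum>(c, g, w')\<leftarrow>split_letter q w. (complex_of_real c * L2_inner f g) *\<^sub>C tens w') =
      (\<Sum>(c, g, w')\<leftarrow>split_letter q w. (complex_of_real c * L2_inner f g) *\<^sub>C tens (h # w'))"
    unfolding blinfun_sum_list_right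
  proof (rule sum_list_cong2, clarify)
    fix c g w' assume "(c, g, w') \<in> set (split_letter q w)"
    then have "w' \<in> words" using split_letter_mem[of c g w' q w] w by (auto simp: in_lists_conv_set)
    then show "blinfun_apply (cr h) ((complex_of_real c * L2_inner f g) *\<^sub>C tens w') =
        (complex_of_real c * L2_inner f g) *\<^sub>C tens (h # w')"
      using h by (simp add: creation copsD)
  qed
  then show "blinfun_apply (an f o\<^sub>L cr h) (tens w) =
      blinfun_apply (q *\<^sub>R (cr h o\<^sub>L an f) + op_scaleC (L2_inner f h) id_blinfun) (tens w)"
    using f h w by (simp add: creation annihilation_tens blinfun.bilinear_simps op_scaleC_apply
        case_prod_unfold comp_def scaleC_sum_list scaleC_scaleC add.commute mult.assoc flip: scaleC_of_real)
qed (use f h creation annihilation in auto)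

text \<open>Additivity of a word in its first letter is read off from inner products: on the other
  side of the inner product stand annihilation operators, whose action on words is an explicit
  sum.\<close>

lemma creation_add:
  assumes f: "f \<in> L2_half_line" and g: "g \<in> L2_half_line"
  shows "cr (\<lambda>x. f x + g x) = cr f + cr g"
proof (rule cops_tens_eqI)
  have fg: "(\<lambda>x. f x + g x) \<in> L2_half_line" using L2_add f g by blast
  show "cr (\<lambda>x. f x + g x) \<in> cops" "cr f + cr g \<in> cops" using creation fg f g by auto
  fix w assume w: "w \<in> words"
  show "blinfun_apply (cr (\<lambda>x. f x + g x)) (tens w) = blinfun_apply (cr f + cr g) (tens w)"
  proof (rule tens_ext)
    fix u assume u: "u \<in> words"
    have an: "blinfun_apply (an (\<lambda>x. f x + g x)) (tens u) = blinfun_apply (an f) (tens u) + blinfun_apply (an g) (tens u)"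
    proof -
      have "(\<Sum>(c, h, w')\<leftarrow>split_letter q u. (complex_of_real c * L2_inner (\<lambda>x. f x + g x) h) *\<^sub>C tens w') =
        (\<Sum>(c, h, w')\<leftarrow>split_letter q u. (complex_of_real c * L2_inner f h) *\<^sub>C tens w' +
            (complex_of_real c * L2_inner g h) *\<^sub>C tens w')"
      proof (rule sum_list_cong2, clarify)
        fix c h w' assume "(c, h, w') \<in> set (split_letter q u)"
        then have h: "h \<in> L2_half_line" using split_letter_mem[of c h w' q u] u by (auto simp: in_lists_conv_set)
        have "L2_inner (\<lambda>x. f x + g x) h = L2_inner f h + L2_inner g h"
          by (simp add: L2_inner_cnj[where f=h] L2_inner_add_right f g h)
        then show "(complex_of_real c * L2_inner (\<lambda>x. f x + g x) h) *\<^sub>C tens w' =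
          (complex_of_real c * L2_inner f h) *\<^sub>C tens w' + (complex_of_real c * L2_inner g h) *\<^sub>C tens w'"
          by (simp add: distrib_left scaleC_add_left)
      qed
      then show ?thesis using f g fg u by (simp add: annihilation_tens case_prod_unfold sum_list_addf)
    qed
    show "cinner (tens u) (blinfun_apply (cr (\<lambda>x. f x + g x)) (tens w)) = cinner (tens u) (blinfun_apply (cr f + cr g) (tens w))"
      by (simp add: annihilation(3)[symmetric] f g fg an blinfun.bilinear_simps cinner_add_right cinner_add_left)
  qed
qed

section \<open>Creation and annihilation by words, row and column estimates\<close>

fun cr_word :: "(real \<Rightarrow> complex) list \<Rightarrow> 'h oper" where
  "cr_word [] = id_blinfun"
| "cr_word (f # w) = cr f o\<^sub>L cr_word w"

fun an_word :: "(real \<Rightarrow> complex) list \<Rightarrow> 'h oper" where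
  "an_word [] = id_blinfun"
| "an_word (f # w) = an f o\<^sub>L an_word w"

lemma cr_word_cops: "u \<in> words \<Longrightarrow> cr_word u \<in> cops"
  by (induction u) (auto simp: creation)

lemma an_word_cops: "u \<in> words \<Longrightarrow> an_word u \<in> cops"
  by (induction u) (auto simp: annihilation)

lemma cr_word_tens: "u \<in> words \<Longrightarrow> w \<in> words \<Longrightarrow> blinfun_apply (cr_word u) (tens w) = tens (u @ w)"
  by (induction u) (auto simp: creation append_in_lists_conv)

lemma cr_word_append: "cr_word (u @ v) = cr_word u o\<^sub>L cr_word v"
  by (induction u) (auto intro!: blinfun_eqI)

lemma adj_an_word: "v \<in> words \<Longrightarrow> adj (an_word v) = cr_word (rev v)"
  by (induction v) (auto simp: adj_simps annihilation an_word_cops adj_cr cr_word_append intro!: blinfun_eqI)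

definition lin :: "(complex \<times> (real \<Rightarrow> complex) list) list \<Rightarrow> 'h oper" where
  "lin xs = (\<Sum>(c, w)\<leftarrow>xs. op_scaleC c (cr_word w))"

lemma lin_cops: "xs \<in> formal \<Longrightarrow> lin xs \<in> cops"
  unfolding lin_def by (rule cops_sum_list) (clarify, rule cops_intros(7)[OF cr_word_cops[OF formalD]], simp)

lemma lin_vec:
  assumes "us \<in> formal" "ys \<in> formal"
  shows "blinfun_apply (lin us) (vec ys) = pair_vec (pair_product us ys)"
proof -
  have "blinfun_apply (lin us) (vec ys) = (\<Sum>(d, u)\<leftarrow>us. \<Sum>(c, v)\<leftarrow>ys. (d * c) *\<^sub>C tens (u @ v))"
    unfolding lin_def vec_def blinfun_sum_list_left
  proof (rule sum_list_cong2, clarify)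
    fix d u assume "(d, u) \<in> set us"
    then have u: "u \<in> words" using assms by blast
    show "blinfun_apply (op_scaleC d (cr_word u)) (\<Sum>(c, w)\<leftarrow>ys. c *\<^sub>C tens w) = (\<Sum>(c, v)\<leftarrow>ys. (d * c) *\<^sub>C tens (u @ v))"
      unfolding blinfun_sum_list_right
    proof (rule sum_list_cong2, clarify)
      fix c v assume "(c, v) \<in> set ys"
      then have v: "v \<in> words" using assms by blast
      show "blinfun_apply (op_scaleC d (cr_word u)) (c *\<^sub>C tens v) = (d * c) *\<^sub>C tens (u @ v)"
        using u v by (simp add: op_scaleC_apply copsD[OF cr_word_cops] cr_word_tens scaleC_scaleC)
    qed
  qed
  then show ?thesis by (simp add: pair_vec_def pair_product_def sum_list_concat_map case_prod_unfold comp_def)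
qed

text \<open>Orthogonality of the vectors of \<open>us a\<close> removes the cross terms of
  \<open>pair_form\<close>, so the concatenation estimate costs \<open>q_const q k\<close> once for
  the whole row instead of once per summand. The arguments \<open>x a\<close> are approximated by
  combinations of words.\<close>

lemma norm_row_le:
  assumes A: "finite A" and us: "\<And>a. a \<in> A \<Longrightarrow> set (us a) \<subseteq> UNIV \<times> {u \<in> words. length u = k}"
    and orth: "\<And>a b. a \<in> A \<Longrightarrow> b \<in> A \<Longrightarrow>
      cinner (vec (us a)) (vec (us b)) = (if a = b then complex_of_real (n a) else 0)"
  shows "(norm (\<Sum>a\<in>A. blinfun_apply (lin (us a)) (x a)))\<^sup>2 \<le> q_const q k * (\<Sum>a\<in>A. n a * (norm (x a))\<^sup>2)"
proof -
  have us': "us a \<in> formal" if "a \<in> A" for a using us[OF that] by auto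
  have span: "(norm (\<Sum>a\<in>A. blinfun_apply (lin (us a)) (vec (ys a))))\<^sup>2 \<le>
      q_const q k * (\<Sum>a\<in>A. n a * (norm (vec (ys a)))\<^sup>2)"
    if ys: "\<And>a. a \<in> A \<Longrightarrow> ys a \<in> formal" for ys
  proof -
    obtain as where as: "set as = A" "distinct as" using finite_distinct_list[OF A] by blast
    define X where "X = concat (map (\<lambda>a. pair_product (us a) (ys a)) as)"
    have "X \<in> pairs k"
      unfolding pairs_def mem_Collect_eq
    proof clarify
      fix c u v assume "(c, u, v) \<in> set X"
      then obtain a where a: "a \<in> A" "(c, u, v) \<in> set (pair_product (us a) (ys a))"
        using as(1) by (auto simp: X_def)
      show "length u = k \<and> u \<in> words \<and> v \<in> words"
        using pairsD[OF pair_product_pairs[OF ys[OF a(1)] us[OF a(1)]] a(2)] by simp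
    qed
    then have "(norm (pair_vec X))\<^sup>2 \<le> q_const q k * Re (pair_form X X)" by (rule norm_pair_vec_le)
    also have "pair_vec X = (\<Sum>a\<leftarrow>as. pair_vec (pair_product (us a) (ys a)))"
      by (simp add: X_def pair_vec_def sum_list_concat_map)
    also have "\<dots> = (\<Sum>a\<in>A. pair_vec (pair_product (us a) (ys a)))"
      unfolding as(1)[symmetric] by (rule sum_list_distinct_conv_sum_set[OF as(2)])
    also have "\<dots> = (\<Sum>a\<in>A. blinfun_apply (lin (us a)) (vec (ys a)))"
      using us' ys by (intro sum.cong) (auto simp: lin_vec)
    also have "pair_form X X = (\<Sum>a\<leftarrow>as. \<Sum>b\<leftarrow>as. pair_form (pair_product (us a) (ys a)) (pair_product (us b) (ys b)))"
      unfolding X_def pair_form_concat by (rule sum_list_swap2)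
    also have "\<dots> = (\<Sum>a\<in>A. \<Sum>b\<in>A. pair_form (pair_product (us a) (ys a)) (pair_product (us b) (ys b)))"
      using as by (simp add: sum_list_distinct_conv_sum_set)
    also have "\<dots> = (\<Sum>a\<in>A. \<Sum>b\<in>A. if b = a then complex_of_real (n a * (norm (vec (ys a)))\<^sup>2) else 0)"
    proof (intro sum.cong refl)
      fix a b assume ab: "a \<in> A" "b \<in> A"
      then show "pair_form (pair_product (us a) (ys a)) (pair_product (us b) (ys b)) =
          (if b = a then complex_of_real (n a * (norm (vec (ys a)))\<^sup>2) else 0)"
        using orth[OF ab] by (subst pair_form_product[OF us' ys us' ys]) (auto simp: cinner_self)
    qed
    also have "\<dots> = complex_of_real (\<Sum>a\<in>A. n a * (norm (vec (ys a)))\<^sup>2)" using A by simp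
    finally show ?thesis by simp
  qed
  have "\<forall>a. \<exists>s. (\<forall>m. s m \<in> formal) \<and> (\<lambda>m. vec (s m)) \<longlonglongrightarrow> x a" using dense_vec by blast
  then obtain s where s: "\<forall>a. (\<forall>m. s a m \<in> formal) \<and> (\<lambda>m. vec (s a m)) \<longlonglongrightarrow> x a" by (rule choice[THEN exE])
  have s1: "s a m \<in> formal" for a m using s by blast
  have s2: "(\<lambda>m. vec (s a m)) \<longlonglongrightarrow> x a" for a using s by blast
  have "(\<lambda>m. (norm (\<Sum>a\<in>A. blinfun_apply (lin (us a)) (vec (s a m))))\<^sup>2) \<longlonglongrightarrow>
      (norm (\<Sum>a\<in>A. blinfun_apply (lin (us a)) (x a)))\<^sup>2"
    by (intro tendsto_intros s2)
  moreover have "(\<lambda>m. q_const q k * (\<Sum>a\<in>A. n a * (norm (vec (s a m)))\<^sup>2)) \<longlonglongrightarrow>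
      q_const q k * (\<Sum>a\<in>A. n a * (norm (x a))\<^sup>2)"
    by (intro tendsto_intros s2)
  ultimately show ?thesis by (rule LIMSEQ_le) (intro exI allI impI span s1)
qed

lemma norm_lin_le:
  assumes us: "set us \<subseteq> UNIV \<times> {u \<in> words. length u = k}"
  shows "norm (lin us) \<le> sqrt (q_const q k) * norm (vec us)"
proof (rule norm_blinfun_bound)
  have qc: "0 \<le> q_const q k" using q_const_bounds(1)[OF q_nonneg q_less_1, of k] by simp
  then show "0 \<le> sqrt (q_const q k) * norm (vec us)" by simp
  fix x
  have "(norm (blinfun_apply (lin us) x))\<^sup>2 \<le> q_const q k * ((norm (vec us))\<^sup>2 * (norm x)\<^sup>2)"
    using norm_row_le[of "{()}" "\<lambda>_. us" k "\<lambda>_. (norm (vec us))\<^sup>2" "\<lambda>_. x"] us by (simp add: cinner_self)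
  also have "\<dots> = (sqrt (q_const q k) * norm (vec us) * norm x)\<^sup>2"
    using qc by (simp add: power_mult_distrib)
  finally show "norm (blinfun_apply (lin us) x) \<le> sqrt (q_const q k) * norm (vec us) * norm x"
    by (rule power2_le_imp_le) (use qc in simp)
qed

text \<open>Duality: with L_a = \<open>lin (us a)\<close> the left side S is the inner product of
  \<open>x\<close> with the sum of L_a applied to the adjoint of L_a at \<open>x\<close>. The row
  inequality bounds the norm of that sum by the square root of \<open>q_const q k * S\<close>, and S
  cancels.\<close>

lemma column_bound:
  assumes A: "finite A" and us: "\<And>a. a \<in> A \<Longrightarrow> set (us a) \<subseteq> UNIV \<times> {u \<in> words. length u = k}"
    and orth: "\<And>a b. a \<in> A \<Longrightarrow> b \<in> A \<Longrightarrow> cinner (vec (us a)) (vec (us b)) = (if a = b then 1 else 0)"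
  shows "(\<Sum>a\<in>A. (norm (blinfun_apply (adj (lin (us a))) x))\<^sup>2) \<le> q_const q k * (norm x)\<^sup>2"
proof -
  define S where "S = (\<Sum>a\<in>A. (norm (blinfun_apply (adj (lin (us a))) x))\<^sup>2)"
  have us': "us a \<in> formal" if "a \<in> A" for a using us[OF that] by auto
  have qc: "0 \<le> q_const q k" using q_const_bounds(1)[OF q_nonneg q_less_1, of k] by simp
  have S0: "0 \<le> S" unfolding S_def by (intro sum_nonneg) auto
  have "complex_of_real S = cinner x (\<Sum>a\<in>A. blinfun_apply (lin (us a)) (blinfun_apply (adj (lin (us a))) x))"
    unfolding S_def cinner_sum_right of_real_sum
  proof (rule sum.cong[OF refl])
    fix a assume "a \<in> A"
    from adj_cinner'[OF lin_cops[OF us'[OF this]], of x "blinfun_apply (adj (lin (us a))) x"]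
    show "complex_of_real ((norm (blinfun_apply (adj (lin (us a))) x))\<^sup>2) =
        cinner x (blinfun_apply (lin (us a)) (blinfun_apply (adj (lin (us a))) x))"
      by (simp only: cinner_self)
  qed
  then have "S = cmod (cinner x (\<Sum>a\<in>A. blinfun_apply (lin (us a)) (blinfun_apply (adj (lin (us a))) x)))"
    using S0 by (metis abs_of_nonneg norm_of_real)
  also have "\<dots> \<le> norm x * norm (\<Sum>a\<in>A. blinfun_apply (lin (us a)) (blinfun_apply (adj (lin (us a))) x))"
    by (rule cmod_cinner_le)
  finally have "S\<^sup>2 \<le> (norm x * norm (\<Sum>a\<in>A. blinfun_apply (lin (us a)) (blinfun_apply (adj (lin (us a))) x)))\<^sup>2"
    using S0 by (intro power_mono) auto
  also have "\<dots> \<le> (norm x)\<^sup>2 * (q_const q k * S)"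
    unfolding power_mult_distrib S_def
    using norm_row_le[OF A us, where n="\<lambda>_. 1" and x="\<lambda>a. blinfun_apply (adj (lin (us a))) x"] orth
    by (intro mult_left_mono) auto
  finally have "S * S \<le> (q_const q k * (norm x)\<^sup>2) * S" by (simp add: power2_eq_square mult_ac)
  then have "S \<le> q_const q k * (norm x)\<^sup>2"
    using S0 qc by (cases "S = 0") auto
  then show ?thesis by (simp add: S_def)
qed

end

section \<open>Composition of operators with sums and scalars\<close>

lemma blinfun_compose_simps:
  "(A + B) o\<^sub>L C = (A o\<^sub>L C) + (B o\<^sub>L C)" "C o\<^sub>L (A + B) = (C o\<^sub>L A) + (C o\<^sub>L B)"
  "(A - B) o\<^sub>L C = (A o\<^sub>L C) - (B o\<^sub>L C)" "C o\<^sub>L (A - B) = (C o\<^sub>L A) - (C o\<^sub>L B)"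
  "(r *\<^sub>R A) o\<^sub>L C = r *\<^sub>R (A o\<^sub>L C)" "C o\<^sub>L (r *\<^sub>R A) = r *\<^sub>R (C o\<^sub>L A)"
  "0 o\<^sub>L C = 0" "C o\<^sub>L 0 = 0" "(- A) o\<^sub>L C = - (A o\<^sub>L C)" "C o\<^sub>L (- A) = - (C o\<^sub>L A)"
  by (rule blinfun_eqI; simp add: blinfun.bilinear_simps)+

lemma blinfun_compose_assoc': "(A o\<^sub>L B) o\<^sub>L C = A o\<^sub>L (B o\<^sub>L C)"
  by (rule blinfun_eqI) simp

lemma blinfun_compose_id [simp]: "id_blinfun o\<^sub>L A = A" "A o\<^sub>L id_blinfun = A"
  by (rule blinfun_eqI; simp)+

lemma blinfun_compose_sum: "(\<Sum>i\<in>I. f i) o\<^sub>L C = (\<Sum>i\<in>I. f i o\<^sub>L C)" "C o\<^sub>L (\<Sum>i\<in>I. f i) = (\<Sum>i\<in>I. C o\<^sub>L f i)"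
  by (induction I rule: infinite_finite_induct) (simp_all add: blinfun_compose_simps)

lemma blinfun_compose_sum_list:
  "(\<Sum>x\<leftarrow>xs. f x) o\<^sub>L C = (\<Sum>x\<leftarrow>xs. f x o\<^sub>L C)" "C o\<^sub>L (\<Sum>x\<leftarrow>xs. f x) = (\<Sum>x\<leftarrow>xs. C o\<^sub>L f x)"
  by (induction xs) (simp_all add: blinfun_compose_simps)

lemma op_scaleC_sum_list: "op_scaleC c (\<Sum>x\<leftarrow>xs. f x) = (\<Sum>x\<leftarrow>xs. op_scaleC c (f x))"
  by (induction xs) (simp_all add: op_scaleC_simps)

lemma scaleR_sum_list: "r *\<^sub>R (\<Sum>x\<leftarrow>xs. f x) = (\<Sum>x\<leftarrow>xs. r *\<^sub>R f x)"
  for f :: "'a \<Rightarrow> 'b::real_vector"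
  by (induction xs) (simp_all add: scaleR_add_right)

lemma adj_sum_list: "(\<And>x. x \<in> set xs \<Longrightarrow> f x \<in> cops) \<Longrightarrow> adj (\<Sum>x\<leftarrow>xs. f x) = (\<Sum>x\<leftarrow>xs. adj (f x))"
  by (induction xs) (simp_all add: adj_simps cops_sum_list)

lemma sum_list_by_length:
  fixes F :: "'a \<times> 'b list \<Rightarrow> 'c::comm_monoid_add"
  assumes "\<And>c w. (c, w) \<in> set xs \<Longrightarrow> length w \<le> N"
  shows "(\<Sum>x\<leftarrow>xs. F x) = (\<Sum>n\<le>N. \<Sum>x\<leftarrow>filter (\<lambda>(c, w). length w = n) xs. F x)"
  using assms
proof (induction xs)
  case (Cons a xs)
  obtain c w where a: "a = (c, w)" by (cases a)
  have len: "length w \<le> N" using Cons.prems[of c w] a by simp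
  have "(\<Sum>n\<le>N. \<Sum>x\<leftarrow>filter (\<lambda>(c, w). length w = n) (a # xs). F x) =
      (\<Sum>n\<le>N. (if n = length w then F a else 0) + (\<Sum>x\<leftarrow>filter (\<lambda>(c, w). length w = n) xs. F x))"
    by (intro sum.cong) (auto simp: a)
  also have "\<dots> = F a + (\<Sum>n\<le>N. \<Sum>x\<leftarrow>filter (\<lambda>(c, w). length w = n) xs. F x)"
    using len by (simp add: sum.distrib)
  also have "(\<Sum>n\<le>N. \<Sum>x\<leftarrow>filter (\<lambda>(c, w). length w = n) xs. F x) = (\<Sum>x\<leftarrow>xs. F x)"
    using Cons.IH[OF Cons.prems[OF list.set_intros(2)]] by simp
  finally show ?case by simp
qed simp

context q_fock
begin

subsection \<open>Wick ordering\<close>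

text \<open>\<open>wick r t Y w\<close> is the normally ordered expansion of the word \<open>w\<close> with \<open>Y\<close> between the creation
  and the annihilation operators, every creation operator weighted by \<open>r\<close> and every annihilation
  operator by \<open>t\<close>; \<open>wick_part k Y w\<close> collects the terms with \<open>k\<close> creation operators.\<close>

fun wick :: "real \<Rightarrow> real \<Rightarrow> 'h oper \<Rightarrow> (real \<Rightarrow> complex) list \<Rightarrow> 'h oper" where
  "wick r t Y [] = Y"
| "wick r t Y (h # w) = r *\<^sub>R (cr h o\<^sub>L wick r t Y w) + t *\<^sub>R wick (r * q) t (Y o\<^sub>L an (conj_fun h)) w"

definition wick_part :: "nat \<Rightarrow> 'h oper \<Rightarrow> (real \<Rightarrow> complex) list \<Rightarrow> 'h oper" where
  "wick_part k Y w = (\<Sum>(c, u, v)\<leftarrow>unshuffle q k w. c *\<^sub>R (cr_word u o\<^sub>L Y o\<^sub>L an_word (map conj_fun v)))"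

lemma wick_part_Cons: "wick_part k Y (h # w) =
    (case k of 0 \<Rightarrow> 0 | Suc k' \<Rightarrow> cr h o\<^sub>L wick_part k' Y w) + q ^ k *\<^sub>R wick_part k (Y o\<^sub>L an (conj_fun h)) w"
  by (cases k) (simp_all add: wick_part_def comp_def case_prod_unfold unshuffle_0 blinfun_compose_sum_list
      blinfun_compose_simps blinfun_compose_assoc' scaleR_sum_list)

lemma wick_part_beyond: "length w < k \<Longrightarrow> wick_part k Y w = 0"
proof (induction w arbitrary: k Y)
  case Nil
  then show ?case by (simp add: wick_part_def)
next
  case (Cons h w)
  then show ?case by (cases k) (simp_all add: wick_part_Cons blinfun_compose_simps)
qed

text \<open>Once a letter has become an annihilation operator, \<open>r\<close> is multiplied by q,
  so every later creation operator pays q for it. This is the crossing weight of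
  \<open>unshuffle\<close>.\<close>

lemma wick_eq: "wick r t Y w = (\<Sum>k\<le>length w. (r ^ k * t ^ (length w - k)) *\<^sub>R wick_part k Y w)"
proof (induction w arbitrary: r Y)
  case Nil
  then show ?case by (simp add: wick_part_def)
next
  case (Cons h w)
  define n where "n = length w"
  have "(\<Sum>k\<le>length (h # w). (r ^ k * t ^ (length (h # w) - k)) *\<^sub>R wick_part k Y (h # w)) =
      (\<Sum>k\<le>Suc n. (r ^ k * t ^ (Suc n - k)) *\<^sub>R (case k of 0 \<Rightarrow> 0 | Suc k' \<Rightarrow> cr h o\<^sub>L wick_part k' Y w)) +
      (\<Sum>k\<le>Suc n. (r ^ k * t ^ (Suc n - k) * q ^ k) *\<^sub>R wick_part k (Y o\<^sub>L an (conj_fun h)) w)"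
    by (simp add: wick_part_Cons n_def scaleR_add_right sum.distrib del: sum.atMost_Suc)
  also have "(\<Sum>k\<le>Suc n. (r ^ k * t ^ (Suc n - k)) *\<^sub>R (case k of 0 \<Rightarrow> 0 | Suc k' \<Rightarrow> cr h o\<^sub>L wick_part k' Y w)) =
      r *\<^sub>R (cr h o\<^sub>L wick r t Y w)"
    unfolding sum.atMost_Suc_shift Cons.IH
    by (simp add: n_def blinfun_compose_sum blinfun_compose_simps scaleR_sum_right mult.assoc)
  also have "(\<Sum>k\<le>Suc n. (r ^ k * t ^ (Suc n - k) * q ^ k) *\<^sub>R wick_part k (Y o\<^sub>L an (conj_fun h)) w) =
      (\<Sum>k\<le>n. (r ^ k * t ^ (Suc n - k) * q ^ k) *\<^sub>R wick_part k (Y o\<^sub>L an (conj_fun h)) w)"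
    by (simp add: wick_part_beyond n_def)
  also have "\<dots> = t *\<^sub>R wick (r * q) t (Y o\<^sub>L an (conj_fun h)) w"
    unfolding Cons.IH scaleR_sum_right n_def[symmetric]
    by (intro sum.cong) (simp_all add: Suc_diff_le power_mult_distrib mult_ac)
  finally show ?case by simp
qed

definition an_lin :: "(complex \<times> (real \<Rightarrow> complex) list) list \<Rightarrow> 'h oper" where
  "an_lin xs = (\<Sum>(c, v)\<leftarrow>xs. op_scaleC c (an_word (map conj_fun v)))"

lemma conj_words: "v \<in> words \<Longrightarrow> map conj_fun v \<in> words"
  by (auto simp: in_lists_conv_set intro: L2_conj_fun)

lemma rev_words: "v \<in> words \<Longrightarrow> rev v \<in> words"
  by (auto simp: in_lists_conv_set)

text \<open>The adjoint is a combination of creation words with conjugated coefficients and letters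
  and reversed order. Both operations preserve the norm of the vector, since they change inner
  products at most by complex conjugation.\<close>

lemma norm_an_lin_le:
  assumes xs: "set xs \<subseteq> UNIV \<times> {v \<in> words. length v = l}"
  shows "norm (an_lin xs) \<le> sqrt (q_const q l) * norm (vec xs)"
proof -
  define ys where "ys = map (\<lambda>(c, v). (cnj c, rev (map conj_fun v))) xs"
  have xs': "xs \<in> formal" using xs by auto
  have w: "v \<in> words" "length v = l" if "(c, v) \<in> set xs" for c v using xs that by auto
  have ys: "set ys \<subseteq> UNIV \<times> {u \<in> words. length u = l}"
  proof
    fix y assume "y \<in> set ys"
    then obtain c v where "(c, v) \<in> set xs" "y = (cnj c, rev (map conj_fun v))" by (auto simp: ys_def)
    then show "y \<in> UNIV \<times> {u \<in> words. length u = l}"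
      using w[of c v] rev_words[OF conj_words[of v]] by simp
  qed
  then have ys': "ys \<in> formal" by auto
  have cops: "op_scaleC c (an_word (map conj_fun v)) \<in> cops" if "(c, v) \<in> set xs" for c v
    using w(1)[OF that] by (intro cops_intros an_word_cops conj_words)
  have adj: "adj (an_lin xs) = lin ys"
  proof -
    have "adj (an_lin xs) = (\<Sum>(c, v)\<leftarrow>xs. adj (op_scaleC c (an_word (map conj_fun v))))"
      unfolding an_lin_def by (subst adj_sum_list) (auto simp: cops case_prod_unfold)
    also have "\<dots> = (\<Sum>(c, v)\<leftarrow>xs. op_scaleC (cnj c) (cr_word (rev (map conj_fun v))))"
    proof (rule sum_list_cong2, clarify)
      fix c v assume "(c, v) \<in> set xs"
      then have "map conj_fun v \<in> words" by (intro conj_words w)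
      then show "adj (op_scaleC c (an_word (map conj_fun v))) = op_scaleC (cnj c) (cr_word (rev (map conj_fun v)))"
        by (simp add: adj_simps(4)[OF an_word_cops an_word_cops] adj_an_word)
    qed
    finally show ?thesis by (simp add: lin_def ys_def case_prod_unfold comp_def)
  qed
  have "cinner (vec ys) (vec ys) = (\<Sum>(c, w)\<leftarrow>xs. \<Sum>(c', w')\<leftarrow>xs. cnj (cnj c * c' * q_inner q w w'))"
    unfolding cinner_vec[OF ys' ys']
    by (simp add: ys_def case_prod_unfold comp_def q_inner_rev q_inner_conj_fun mult_ac)
  also have "\<dots> = cnj (cinner (vec xs) (vec xs))"
    unfolding cinner_vec[OF xs' xs'] by (simp add: cnj_sum_list case_prod_unfold)
  finally have "(norm (vec ys))\<^sup>2 = (norm (vec xs))\<^sup>2" by (simp add: norm_sq_cinner)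
  then have nv: "norm (vec ys) = norm (vec xs)" by (rule power2_eq_imp_eq) auto
  have "an_lin xs \<in> cops" unfolding an_lin_def using cops by (intro cops_sum_list) auto
  then have "norm (an_lin xs) = norm (lin ys)" using norm_adj adj by metis
  also have "\<dots> \<le> sqrt (q_const q l) * norm (vec xs)" using norm_lin_le[OF ys] nv by simp
  finally show ?thesis .
qed

lemma lin_scale: "lin (map (\<lambda>(d, u). (c * d, u)) us) = op_scaleC c (lin us)"
  "vec (map (\<lambda>(d, u). (c * d, u)) us) = c *\<^sub>C vec us"
  by (induction us) (auto simp: lin_def scaleC_add_right scaleC_scaleC op_scaleC_simps vec_def)

lemma lin_Cons: "lin ((c, u) # us) = op_scaleC c (cr_word u) + lin us"
  by (simp add: lin_def)

lemma lin_concat: "lin (concat (map f bs)) = (\<Sum>b\<leftarrow>bs. lin (f b))" "vec (concat (map f bs)) = (\<Sum>b\<leftarrow>bs. vec (f b))"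
  by (simp_all add: lin_def vec_def sum_list_concat_map)

text \<open>After expansion of the left subwords in an orthonormal basis \<open>B\<close>, the
  operator is a row of creation operators times \<open>Y\<close> times a column of annihilation
  operators. The row costs the square root of \<open>q_const q k\<close>; each entry of the column
  costs the square root of \<open>q_const q (n - k)\<close> times the norm of its vector; and the
  sum of the squares of these norms is again controlled by \<open>q_const q k\<close>, through
  \<open>column_bound\<close>.\<close>

lemma norm_wick_part_le:
  assumes xs: "set xs \<subseteq> UNIV \<times> {w \<in> words. length w = n}" and k: "k \<le> n" and Y: "Y \<in> cops"
  shows "norm (\<Sum>(c, w)\<leftarrow>xs. op_scaleC c (wick_part k Y w)) \<le>
    q_const q k * sqrt (q_const q (n - k)) * norm Y * norm (vec xs)"
proof -
  have xs': "xs \<in> formal" using xs by auto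
  define terms where "terms = concat (map (\<lambda>(c, w). map (\<lambda>(d, u, v). (c * complex_of_real d, u, v)) (unshuffle q k w)) xs)"
  have terms: "length u = k \<and> u \<in> words \<and> v \<in> words \<and> length v = n - k" if "(e, u, v) \<in> set terms" for e u v
  proof -
    from that obtain c w d where cw: "(c, w) \<in> set xs" "(d, u, v) \<in> set (unshuffle q k w)"
      by (auto simp: terms_def)
    have "w \<in> words" "length w = n" using xs cw(1) by auto
    then show ?thesis using unshuffle_props[OF cw(2) q_nonneg] k by (auto simp: in_lists_conv_set)
  qed
  define U where "U = (\<lambda>(e, u, v). u) ` set terms"
  have finU: "finite (tens ` U)" by (simp add: U_def)
  have U: "u \<in> words \<and> length u = k" if "u \<in> U" for u
  proof -
    obtain e v where "(e, u, v) \<in> set terms" using \<open>u \<in> U\<close> by (auto simp: U_def)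
    then show ?thesis using terms by blast
  qed
  obtain B where B': "finite B \<and> (\<forall>x\<in>B. \<forall>y\<in>B. cinner x y = (if x = y then 1 else 0)) \<and>
    (\<forall>x\<in>B. \<exists>d. x = (\<Sum>v\<in>tens ` U. d v *\<^sub>C v)) \<and> (\<forall>v\<in>tens ` U. v = (\<Sum>x\<in>B. cinner x v *\<^sub>C x))"
    by (rule exE[OF gram_schmidt[OF finU]])
  obtain vs where vs: "set vs = tens ` U" "distinct vs" using finite_distinct_list[OF finU] by blast
  have "\<forall>b\<in>B. \<exists>us. set us \<subseteq> UNIV \<times> {u \<in> words. length u = k} \<and> vec us = b"
  proof
    fix b assume "b \<in> B"
    with B' have "\<exists>d. b = (\<Sum>v\<in>tens ` U. d v *\<^sub>C v)" by blast
    then obtain d where d: "b = (\<Sum>v\<in>tens ` U. d v *\<^sub>C v)" by (rule exE)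
    define pick where "pick v = (SOME u. u \<in> U \<and> tens u = v)" for v
    have pick: "pick v \<in> U \<and> tens (pick v) = v" if "v \<in> tens ` U" for v
      unfolding pick_def by (rule someI_ex) (use that in auto)
    have "vec (map (\<lambda>v. (d v, pick v)) vs) = (\<Sum>v\<leftarrow>vs. d v *\<^sub>C tens (pick v))"
      by (simp add: vec_def comp_def)
    also have "\<dots> = (\<Sum>v\<leftarrow>vs. d v *\<^sub>C v)" by (rule sum_list_cong2) (simp add: pick vs)
    also have "\<dots> = b" unfolding d vs(1)[symmetric] by (rule sum_list_distinct_conv_sum_set[OF vs(2)])
    finally have "vec (map (\<lambda>v. (d v, pick v)) vs) = b" .
    moreover have "set (map (\<lambda>v. (d v, pick v)) vs) \<subseteq> UNIV \<times> {u \<in> words. length u = k}"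
    proof
      fix y assume "y \<in> set (map (\<lambda>v. (d v, pick v)) vs)"
      then obtain v where "v \<in> tens ` U" "y = (d v, pick v)" using vs by auto
      then show "y \<in> UNIV \<times> {u \<in> words. length u = k}" using pick[of v] U[of "pick v"] by simp
    qed
    ultimately show "\<exists>us. set us \<subseteq> UNIV \<times> {u \<in> words. length u = k} \<and> vec us = b" by blast
  qed
  then obtain us where us: "\<forall>b\<in>B. set (us b) \<subseteq> UNIV \<times> {u \<in> words. length u = k} \<and> vec (us b) = b"
    by (rule bchoice[THEN exE])
  have us1: "set (us b) \<subseteq> UNIV \<times> {u \<in> words. length u = k}" if "b \<in> B" for b using us that by blast
  have us2: "vec (us b) = b" if "b \<in> B" for b using us that by blast
  have us3: "us b \<in> formal" if "b \<in> B" for b using us1[OF that] by auto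
  have finB: "finite B" using B' by blast
  obtain bs where bs: "set bs = B" "distinct bs" using finite_distinct_list[OF finB] by blast
  have orth: "cinner (vec (us a)) (vec (us b)) = (if a = b then 1 else 0)" if "a \<in> B" "b \<in> B" for a b
    unfolding us2[OF that(1)] us2[OF that(2)]
    by (rule bspec[OF bspec[OF conjunct1[OF conjunct2[OF B']] that(1)] that(2)])
  \<comment> \<open>A linear relation among vectors of words lifts to the creation operators: by
    \<open>norm_lin_le\<close> a combination of words of length \<open>k\<close> whose vector
    vanishes also vanishes as an operator.\<close>
  have expand: "cr_word u = (\<Sum>b\<in>B. op_scaleC (cinner b (tens u)) (lin (us b)))" if u: "u \<in> U" for u
  proof -
    define ls where "ls = (1, u) # concat (map (\<lambda>b. map (\<lambda>(d, u'). (- cinner b (tens u) * d, u')) (us b)) bs)"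
    have "tens u = (\<Sum>x\<in>B. cinner x (tens u) *\<^sub>C x)" using B' u by blast
    moreover have "vec ls = tens u - (\<Sum>x\<in>B. cinner x (tens u) *\<^sub>C x)"
    proof -
      have "vec ls = tens u + (\<Sum>b\<leftarrow>bs. (- cinner b (tens u)) *\<^sub>C vec (us b))"
        unfolding ls_def vec_simps lin_concat lin_scale by simp
      also have "(\<Sum>b\<leftarrow>bs. (- cinner b (tens u)) *\<^sub>C vec (us b)) = (\<Sum>b\<leftarrow>bs. - (cinner b (tens u) *\<^sub>C b))"
        by (rule sum_list_cong2) (simp add: bs us2 scaleC_minus)
      also have "\<dots> = - (\<Sum>b\<in>B. cinner b (tens u) *\<^sub>C b)"
        unfolding bs(1)[symmetric] sum_negf[symmetric] by (rule sum_list_distinct_conv_sum_set[OF bs(2)])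
      finally show ?thesis by simp
    qed
    ultimately have "vec ls = 0" by simp
    moreover have "set ls \<subseteq> UNIV \<times> {u \<in> words. length u = k}"
    proof
      fix y assume "y \<in> set ls"
      then consider "y = (1, u)" | b d u' where "b \<in> B" "(d, u') \<in> set (us b)" "snd y = u'"
        using bs(1) by (auto simp: ls_def)
      then show "y \<in> UNIV \<times> {u \<in> words. length u = k}"
      proof cases
        case 1
        then show ?thesis using U[OF u] by simp
      next
        case 2
        then show ?thesis using us1[OF 2(1)] by (cases y) auto
      qed
    qed
    ultimately have "lin ls = 0" using norm_lin_le[of ls k] by simp
    moreover have "lin ls = cr_word u + (\<Sum>b\<leftarrow>bs. op_scaleC (- cinner b (tens u)) (lin (us b)))"
      unfolding ls_def lin_Cons lin_concat lin_scale op_scaleC_simps by simp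
    moreover have "(\<Sum>b\<leftarrow>bs. op_scaleC (- cinner b (tens u)) (lin (us b))) = - (\<Sum>b\<in>B. op_scaleC (cinner b (tens u)) (lin (us b)))"
      unfolding bs(1)[symmetric] sum_negf[symmetric] op_scaleC_simps by (rule sum_list_distinct_conv_sum_set[OF bs(2)])
    ultimately show ?thesis by simp
  qed
  define es where "es b = map (\<lambda>(e, u, v). (e * cinner b (tens u), v)) terms" for b
  have es: "set (es b) \<subseteq> UNIV \<times> {v \<in> words. length v = n - k}" for b
    using terms by (auto simp: es_def)
  have main: "(\<Sum>(c, w)\<leftarrow>xs. op_scaleC c (wick_part k Y w)) = (\<Sum>b\<in>B. lin (us b) o\<^sub>L Y o\<^sub>L an_lin (es b))"
  proof -
    have "(\<Sum>(c, w)\<leftarrow>xs. op_scaleC c (wick_part k Y w)) =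
        (\<Sum>(e, u, v)\<leftarrow>terms. op_scaleC e (cr_word u o\<^sub>L Y o\<^sub>L an_word (map conj_fun v)))"
      unfolding wick_part_def terms_def
      by (simp add: sum_list_concat_map case_prod_unfold comp_def op_scaleC_sum_list op_scaleC_simps(3)
          flip: op_scaleC_simps(7))
    also have "\<dots> = (\<Sum>(e, u, v)\<leftarrow>terms. \<Sum>b\<in>B. lin (us b) o\<^sub>L Y o\<^sub>L op_scaleC (e * cinner b (tens u)) (an_word (map conj_fun v)))"
    proof (rule sum_list_cong2, clarify)
      fix e u v assume "(e, u, v) \<in> set terms"
      then have u: "u \<in> U" by (force simp: U_def)
      have "op_scaleC e (cr_word u o\<^sub>L Y o\<^sub>L an_word (map conj_fun v)) =
        (\<Sum>b\<in>B. op_scaleC e (op_scaleC (cinner b (tens u)) (lin (us b)) o\<^sub>L Y o\<^sub>L an_word (map conj_fun v)))"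
        unfolding expand[OF u] by (simp add: blinfun_compose_sum op_scaleC_sum)
      also have "\<dots> = (\<Sum>b\<in>B. lin (us b) o\<^sub>L Y o\<^sub>L op_scaleC (e * cinner b (tens u)) (an_word (map conj_fun v)))"
      proof (rule sum.cong[OF refl])
        fix b assume "b \<in> B"
        then have "lin (us b) o\<^sub>L Y \<in> cops" using lin_cops[OF us3] Y by auto
        then show "op_scaleC e (op_scaleC (cinner b (tens u)) (lin (us b)) o\<^sub>L Y o\<^sub>L an_word (map conj_fun v)) =
            lin (us b) o\<^sub>L Y o\<^sub>L op_scaleC (e * cinner b (tens u)) (an_word (map conj_fun v))"
          by (simp add: op_scaleC_comp op_scaleC_simps(3))
      qed
      finally show "op_scaleC e (cr_word u o\<^sub>L Y o\<^sub>L an_word (map conj_fun v)) =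
        (\<Sum>b\<in>B. lin (us b) o\<^sub>L Y o\<^sub>L op_scaleC (e * cinner b (tens u)) (an_word (map conj_fun v)))" .
    qed
    also have "\<dots> = (\<Sum>b\<in>B. \<Sum>(e, u, v)\<leftarrow>terms. lin (us b) o\<^sub>L Y o\<^sub>L op_scaleC (e * cinner b (tens u)) (an_word (map conj_fun v)))"
      using finB by (induction B rule: finite_induct) (simp_all add: case_prod_unfold sum_list_addf)
    also have "\<dots> = (\<Sum>b\<in>B. lin (us b) o\<^sub>L Y o\<^sub>L an_lin (es b))"
      by (simp add: an_lin_def es_def case_prod_unfold comp_def blinfun_compose_sum_list)
    finally show ?thesis .
  qed
  \<comment> \<open>Pairing words of the form u @ v' with \<open>xs\<close> unshuffles the words of
    \<open>xs\<close>, so the right-hand coefficients along \<open>b\<close> are obtained by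
    applying the adjoint of the creation operator of \<open>b\<close>. Hence
    \<open>column_bound\<close> applies to them.\<close>
  have vec_es: "vec (es b) = blinfun_apply (adj (lin (us b))) (vec xs)" if b: "b \<in> B" for b
  proof (rule tens_ext)
    fix v' assume v': "v' \<in> words"
    have single: "[(1, v')] \<in> formal" "vec [(1, v')] = tens v'" using v' by simp_all
    have "cinner (tens v') (blinfun_apply (adj (lin (us b))) (vec xs)) = cinner (pair_vec (pair_product (us b) [(1, v')])) (vec xs)"
      unfolding adj_cinner[OF lin_cops[OF us3[OF b]], symmetric] lin_vec[OF us3[OF b] single(1), symmetric] single(2) ..
    also have "pair_vec (pair_product (us b) [(1, v')]) = vec (map (\<lambda>(d, u). (d, u @ v')) (us b))"
      by (simp add: pair_vec_def pair_product_def vec_def case_prod_unfold comp_def sum_list_concat_map)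
    also have "cinner \<dots> (vec xs) = (\<Sum>(d, u)\<leftarrow>us b. \<Sum>(c, w)\<leftarrow>xs. cnj d * c * q_inner q (u @ v') w)"
    proof -
      have "u @ v' \<in> words" if "(d, u) \<in> set (us b)" for d u
        using formalD[OF us3[OF b] that] v' by simp
      then have "map (\<lambda>(d, u). (d, u @ v')) (us b) \<in> formal"
        by (auto simp del: in_lists_conv_set append_in_lists_conv)
      from cinner_vec[OF this xs'] show ?thesis by (simp add: case_prod_unfold comp_def)
    qed
    also have "\<dots> = (\<Sum>(d, u)\<leftarrow>us b. \<Sum>(c, w)\<leftarrow>xs. cnj d * c *
        (\<Sum>(a, x, y)\<leftarrow>unshuffle q k w. complex_of_real a * q_inner q u x * q_inner q v' y))"
    proof (rule sum_list_cong2, clarify)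
      fix d u assume "(d, u) \<in> set (us b)"
      then have "length u = k" using us1[OF b] by auto
      then show "(\<Sum>(c, w)\<leftarrow>xs. cnj d * c * q_inner q (u @ v') w) = (\<Sum>(c, w)\<leftarrow>xs. cnj d * c *
        (\<Sum>(a, x, y)\<leftarrow>unshuffle q k w. complex_of_real a * q_inner q u x * q_inner q v' y))"
        by (simp add: q_inner_append)
    qed
    also have "\<dots> = (\<Sum>(e, x, y)\<leftarrow>terms. e * (\<Sum>(d, u)\<leftarrow>us b. cnj d * q_inner q u x) * q_inner q v' y)"
      unfolding terms_def case_prod_unfold sum_list_concat_map
      by (subst sum_list_swap2) (simp add: comp_def case_prod_unfold sum_list_swap2[of _ "us b"] mult_ac
          flip: sum_list_const_mult)
    also have "\<dots> = (\<Sum>(e, x, y)\<leftarrow>terms. e * cinner b (tens x) * cinner (tens v') (tens y))"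
    proof (rule sum_list_cong2, clarify)
      fix e x y assume "(e, x, y) \<in> set terms"
      then have xy: "x \<in> words" "y \<in> words" using terms by auto
      then have "[(1, x)] \<in> formal" by simp
      from cinner_vec[OF us3[OF b] this] have "cinner b (tens x) = (\<Sum>(d, u)\<leftarrow>us b. cnj d * q_inner q u x)"
        by (simp add: us2[OF b])
      then show "e * (\<Sum>(d, u)\<leftarrow>us b. cnj d * q_inner q u x) * q_inner q v' y = e * cinner b (tens x) * cinner (tens v') (tens y)"
        using xy v' by (simp add: cinner_tens)
    qed
    also have "\<dots> = cinner (tens v') (vec (es b))"
      by (simp add: vec_def es_def case_prod_unfold comp_def cinner_sum_list_right cinner_scaleC_right mult_ac)
    finally show "cinner (tens v') (vec (es b)) = cinner (tens v') (blinfun_apply (adj (lin (us b))) (vec xs))" by simp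
  qed
  have qc: "0 \<le> q_const q m" for m using q_const_bounds(1)[OF q_nonneg q_less_1, of m] by simp
  show ?thesis
    unfolding main
  proof (rule norm_blinfun_bound)
    show "0 \<le> q_const q k * sqrt (q_const q (n - k)) * norm Y * norm (vec xs)" using qc by simp
    fix x
    have one: "(norm (blinfun_apply Y (blinfun_apply (an_lin (es b)) x)))\<^sup>2 \<le>
       (norm (blinfun_apply (adj (lin (us b))) (vec xs)))\<^sup>2 * (q_const q (n - k) * (norm Y)\<^sup>2 * (norm x)\<^sup>2)" if b: "b \<in> B" for b
    proof -
      have "norm (blinfun_apply Y (blinfun_apply (an_lin (es b)) x)) \<le> norm Y * (norm (an_lin (es b)) * norm x)"
        by (meson norm_blinfun norm_ge_zero mult_left_mono order_trans)
      also have "\<dots> \<le> norm Y * ((sqrt (q_const q (n - k)) * norm (vec (es b))) * norm x)"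
        by (intro mult_left_mono mult_right_mono norm_an_lin_le es) auto
      finally have "(norm (blinfun_apply Y (blinfun_apply (an_lin (es b)) x)))\<^sup>2 \<le>
          (norm Y * ((sqrt (q_const q (n - k)) * norm (vec (es b))) * norm x))\<^sup>2" by (intro power_mono) auto
      then show ?thesis unfolding vec_es[OF b] using qc by (simp add: power_mult_distrib mult_ac)
    qed
    have "(norm (blinfun_apply (\<Sum>b\<in>B. lin (us b) o\<^sub>L Y o\<^sub>L an_lin (es b)) x))\<^sup>2 =
        (norm (\<Sum>b\<in>B. blinfun_apply (lin (us b)) (blinfun_apply Y (blinfun_apply (an_lin (es b)) x))))\<^sup>2"
      by (simp add: blinfun.sum_left)
    also have "\<dots> \<le> q_const q k * (\<Sum>b\<in>B. 1 * (norm (blinfun_apply Y (blinfun_apply (an_lin (es b)) x)))\<^sup>2)"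
      by (rule norm_row_le[OF finB us1]) (use orth in auto)
    also have "\<dots> \<le> q_const q k * (\<Sum>b\<in>B. (norm (blinfun_apply (adj (lin (us b))) (vec xs)))\<^sup>2 * (q_const q (n - k) * (norm Y)\<^sup>2 * (norm x)\<^sup>2))"
      using one by (intro mult_left_mono sum_mono qc) auto
    also have "\<dots> = q_const q k * ((\<Sum>b\<in>B. (norm (blinfun_apply (adj (lin (us b))) (vec xs)))\<^sup>2) * (q_const q (n - k) * (norm Y)\<^sup>2 * (norm x)\<^sup>2))"
      by (simp only: sum_distrib_right)
    also have "\<dots> \<le> q_const q k * ((q_const q k * (norm (vec xs))\<^sup>2) * (q_const q (n - k) * (norm Y)\<^sup>2 * (norm x)\<^sup>2))"
      by (intro mult_left_mono mult_right_mono column_bound[OF finB us1] orth qc mult_nonneg_nonneg) auto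
    also have "\<dots> = (q_const q k * sqrt (q_const q (n - k)) * norm Y * norm (vec xs) * norm x)\<^sup>2"
      using qc by (simp add: power_mult_distrib power2_eq_square)
    finally show "norm (blinfun_apply (\<Sum>b\<in>B. lin (us b) o\<^sub>L Y o\<^sub>L an_lin (es b)) x) \<le>
        q_const q k * sqrt (q_const q (n - k)) * norm Y * norm (vec xs) * norm x"
      by (rule power2_le_imp_le) (use qc in simp)
  qed
qed

end

lemma sum_list_eq_0I: "(\<And>x. x \<in> set xs \<Longrightarrow> f x = 0) \<Longrightarrow> (\<Sum>x\<leftarrow>xs. f x) = (0::'b::comm_monoid_add)"
  by (induction xs) simp_all

lemma op_scaleC_scaleR: "op_scaleC (r *\<^sub>R c) T = r *\<^sub>R op_scaleC c T"
  by (rule blinfun_eqI) (simp only: op_scaleC_apply scaleC_scaleR blinfun.scaleR_left)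

context q_fock
begin

subsection \<open>The Haagerup inequality\<close>

text \<open>There are n + 1 Wick parts in degree n, each bounded by
  \<open>(q_const q n)\<^sup>2\<close>, and the weights r = t = q contribute
  \<open>q ^ n\<close>.\<close>

definition haagerup_term :: "nat \<Rightarrow> real" where
  "haagerup_term n = q ^ n * real (Suc n) * (q_const q n)\<^sup>2"

lemma q_const_ge_1: "1 \<le> q_const q n"
  by (rule q_const_bounds[OF q_nonneg q_less_1])

lemma haagerup_term_nonneg: "0 \<le> haagerup_term n"
  using q_nonneg by (simp add: haagerup_term_def)

lemma summable_haagerup_term: "summable haagerup_term"
proof -
  \<comment> \<open>The ratio of consecutive terms; it tends to q, so (1 + q) / 2 serves in the
    ratio test.\<close>
  define g where "g n = q * (real (Suc (Suc n)) / real (Suc n)) * (1 / (1 - q ^ Suc n))\<^sup>2" for n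
  have "(\<lambda>n. q ^ Suc n) \<longlonglongrightarrow> 0"
    using q_nonneg q_less_1 by (intro LIMSEQ_Suc LIMSEQ_power_zero) auto
  moreover have "(\<lambda>n. real (Suc (Suc n)) / real (Suc n)) \<longlonglongrightarrow> 1"
  proof -
    have "(\<lambda>n. 1 + inverse (real (Suc n))) \<longlonglongrightarrow> 1 + 0" by (intro tendsto_intros LIMSEQ_inverse_real_of_nat)
    moreover have "real (Suc (Suc n)) / real (Suc n) = 1 + inverse (real (Suc n))" for n by (simp add: field_simps)
    ultimately show ?thesis by simp
  qed
  ultimately have "g \<longlonglongrightarrow> q * 1 * (1 / (1 - 0))\<^sup>2"
    unfolding g_def by (intro tendsto_mult tendsto_power tendsto_divide tendsto_diff tendsto_const) auto
  then have "g \<longlonglongrightarrow> q" by simp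
  then have "eventually (\<lambda>n. g n < (1 + q) / 2) sequentially"
    using q_less_1 by (intro order_tendstoD(2)) auto
  then obtain N where N: "\<And>n. n \<ge> N \<Longrightarrow> g n < (1 + q) / 2" by (auto simp: eventually_sequentially)
  show ?thesis
  proof (rule summable_ratio_test)
    show "(1 + q) / 2 < 1" using q_less_1 by simp
    fix n assume "N \<le> n"
    have "haagerup_term (Suc n) = q * (real (Suc (Suc n)) / real (Suc n) * real (Suc n)) * q ^ n *
        (q_const q n * (1 / (1 - q ^ Suc n)))\<^sup>2"
      by (simp add: haagerup_term_def mult_ac del: of_nat_Suc)
    also have "\<dots> = g n * haagerup_term n"
      by (simp only: haagerup_term_def g_def power_mult_distrib mult_ac)
    also have "\<dots> \<le> (1 + q) / 2 * haagerup_term n"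
      by (intro mult_right_mono less_imp_le[OF N[OF \<open>N \<le> n\<close>]] haagerup_term_nonneg)
    finally show "norm (haagerup_term (Suc n)) \<le> (1 + q) / 2 * norm (haagerup_term n)"
      using haagerup_term_nonneg by simp
  qed
qed

definition haagerup_const :: real where "haagerup_const = suminf haagerup_term"

lemma haagerup_const_nonneg: "0 \<le> haagerup_const"
  unfolding haagerup_const_def by (intro suminf_nonneg summable_haagerup_term haagerup_term_nonneg)

lemma norm_wick_homogeneous:
  assumes xs: "set xs \<subseteq> UNIV \<times> {w \<in> words. length w = n}" and Y: "Y \<in> cops"
  shows "norm (\<Sum>(c, w)\<leftarrow>xs. op_scaleC c (wick q q Y w)) \<le> haagerup_term n * (norm Y * norm (vec xs))"
proof -
  have len: "length w = n" if "(c, w) \<in> set xs" for c w using xs that by auto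
  have "(\<Sum>(c, w)\<leftarrow>xs. op_scaleC c (wick q q Y w)) =
      (\<Sum>(c, w)\<leftarrow>xs. \<Sum>k\<le>n. q ^ n *\<^sub>R op_scaleC c (wick_part k Y w))"
  proof (rule sum_list_cong2, clarify)
    fix c w assume "(c, w) \<in> set xs"
    then have "wick q q Y w = (\<Sum>k\<le>n. q ^ n *\<^sub>R wick_part k Y w)"
      unfolding wick_eq len[OF \<open>(c, w) \<in> set xs\<close>] by (intro sum.cong) (simp_all flip: power_add)
    then show "op_scaleC c (wick q q Y w) = (\<Sum>k\<le>n. q ^ n *\<^sub>R op_scaleC c (wick_part k Y w))"
      by (simp add: op_scaleC_sum op_scaleC_simps)
  qed
  also have "\<dots> = (\<Sum>k\<le>n. q ^ n *\<^sub>R (\<Sum>(c, w)\<leftarrow>xs. op_scaleC c (wick_part k Y w)))"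
    by (induction xs) (simp_all add: sum.distrib scaleR_add_right case_prod_unfold)
  finally have "norm (\<Sum>(c, w)\<leftarrow>xs. op_scaleC c (wick q q Y w)) \<le>
      (\<Sum>k\<le>n. norm (q ^ n *\<^sub>R (\<Sum>(c, w)\<leftarrow>xs. op_scaleC c (wick_part k Y w))))"
    by (simp only: norm_sum)
  also have "\<dots> \<le> (\<Sum>k\<le>n. q ^ n * ((q_const q n)\<^sup>2 * (norm Y * norm (vec xs))))"
  proof (rule sum_mono)
    fix k assume "k \<in> {..n}"
    then have k: "k \<le> n" by simp
    have mono: "q_const q m \<le> q_const q n" if "m \<le> n" for m using q_const_mono[OF q_nonneg q_less_1 that] .
    have "q_const q (n - k) \<le> (q_const q n)\<^sup>2"
      using mono[of "n - k"] self_le_power[OF q_const_ge_1, of 2 n] by simp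
    then have s: "sqrt (q_const q (n - k)) \<le> q_const q n"
      using q_const_ge_1[of n] by (intro real_le_lsqrt) auto
    have "q_const q k * sqrt (q_const q (n - k)) \<le> q_const q n * q_const q n"
      using q_const_ge_1[of n] q_const_ge_1[of "n - k"] by (intro mult_mono mono k s) auto
    then have "q_const q k * sqrt (q_const q (n - k)) * (norm Y * norm (vec xs)) \<le> (q_const q n)\<^sup>2 * (norm Y * norm (vec xs))"
      unfolding power2_eq_square by (intro mult_right_mono) auto
    with norm_wick_part_le[OF xs k Y] have "norm (\<Sum>(c, w)\<leftarrow>xs. op_scaleC c (wick_part k Y w)) \<le>
        (q_const q n)\<^sup>2 * (norm Y * norm (vec xs))" by (simp add: mult.assoc)
    then show "norm (q ^ n *\<^sub>R (\<Sum>(c, w)\<leftarrow>xs. op_scaleC c (wick_part k Y w))) \<le>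
        q ^ n * ((q_const q n)\<^sup>2 * (norm Y * norm (vec xs)))"
      using q_nonneg by (simp add: mult_left_mono)
  qed
  also have "\<dots> = haagerup_term n * (norm Y * norm (vec xs))" by (simp add: haagerup_term_def mult_ac)
  finally show ?thesis .
qed

text \<open>Words of different lengths are orthogonal, so restriction to one length is an orthogonal
  projection.\<close>

lemma norm_vec_filter_le:
  assumes "xs \<in> formal"
  shows "norm (vec (filter (\<lambda>(c, w). length w = n) xs)) \<le> norm (vec xs)"
proof -
  let ?f = "filter (\<lambda>(c, w). length w = n) xs" and ?g = "filter (\<lambda>(c, w). length w \<noteq> n) xs"
  have fg: "?f \<in> formal" "?g \<in> formal" using assms by auto
  have "vec xs = vec ?f + vec ?g" by (induction xs) auto
  moreover have "cinner (vec ?f) (vec ?g) = 0"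
    unfolding cinner_vec[OF fg]
  proof (rule sum_list_eq_0I, clarify, rule sum_list_eq_0I, clarify)
    fix c w c' w' assume "(c, w) \<in> set ?f" "(c', w') \<in> set ?g"
    then show "cnj c * c' * q_inner q w w' = 0" by (simp add: q_inner_eq)
  qed
  ultimately have "complex_of_real ((norm (vec ?f))\<^sup>2) = cinner (vec ?f) (vec xs)"
    by (simp add: cinner_add_right cinner_self)
  then have "cmod (complex_of_real ((norm (vec ?f))\<^sup>2)) \<le> norm (vec ?f) * norm (vec xs)"
    using cmod_cinner_le by metis
  then have "norm (vec ?f) * norm (vec ?f) \<le> norm (vec ?f) * norm (vec xs)"
    unfolding norm_of_real by (simp add: power2_eq_square)
  then show ?thesis by (cases "norm (vec ?f) = 0") simp_all
qed

text \<open>The weights \<open>r = t = q\<close> damp the words of length \<open>n\<close> by \<open>q ^ n\<close>, which removes the dependence of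
  the usual Haagerup inequality on the degree.\<close>

lemma haagerup_inequality:
  assumes xs: "xs \<in> formal" and Y: "Y \<in> cops"
  shows "norm (\<Sum>(c, w)\<leftarrow>xs. op_scaleC c (wick q q Y w)) \<le> haagerup_const * norm Y * norm (vec xs)"
proof -
  define N where "N = (\<Sum>(c, w)\<leftarrow>xs. length w)"
  have N: "length w \<le> N" if "(c, w) \<in> set xs" for c w
    using member_le_sum_list[of "length w" "map (\<lambda>(c, w). length w) xs"] that by (force simp: N_def)
  let ?f = "\<lambda>n. filter (\<lambda>(c, w). length w = n) xs"
  have "(\<Sum>(c, w)\<leftarrow>xs. op_scaleC c (wick q q Y w)) = (\<Sum>n\<le>N. \<Sum>(c, w)\<leftarrow>?f n. op_scaleC c (wick q q Y w))"
    by (rule sum_list_by_length) (rule N)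
  then have "norm (\<Sum>(c, w)\<leftarrow>xs. op_scaleC c (wick q q Y w)) \<le> (\<Sum>n\<le>N. norm (\<Sum>(c, w)\<leftarrow>?f n. op_scaleC c (wick q q Y w)))"
    by (simp only: norm_sum)
  also have "\<dots> \<le> (\<Sum>n\<le>N. haagerup_term n * (norm Y * norm (vec xs)))"
  proof (rule sum_mono)
    fix n
    have "set (?f n) \<subseteq> UNIV \<times> {w \<in> words. length w = n}" using xs by auto
    then have "norm (\<Sum>(c, w)\<leftarrow>?f n. op_scaleC c (wick q q Y w)) \<le> haagerup_term n * (norm Y * norm (vec (?f n)))"
      by (rule norm_wick_homogeneous[OF _ Y])
    also have "\<dots> \<le> haagerup_term n * (norm Y * norm (vec xs))"
      by (intro mult_left_mono norm_vec_filter_le xs haagerup_term_nonneg) simp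
    finally show "norm (\<Sum>(c, w)\<leftarrow>?f n. op_scaleC c (wick q q Y w)) \<le> haagerup_term n * (norm Y * norm (vec xs))" .
  qed
  also have "\<dots> = (\<Sum>n\<le>N. haagerup_term n) * (norm Y * norm (vec xs))" by (simp add: sum_distrib_right)
  also have "\<dots> \<le> haagerup_const * (norm Y * norm (vec xs))"
    unfolding haagerup_const_def
    by (intro mult_right_mono sum_le_suminf summable_haagerup_term) (auto simp: haagerup_term_nonneg)
  finally show ?thesis by (simp add: mult_ac)
qed

lemma wick_extension_ex:
  assumes Y: "Y \<in> cops"
  shows "\<exists>Z :: 'h \<Rightarrow>\<^sub>L 'h oper. norm Z \<le> haagerup_const * norm Y \<and>
    (\<forall>c. \<forall>w\<in>words. blinfun_apply Z (c *\<^sub>C tens w) = op_scaleC c (wick q q Y w))"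
proof -
  have "\<exists>Z :: 'h \<Rightarrow>\<^sub>L 'h oper. norm Z \<le> haagerup_const * norm Y \<and>
    (\<forall>i\<in>UNIV \<times> words. blinfun_apply Z ((\<lambda>(c, w). c *\<^sub>C tens w) i) = (\<lambda>(c, w). op_scaleC c (wick q q Y w)) i)"
  proof (rule bounded_extension)
    fix xs :: "(complex \<times> (real \<Rightarrow> complex) list) list" assume "set xs \<subseteq> UNIV \<times> words"
    then show "norm (\<Sum>(c, w)\<leftarrow>xs. op_scaleC c (wick q q Y w)) \<le> haagerup_const * norm Y * norm (\<Sum>(c, w)\<leftarrow>xs. c *\<^sub>C tens w)"
      using haagerup_inequality[OF _ Y] by (simp add: vec_def)
  next
    fix i :: "complex \<times> (real \<Rightarrow> complex) list" and r assume "i \<in> UNIV \<times> words"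
    then show "\<exists>j\<in>UNIV \<times> words. (\<lambda>(c, w). c *\<^sub>C tens w) j = r *\<^sub>R (\<lambda>(c, w). c *\<^sub>C tens w) i \<and>
        (\<lambda>(c, w). op_scaleC c (wick q q Y w)) j = r *\<^sub>R (\<lambda>(c, w). op_scaleC c (wick q q Y w)) i"
      by (intro bexI[of _ "(r *\<^sub>R fst i, snd i)"])
        (auto simp: scaleC_scaleR op_scaleC_scaleR simp del: in_lists_conv_set)
  next
    show "closure {\<Sum>(c, w)\<leftarrow>xs. c *\<^sub>C tens w | xs. set xs \<subseteq> UNIV \<times> words} = UNIV" by (rule dense_span)
    show "0 \<le> haagerup_const * norm Y" using haagerup_const_nonneg by simp
  qed
  then show ?thesis by auto
qed

text \<open>The damped Wick expansion as a bounded map of the vector alone. An operator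
  \<open>b\<close> that is only a norm limit of Wick polynomials has no expansion into words, but it
  has the vector \<open>b vacuum\<close>.\<close>

definition wick_ext :: "'h oper \<Rightarrow> 'h \<Rightarrow>\<^sub>L 'h oper" where
  "wick_ext Y = (SOME Z. norm Z \<le> haagerup_const * norm Y \<and>
    (\<forall>c. \<forall>w\<in>words. blinfun_apply Z (c *\<^sub>C tens w) = op_scaleC c (wick q q Y w)))"

lemma wick_ext:
  assumes "Y \<in> cops"
  shows "norm (wick_ext Y) \<le> haagerup_const * norm Y"
    "w \<in> words \<Longrightarrow> blinfun_apply (wick_ext Y) (c *\<^sub>C tens w) = op_scaleC c (wick q q Y w)"
  using someI_ex[OF wick_extension_ex[OF assms]] unfolding wick_ext_def[symmetric] by blast+

lemma wick_ext_vec: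
  assumes "Y \<in> cops" "xs \<in> formal"
  shows "blinfun_apply (wick_ext Y) (vec xs) = (\<Sum>(c, w)\<leftarrow>xs. op_scaleC c (wick q q Y w))"
  unfolding vec_def blinfun_sum_list_right
  by (rule sum_list_cong2) (clarify, rule wick_ext(2)[OF assms(1) formalD[OF assms(2)]])

lemma wick_cops: "Y \<in> cops \<Longrightarrow> w \<in> words \<Longrightarrow> wick r t Y w \<in> cops"
proof (induction w arbitrary: r Y)
  case (Cons h w)
  then have h: "h \<in> L2_half_line" "w \<in> words" by auto
  show ?case unfolding wick.simps
    by (intro cops_intros(3,6,8) Cons.IH creation(1) annihilation(1) L2_conj_fun h Cons.prems(1))
qed simp

lemma wick_ext_scaleC:
  assumes Y: "Y \<in> cops"
  shows "blinfun_apply (wick_ext Y) (c *\<^sub>C x) = op_scaleC c (blinfun_apply (wick_ext Y) x)"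
proof -
  have bl: "bounded_linear (\<lambda>x. blinfun_apply (wick_ext Y) (c *\<^sub>C x))"
    by (intro bounded_linear_compose[OF blinfun.bounded_linear_right bounded_linear_scaleC])
  have bl': "bounded_linear (\<lambda>x. op_scaleC c (blinfun_apply (wick_ext Y) x))"
    by (intro bounded_linear_compose[OF bounded_linear_op_scaleC blinfun.bounded_linear_right])
  have "Blinfun (\<lambda>x. blinfun_apply (wick_ext Y) (c *\<^sub>C x)) = Blinfun (\<lambda>x. op_scaleC c (blinfun_apply (wick_ext Y) x))"
    by (rule blinfun_tens_eqI) (simp add: bounded_linear_Blinfun_apply bl bl' wick_ext Y scaleC_scaleC op_scaleC_simps)
  then have "blinfun_apply (Blinfun (\<lambda>x. blinfun_apply (wick_ext Y) (c *\<^sub>C x))) x =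
      blinfun_apply (Blinfun (\<lambda>x. op_scaleC c (blinfun_apply (wick_ext Y) x))) x" by simp
  then show ?thesis by (simp add: bounded_linear_Blinfun_apply bl bl')
qed

lemma wick_ext_cops:
  assumes Y: "Y \<in> cops"
  shows "blinfun_apply (wick_ext Y) x \<in> cops"
proof -
  obtain s where s: "\<forall>n. s n \<in> formal" "(\<lambda>n. vec (s n)) \<longlonglongrightarrow> x" using dense_vec by blast
  have s1: "s n \<in> formal" for n using s(1) by blast
  have "blinfun_apply (wick_ext Y) (vec (s n)) \<in> cops" for n
    unfolding wick_ext_vec[OF Y s1]
    by (rule cops_sum_list) (clarify, rule cops_intros(7), rule wick_cops[OF Y formalD[OF s1]])
  moreover have "(\<lambda>n. blinfun_apply (wick_ext Y) (vec (s n))) \<longlonglongrightarrow> blinfun_apply (wick_ext Y) x"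
    by (intro tendsto_intros s)
  ultimately show ?thesis using closed_cops closed_sequentially by metis
qed

subsection \<open>Identities for Wick ordered words\<close>

lemma wick_scale: "wick r t (a *\<^sub>R Y) w = a *\<^sub>R wick r t Y w"
  by (induction w arbitrary: r Y) (simp_all add: blinfun_compose_simps scaleR_add_right mult.commute)

lemma wick_add: "wick r t (Y + Y') w = wick r t Y w + wick r t Y' w"
  by (induction w arbitrary: r Y Y') (simp_all add: blinfun_compose_simps scaleR_add_right)

lemma wick_zero: "wick r t 0 w = 0"
  using wick_scale[of r t 0 0 w] by simp

lemma wick_sum: "finite I \<Longrightarrow> wick r t (\<Sum>i\<in>I. f i) w = (\<Sum>i\<in>I. wick r t (f i) w)"
  by (induction I rule: finite_induct) (simp_all add: wick_add wick_zero)

text \<open>On its way to the middle \<open>an e\<close> pays q for each creation operator, which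
  turns \<open>r\<close> into q * r. The commutator terms contract \<open>e\<close> with a letter
  that was to be created, hence the factor \<open>r\<close>; the weights of
  \<open>split_letter\<close> come from the letters passed before.\<close>

lemma an_wick:
  assumes e: "e \<in> L2_half_line" and w: "w \<in> words"
  shows "an e o\<^sub>L wick r t Y w = wick (q * r) t (an e o\<^sub>L Y) w +
    r *\<^sub>R (\<Sum>(c, g, w')\<leftarrow>split_letter q w. op_scaleC (complex_of_real c * L2_inner e g) (wick r t Y w'))"
  using w
proof (induction w arbitrary: r Y)
  case (Cons h w)
  then have h: "h \<in> L2_half_line" and w: "w \<in> words" by auto
  define S where "S r Y = (\<Sum>(c, g, w')\<leftarrow>split_letter q w. op_scaleC (complex_of_real c * L2_inner e g) (wick r t Y w'))" for r Y
  have IH: "an e o\<^sub>L wick r t Y w = wick (q * r) t (an e o\<^sub>L Y) w + r *\<^sub>R S r Y" for r Y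
    using Cons.IH w by (simp add: S_def)
  have "an e o\<^sub>L wick r t Y (h # w) = r *\<^sub>R ((an e o\<^sub>L cr h) o\<^sub>L wick r t Y w) + t *\<^sub>R (an e o\<^sub>L wick (r * q) t (Y o\<^sub>L an (conj_fun h)) w)"
    by (simp add: blinfun_compose_simps blinfun_compose_assoc')
  also have "(an e o\<^sub>L cr h) o\<^sub>L wick r t Y w = q *\<^sub>R (cr h o\<^sub>L (an e o\<^sub>L wick r t Y w)) + op_scaleC (L2_inner e h) (wick r t Y w)"
    by (simp add: q_commutation[OF e h] blinfun_compose_simps blinfun_compose_assoc' op_scaleC_comp)
  finally have 1: "an e o\<^sub>L wick r t Y (h # w) = wick (q * r) t (an e o\<^sub>L Y) (h # w) +
      r *\<^sub>R (op_scaleC (L2_inner e h) (wick r t Y w) + q *\<^sub>R (r *\<^sub>R (cr h o\<^sub>L S r Y) + t *\<^sub>R S (r * q) (Y o\<^sub>L an (conj_fun h))))"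
    unfolding IH
    by (simp add: blinfun_compose_simps blinfun_compose_assoc' scaleR_add_right mult_ac)
  have "r *\<^sub>R (cr h o\<^sub>L S r Y) + t *\<^sub>R S (r * q) (Y o\<^sub>L an (conj_fun h)) =
      (\<Sum>(c, g, w')\<leftarrow>split_letter q w. op_scaleC (complex_of_real c * L2_inner e g) (wick r t Y (h # w')))"
    unfolding S_def
    by (simp add: blinfun_compose_sum_list case_prod_unfold op_scaleC_simps op_scaleC_comp creation(1)[OF h]
      scaleR_sum_list sum_list_addf)
  then have "q *\<^sub>R (r *\<^sub>R (cr h o\<^sub>L S r Y) + t *\<^sub>R S (r * q) (Y o\<^sub>L an (conj_fun h))) =
      (\<Sum>(c, g, w')\<leftarrow>split_letter q w. op_scaleC (complex_of_real (q * c) * L2_inner e g) (wick r t Y (h # w')))"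
    by (simp add: scaleR_sum_list case_prod_unfold mult.assoc op_scaleC_simps(3)[symmetric] op_scaleC_simps(7)
        del: wick.simps)
  then show ?case unfolding 1
    by (simp add: case_prod_unfold comp_def del: wick.simps)
qed simp

text \<open>In every term annihilation operators act first and keep the vector in \<open>V\<close>;
  then \<open>Y\<close> kills it.\<close>

lemma wick_kills:
  assumes "\<And>v. v \<in> V \<Longrightarrow> blinfun_apply Y v = 0"
    and "\<And>h v. h \<in> set w \<Longrightarrow> v \<in> V \<Longrightarrow> blinfun_apply (an (conj_fun h)) v \<in> V" and "v \<in> V"
  shows "blinfun_apply (wick r t Y w) v = 0"
  using assms
proof (induction w arbitrary: r Y)
  case (Cons h w)
  have "blinfun_apply (wick r t Y w) v = 0"
    by (rule Cons.IH) (use Cons.prems in auto)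
  moreover have "blinfun_apply (wick (r * q) t (Y o\<^sub>L an (conj_fun h)) w) v = 0"
    by (rule Cons.IH) (use Cons.prems in auto)
  ultimately show ?case by (simp add: blinfun.bilinear_simps)
qed simp

text \<open>Only the term consisting of creation operators alone survives on the vacuum.\<close>

lemma wick_vacuum:
  assumes "w \<in> words"
  shows "blinfun_apply (wick 1 1 id_blinfun w) vacuum = tens w"
  using assms
proof (induction w)
  case (Cons h w)
  then have h: "h \<in> L2_half_line" "w \<in> words" by auto
  have "blinfun_apply (wick q 1 (an (conj_fun h)) w) vacuum = 0"
  proof (rule wick_kills[where V="{vacuum, 0}"])
    fix g v assume "g \<in> set w" "v \<in> {vacuum, 0}"
    then have "g \<in> L2_half_line" using h by (auto simp: in_lists_conv_set)
    then show "blinfun_apply (an (conj_fun g)) v \<in> {vacuum, 0}"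
      using \<open>v \<in> _\<close> annihilation_vacuum[OF L2_conj_fun] by (auto simp: blinfun.bilinear_simps)
  qed (use annihilation_vacuum[OF L2_conj_fun[OF h(1)]] in \<open>auto simp: blinfun.bilinear_simps\<close>)
  then show ?case using Cons h by (simp add: blinfun.bilinear_simps creation)
qed simp

text \<open>Orthogonality removes the scalars from the q-commutation relations. Each letter is
  passed exactly once: by \<open>an f\<close> if it is created, by \<open>cr g\<close> if it is
  annihilated. So every letter pays q, irrespective of its role, and both weights are multiplied by
  q.\<close>

lemma wick_conjugate:
  assumes f: "f \<in> L2_half_line" and g: "g \<in> L2_half_line" and w: "w \<in> words"
    and orth: "\<And>h. h \<in> set w \<Longrightarrow> L2_inner f h = 0 \<and> L2_inner (conj_fun h) g = 0"
  shows "an f o\<^sub>L wick r t Y w o\<^sub>L cr g = wick (q * r) (q * t) (an f o\<^sub>L Y o\<^sub>L cr g) w"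
  using w orth
proof (induction w arbitrary: r Y)
  case (Cons h w)
  then have h: "h \<in> L2_half_line" "w \<in> words" by auto
  have IH: "an f o\<^sub>L wick r t Y w o\<^sub>L cr g = wick (q * r) (q * t) (an f o\<^sub>L Y o\<^sub>L cr g) w" for r Y
    using Cons.IH Cons.prems by simp
  have c1: "an f o\<^sub>L cr h = q *\<^sub>R (cr h o\<^sub>L an f)"
    using q_commutation[OF f h(1)] Cons.prems(1)[of h] by (simp add: op_scaleC_simps)
  have c2: "an (conj_fun h) o\<^sub>L cr g = q *\<^sub>R (cr g o\<^sub>L an (conj_fun h))"
    using q_commutation[OF L2_conj_fun[OF h(1)] g] Cons.prems(1)[of h] by (simp add: op_scaleC_simps)
  have "an f o\<^sub>L wick r t Y (h # w) o\<^sub>L cr g = r *\<^sub>R ((an f o\<^sub>L cr h) o\<^sub>L wick r t Y w o\<^sub>L cr g) +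
      t *\<^sub>R (an f o\<^sub>L wick (r * q) t (Y o\<^sub>L an (conj_fun h)) w o\<^sub>L cr g)"
    by (simp add: blinfun_compose_simps blinfun_compose_assoc')
  also have "(an f o\<^sub>L cr h) o\<^sub>L wick r t Y w o\<^sub>L cr g = q *\<^sub>R (cr h o\<^sub>L wick (q * r) (q * t) (an f o\<^sub>L Y o\<^sub>L cr g) w)"
    unfolding c1 by (simp add: blinfun_compose_simps blinfun_compose_assoc' IH[unfolded blinfun_compose_assoc'])
  also have "an f o\<^sub>L wick (r * q) t (Y o\<^sub>L an (conj_fun h)) w o\<^sub>L cr g =
      wick (q * (r * q)) (q * t) ((an f o\<^sub>L Y) o\<^sub>L (an (conj_fun h) o\<^sub>L cr g)) w"
    unfolding IH by (simp add: blinfun_compose_assoc')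
  also have "\<dots> = q *\<^sub>R wick (q * r * q) (q * t) ((an f o\<^sub>L Y o\<^sub>L cr g) o\<^sub>L an (conj_fun h)) w"
    unfolding c2 by (simp add: blinfun_compose_simps wick_scale blinfun_compose_assoc' mult.assoc)
  finally show ?case by (simp add: mult_ac)
qed simp

section \<open>Field operators and Wick polynomials of the past\<close>

definition gauss :: "(real \<Rightarrow> complex) \<Rightarrow> 'h oper" where
  "gauss f = an f + cr f"

lemma gauss_cops: "f \<in> L2_half_line \<Longrightarrow> gauss f \<in> cops"
  by (simp add: gauss_def creation annihilation)

lemma adj_gauss: "f \<in> L2_half_line \<Longrightarrow> adj (gauss f) = gauss f"
  by (simp add: gauss_def adj_simps creation annihilation adj_cr)

text \<open>Letters are real-valued, so that \<open>conj_fun h = h\<close> and the field operator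
  \<open>gauss h\<close> is the Wick product of the one-letter word.\<close>

definition past :: "real \<Rightarrow> (real \<Rightarrow> complex) set" where
  "past s = {h \<in> L2_half_line. conj_fun h = h \<and> (\<forall>x>s. h x = 0)}"

definition wick_polys :: "real \<Rightarrow> 'h oper set" where
  "wick_polys s = {\<Sum>(c, w)\<leftarrow>xs. op_scaleC c (wick 1 1 id_blinfun w) | xs. set xs \<subseteq> UNIV \<times> lists (past s)}"

lemma past_words: "w \<in> lists (past s) \<Longrightarrow> w \<in> words"
  by (auto simp: past_def in_lists_conv_set)

lemma wick_polys_add: "T \<in> wick_polys s \<Longrightarrow> R \<in> wick_polys s \<Longrightarrow> T + R \<in> wick_polys s"
proof -
  assume "T \<in> wick_polys s" "R \<in> wick_polys s"
  then obtain xs ys where "set xs \<subseteq> UNIV \<times> lists (past s)" "set ys \<subseteq> UNIV \<times> lists (past s)"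
    "T = (\<Sum>(c, w)\<leftarrow>xs. op_scaleC c (wick 1 1 id_blinfun w))" "R = (\<Sum>(c, w)\<leftarrow>ys. op_scaleC c (wick 1 1 id_blinfun w))"
    unfolding wick_polys_def by blast
  then have "set (xs @ ys) \<subseteq> UNIV \<times> lists (past s)" "T + R = (\<Sum>(c, w)\<leftarrow>xs @ ys. op_scaleC c (wick 1 1 id_blinfun w))"
    by simp_all
  then show ?thesis unfolding wick_polys_def by blast
qed

lemma wick_polys_scale: "T \<in> wick_polys s \<Longrightarrow> op_scaleC a T \<in> wick_polys s"
proof -
  assume "T \<in> wick_polys s"
  then obtain xs where xs: "set xs \<subseteq> UNIV \<times> lists (past s)"
    "T = (\<Sum>(c, w)\<leftarrow>xs. op_scaleC c (wick 1 1 id_blinfun w))" unfolding wick_polys_def by blast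
  have "op_scaleC a T = (\<Sum>(c, w)\<leftarrow>map (\<lambda>(c, w). (a * c, w)) xs. op_scaleC c (wick 1 1 id_blinfun w))"
    by (simp add: xs(2) op_scaleC_sum_list case_prod_unfold comp_def op_scaleC_simps)
  moreover have "set (map (\<lambda>(c, w). (a * c, w)) xs) \<subseteq> UNIV \<times> lists (past s)" using xs(1) by fastforce
  ultimately show ?thesis unfolding wick_polys_def by blast
qed

lemma wick_polys_wick: "w \<in> lists (past s) \<Longrightarrow> wick 1 1 id_blinfun w \<in> wick_polys s"
  unfolding wick_polys_def
  by (intro CollectI exI[of _ "[(1, w)]"]) (simp add: op_scaleC_simps)

lemma wick_polys_zero: "0 \<in> wick_polys s"
  unfolding wick_polys_def by (intro CollectI exI[of _ "[]"]) simp

lemma wick_polys_sum_list: "(\<And>x. x \<in> set xs \<Longrightarrow> f x \<in> wick_polys s) \<Longrightarrow> (\<Sum>x\<leftarrow>xs. f x) \<in> wick_polys s"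
  by (induction xs) (auto intro: wick_polys_add wick_polys_zero)

text \<open>Moving the annihilation part of \<open>gauss h\<close> to the middle leaves
  contractions, which are shorter Wick products; the remaining term and the creation part combine to
  the Wick product of h # w.\<close>

lemma gauss_wick_polys:
  assumes h: "h \<in> past s" and T: "T \<in> wick_polys s"
  shows "gauss h o\<^sub>L T \<in> wick_polys s"
proof -
  have h': "h \<in> L2_half_line" "conj_fun h = h" using h by (auto simp: past_def)
  have one: "gauss h o\<^sub>L wick 1 1 id_blinfun w \<in> wick_polys s" if w: "w \<in> lists (past s)" for w
  proof -
    have "gauss h o\<^sub>L wick 1 1 id_blinfun w = wick 1 1 id_blinfun (h # w) +
      (\<Sum>(c, g, w')\<leftarrow>split_letter q w. op_scaleC (complex_of_real c * L2_inner h g) (wick 1 1 id_blinfun w'))"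
      unfolding gauss_def blinfun_compose_simps an_wick[OF h'(1) past_words[OF w]] by (simp add: h')
    also have "\<dots> \<in> wick_polys s"
    proof (rule wick_polys_add)
      show "wick 1 1 id_blinfun (h # w) \<in> wick_polys s" using h w by (intro wick_polys_wick) simp
      show "(\<Sum>(c, g, w')\<leftarrow>split_letter q w. op_scaleC (complex_of_real c * L2_inner h g) (wick 1 1 id_blinfun w')) \<in> wick_polys s"
      proof (rule wick_polys_sum_list, clarify)
        fix c g w' assume "(c, g, w') \<in> set (split_letter q w)"
        then have "w' \<in> lists (past s)" using split_letter_mem[of c g w' q w] w by (auto simp: in_lists_conv_set)
        then show "op_scaleC (complex_of_real c * L2_inner h g) (wick 1 1 id_blinfun w') \<in> wick_polys s"
          by (intro wick_polys_scale wick_polys_wick)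
      qed
    qed
    finally show ?thesis .
  qed
  obtain xs where xs: "set xs \<subseteq> UNIV \<times> lists (past s)"
    "T = (\<Sum>(c, w)\<leftarrow>xs. op_scaleC c (wick 1 1 id_blinfun w))" using T unfolding wick_polys_def by blast
  have "gauss h o\<^sub>L T = (\<Sum>(c, w)\<leftarrow>xs. op_scaleC c (gauss h o\<^sub>L wick 1 1 id_blinfun w))"
    unfolding xs(2) by (simp add: blinfun_compose_sum_list case_prod_unfold op_scaleC_comp gauss_cops[OF h'(1)])
  also have "\<dots> \<in> wick_polys s"
  proof (rule wick_polys_sum_list, clarify)
    fix c w assume "(c, w) \<in> set xs"
    then show "op_scaleC c (gauss h o\<^sub>L wick 1 1 id_blinfun w) \<in> wick_polys s"
      using xs(1) by (intro wick_polys_scale one) blast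
  qed
  finally show ?thesis .
qed

lemma wick_polys_cops: "T \<in> wick_polys s \<Longrightarrow> T \<in> cops"
proof -
  assume "T \<in> wick_polys s"
  then obtain xs where xs: "set xs \<subseteq> UNIV \<times> lists (past s)"
    "T = (\<Sum>(c, w)\<leftarrow>xs. op_scaleC c (wick 1 1 id_blinfun w))" unfolding wick_polys_def by blast
  show ?thesis unfolding xs(2)
  proof (rule cops_sum_list, clarify)
    fix c w assume "(c, w) \<in> set xs"
    then have "w \<in> words" using xs(1) past_words by blast
    then show "op_scaleC c (wick 1 1 id_blinfun w) \<in> cops" by (intro cops_intros wick_cops)
  qed
qed

text \<open>The induction shows that left multiplication by \<open>T\<close> preserves Wick
  polynomials. This property passes to products immediately, and applied to the identity it gives
  the claim.\<close>

lemma generated_algebra_wick_polys: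
  assumes T: "T \<in> generated_algebra S" and S: "S \<subseteq> gauss ` past s"
  shows "T \<in> wick_polys s"
proof -
  have "T \<in> cops \<and> (\<forall>R\<in>wick_polys s. T o\<^sub>L R \<in> wick_polys s)"
    using T
  proof (induction rule: generated_algebra.induct)
    case (gen T)
    then obtain h where "h \<in> past s" "T = gauss h" using S by auto
    then show ?case using gauss_wick_polys gauss_cops by (auto simp: past_def)
  qed (auto simp: blinfun_compose_simps op_scaleC_comp blinfun_compose_assoc' intro: wick_polys_add wick_polys_scale)
  moreover have "id_blinfun \<in> wick_polys s" using wick_polys_wick[of "[]" s] by simp
  ultimately have "T o\<^sub>L id_blinfun \<in> wick_polys s" by blast
  then show ?thesis by simp
qed

end

lemma closure_sequenceI: "(\<And>n. s n \<in> S) \<Longrightarrow> s \<longlonglongrightarrow> x \<Longrightarrow> x \<in> closure S"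
  for x :: "'a::metric_space"
  unfolding closure_sequential by blast

context q_fock
begin

subsection \<open>Sums over orthogonal pairs of increments\<close>

lemma cinner_tens_letters:
  "f \<in> L2_half_line \<Longrightarrow> g \<in> L2_half_line \<Longrightarrow> cinner (tens [f]) (tens [g]) = L2_inner f g"
  by (simp add: cinner_tens q_inner_Cons q_inner_Nil)

lemma norm_creation_row_le:
  assumes K: "finite K" and f: "\<And>k. k \<in> K \<Longrightarrow> f k \<in> L2_half_line"
    and orth: "\<And>i j. i \<in> K \<Longrightarrow> j \<in> K \<Longrightarrow> L2_inner (f i) (f j) = (if i = j then complex_of_real (nf i) else 0)"
  shows "norm (\<Sum>k\<in>K. cr (f k) o\<^sub>L R k) \<le> sqrt (1 / (1 - q) * (\<Sum>k\<in>K. nf k * (norm (R k))\<^sup>2))"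
proof (rule norm_blinfun_bound)
  have nf: "0 \<le> nf k" if "k \<in> K" for k
    using norm_tens_letter[OF f[OF that]] orth[OF that that] by (metis Re_complex_of_real zero_le_power2)
  have q1: "0 < 1 - q" using q_less_1 by simp
  have S: "0 \<le> 1 / (1 - q) * (\<Sum>k\<in>K. nf k * (norm (R k))\<^sup>2)"
    using q1 nf by (intro mult_nonneg_nonneg sum_nonneg) auto
  then show "0 \<le> sqrt (1 / (1 - q) * (\<Sum>k\<in>K. nf k * (norm (R k))\<^sup>2))" by simp
  fix x
  have lin1: "lin [(1, [f k])] = cr (f k)" for k by (simp add: lin_def op_scaleC_simps)
  have "(norm (blinfun_apply (\<Sum>k\<in>K. cr (f k) o\<^sub>L R k) x))\<^sup>2 =
      (norm (\<Sum>k\<in>K. blinfun_apply (lin [(1, [f k])]) (blinfun_apply (R k) x)))\<^sup>2"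
    by (simp add: blinfun.sum_left lin1)
  also have "\<dots> \<le> q_const q 1 * (\<Sum>k\<in>K. nf k * (norm (blinfun_apply (R k) x))\<^sup>2)"
  proof (rule norm_row_le[OF K])
    fix k assume k: "k \<in> K"
    show "set [(1, [f k])] \<subseteq> UNIV \<times> {u \<in> words. length u = 1}" using f[OF k] by simp
    fix j assume j: "j \<in> K"
    show "cinner (vec [(1, [f k])]) (vec [(1, [f j])]) = (if k = j then complex_of_real (nf k) else 0)"
      using orth[OF k j] by (simp add: cinner_tens_letters f k j)
  qed
  also have "\<dots> \<le> 1 / (1 - q) * (\<Sum>k\<in>K. nf k * ((norm (R k))\<^sup>2 * (norm x)\<^sup>2))"
  proof -
    have "(norm (blinfun_apply (R k) x))\<^sup>2 \<le> (norm (R k))\<^sup>2 * (norm x)\<^sup>2" for k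
      unfolding power_mult_distrib[symmetric] by (intro power_mono norm_blinfun) simp
    then show ?thesis using q1 nf by (simp add: divide_right_mono sum_mono mult_left_mono)
  qed
  also have "\<dots> = (1 / (1 - q) * (\<Sum>k\<in>K. nf k * (norm (R k))\<^sup>2)) * (norm x)\<^sup>2"
    by (simp only: sum_distrib_right mult.assoc)
  also have "\<dots> = (sqrt (1 / (1 - q) * (\<Sum>k\<in>K. nf k * (norm (R k))\<^sup>2)) * norm x)\<^sup>2"
    using S by (simp only: power_mult_distrib real_sqrt_pow2)
  finally show "norm (blinfun_apply (\<Sum>k\<in>K. cr (f k) o\<^sub>L R k) x) \<le>
      sqrt (1 / (1 - q) * (\<Sum>k\<in>K. nf k * (norm (R k))\<^sup>2)) * norm x"
    by (rule power2_le_imp_le) (use S in simp)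
qed

lemma norm_cr_sq:
  assumes f: "f \<in> L2_half_line" "L2_inner f f = complex_of_real nf"
  shows "(norm (cr f))\<^sup>2 \<le> nf / (1 - q)" "(norm (an f))\<^sup>2 \<le> nf / (1 - q)"
proof -
  have "0 \<le> nf" using norm_tens_letter[OF f(1)] f(2) by (metis Re_complex_of_real zero_le_power2)
  have "norm (cr f) \<le> sqrt (1 / (1 - q) * (nf * (norm (id_blinfun :: 'h oper))\<^sup>2))"
    using norm_creation_row_le[of "{()}" "\<lambda>_. f" "\<lambda>_. nf" "\<lambda>_. id_blinfun"] f by simp
  also have "\<dots> \<le> sqrt (1 / (1 - q) * (nf * 1\<^sup>2))"
    using q_less_1 \<open>0 \<le> nf\<close> by (intro real_sqrt_le_mono mult_left_mono power_mono norm_blinfun_id_le) auto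
  finally have "(norm (cr f))\<^sup>2 \<le> (sqrt (1 / (1 - q) * (nf * 1\<^sup>2)))\<^sup>2" by (intro power_mono) auto
  also have "\<dots> = nf / (1 - q)" using q_less_1 \<open>0 \<le> nf\<close> by simp
  finally show "(norm (cr f))\<^sup>2 \<le> nf / (1 - q)" .
  then show "(norm (an f))\<^sup>2 \<le> nf / (1 - q)"
    by (simp add: annihilation_def norm_adj creation(1)[OF f(1)])
qed

text \<open>\<open>pair_op K f g b\<close> is the sum over \<open>K\<close> of \<open>gauss (f k) b gauss (g k)\<close> for \<open>f k\<close> and \<open>g k\<close>
  orthogonal to each other and to the letters of the Wick polynomial \<open>b\<close>: commuting the inner
  operators of \<open>an (f k) b cr (g k)\<close> past \<open>b\<close> turns it into \<open>q\<close> times the expansion with weights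
  \<open>r = t = q\<close> of \<open>b \<Omega>\<close>.\<close>

definition pair_op ::
    "nat set \<Rightarrow> (nat \<Rightarrow> real \<Rightarrow> complex) \<Rightarrow> (nat \<Rightarrow> real \<Rightarrow> complex) \<Rightarrow> 'h oper \<Rightarrow> 'h oper" where
  "pair_op K f g b =
    (\<Sum>k\<in>K. cr (f k) o\<^sub>L (b o\<^sub>L cr (g k))) + (\<Sum>k\<in>K. cr (f k) o\<^sub>L (b o\<^sub>L an (g k))) +
    (\<Sum>k\<in>K. an (f k) o\<^sub>L (b o\<^sub>L an (g k))) +
    q *\<^sub>R blinfun_apply (wick_ext (\<Sum>k\<in>K. cr (g k) o\<^sub>L an (f k))) (blinfun_apply b vacuum)"

definition orth_pairs where
  "orth_pairs K f g nf ng \<longleftrightarrow> finite K \<and> (\<forall>k\<in>K. f k \<in> L2_half_line \<and> g k \<in> L2_half_line \<and> L2_inner (f k) (g k) = 0) \<and>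
    (\<forall>i\<in>K. \<forall>j\<in>K. L2_inner (f i) (f j) = (if i = j then complex_of_real (nf i) else 0)) \<and>
    (\<forall>i\<in>K. \<forall>j\<in>K. L2_inner (g i) (g j) = (if i = j then complex_of_real (ng i) else 0))"

lemma orth_pairsD:
  assumes "orth_pairs K f g nf ng"
  shows "finite K" "k \<in> K \<Longrightarrow> f k \<in> L2_half_line" "k \<in> K \<Longrightarrow> g k \<in> L2_half_line" "k \<in> K \<Longrightarrow> L2_inner (f k) (g k) = 0"
    "i \<in> K \<Longrightarrow> j \<in> K \<Longrightarrow> L2_inner (f i) (f j) = (if i = j then complex_of_real (nf i) else 0)"
    "i \<in> K \<Longrightarrow> j \<in> K \<Longrightarrow> L2_inner (g i) (g j) = (if i = j then complex_of_real (ng i) else 0)"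
    "k \<in> K \<Longrightarrow> 0 \<le> nf k" "k \<in> K \<Longrightarrow> 0 \<le> ng k"
proof -
  show 1: "finite K" "k \<in> K \<Longrightarrow> f k \<in> L2_half_line" "k \<in> K \<Longrightarrow> g k \<in> L2_half_line" "k \<in> K \<Longrightarrow> L2_inner (f k) (g k) = 0"
    "i \<in> K \<Longrightarrow> j \<in> K \<Longrightarrow> L2_inner (f i) (f j) = (if i = j then complex_of_real (nf i) else 0)"
    "i \<in> K \<Longrightarrow> j \<in> K \<Longrightarrow> L2_inner (g i) (g j) = (if i = j then complex_of_real (ng i) else 0)" for i j k
    using assms unfolding orth_pairs_def by blast+
  show "0 \<le> nf k" if "k \<in> K"
    using norm_tens_letter[OF 1(2)[OF that]] 1(5)[OF that that] by (metis Re_complex_of_real zero_le_power2)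
  show "0 \<le> ng k" if "k \<in> K"
    using norm_tens_letter[OF 1(3)[OF that]] 1(6)[OF that that] by (metis Re_complex_of_real zero_le_power2)
qed

lemma orth_pairs_sym:
  assumes p: "orth_pairs K f g nf ng" shows "orth_pairs K g f ng nf"
proof -
  have "L2_inner (g k) (f k) = 0" if "k \<in> K" for k
    using orth_pairsD(4)[OF p that] L2_inner_cnj[where f="f k" and g="g k"] by simp
  then show ?thesis using p unfolding orth_pairs_def by simp
qed

lemma norm_op_cr_sq:
  assumes "f \<in> L2_half_line" "L2_inner f f = complex_of_real nf"
  shows "(norm (b o\<^sub>L cr f))\<^sup>2 \<le> (norm b)\<^sup>2 * (nf / (1 - q))" "(norm (b o\<^sub>L an f))\<^sup>2 \<le> (norm b)\<^sup>2 * (nf / (1 - q))"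
proof -
  have "(norm (b o\<^sub>L c))\<^sup>2 \<le> (norm b)\<^sup>2 * (nf / (1 - q))" if "(norm c)\<^sup>2 \<le> nf / (1 - q)" for c :: "'h oper"
  proof -
    have "(norm (b o\<^sub>L c))\<^sup>2 \<le> (norm b * norm c)\<^sup>2" by (intro power_mono norm_blinfun_compose) simp
    also have "\<dots> \<le> (norm b)\<^sup>2 * (nf / (1 - q))"
      unfolding power_mult_distrib by (intro mult_left_mono that) simp
    finally show ?thesis .
  qed
  then show "(norm (b o\<^sub>L cr f))\<^sup>2 \<le> (norm b)\<^sup>2 * (nf / (1 - q))" "(norm (b o\<^sub>L an f))\<^sup>2 \<le> (norm b)\<^sup>2 * (nf / (1 - q))"
    using norm_cr_sq[OF assms] by blast+
qed

lemma norm_creation_row_pair_le: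
  assumes p: "orth_pairs K f g nf ng" and R: "\<And>k. k \<in> K \<Longrightarrow> (norm (R k))\<^sup>2 \<le> \<beta>\<^sup>2 * (ng k / (1 - q))" and "0 \<le> \<beta>"
  shows "norm (\<Sum>k\<in>K. cr (f k) o\<^sub>L R k) \<le> \<beta> * (sqrt (\<Sum>k\<in>K. nf k * ng k) / (1 - q))"
proof -
  note pd = orth_pairsD[OF p]
  have q1: "0 < 1 - q" using q_less_1 by simp
  have "norm (\<Sum>k\<in>K. cr (f k) o\<^sub>L R k) \<le> sqrt (1 / (1 - q) * (\<Sum>k\<in>K. nf k * (norm (R k))\<^sup>2))"
    by (rule norm_creation_row_le[OF pd(1,2) pd(5)])
  also have "\<dots> \<le> sqrt (1 / (1 - q) * (\<Sum>k\<in>K. nf k * (\<beta>\<^sup>2 * (ng k / (1 - q)))))"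
    using q1 by (intro real_sqrt_le_mono mult_left_mono sum_mono R pd(7)) auto
  also have "(\<Sum>k\<in>K. nf k * (\<beta>\<^sup>2 * (ng k / (1 - q)))) = \<beta>\<^sup>2 / (1 - q) * (\<Sum>k\<in>K. nf k * ng k)"
    by (simp add: sum_distrib_left sum_divide_distrib mult_ac)
  also have "1 / (1 - q) * (\<beta>\<^sup>2 / (1 - q) * (\<Sum>k\<in>K. nf k * ng k)) = (\<beta> / (1 - q))\<^sup>2 * (\<Sum>k\<in>K. nf k * ng k)"
    by (simp add: power2_eq_square)
  also have "sqrt \<dots> = \<beta> * (sqrt (\<Sum>k\<in>K. nf k * ng k) / (1 - q))"
    using q1 \<open>0 \<le> \<beta>\<close> by (simp add: real_sqrt_mult)
  finally show ?thesis .
qed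

text \<open>One unit for each of the three sums of row type, and \<open>q * haagerup_const\<close>
  for the sum with annihilation on the left and creation on the right. Each of the two families of
  increments contributes 1 / sqrt (1 - q).\<close>

definition pair_const :: real where "pair_const = (3 + q * haagerup_const) / (1 - q)"

lemma pair_const_nonneg: "0 \<le> pair_const"
  unfolding pair_const_def using q_nonneg q_less_1 haagerup_const_nonneg by simp

text \<open>The first two sums are rows of creation operators. The third becomes one after taking
  adjoints, which exchanges \<open>f\<close> and \<open>g\<close>. In the last one the middle
  operator is a row with entries \<open>an (f k)\<close>, and it enters the Haagerup inequality
  through its norm only.\<close>

lemma norm_pair_op_le:
  assumes p: "orth_pairs K f g nf ng" and b: "b \<in> cops"
  shows "norm (pair_op K f g b) \<le> pair_const * sqrt (\<Sum>k\<in>K. nf k * ng k) * norm b"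
proof -
  note pd = orth_pairsD[OF p]
  define \<rho> where "\<rho> = sqrt (\<Sum>k\<in>K. nf k * ng k) / (1 - q)"
  have q1: "0 < 1 - q" using q_less_1 by simp
  have \<rho>: "0 \<le> \<rho>" unfolding \<rho>_def using q1 by (simp add: sum_nonneg pd)
  have ff: "L2_inner (f k) (f k) = complex_of_real (nf k)" and gg: "L2_inner (g k) (g k) = complex_of_real (ng k)"
    if "k \<in> K" for k using pd(5)[OF that that] pd(6)[OF that that] by simp_all
  have n1: "norm (\<Sum>k\<in>K. cr (f k) o\<^sub>L (b o\<^sub>L cr (g k))) \<le> norm b * \<rho>"
    unfolding \<rho>_def by (rule norm_creation_row_pair_le[OF p norm_op_cr_sq(1)[OF pd(3) gg] norm_ge_zero])
  have n2: "norm (\<Sum>k\<in>K. cr (f k) o\<^sub>L (b o\<^sub>L an (g k))) \<le> norm b * \<rho>"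
    unfolding \<rho>_def by (rule norm_creation_row_pair_le[OF p norm_op_cr_sq(2)[OF pd(3) gg] norm_ge_zero])
  have comm: "(\<Sum>k\<in>K. ng k * nf k) = (\<Sum>k\<in>K. nf k * ng k)" by (simp add: mult.commute)
  have n3: "norm (\<Sum>k\<in>K. an (f k) o\<^sub>L (b o\<^sub>L an (g k))) \<le> norm b * \<rho>"
  proof -
    have c: "an (f k) o\<^sub>L (b o\<^sub>L an (g k)) \<in> cops" if "k \<in> K" for k
      using pd that b by (intro cops_intros annihilation) auto
    have "adj (\<Sum>k\<in>K. an (f k) o\<^sub>L (b o\<^sub>L an (g k))) = (\<Sum>k\<in>K. adj (an (f k) o\<^sub>L (b o\<^sub>L an (g k))))"
      by (rule adj_sum) (rule c)
    also have "\<dots> = (\<Sum>k\<in>K. cr (g k) o\<^sub>L (adj b o\<^sub>L cr (f k)))"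
      by (rule sum.cong[OF refl]) (simp add: adj_simps annihilation pd b adj_cr blinfun_compose_assoc')
    finally have "norm (\<Sum>k\<in>K. an (f k) o\<^sub>L (b o\<^sub>L an (g k))) = norm (\<Sum>k\<in>K. cr (g k) o\<^sub>L (adj b o\<^sub>L cr (f k)))"
      using norm_adj[OF cops_sum, of K "\<lambda>k. an (f k) o\<^sub>L (b o\<^sub>L an (g k))"] c by simp
    also have "\<dots> \<le> norm (adj b) * (sqrt (\<Sum>k\<in>K. ng k * nf k) / (1 - q))"
      by (rule norm_creation_row_pair_le[OF orth_pairs_sym[OF p] norm_op_cr_sq(1)[OF pd(2) ff] norm_ge_zero])
    finally show ?thesis unfolding comm \<rho>_def norm_adj[OF b] .
  qed
  define Y where "Y = (\<Sum>k\<in>K. cr (g k) o\<^sub>L an (f k))"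
  have Yc: "Y \<in> cops" unfolding Y_def using pd by (intro cops_sum cops_intros creation annihilation) auto
  have "norm Y \<le> 1 * (sqrt (\<Sum>k\<in>K. ng k * nf k) / (1 - q))"
    unfolding Y_def by (rule norm_creation_row_pair_le[OF orth_pairs_sym[OF p]]) (use norm_cr_sq(2)[OF pd(2) ff] in auto)
  then have nY: "norm Y \<le> \<rho>" unfolding comm \<rho>_def by simp
  have "norm (blinfun_apply (wick_ext Y) (blinfun_apply b vacuum)) \<le> norm (wick_ext Y) * norm (blinfun_apply b vacuum)"
    by (rule norm_blinfun)
  also have "\<dots> \<le> (haagerup_const * \<rho>) * norm b"
  proof (rule mult_mono)
    show "norm (wick_ext Y) \<le> haagerup_const * \<rho>"
      using wick_ext(1)[OF Yc] mult_left_mono[OF nY haagerup_const_nonneg] by simp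
    show "norm (blinfun_apply b vacuum) \<le> norm b" using norm_blinfun[of b vacuum] by (simp add: norm_vacuum)
  qed (use haagerup_const_nonneg \<rho> in auto)
  finally have n4: "norm (q *\<^sub>R blinfun_apply (wick_ext Y) (blinfun_apply b vacuum)) \<le> q * (haagerup_const * \<rho> * norm b)"
    using q_nonneg by (simp add: mult_left_mono)
  have "norm (pair_op K f g b) \<le> norm b * \<rho> + norm b * \<rho> + norm b * \<rho> + q * (haagerup_const * \<rho> * norm b)"
    unfolding pair_op_def Y_def[symmetric] by (intro norm_triangle_le add_mono n1 n2 n3 n4)
  also have "\<dots> = pair_const * sqrt (\<Sum>k\<in>K. nf k * ng k) * norm b"
  proof -
    have "norm b * \<rho> + norm b * \<rho> + norm b * \<rho> + q * (haagerup_const * \<rho> * norm b) = (3 + q * haagerup_const) * \<rho> * norm b"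
      by (simp add: algebra_simps)
    then show ?thesis by (simp add: pair_const_def \<rho>_def)
  qed
  finally show ?thesis .
qed

lemma pair_op_linear:
  "pair_op K f g (b + b') = pair_op K f g b + pair_op K f g b'"
  "pair_op K f g (b - b') = pair_op K f g b - pair_op K f g b'"
  by (simp_all add: pair_op_def blinfun_compose_simps sum.distrib sum_subtractf blinfun.bilinear_simps scaleR_add_right
      scaleR_diff_right algebra_simps)

lemma pair_op_scaleC:
  assumes p: "orth_pairs K f g nf ng"
  shows "pair_op K f g (op_scaleC c b) = op_scaleC c (pair_op K f g b)"
proof -
  note pd = orth_pairsD[OF p]
  have Y: "(\<Sum>k\<in>K. cr (g k) o\<^sub>L an (f k)) \<in> cops" using pd by (intro cops_sum cops_intros creation annihilation) auto
  have "(\<Sum>k\<in>K. cr (f k) o\<^sub>L (op_scaleC c b o\<^sub>L R k)) = op_scaleC c (\<Sum>k\<in>K. cr (f k) o\<^sub>L (b o\<^sub>L R k))" for R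
    unfolding op_scaleC_sum by (rule sum.cong[OF refl]) (simp add: op_scaleC_comp creation pd)
  moreover have "(\<Sum>k\<in>K. an (f k) o\<^sub>L (op_scaleC c b o\<^sub>L R k)) = op_scaleC c (\<Sum>k\<in>K. an (f k) o\<^sub>L (b o\<^sub>L R k))" for R
    unfolding op_scaleC_sum by (rule sum.cong[OF refl]) (simp add: op_scaleC_comp annihilation pd)
  ultimately show ?thesis
    by (simp add: pair_op_def op_scaleC_simps op_scaleC_apply wick_ext_scaleC[OF Y])
qed

lemma pair_op_cops:
  assumes p: "orth_pairs K f g nf ng" and b: "b \<in> cops"
  shows "pair_op K f g b \<in> cops"
proof -
  note pd = orth_pairsD[OF p]
  have Y: "(\<Sum>k\<in>K. cr (g k) o\<^sub>L an (f k)) \<in> cops" using pd by (intro cops_sum cops_intros creation annihilation) auto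
  show ?thesis unfolding pair_op_def
    by (intro cops_intros(3,6,8) cops_sum wick_ext_cops Y creation(1) annihilation(1) b pd)
qed

lemma pair_op_wick_polys:
  assumes p: "orth_pairs K f g nf ng" and b: "b \<in> wick_polys s"
    and van: "\<And>k x. k \<in> K \<Longrightarrow> x \<le> s \<Longrightarrow> f k x = 0 \<and> g k x = 0"
  shows "pair_op K f g b = (\<Sum>k\<in>K. gauss (f k) o\<^sub>L b o\<^sub>L gauss (g k))"
proof -
  note pd = orth_pairsD[OF p]
  obtain xs where xs: "set xs \<subseteq> UNIV \<times> lists (past s)"
    "b = (\<Sum>(c, w)\<leftarrow>xs. op_scaleC c (wick 1 1 id_blinfun w))" using b unfolding wick_polys_def by blast
  have w: "w \<in> lists (past s)" "w \<in> words" if "(c, w) \<in> set xs" for c w using xs(1) that past_words by blast+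
  have xs': "xs \<in> formal" using w(2) by (auto simp del: in_lists_conv_set)
  define Y where "Y = (\<Sum>k\<in>K. cr (g k) o\<^sub>L an (f k))"
  have Y: "Y \<in> cops" unfolding Y_def using pd by (intro cops_sum cops_intros creation annihilation) auto
  have b\<Omega>: "blinfun_apply b vacuum = vec xs"
    unfolding xs(2) vec_def blinfun_sum_list_left
    by (rule sum_list_cong2) (clarify, simp only: op_scaleC_apply wick_vacuum w)
  have conj: "an (f k) o\<^sub>L (b o\<^sub>L cr (g k)) = q *\<^sub>R (\<Sum>(c, w)\<leftarrow>xs. op_scaleC c (wick q q (cr (g k) o\<^sub>L an (f k)) w))" if k: "k \<in> K" for k
  proof -
    \<comment> \<open>The additional factor q arises when the two operators, after passing all
      letters of the word, are exchanged with each other.\<close>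
    have c1: "an (f k) o\<^sub>L cr (g k) = q *\<^sub>R (cr (g k) o\<^sub>L an (f k))"
      using q_commutation[OF pd(2,3)[OF k]] pd(4)[OF k] by (simp add: op_scaleC_simps)
    have one: "an (f k) o\<^sub>L (wick 1 1 id_blinfun w o\<^sub>L cr (g k)) = q *\<^sub>R wick q q (cr (g k) o\<^sub>L an (f k)) w"
      if "(c, w) \<in> set xs" for c w
    proof -
      have orth: "L2_inner (f k) h = 0 \<and> L2_inner (conj_fun h) (g k) = 0" if "h \<in> set w" for h
      proof -
        have "h \<in> past s" using w(1)[OF \<open>(c, w) \<in> set xs\<close>] that by auto
        then have h: "conj_fun h = h" "\<And>x. x > s \<Longrightarrow> h x = 0" by (auto simp: past_def)
        have "f k x = 0 \<or> h x = 0" "conj_fun h x = 0 \<or> g k x = 0" for x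
          using van[OF k, of x] h by (cases "x \<le> s"; auto)+
        then show ?thesis by (auto intro!: L2_inner_disjoint)
      qed
      have "an (f k) o\<^sub>L (wick 1 1 id_blinfun w o\<^sub>L cr (g k)) = wick (q * 1) (q * 1) (an (f k) o\<^sub>L id_blinfun o\<^sub>L cr (g k)) w"
        unfolding blinfun_compose_assoc'[symmetric]
        by (rule wick_conjugate[OF pd(2,3)[OF k] w(2)[OF that] orth])
      then show ?thesis by (simp add: c1 wick_scale)
    qed
    have "an (f k) o\<^sub>L (b o\<^sub>L cr (g k)) = (\<Sum>(c, w)\<leftarrow>xs. op_scaleC c (an (f k) o\<^sub>L (wick 1 1 id_blinfun w o\<^sub>L cr (g k))))"
      unfolding xs(2)
      by (simp add: blinfun_compose_sum_list case_prod_unfold op_scaleC_comp annihilation(1)[OF pd(2)[OF k]])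
    also have "\<dots> = (\<Sum>(c, w)\<leftarrow>xs. op_scaleC c (q *\<^sub>R wick q q (cr (g k) o\<^sub>L an (f k)) w))"
      by (rule sum_list_cong2) (clarify, simp only: one)
    finally show ?thesis by (simp add: scaleR_sum_list case_prod_unfold op_scaleC_simps)
  qed
  have "q *\<^sub>R blinfun_apply (wick_ext Y) (blinfun_apply b vacuum) = q *\<^sub>R (\<Sum>(c, w)\<leftarrow>xs. op_scaleC c (wick q q Y w))"
    unfolding b\<Omega> wick_ext_vec[OF Y xs'] ..
  also have "(\<Sum>(c, w)\<leftarrow>xs. op_scaleC c (wick q q Y w)) = (\<Sum>(c, w)\<leftarrow>xs. \<Sum>k\<in>K. op_scaleC c (wick q q (cr (g k) o\<^sub>L an (f k)) w))"
    unfolding Y_def by (simp add: wick_sum pd(1) op_scaleC_sum)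
  also have "\<dots> = (\<Sum>k\<in>K. \<Sum>(c, w)\<leftarrow>xs. op_scaleC c (wick q q (cr (g k) o\<^sub>L an (f k)) w))"
    by (induction xs) (simp_all add: sum.distrib case_prod_unfold)
  also have "q *\<^sub>R \<dots> = (\<Sum>k\<in>K. an (f k) o\<^sub>L (b o\<^sub>L cr (g k)))"
    unfolding scaleR_sum_right by (rule sum.cong[OF refl]) (simp only: conj)
  finally show ?thesis
    unfolding pair_op_def Y_def[symmetric]
    by (simp add: gauss_def blinfun_compose_simps blinfun_compose_assoc' sum.distrib algebra_simps)
qed

text \<open>Both sides are continuous in \<open>b\<close> for the operator norm. For the left side
  this rests on a bound that does not see the degree of the approximating Wick polynomials.\<close>

lemma pair_op_closure:
  assumes p: "orth_pairs K f g nf ng" and b: "b \<in> closure (wick_polys s)"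
    and van: "\<And>k x. k \<in> K \<Longrightarrow> x \<le> s \<Longrightarrow> f k x = 0 \<and> g k x = 0"
  shows "pair_op K f g b = (\<Sum>k\<in>K. gauss (f k) o\<^sub>L b o\<^sub>L gauss (g k))"
proof -
  obtain bn where bn: "\<And>n. bn n \<in> wick_polys s" "bn \<longlonglongrightarrow> b" using b closure_sequential by blast
  have "b \<in> cops" using bn wick_polys_cops closed_cops closed_sequentially by metis
  define C where "C = pair_const * sqrt (\<Sum>k\<in>K. nf k * ng k)"
  have "(\<lambda>n. pair_op K f g (bn n) - pair_op K f g b) \<longlonglongrightarrow> 0"
  proof (rule Lim_null_comparison)
    show "\<forall>\<^sub>F n in sequentially. norm (pair_op K f g (bn n) - pair_op K f g b) \<le> C * norm (bn n - b)"
      unfolding C_def pair_op_linear(2)[symmetric] using \<open>b \<in> cops\<close> wick_polys_cops[OF bn(1)]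
      by (intro always_eventually allI norm_pair_op_le[OF p]) auto
    show "(\<lambda>n. C * norm (bn n - b)) \<longlonglongrightarrow> 0"
      using tendsto_mult_right_zero[OF tendsto_norm_zero[OF LIM_zero[OF bn(2)]]] .
  qed
  then have l: "(\<lambda>n. pair_op K f g (bn n)) \<longlonglongrightarrow> pair_op K f g b" by (rule LIM_zero_cancel)
  have r: "(\<lambda>n. \<Sum>k\<in>K. gauss (f k) o\<^sub>L bn n o\<^sub>L gauss (g k)) \<longlonglongrightarrow> (\<Sum>k\<in>K. gauss (f k) o\<^sub>L b o\<^sub>L gauss (g k))"
    by (intro tendsto_sum bounded_bilinear.tendsto[OF bounded_bilinear_blinfun_compose] tendsto_const bn)
  have eq: "(\<lambda>n. pair_op K f g (bn n)) = (\<lambda>n. \<Sum>k\<in>K. gauss (f k) o\<^sub>L bn n o\<^sub>L gauss (g k))"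
    by (rule ext) (rule pair_op_wick_polys[OF p bn(1) van])
  show ?thesis using l unfolding eq by (rule LIMSEQ_unique[OF _ r])
qed

subsection \<open>Vectors measurable with respect to the past\<close>

definition past_space :: "real \<Rightarrow> 'h set" where
  "past_space u = closure {vec xs | xs. set xs \<subseteq> UNIV \<times> lists (past u)}"

lemma past_spaceI: "set xs \<subseteq> UNIV \<times> lists (past u) \<Longrightarrow> vec xs \<in> past_space u"
  unfolding past_space_def by (intro subsetD[OF closure_subset]) blast

lemma past_space_add:
  assumes xy: "x \<in> past_space u" "y \<in> past_space u" shows "x + y \<in> past_space u"
proof -
  obtain sx sy where s: "\<And>n. sx n \<in> {vec xs | xs. set xs \<subseteq> UNIV \<times> lists (past u)}" "sx \<longlonglongrightarrow> x"
    "\<And>n. sy n \<in> {vec xs | xs. set xs \<subseteq> UNIV \<times> lists (past u)}" "sy \<longlonglongrightarrow> y"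
    using xy unfolding past_space_def closure_sequential by blast
  have "sx n + sy n \<in> {vec xs | xs. set xs \<subseteq> UNIV \<times> lists (past u)}" for n
  proof -
    obtain xs ys where "set xs \<subseteq> UNIV \<times> lists (past u)" "set ys \<subseteq> UNIV \<times> lists (past u)" "sx n = vec xs" "sy n = vec ys"
      using s(1)[of n] s(3)[of n] by blast
    then have "set (xs @ ys) \<subseteq> UNIV \<times> lists (past u)" "sx n + sy n = vec (xs @ ys)" by simp_all
    then show ?thesis by blast
  qed
  then show ?thesis unfolding past_space_def by (rule closure_sequenceI[OF _ tendsto_add[OF s(2,4)]])
qed

lemma past_space_scaleC:
  assumes x: "x \<in> past_space u" shows "c *\<^sub>C x \<in> past_space u"
proof -
  obtain sx where s: "\<And>n. sx n \<in> {vec xs | xs. set xs \<subseteq> UNIV \<times> lists (past u)}" "sx \<longlonglongrightarrow> x"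
    using x unfolding past_space_def closure_sequential by blast
  have "c *\<^sub>C sx n \<in> {vec xs | xs. set xs \<subseteq> UNIV \<times> lists (past u)}" for n
  proof -
    obtain xs where xs: "set xs \<subseteq> UNIV \<times> lists (past u)" "sx n = vec xs" using s(1)[of n] by blast
    have "set (map (\<lambda>(d, u). (c * d, u)) xs) \<subseteq> UNIV \<times> lists (past u)" using xs(1) by fastforce
    then show ?thesis unfolding xs(2) lin_scale(2)[symmetric] by blast
  qed
  then show ?thesis unfolding past_space_def by (rule closure_sequenceI[OF _ tendsto_scaleC[OF tendsto_const s(2)]])
qed

lemma past_space_invariant:
  assumes "\<And>w. w \<in> lists (past u) \<Longrightarrow> blinfun_apply T (tens w) \<in> past_space u" "T \<in> cops" "v \<in> past_space u"
  shows "blinfun_apply T v \<in> past_space u"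
proof -
  have cl: "closed (past_space u)" by (simp add: past_space_def)
  have vec: "blinfun_apply T (vec xs) \<in> past_space u" if "set xs \<subseteq> UNIV \<times> lists (past u)" for xs
    using that
  proof (induction xs)
    case Nil
    then show ?case using past_spaceI[of "[]" u] by (simp add: blinfun.bilinear_simps)
  next
    case (Cons a xs)
    obtain c w where a: "a = (c, w)" by (cases a)
    then have w: "w \<in> lists (past u)" "set xs \<subseteq> UNIV \<times> lists (past u)" using Cons.prems by simp_all
    have "blinfun_apply T (vec (a # xs)) = c *\<^sub>C blinfun_apply T (tens w) + blinfun_apply T (vec xs)"
      by (simp add: a blinfun.bilinear_simps copsD[OF assms(2)])
    then show ?case using past_space_add[OF past_space_scaleC[OF assms(1)[OF w(1)]] Cons.IH[OF w(2)]] by simp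
  qed
  obtain sv where s: "\<And>n. sv n \<in> {vec xs | xs. set xs \<subseteq> UNIV \<times> lists (past u)}" "sv \<longlonglongrightarrow> v"
    using assms(3) unfolding past_space_def closure_sequential by blast
  have mem: "blinfun_apply T (sv n) \<in> past_space u" for n
  proof -
    obtain xs where "set xs \<subseteq> UNIV \<times> lists (past u)" "sv n = vec xs" using s(1)[of n] by blast
    then show ?thesis using vec by simp
  qed
  have "(\<lambda>n. blinfun_apply T (sv n)) \<longlonglongrightarrow> blinfun_apply T v" by (intro tendsto_intros s)
  then have "blinfun_apply T v \<in> closure (past_space u)" by (rule closure_sequenceI[OF mem])
  then show ?thesis using cl by simp
qed

lemma past_space_an_past:
  assumes h: "h \<in> past u" and v: "v \<in> past_space u"
  shows "blinfun_apply (an h) v \<in> past_space u"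
proof (rule past_space_invariant[OF _ _ v])
  have h': "h \<in> L2_half_line" using h by (simp add: past_def)
  show "an h \<in> cops" using annihilation(1)[OF h'] .
  fix w assume w: "w \<in> lists (past u)"
  define xs where "xs = map (\<lambda>(c, g, w'). (complex_of_real c * L2_inner h g, w')) (split_letter q w)"
  have "blinfun_apply (an h) (tens w) = vec xs"
    by (simp add: annihilation_tens[OF h' past_words[OF w]] vec_def xs_def case_prod_unfold comp_def)
  moreover have "set xs \<subseteq> UNIV \<times> lists (past u)"
  proof
    fix y assume "y \<in> set xs"
    then obtain c g w' where y: "(c, g, w') \<in> set (split_letter q w)" "y = (complex_of_real c * L2_inner h g, w')"
      by (auto simp: xs_def)
    have "w' \<in> lists (past u)" using split_letter_mem[OF y(1)] w by (auto simp: in_lists_conv_set)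
    then show "y \<in> UNIV \<times> lists (past u)" using y(2) by simp
  qed
  ultimately show "blinfun_apply (an h) (tens w) \<in> past_space u" using past_spaceI by simp
qed

lemma past_space_cr_past:
  assumes h: "h \<in> past u" and v: "v \<in> past_space u"
  shows "blinfun_apply (cr h) v \<in> past_space u"
proof (rule past_space_invariant[OF _ _ v])
  have h': "h \<in> L2_half_line" using h by (simp add: past_def)
  show "cr h \<in> cops" using creation(1)[OF h'] .
  fix w assume w: "w \<in> lists (past u)"
  then show "blinfun_apply (cr h) (tens w) \<in> past_space u"
    using past_spaceI[of "[(1, h # w)]" u] h by (simp add: creation(2)[OF h' past_words[OF w]])
qed

lemma an_future_past_space:
  assumes g: "g \<in> L2_half_line" "\<And>x. x \<le> u \<Longrightarrow> g x = 0" and v: "v \<in> past_space u"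
  shows "blinfun_apply (an g) v = 0"
proof -
  have tens: "blinfun_apply (an g) (tens w) = 0" if w: "w \<in> lists (past u)" for w
    unfolding annihilation_tens[OF g(1) past_words[OF w]]
  proof (rule sum_list_eq_0I, clarify)
    fix c h w' assume "(c, h, w') \<in> set (split_letter q w)"
    then have "h \<in> past u" using split_letter_mem[of c h w' q w] w by (auto simp: in_lists_conv_set)
    then have "g x = 0 \<or> h x = 0" for x using g(2)[of x] by (cases "x \<le> u") (auto simp: past_def)
    then have "L2_inner g h = 0" by (rule L2_inner_disjoint)
    then show "(complex_of_real c * L2_inner g h) *\<^sub>C tens w' = 0" by simp
  qed
  have vec: "blinfun_apply (an g) (vec xs) = 0" if "set xs \<subseteq> UNIV \<times> lists (past u)" for xs
    unfolding vec_def blinfun_sum_list_right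
  proof (rule sum_list_eq_0I, clarify)
    fix c w assume "(c, w) \<in> set xs"
    then have "w \<in> lists (past u)" using that by blast
    then show "blinfun_apply (an g) (c *\<^sub>C tens w) = 0" by (simp add: copsD[OF annihilation(1)[OF g(1)]] tens del: in_lists_conv_set)
  qed
  obtain sv where s: "\<And>n. sv n \<in> {vec xs | xs. set xs \<subseteq> UNIV \<times> lists (past u)}" "sv \<longlonglongrightarrow> v"
    using v unfolding past_space_def closure_sequential by blast
  have "(\<lambda>n. blinfun_apply (an g) (sv n)) \<longlonglongrightarrow> blinfun_apply (an g) v" by (intro tendsto_intros s)
  moreover have "blinfun_apply (an g) (sv n) = 0" for n
  proof -
    obtain xs where "set xs \<subseteq> UNIV \<times> lists (past u)" "sv n = vec xs" using s(1)[of n] by blast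
    then show ?thesis using vec by simp
  qed
  ultimately show ?thesis by (simp add: LIMSEQ_const_iff)
qed

text \<open>Increments over disjoint intervals after time \<open>u\<close> have vanishing conditional covariance.\<close>

lemma cinner_gauss_pair:
  assumes f: "f \<in> L2_half_line" "\<And>x. x \<le> u \<Longrightarrow> f x = 0" and g: "g \<in> L2_half_line" "\<And>x. x \<le> u \<Longrightarrow> g x = 0"
    and fg: "L2_inner f g = 0" and b: "b \<in> closure (wick_polys u)"
    and v: "v \<in> past_space u" "v' \<in> past_space u"
  shows "cinner v' (blinfun_apply (gauss f o\<^sub>L b o\<^sub>L gauss g) v) = 0"
proof -
  \<comment> \<open>The term where both increments act across \<open>b\<close>. Commuting them
    through leaves \<open>an f\<close> acting on a vector of the past, which vanishes.\<close>
  have poly: "blinfun_apply (an f o\<^sub>L b o\<^sub>L cr g) v = 0" if b: "b \<in> wick_polys u" for b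
  proof -
    obtain xs where xs: "set xs \<subseteq> UNIV \<times> lists (past u)"
      "b = (\<Sum>(c, w)\<leftarrow>xs. op_scaleC c (wick 1 1 id_blinfun w))" using b unfolding wick_polys_def by blast
    have "an f o\<^sub>L b o\<^sub>L cr g = (\<Sum>(c, w)\<leftarrow>xs. op_scaleC c (an f o\<^sub>L wick 1 1 id_blinfun w o\<^sub>L cr g))"
      unfolding xs(2)
      by (simp add: blinfun_compose_sum_list case_prod_unfold op_scaleC_comp annihilation(1)[OF f(1)])
    then have "blinfun_apply (an f o\<^sub>L b o\<^sub>L cr g) v =
        (\<Sum>(c, w)\<leftarrow>xs. c *\<^sub>C blinfun_apply (an f o\<^sub>L wick 1 1 id_blinfun w o\<^sub>L cr g) v)"
      by (simp add: blinfun_sum_list_left case_prod_unfold op_scaleC_apply)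
    also have "\<dots> = 0"
    proof (rule sum_list_eq_0I, clarify)
      fix c w assume "(c, w) \<in> set xs"
      then have w: "w \<in> lists (past u)" using xs(1) by blast
      have orth: "L2_inner f h = 0 \<and> L2_inner (conj_fun h) g = 0" if "h \<in> set w" for h
      proof -
        have "h \<in> past u" using w that by auto
        then have "f x = 0 \<or> h x = 0" "conj_fun h x = 0 \<or> g x = 0" for x
          using f(2)[of x] g(2)[of x] by (cases "x \<le> u"; auto simp: past_def)+
        then show ?thesis by (auto intro!: L2_inner_disjoint)
      qed
      have "an f o\<^sub>L wick 1 1 id_blinfun w o\<^sub>L cr g = wick (q * 1) (q * 1) (an f o\<^sub>L id_blinfun o\<^sub>L cr g) w"
        by (rule wick_conjugate[OF f(1) g(1) past_words[OF w] orth])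
      also have "\<dots> = wick q q (q *\<^sub>R (cr g o\<^sub>L an f)) w"
        using q_commutation[OF f(1) g(1)] fg by (simp add: op_scaleC_simps)
      also have "blinfun_apply \<dots> v = 0"
      proof (rule wick_kills[where V="past_space u"])
        show "blinfun_apply (q *\<^sub>R (cr g o\<^sub>L an f)) x = 0" if "x \<in> past_space u" for x
          using an_future_past_space[OF f that] by (simp add: blinfun.bilinear_simps)
        show "blinfun_apply (an (conj_fun h)) x \<in> past_space u" if "h \<in> set w" "x \<in> past_space u" for h x
        proof -
          have h: "h \<in> past u" using w that(1) by auto
          moreover from h have "conj_fun h = h" by (simp add: past_def)
          ultimately show ?thesis using past_space_an_past that(2) by simp
        qed
      qed (rule v)
      finally show "c *\<^sub>C blinfun_apply (an f o\<^sub>L wick 1 1 id_blinfun w o\<^sub>L cr g) v = 0" by simp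
    qed
    finally show ?thesis .
  qed
  have zero: "blinfun_apply (an f o\<^sub>L b o\<^sub>L cr g) v = 0"
  proof -
    obtain bn where bn: "\<And>n. bn n \<in> wick_polys u" "bn \<longlonglongrightarrow> b" using b closure_sequential by blast
    have "(\<lambda>n. blinfun_apply (an f o\<^sub>L bn n o\<^sub>L cr g) v) \<longlonglongrightarrow> blinfun_apply (an f o\<^sub>L b o\<^sub>L cr g) v"
      by (intro tendsto_intros bounded_bilinear.tendsto[OF bounded_bilinear_blinfun_compose] bn)
    then show ?thesis using poly[OF bn(1)] by (simp add: LIMSEQ_const_iff)
  qed
  \<comment> \<open>The other three terms vanish because the annihilation part of either increment
    kills the vector of the past on its side of the inner product.\<close>
  have "cinner v' (blinfun_apply (gauss f o\<^sub>L b o\<^sub>L gauss g) v) = cinner v' (blinfun_apply (gauss f) (blinfun_apply b (blinfun_apply (cr g) v)))"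
    by (simp add: gauss_def[of g] blinfun.bilinear_simps an_future_past_space[OF g v(1)])
  also have "\<dots> = cinner (blinfun_apply (gauss f) v') (blinfun_apply b (blinfun_apply (cr g) v))"
    using adj_cinner'[OF gauss_cops[OF f(1)]] by (simp add: adj_gauss[OF f(1)])
  also have "\<dots> = cinner (blinfun_apply (cr f) v') (blinfun_apply b (blinfun_apply (cr g) v))"
    by (simp add: gauss_def[of f] blinfun.bilinear_simps an_future_past_space[OF f v(2)])
  also have "\<dots> = cinner v' (blinfun_apply (an f o\<^sub>L b o\<^sub>L cr g) v)"
    by (simp add: annihilation(4)[OF f(1)])
  finally show ?thesis unfolding zero by simp
qed

end

section \<open>Dyadic grids and trapezoidal approximations of the area\<close>

lemma sum_lessThan_double: "(\<Sum>i<2 * m. f i) = (\<Sum>i<m. f (2 * i) + f (Suc (2 * i)))" for f :: "nat \<Rightarrow> 'a::comm_monoid_add"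
  by (induction m) (simp_all add: add.assoc)

definition clamp_to :: "real \<Rightarrow> real \<Rightarrow> real \<Rightarrow> real" where
  "clamp_to s t x = max s (min t x)"

lemma clamp_to_bounds: "s \<le> t \<Longrightarrow> s \<le> clamp_to s t x \<and> clamp_to s t x \<le> t"
  by (simp add: clamp_to_def)

lemma clamp_to_mono: "x \<le> y \<Longrightarrow> clamp_to s t x \<le> clamp_to s t y"
  by (auto simp: clamp_to_def)

lemma clamp_to_diff: "x \<le> y \<Longrightarrow> clamp_to s t y - clamp_to s t x \<le> y - x"
  by (auto simp: clamp_to_def max_def min_def)

text \<open>Times are restricted to \<open>[0, 2 ^ L]\<close>, so that all dyadic grids start and end at the same points.\<close>

locale q_brownian_motion = q_fock +
  fixes L :: nat
begin

definition bm :: "real \<Rightarrow> 'a oper" where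
  "bm t = gauss (indicator {0..t})"

lemma q_brownian_eq: "q_brownian tens = bm"
  by (rule ext) (simp add: q_brownian_def bm_def gauss_def)

lemma L2_indicator: "indicator {0..t} \<in> L2_half_line" "indicator {a<..b} \<in> L2_half_line"
  by (rule L2_interval[where a=0 and b=t]; simp) (rule L2_interval[where a=a and b=b]; auto)

lemma bm_diff:
  assumes "0 \<le> a" "a \<le> b"
  shows "bm b - bm a = gauss (indicator {a<..b})"
proof -
  have "(indicator {0..b} :: real \<Rightarrow> complex) = (\<lambda>x. indicator {0..a} x + indicator {a<..b} x)"
    using assms by (auto simp: indicator_def)
  then have "cr (indicator {0..b}) = cr (indicator {0..a}) + cr (indicator {a<..b})"
    using creation_add[OF L2_indicator(1)[of a] L2_indicator(2)[of a b]] by simp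
  then show ?thesis
    by (simp add: bm_def gauss_def annihilation_def adj_simps creation L2_indicator)
qed

lemma bm_cops: "bm t \<in> cops"
  unfolding bm_def by (rule gauss_cops[OF L2_indicator(1)])

definition incr_const :: real where "incr_const = 2 / sqrt (1 - q)"

lemma incr_const_pos: "0 < incr_const"
  using q_less_1 by (simp add: incr_const_def)

lemma norm_bm_diff_le:
  assumes "0 \<le> a" "a \<le> b"
  shows "norm (bm b - bm a) \<le> incr_const * sqrt (b - a)"
proof -
  note n = norm_cr_sq[OF L2_indicator(2) L2_inner_interval[OF assms]]
  have "norm (cr (indicator {a<..b})) \<le> sqrt ((b - a) / (1 - q))" "norm (an (indicator {a<..b})) \<le> sqrt ((b - a) / (1 - q))"
    using n by (simp_all add: real_le_rsqrt)
  then have "norm (gauss (indicator {a<..b})) \<le> sqrt ((b - a) / (1 - q)) + sqrt ((b - a) / (1 - q))"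
    unfolding gauss_def by (intro norm_triangle_le) simp
  then show ?thesis unfolding bm_diff[OF assms] incr_const_def by (simp add: real_sqrt_divide)
qed

text \<open>Clamping to [s, t] lets all intervals share the index set of the dyadic grid of
  [0, 2^L]; cells outside [s, t] collapse to points and contribute nothing. Sums over adjacent
  intervals can then be compared cell by cell.\<close>

definition grid :: "real \<Rightarrow> real \<Rightarrow> nat \<Rightarrow> nat \<Rightarrow> real" where
  "grid s t n i = clamp_to s t (2 ^ L * real i / 2 ^ n)"

lemma grid_double: "grid s t (Suc n) (2 * i) = grid s t n i"
  by (simp add: grid_def field_simps)

lemma grid_mono: "i \<le> j \<Longrightarrow> grid s t n i \<le> grid s t n j"
  unfolding grid_def by (intro clamp_to_mono) (simp add: divide_right_mono)

lemma grid_bounds: "s \<le> t \<Longrightarrow> s \<le> grid s t n i" "s \<le> t \<Longrightarrow> grid s t n i \<le> t"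
  by (simp_all add: grid_def clamp_to_bounds)

lemma grid_step: "grid s t n (Suc i) - grid s t n i \<le> 2 ^ L / 2 ^ n"
proof -
  have "grid s t n (Suc i) - grid s t n i \<le> 2 ^ L * real (Suc i) / 2 ^ n - 2 ^ L * real i / 2 ^ n"
    unfolding grid_def by (rule clamp_to_diff) (simp add: divide_right_mono)
  also have "\<dots> = 2 ^ L / 2 ^ n" by (simp add: field_simps)
  finally show ?thesis .
qed

lemma grid_ends:
  assumes "0 \<le> s" "s \<le> t" "t \<le> 2 ^ L"
  shows "grid s t n 0 = s" "grid s t n (2 ^ n) = t"
  using assms by (simp_all add: grid_def clamp_to_def)

text \<open>The integral of (X - X s) b dX along the path that is linear between the grid points: on
  each cell the mean of the endpoint values times the increment.\<close>

definition trap :: "real \<Rightarrow> real \<Rightarrow> nat \<Rightarrow> 'a oper \<Rightarrow> 'a oper" where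
  "trap s t n b = (\<Sum>i<2 ^ n. ((1/2) *\<^sub>R (bm (grid s t n i) + bm (grid s t n (Suc i))) - bm s) o\<^sub>L b
      o\<^sub>L (bm (grid s t n (Suc i)) - bm (grid s t n i)))"

text \<open>Half-open intervals, so that the two halves of a cell and different cells are disjoint
  and their indicators orthogonal.\<close>

definition left_half :: "real \<Rightarrow> real \<Rightarrow> nat \<Rightarrow> nat \<Rightarrow> real \<Rightarrow> complex" where
  "left_half s t n i = indicator {grid s t n i<..grid s t (Suc n) (Suc (2 * i))}"

definition right_half :: "real \<Rightarrow> real \<Rightarrow> nat \<Rightarrow> nat \<Rightarrow> real \<Rightarrow> complex" where
  "right_half s t n i = indicator {grid s t (Suc n) (Suc (2 * i))<..grid s t n (Suc i)}"

lemma grid_mid: "grid s t n i \<le> grid s t (Suc n) (Suc (2 * i))" "grid s t (Suc n) (Suc (2 * i)) \<le> grid s t n (Suc i)"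
  using grid_mono[of "2 * i" "Suc (2 * i)" s t "Suc n"] grid_mono[of "Suc (2 * i)" "2 * Suc i" s t "Suc n"]
  unfolding grid_double by simp_all

text \<open>Inserting a point into a segment of the path changes the integral by the signed area of
  the triangle, which is antisymmetric in the two new increments.\<close>

lemma trapezoid_split:
  fixes X0 A B C b :: "'a oper"
  shows "(((1/2) *\<^sub>R (X0 + (X0 + A)) - C) o\<^sub>L b o\<^sub>L A) + (((1/2) *\<^sub>R ((X0 + A) + (X0 + A + B)) - C) o\<^sub>L b o\<^sub>L B)
    - (((1/2) *\<^sub>R (X0 + (X0 + A + B)) - C) o\<^sub>L b o\<^sub>L (A + B)) = (1/2) *\<^sub>R ((A o\<^sub>L b o\<^sub>L B) - (B o\<^sub>L b o\<^sub>L A))"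
proof -
  have half: "(1/2) *\<^sub>R (Z + (Z + Y)) = Z + (1/2) *\<^sub>R Y" for Z Y :: "'a oper"
    by (simp add: scaleR_add_right flip: scaleR_add_left)
  have 1: "(1/2) *\<^sub>R (X0 + (X0 + A)) = X0 + (1/2) *\<^sub>R A" "(1/2) *\<^sub>R ((X0 + A) + (X0 + A + B)) = X0 + A + (1/2) *\<^sub>R B"
    "(1/2) *\<^sub>R (X0 + (X0 + A + B)) = X0 + ((1/2) *\<^sub>R A + (1/2) *\<^sub>R B)"
    using half[of X0 A] half[of "X0 + A" B] half[of X0 "A + B"] by (simp_all add: add.assoc scaleR_add_right)
  have 2: "Z = (1/2) *\<^sub>R Z + (1/2) *\<^sub>R Z" for Z :: "'a oper" by (simp flip: scaleR_add_left)
  show ?thesis unfolding 1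
    using 2[of "A o\<^sub>L b o\<^sub>L B"]
    by (simp add: blinfun_compose_simps algebra_simps)
qed

lemma trap_Suc:
  assumes st: "0 \<le> s" "s \<le> t"
  shows "trap s t (Suc n) b - trap s t n b = (1/2) *\<^sub>R
    ((\<Sum>i<2 ^ n. gauss (left_half s t n i) o\<^sub>L b o\<^sub>L gauss (right_half s t n i)) -
     (\<Sum>i<2 ^ n. gauss (right_half s t n i) o\<^sub>L b o\<^sub>L gauss (left_half s t n i)))"
proof -
  let ?f = "\<lambda>i. ((1/2) *\<^sub>R (bm (grid s t (Suc n) i) + bm (grid s t (Suc n) (Suc i))) - bm s) o\<^sub>L b
      o\<^sub>L (bm (grid s t (Suc n) (Suc i)) - bm (grid s t (Suc n) i))"
  have "trap s t (Suc n) b = (\<Sum>i<2 ^ n. ?f (2 * i) + ?f (Suc (2 * i)))"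
    unfolding trap_def power_Suc by (rule sum_lessThan_double)
  then have "trap s t (Suc n) b - trap s t n b = (\<Sum>i<2 ^ n. (?f (2 * i) + ?f (Suc (2 * i))) -
      (((1/2) *\<^sub>R (bm (grid s t n i) + bm (grid s t n (Suc i))) - bm s) o\<^sub>L b
      o\<^sub>L (bm (grid s t n (Suc i)) - bm (grid s t n i))))"
    unfolding trap_def sum_subtractf by (rule arg_cong)
  also have "\<dots> = (\<Sum>i<2 ^ n. (1/2) *\<^sub>R ((gauss (left_half s t n i) o\<^sub>L b o\<^sub>L gauss (right_half s t n i)) -
      (gauss (right_half s t n i) o\<^sub>L b o\<^sub>L gauss (left_half s t n i))))"
  proof (rule sum.cong[OF refl])
    fix i
    define A where "A = bm (grid s t (Suc n) (Suc (2 * i))) - bm (grid s t n i)"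
    define B where "B = bm (grid s t n (Suc i)) - bm (grid s t (Suc n) (Suc (2 * i)))"
    have AB: "gauss (left_half s t n i) = A" "gauss (right_half s t n i) = B"
      unfolding A_def B_def left_half_def right_half_def
      using st grid_mid grid_bounds[OF st(2)] by (intro bm_diff[symmetric]; meson order_trans)+
    have dd: "grid s t (Suc n) (2 * i) = grid s t n i" "grid s t (Suc n) (Suc (Suc (2 * i))) = grid s t n (Suc i)"
      using grid_double[of s t n i] grid_double[of s t n "Suc i"] by simp_all
    have m: "bm (grid s t (Suc n) (Suc (2 * i))) = bm (grid s t n i) + A"
      "bm (grid s t n (Suc i)) = bm (grid s t n i) + A + B" by (simp_all add: A_def B_def)
    show "(?f (2 * i) + ?f (Suc (2 * i))) - (((1/2) *\<^sub>R (bm (grid s t n i) + bm (grid s t n (Suc i))) - bm s) o\<^sub>L b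
      o\<^sub>L (bm (grid s t n (Suc i)) - bm (grid s t n i))) = (1/2) *\<^sub>R ((gauss (left_half s t n i) o\<^sub>L b o\<^sub>L gauss (right_half s t n i)) -
      (gauss (right_half s t n i) o\<^sub>L b o\<^sub>L gauss (left_half s t n i)))"
      unfolding dd m AB using trapezoid_split[of "bm (grid s t n i)" A "bm s" b B] by simp
  qed
  finally show ?thesis by (simp add: sum_subtractf flip: scaleR_sum_right)
qed

definition len_left where "len_left s t n i = grid s t (Suc n) (Suc (2 * i)) - grid s t n i"
definition len_right where "len_right s t n i = grid s t n (Suc i) - grid s t (Suc n) (Suc (2 * i))"

lemma orth_halves:
  assumes st: "0 \<le> s" "s \<le> t"
  shows "orth_pairs {..<2 ^ n} (left_half s t n) (right_half s t n) (len_left s t n) (len_right s t n)"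
proof -
  have ge: "0 \<le> grid s t m i" for m i using grid_bounds(1)[OF st(2), of m i] st(1) by linarith
  have dis: "left_half s t n i x = 0 \<or> right_half s t n i x = 0" for i x
    by (auto simp: left_half_def right_half_def indicator_def)
  have blocks: "grid s t n (Suc i) \<le> grid s t n j" if "i < j" for i j using that by (intro grid_mono) simp
  have in_block: "grid s t n i < x \<and> x \<le> grid s t n (Suc i)" if "left_half s t n i x \<noteq> 0 \<or> right_half s t n i x \<noteq> 0" for i x
    using that grid_mid[where s=s and t=t and n=n and i=i] by (auto simp: left_half_def right_half_def indicator_def split: if_splits)
  have excl: "\<not> (left_half s t n i x \<noteq> 0 \<or> right_half s t n i x \<noteq> 0) \<or> \<not> (left_half s t n j x \<noteq> 0 \<or> right_half s t n j x \<noteq> 0)"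
    if "i \<noteq> j" for i j x
    using in_block[of i x] in_block[of j x] blocks[of i j] blocks[of j i] that by (cases "i < j") fastforce+
  show ?thesis
    unfolding orth_pairs_def
  proof (intro conjI ballI)
    fix i j assume "i \<in> {..<2 ^ n :: nat}" "j \<in> {..<2 ^ n :: nat}"
    show "L2_inner (left_half s t n i) (left_half s t n j) = (if i = j then complex_of_real (len_left s t n i) else 0)"
      using L2_inner_interval[OF ge grid_mid(1)] excl[of i j]
      by (auto simp: left_half_def[symmetric] len_left_def intro!: L2_inner_disjoint)
    show "L2_inner (right_half s t n i) (right_half s t n j) = (if i = j then complex_of_real (len_right s t n i) else 0)"
      using L2_inner_interval[OF ge grid_mid(2)] excl[of i j]
      by (auto simp: right_half_def[symmetric] len_right_def intro!: L2_inner_disjoint)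
  next
    fix k
    show "left_half s t n k \<in> L2_half_line" "right_half s t n k \<in> L2_half_line"
      by (simp_all add: left_half_def right_half_def L2_indicator)
    show "L2_inner (left_half s t n k) (right_half s t n k) = 0" by (rule L2_inner_disjoint) (rule dis)
  qed simp
qed

lemma halves_vanish:
  assumes "s \<le> t" "x \<le> s" shows "left_half s t n i x = 0 \<and> right_half s t n i x = 0"
  using assms grid_bounds(1)[OF assms(1), of n i] grid_bounds(1)[OF assms(1), of "Suc n" "Suc (2 * i)"]
  by (auto simp: left_half_def right_half_def indicator_def)

section \<open>Summation over the dyadic levels\<close>

definition decay :: real where "decay = (1/2) powr (1/4)"

lemma decay: "0 < decay" "decay < 1"
proof -
  show "0 < decay" by (simp add: decay_def)
  have "(1/2) powr (1/4) < (1::real) powr (1/4)" by (intro powr_less_mono2) auto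
  then show "decay < 1" by (simp add: decay_def)
qed

text \<open>With d = t - s and the mesh h, a left half is shorter than both d and h, hence than sqrt
  (d h), and the right halves add up to at most d. The square root of sqrt (d h) d is d^(3/4)
  h^(1/4), and each halving of h gains the factor \<open>decay\<close>.\<close>

lemma sum_len_le:
  assumes st: "0 \<le> s" "s \<le> t" "t \<le> 2 ^ L"
  shows "sqrt (\<Sum>i<2 ^ n. len_left s t n i * len_right s t n i) \<le> (t - s) powr (3/4) * ((2 ^ L) powr (1/4) * decay ^ n)"
proof -
  define d h where "d = t - s" and "h = (2::real) ^ L / 2 ^ n"
  have d: "0 \<le> d" and h: "0 < h" using st by (simp_all add: d_def h_def)
  have ll: "0 \<le> len_left s t n i" "0 \<le> len_right s t n i" for i
    using grid_mid by (simp_all add: len_left_def len_right_def)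
  have lsq: "len_left s t n i \<le> sqrt (d * h)" for i
  proof -
    have "len_left s t n i \<le> h"
      using grid_step[of s t n i] grid_mid(2)[of s t n i] unfolding len_left_def h_def by linarith
    moreover have "len_left s t n i \<le> d"
      using grid_bounds(2)[OF st(2), of "Suc n" "Suc (2 * i)"] grid_bounds(1)[OF st(2), of n i] unfolding len_left_def d_def by linarith
    ultimately have "len_left s t n i * len_left s t n i \<le> d * h" using ll d by (intro mult_mono) auto
    then show ?thesis by (intro real_le_rsqrt) (simp add: power2_eq_square)
  qed
  have "(\<Sum>i<2 ^ n. len_left s t n i * len_right s t n i) \<le> (\<Sum>i<2 ^ n. sqrt (d * h) * (grid s t n (Suc i) - grid s t n i))"
  proof (rule sum_mono, rule mult_mono)
    show "len_right s t n i \<le> grid s t n (Suc i) - grid s t n i" for i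
      using grid_mid(1)[of s t n i] by (simp add: len_right_def)
  qed (use lsq ll d h in auto)
  also have "\<dots> = sqrt (d * h) * (grid s t n (2 ^ n) - grid s t n 0)"
    unfolding sum_distrib_left[symmetric] by (simp only: sum_lessThan_telescope)
  also have "\<dots> = sqrt (d * h) * d" by (simp add: grid_ends[OF st] d_def)
  finally have "sqrt (\<Sum>i<2 ^ n. len_left s t n i * len_right s t n i) \<le> sqrt (sqrt (d * h) * d)"
    by (rule real_sqrt_le_mono)
  also have "\<dots> = d powr (3/4) * ((2 ^ L) powr (1/4) * decay ^ n)"
  proof (cases "d = 0")
    case False
    then have d: "0 < d" using d by simp
    have rp: "x ^ n = x powr real n" if "0 < x" for x :: real using that by (simp add: powr_realpow)
    have "decay ^ n = (1/2) powr (1/4 * real n)"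
      unfolding rp[OF decay(1)] unfolding decay_def by (rule powr_powr)
    also have "\<dots> = (1/2) powr (real n * (1/4))" by (simp only: mult.commute)
    also have "\<dots> = ((1/2) ^ n) powr (1/4)"
    proof -
      have "((1/2::real) ^ n) = (1/2) powr real n" by (rule rp) simp
      then show ?thesis by (simp only: powr_powr)
    qed
    finally have "(2 ^ L) powr (1/4) * decay ^ n = (2 ^ L * (1/2) ^ n) powr (1/4)"
      by (simp only: powr_mult zero_le_power zero_le_numeral zero_le_divide_1_iff)
    moreover have "2 ^ L * (1/2) ^ n = h" by (simp add: h_def power_one_over)
    ultimately have "(2 ^ L) powr (1/4) * decay ^ n = h powr (1/4)" by simp
    moreover have "sqrt (sqrt (d * h) * d) = d powr (3/4) * h powr (1/4)"
    proof (rule real_sqrt_unique)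
      have sq: "(x powr a)\<^sup>2 = x powr (a + a)" for x a :: real by (simp only: power2_eq_square powr_add)
      have "(d powr (3/4) * h powr (1/4))\<^sup>2 = d powr (3/4 + 3/4) * h powr (1/4 + 1/4)"
        by (simp only: power_mult_distrib sq)
      also have "\<dots> = d powr (1 + 1/2) * h powr (1/2)" by simp
      also have "\<dots> = d powr 1 * d powr (1/2) * h powr (1/2)" by (simp only: powr_add)
      also have "\<dots> = sqrt (d * h) * d" using d h by (simp add: powr_half_sqrt real_sqrt_mult)
      finally show "(d powr (3/4) * h powr (1/4))\<^sup>2 = sqrt (d * h) * d" .
    qed simp
    ultimately show ?thesis by simp
  qed simp
  finally show ?thesis by (simp add: d_def)
qed

definition levy_term :: "real \<Rightarrow> real \<Rightarrow> nat \<Rightarrow> 'a oper \<Rightarrow> 'a oper" where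
  "levy_term s t n b = (1/2) *\<^sub>R (pair_op {..<2 ^ n} (left_half s t n) (right_half s t n) b -
     pair_op {..<2 ^ n} (right_half s t n) (left_half s t n) b)"

lemma norm_levy_term_le:
  assumes st: "0 \<le> s" "s \<le> t" "t \<le> 2 ^ L" and b: "b \<in> cops"
  shows "norm (levy_term s t n b) \<le> (pair_const * (2 ^ L) powr (1/4) * (t - s) powr (3/4) * norm b) * decay ^ n"
proof -
  let ?S = "sqrt (\<Sum>i<2 ^ n. len_left s t n i * len_right s t n i)"
  have comm: "(\<Sum>i<2 ^ n. len_right s t n i * len_left s t n i) = (\<Sum>i<2 ^ n. len_left s t n i * len_right s t n i)"
    by (simp add: mult.commute)
  have 1: "norm (pair_op {..<2 ^ n} (left_half s t n) (right_half s t n) b) \<le> pair_const * ?S * norm b"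
    by (rule norm_pair_op_le[OF orth_halves[OF st(1,2)] b])
  have 2: "norm (pair_op {..<2 ^ n} (right_half s t n) (left_half s t n) b) \<le> pair_const * ?S * norm b"
    using norm_pair_op_le[OF orth_pairs_sym[OF orth_halves[OF st(1,2), of n]] b] unfolding comm .
  have "norm (levy_term s t n b) = (1/2) * norm (pair_op {..<2 ^ n} (left_half s t n) (right_half s t n) b -
     pair_op {..<2 ^ n} (right_half s t n) (left_half s t n) b)" by (simp add: levy_term_def)
  also have "\<dots> \<le> (1/2) * (pair_const * ?S * norm b + pair_const * ?S * norm b)"
    by (intro mult_left_mono order_trans[OF norm_triangle_ineq4] add_mono 1 2) simp
  also have "\<dots> = pair_const * norm b * ?S" by simp
  also have "\<dots> \<le> pair_const * norm b * ((t - s) powr (3/4) * ((2 ^ L) powr (1/4) * decay ^ n))"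
    by (intro mult_left_mono sum_len_le st mult_nonneg_nonneg pair_const_nonneg) simp
  finally show ?thesis by (simp only: mult_ac)
qed

text \<open>The limit of \<open>trap s t n b\<close>, with the increment of step \<open>n\<close> written as \<open>levy_term\<close>, which is defined
  for every bounded \<open>b\<close>.\<close>

definition levy :: "real \<Rightarrow> real \<Rightarrow> 'a oper \<Rightarrow> 'a oper" where
  "levy s t b = (1/2) *\<^sub>R ((bm t - bm s) o\<^sub>L b o\<^sub>L (bm t - bm s)) + (\<Sum>n. levy_term s t n b)"

lemma summable_levy_term:
  assumes "0 \<le> s" "s \<le> t" "t \<le> 2 ^ L" "b \<in> cops"
  shows "summable (\<lambda>n. levy_term s t n b)"
proof (rule summable_comparison_test')
  show "summable (\<lambda>n. (pair_const * (2 ^ L) powr (1/4) * (t - s) powr (3/4) * norm b) * decay ^ n)"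
    by (intro summable_mult summable_geometric) (use decay in auto)
  show "norm (levy_term s t n b) \<le> (pair_const * (2 ^ L) powr (1/4) * (t - s) powr (3/4) * norm b) * decay ^ n" for n
    by (rule norm_levy_term_le[OF assms])
qed

definition levy_const :: real where
  "levy_const = pair_const * (2 ^ L) powr (1/4) / (1 - decay)"

lemma levy_const_nonneg: "0 \<le> levy_const"
  unfolding levy_const_def using decay pair_const_nonneg by simp

lemma norm_levy_diff_le:
  assumes st: "0 \<le> s" "s \<le> t" "t \<le> 2 ^ L" and b: "b \<in> cops"
  shows "norm (levy s t b - (1/2) *\<^sub>R ((bm t - bm s) o\<^sub>L b o\<^sub>L (bm t - bm s))) \<le> levy_const * (t - s) powr (3/4) * norm b"
proof -
  let ?C = "pair_const * (2 ^ L) powr (1/4) * (t - s) powr (3/4) * norm b"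
  have "norm (\<Sum>n. levy_term s t n b) \<le> (\<Sum>n. ?C * decay ^ n)"
    by (intro norm_suminf_le norm_levy_term_le[OF assms] summable_mult summable_geometric) (use decay in auto)
  also have "\<dots> = ?C * (1 / (1 - decay))"
    using decay by (simp add: suminf_mult suminf_geometric summable_geometric)
  finally show ?thesis by (simp add: levy_def levy_const_def mult_ac)
qed

definition levy_const' :: real where
  "levy_const' = levy_const + incr_const\<^sup>2 * (2 ^ L) powr (1/4)"

lemma levy_const'_nonneg: "0 \<le> levy_const'"
  unfolding levy_const'_def using levy_const_nonneg by simp

lemma norm_levy_le:
  assumes st: "0 \<le> s" "s \<le> t" "t \<le> 2 ^ L" and b: "b \<in> cops"
  shows "norm (levy s t b) \<le> levy_const' * (t - s) powr (3/4) * norm b"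
proof -
  let ?D = "(1/2) *\<^sub>R ((bm t - bm s) o\<^sub>L b o\<^sub>L (bm t - bm s))"
  \<comment> \<open>The symmetric part of the area is of order t - s; it is brought to the common
    exponent 3/4 at the price of a constant depending on the time horizon
    \<open>2 ^ L\<close>.\<close>
  have "t - s = (t - s) powr (1/4) * (t - s) powr (3/4)"
    using st(2) by (cases "t = s") (simp_all add: powr_add[symmetric])
  also have "\<dots> \<le> (2 ^ L) powr (1/4) * (t - s) powr (3/4)"
    using st by (intro mult_right_mono powr_mono2) auto
  finally have ts: "t - s \<le> (2 ^ L) powr (1/4) * (t - s) powr (3/4)" .
  have "norm ?D \<le> norm ((bm t - bm s) o\<^sub>L b o\<^sub>L (bm t - bm s))" by simp
  also have "\<dots> \<le> norm (bm t - bm s) * norm b * norm (bm t - bm s)"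
    by (intro order_trans[OF norm_blinfun_compose] mult_right_mono norm_blinfun_compose) simp
  also have "\<dots> \<le> (incr_const * sqrt (t - s)) * norm b * (incr_const * sqrt (t - s))"
    using incr_const_pos st by (intro mult_mono norm_bm_diff_le) auto
  also have "\<dots> = incr_const\<^sup>2 * norm b * (sqrt (t - s) * sqrt (t - s))" by (simp only: power2_eq_square mult_ac)
  also have "\<dots> = incr_const\<^sup>2 * norm b * (t - s)" using st by simp
  also have "\<dots> \<le> incr_const\<^sup>2 * norm b * ((2 ^ L) powr (1/4) * (t - s) powr (3/4))"
    by (intro mult_left_mono ts) simp
  finally have "norm ?D \<le> incr_const\<^sup>2 * (2 ^ L) powr (1/4) * (t - s) powr (3/4) * norm b" by (simp only: mult_ac)
  moreover have "norm (levy s t b) \<le> norm (levy s t b - ?D) + norm ?D"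
    using norm_triangle_ineq[of "levy s t b - ?D" ?D] by simp
  ultimately show ?thesis using norm_levy_diff_le[OF assms] by (simp add: levy_const'_def algebra_simps)
qed

lemma levy_linear:
  assumes st: "0 \<le> s" "s \<le> t" "t \<le> 2 ^ L" and b: "b \<in> cops" "b' \<in> cops"
  shows "levy s t (b + op_scaleC c b') = levy s t b + op_scaleC c (levy s t b')"
proof -
  have trm: "levy_term s t n (b + op_scaleC c b') = levy_term s t n b + op_scaleC c (levy_term s t n b')" for n
    unfolding levy_term_def
    by (simp add: pair_op_linear pair_op_scaleC[OF orth_halves[OF st(1,2)]] op_scaleC_simps
      pair_op_scaleC[OF orth_pairs_sym[OF orth_halves[OF st(1,2)]]] algebra_simps)
  have "(\<Sum>n. levy_term s t n (b + op_scaleC c b')) = (\<Sum>n. levy_term s t n b) + (\<Sum>n. op_scaleC c (levy_term s t n b'))"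
    unfolding trm
    by (intro suminf_add[symmetric] summable_levy_term st b bounded_linear.summable[OF bounded_linear_op_scaleC])
  also have "(\<Sum>n. op_scaleC c (levy_term s t n b')) = op_scaleC c (\<Sum>n. levy_term s t n b')"
    by (rule bounded_linear.suminf[OF bounded_linear_op_scaleC, symmetric]) (intro summable_levy_term st b)
  moreover have "bm t - bm s \<in> cops" using bm_cops by auto
  ultimately show ?thesis unfolding levy_def
    by (simp add: blinfun_compose_simps op_scaleC_comp op_scaleC_simps algebra_simps bm_cops)
qed

lemma levy_cops:
  assumes st: "0 \<le> s" "s \<le> t" "t \<le> 2 ^ L" and b: "b \<in> cops"
  shows "levy s t b \<in> cops"
proof -
  have lt: "levy_term s t n b \<in> cops" for n
    unfolding levy_term_def
    by (intro cops_intros(4,6) pair_op_cops[OF orth_halves[OF st(1,2)]] pair_op_cops[OF orth_pairs_sym[OF orth_halves[OF st(1,2)]]] b)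
  have "(\<Sum>m<n. levy_term s t m b) \<in> cops" for n by (intro cops_sum lt)
  then have "(\<Sum>n. levy_term s t n b) \<in> closure cops"
    by (rule closure_sequenceI) (rule summable_LIMSEQ[OF summable_levy_term[OF assms]])
  then have "(\<Sum>n. levy_term s t n b) \<in> cops" unfolding closure_closed[OF closed_cops] .
  then show ?thesis unfolding levy_def by (intro cops_intros(3,4,6,8) bm_cops b)
qed

lemma closure_wick_polys_cops:
  assumes "b \<in> closure (wick_polys s)" shows "b \<in> cops"
  using closure_minimal[of "wick_polys s" cops, OF subsetI[OF wick_polys_cops] closed_cops] assms by (rule subsetD)

text \<open>Telescoping over the levels; at level 0 there is a single cell, and its trapezoid is the
  symmetric part of the area.\<close>

lemma trap_tendsto_levy:
  assumes st: "0 \<le> s" "s \<le> t" "t \<le> 2 ^ L" and b: "b \<in> closure (wick_polys s)"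
  shows "(\<lambda>n. trap s t n b) \<longlonglongrightarrow> levy s t b"
proof -
  have "b \<in> cops" by (rule closure_wick_polys_cops[OF b])
  have "trap s t (Suc n) b - trap s t n b = levy_term s t n b" for n
    unfolding trap_Suc[OF st(1,2)] levy_term_def
    using pair_op_closure[OF orth_halves[OF st(1,2)] b halves_vanish[OF st(2)]]
      pair_op_closure[OF orth_pairs_sym[OF orth_halves[OF st(1,2)]] b] halves_vanish[OF st(2)] by simp
  then have step: "trap s t (Suc n) b = trap s t n b + levy_term s t n b" for n by (simp add: algebra_simps)
  have "trap s t 0 b = (1/2) *\<^sub>R ((bm t - bm s) o\<^sub>L b o\<^sub>L (bm t - bm s))"
  proof -
    have "(1/2) *\<^sub>R (bm s + bm t) - bm s = (1/2) *\<^sub>R (bm t - bm s)"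
    proof -
      have "bm s = (1/2) *\<^sub>R bm s + (1/2) *\<^sub>R bm s" by (simp flip: scaleR_add_left)
      then show ?thesis by (simp add: scaleR_add_right scaleR_diff_right algebra_simps)
    qed
    then show ?thesis using grid_ends[OF st, of 0] by (simp add: trap_def blinfun_compose_simps(5))
  qed
  then have "trap s t n b = (1/2) *\<^sub>R ((bm t - bm s) o\<^sub>L b o\<^sub>L (bm t - bm s)) + (\<Sum>m<n. levy_term s t m b)" for n
    by (induction n) (simp_all add: step add.assoc)
  then show ?thesis unfolding levy_def
    using tendsto_add[OF tendsto_const summable_LIMSEQ[OF summable_levy_term[OF st \<open>b \<in> cops\<close>]]] by simp
qed

text \<open>Each level consists of products \<delta>X' b \<delta>X'' over disjoint intervals after
  time \<open>s\<close>, and a bounded functional may be applied to the series term by term.\<close>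

lemma levy_orthogonal:
  assumes st: "0 \<le> s" "s \<le> t" "t \<le> 2 ^ L" and b: "b \<in> closure (wick_polys s)"
    and v: "v \<in> past_space s" "v' \<in> past_space s"
  shows "cinner v' (blinfun_apply (levy s t b - (1/2) *\<^sub>R ((bm t - bm s) o\<^sub>L b o\<^sub>L (bm t - bm s))) v) = 0"
proof -
  have "b \<in> cops" by (rule closure_wick_polys_cops[OF b])
  have trm: "cinner v' (blinfun_apply (levy_term s t n b) v) = 0" for n
  proof -
    have pe: "pair_op {..<2 ^ n} (left_half s t n) (right_half s t n) b =
        (\<Sum>i<2 ^ n. gauss (left_half s t n i) o\<^sub>L b o\<^sub>L gauss (right_half s t n i))"
      "pair_op {..<2 ^ n} (right_half s t n) (left_half s t n) b =
        (\<Sum>i<2 ^ n. gauss (right_half s t n i) o\<^sub>L b o\<^sub>L gauss (left_half s t n i))"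
      using pair_op_closure[OF orth_halves[OF st(1,2)] b halves_vanish[OF st(2)]]
      pair_op_closure[OF orth_pairs_sym[OF orth_halves[OF st(1,2)]] b] halves_vanish[OF st(2)] by simp_all
    note o = orth_pairsD[OF orth_halves[OF st(1,2), of n]] orth_pairsD(4)[OF orth_pairs_sym[OF orth_halves[OF st(1,2), of n]]]
    have "cinner v' (blinfun_apply (gauss (left_half s t n i) o\<^sub>L b o\<^sub>L gauss (right_half s t n i)) v) = 0"
      "cinner v' (blinfun_apply (gauss (right_half s t n i) o\<^sub>L b o\<^sub>L gauss (left_half s t n i)) v) = 0" if "i < 2 ^ n" for i
      using that halves_vanish[OF st(2)] by (intro cinner_gauss_pair[OF _ _ _ _ _ b v] o; simp)+
    then show ?thesis
      unfolding levy_term_def pe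
      by (simp add: blinfun.bilinear_simps blinfun.sum_left cinner_scaleR cinner_diff cinner_sum_right)
  qed
  have "(\<lambda>n. cinner v' (blinfun_apply (levy_term s t n b) v)) sums
      cinner v' (blinfun_apply (\<Sum>n. levy_term s t n b) v)"
    by (intro bounded_linear.sums[OF bounded_bilinear.bounded_linear_right[OF bounded_bilinear_cinner]]
      bounded_linear.sums[OF blinfun.bounded_linear_left] summable_sums summable_levy_term st \<open>b \<in> cops\<close>)
  then have "cinner v' (blinfun_apply (\<Sum>n. levy_term s t n b) v) = 0"
    unfolding trm using sums_unique2[OF sums_zero] by metis
  then show ?thesis by (simp add: levy_def)
qed

end

lemma card_le_1I: "(\<And>i j. i \<in> I \<Longrightarrow> j \<in> I \<Longrightarrow> i = j) \<Longrightarrow> card I \<le> 1"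
  by (cases "finite I") (auto simp: card_le_Suc0_iff_eq)

text \<open>Meant for comparisons of sums over a grid in which only the cells at an endpoint or at
  an inserted point differ.\<close>

lemma norm_sum_sparse_le:
  fixes f :: "'i \<Rightarrow> 'b::real_normed_vector"
  assumes "finite A" "I \<subseteq> A" "card I \<le> k" "0 \<le> K"
    and "\<And>i. i \<in> A \<Longrightarrow> i \<notin> I \<Longrightarrow> f i = 0" "\<And>i. i \<in> I \<Longrightarrow> norm (f i) \<le> K"
  shows "norm (\<Sum>i\<in>A. f i) \<le> real k * K"
proof -
  have "(\<Sum>i\<in>A. f i) = (\<Sum>i\<in>I. f i)" using assms by (intro sum.mono_neutral_right) auto
  then have "norm (\<Sum>i\<in>A. f i) \<le> (\<Sum>i\<in>I. norm (f i))" by (simp add: norm_sum)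
  also have "\<dots> \<le> real (card I) * K" using assms(6) by (rule sum_bounded_above)
  also have "\<dots> \<le> real k * K" using assms by (intro mult_right_mono) auto
  finally show ?thesis .
qed

lemma norm_sandwich_le: "norm (A o\<^sub>L b o\<^sub>L B) \<le> norm A * norm b * norm B"
  by (rule order_trans[OF norm_blinfun_compose]) (intro mult_right_mono norm_blinfun_compose norm_ge_zero)

context q_brownian_motion
begin

subsection \<open>Chen's relation\<close>

lemma wick_polys_mono: "s \<le> t \<Longrightarrow> wick_polys s \<subseteq> wick_polys t"
proof -
  assume "s \<le> t"
  then have "lists (past s) \<subseteq> lists (past t)" by (intro lists_mono) (auto simp: past_def)
  then show ?thesis unfolding wick_polys_def by blast
qed

definition trapezoid :: "(real \<Rightarrow> 'a oper) \<Rightarrow> 'a oper \<Rightarrow> real \<Rightarrow> real \<Rightarrow> real \<Rightarrow> 'a oper" where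
  "trapezoid X b c x y = ((1/2) *\<^sub>R (X x + X y) - X c) o\<^sub>L b o\<^sub>L (X y - X x)"

lemma trapezoid_self [simp]: "trapezoid X b c x x = 0"
  by (simp add: trapezoid_def blinfun_compose_simps)

text \<open>Minima and maxima with \<open>w\<close> treat the cells before, after and around
  \<open>w\<close> by one formula. Before and after, one of \<open>A\<close>, \<open>B\<close>
  vanishes; the mixed product accounts for the change of base point from \<open>s\<close> to
  \<open>w\<close>.\<close>

lemma trapezoid_insert:
  fixes X :: "real \<Rightarrow> 'a oper" and x0 x1 w s :: real
  assumes "x0 \<le> x1"
  defines "A \<equiv> X (min w x1) - X (min w x0)" and "B \<equiv> X (max w x1) - X (max w x0)"
  shows "trapezoid X b s (min w x0) (min w x1) + trapezoid X b w (max w x0) (max w x1) + ((X w - X s) o\<^sub>L b o\<^sub>L B)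
    - trapezoid X b s x0 x1 = (1/2) *\<^sub>R ((A o\<^sub>L b o\<^sub>L B) - (B o\<^sub>L b o\<^sub>L A))"
proof -
  have base: "trapezoid X b w x y + ((X w - X s) o\<^sub>L b o\<^sub>L (X y - X x)) = trapezoid X b s x y" for x y
    unfolding trapezoid_def by (simp add: blinfun_compose_simps algebra_simps)
  consider "x1 \<le> w" | "w \<le> x0" | "x0 < w" "w < x1" by linarith
  then show ?thesis
  proof cases
    case 1
    then have "min w x0 = x0" "min w x1 = x1" "max w x0 = w" "max w x1 = w" using assms(1) by auto
    then show ?thesis by (simp add: A_def B_def blinfun_compose_simps)
  next
    case 2
    then have "min w x0 = w" "min w x1 = w" "max w x0 = x0" "max w x1 = x1" using assms(1) by auto
    then show ?thesis using base[of x0 x1] by (simp add: A_def B_def blinfun_compose_simps(7,8))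
  next
    case 3
    then have m: "min w x0 = x0" "min w x1 = w" "max w x0 = w" "max w x1 = x1" by auto
    have AB: "X w = X x0 + A" "X x1 = X x0 + A + B" by (simp_all add: A_def B_def m)
    have "trapezoid X b s x0 w + (trapezoid X b w w x1 + ((X w - X s) o\<^sub>L b o\<^sub>L B)) - trapezoid X b s x0 x1 =
        trapezoid X b s x0 w + trapezoid X b s w x1 - trapezoid X b s x0 x1"
      using base[of w x1] by (simp add: B_def m)
    also have "\<dots> = (1/2) *\<^sub>R ((A o\<^sub>L b o\<^sub>L B) - (B o\<^sub>L b o\<^sub>L A))"
      unfolding trapezoid_def AB using trapezoid_split[of "X x0" A "X s" b B] by simp
    finally show ?thesis by (simp add: m add.assoc)
  qed
qed

lemma trap_eq: "trap s t n b = (\<Sum>i<2 ^ n. trapezoid bm b s (grid s t n i) (grid s t n (Suc i)))"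
  by (simp add: trap_def trapezoid_def)

lemma grid_restrict:
  assumes "s \<le> w" "w \<le> t"
  shows "grid s w n i = min w (grid s t n i)" "grid w t n i = max w (grid s t n i)"
  using assms by (auto simp: grid_def clamp_to_def min_def max_def)

text \<open>At level n the relation fails for the trapezoidal sums only on the cell that contains
  \<open>w\<close> in its interior. The failure is antisymmetric in two increments inside this cell,
  hence of order \<open>2 ^ L / 2 ^ n\<close>, and disappears in the limit.\<close>

lemma levy_chen:
  assumes st: "0 \<le> s" "s \<le> w" "w \<le> t" "t \<le> 2 ^ L" and b: "b \<in> closure (wick_polys s)"
  shows "levy s t b = levy s w b + levy w t b + ((bm w - bm s) o\<^sub>L b o\<^sub>L (bm t - bm w))"
proof -
  define e where "e n = trap s w n b + trap w t n b + ((bm w - bm s) o\<^sub>L b o\<^sub>L (bm t - bm w)) - trap s t n b" for n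
  have st': "s \<le> t" using st by simp
  have bound: "norm (e n) \<le> (incr_const\<^sup>2 * norm b * 2 ^ L) * (1/2) ^ n" for n
  proof -
    define p where "p = grid s t n"
    define A where "A i = bm (min w (p (Suc i))) - bm (min w (p i))" for i
    define B where "B i = bm (max w (p (Suc i))) - bm (max w (p i))" for i
    have tele: "(\<Sum>i<2 ^ n. B i) = bm t - bm w"
      unfolding B_def using sum_lessThan_telescope[of "\<lambda>i. bm (max w (p i))" "2 ^ n"] grid_ends[OF st(1) st' st(4), of n] st
      by (simp add: p_def max_def)
    have "e n = (\<Sum>i<2 ^ n. trapezoid bm b s (min w (p i)) (min w (p (Suc i))) +
        trapezoid bm b w (max w (p i)) (max w (p (Suc i))) + ((bm w - bm s) o\<^sub>L b o\<^sub>L B i) - trapezoid bm b s (p i) (p (Suc i)))"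
      unfolding e_def trap_eq grid_restrict[OF st(2,3)] tele[symmetric] p_def[symmetric]
      by (simp add: sum.distrib sum_subtractf blinfun_compose_sum)
    also have "\<dots> = (\<Sum>i<2 ^ n. (1/2) *\<^sub>R ((A i o\<^sub>L b o\<^sub>L B i) - (B i o\<^sub>L b o\<^sub>L A i)))"
      unfolding A_def B_def by (intro sum.cong refl trapezoid_insert) (simp add: p_def grid_mono)
    finally have en: "e n = (\<Sum>i<2 ^ n. (1/2) *\<^sub>R ((A i o\<^sub>L b o\<^sub>L B i) - (B i o\<^sub>L b o\<^sub>L A i)))" .
    define I where "I = {i \<in> {..<2 ^ n}. p i < w \<and> w < p (Suc i)}"
    have "norm (e n) \<le> real 1 * (incr_const\<^sup>2 * norm b * (2 ^ L / 2 ^ n))"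
      unfolding en
    proof (rule norm_sum_sparse_le[where I=I])
      show "card I \<le> 1"
      proof (rule card_le_1I)
        have "False" if "i \<in> I" "j \<in> I" "i < j" for i j
          using that grid_mono[of "Suc i" j s t n] by (auto simp: I_def p_def)
        then show "i = j" if "i \<in> I" "j \<in> I" for i j using that by (metis linorder_neqE_nat)
      qed
      show "(1/2) *\<^sub>R ((A i o\<^sub>L b o\<^sub>L B i) - (B i o\<^sub>L b o\<^sub>L A i)) = 0" if "i \<in> {..<2 ^ n}" "i \<notin> I" for i
      proof -
        have "p i \<le> p (Suc i)" by (simp add: p_def grid_mono)
        then have "A i = 0 \<or> B i = 0" using that by (auto simp: A_def B_def I_def min_def max_def not_less)
        then show ?thesis by (auto simp: blinfun_compose_simps)
      qed
      fix i assume "i \<in> I"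
      then have i: "p i < w" "w < p (Suc i)" by (auto simp: I_def)
      have p0: "0 \<le> p i" using grid_bounds(1)[OF st', of n i] st(1) by (simp add: p_def)
      have h: "p (Suc i) - p i \<le> 2 ^ L / 2 ^ n" unfolding p_def by (rule grid_step)
      define r where "r = incr_const * sqrt (2 ^ L / 2 ^ n)"
      have nA: "norm (A i) \<le> r" and nB: "norm (B i) \<le> r"
      proof -
        have "norm (A i) \<le> incr_const * sqrt (w - p i)"
          using i p0 norm_bm_diff_le[of "p i" w] by (simp add: A_def)
        also have "\<dots> \<le> r" unfolding r_def using incr_const_pos i h by (intro mult_left_mono real_sqrt_le_mono) auto
        finally show "norm (A i) \<le> r" .
        have "norm (B i) \<le> incr_const * sqrt (p (Suc i) - w)"
          using i p0 norm_bm_diff_le[of w "p (Suc i)"] by (simp add: B_def)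
        also have "\<dots> \<le> r" unfolding r_def using incr_const_pos i h by (intro mult_left_mono real_sqrt_le_mono) auto
        finally show "norm (B i) \<le> r" .
      qed
      have r0: "0 \<le> r" using incr_const_pos by (simp add: r_def)
      have "norm (A i o\<^sub>L b o\<^sub>L B i) \<le> r * norm b * r" "norm (B i o\<^sub>L b o\<^sub>L A i) \<le> r * norm b * r"
        by (rule order_trans[OF norm_sandwich_le], intro mult_mono nA nB, use r0 in auto)+
      then have "norm ((A i o\<^sub>L b o\<^sub>L B i) - (B i o\<^sub>L b o\<^sub>L A i)) \<le> r * norm b * r + r * norm b * r"
        by (intro order_trans[OF norm_triangle_ineq4] add_mono)
      then have "norm ((1/2) *\<^sub>R ((A i o\<^sub>L b o\<^sub>L B i) - (B i o\<^sub>L b o\<^sub>L A i))) \<le> r * norm b * r" by (simp add: mult_ac)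
      also have "r * norm b * r = incr_const\<^sup>2 * norm b * (2 ^ L / 2 ^ n)"
        by (simp add: r_def power2_eq_square mult_ac)
      finally show "norm ((1/2) *\<^sub>R ((A i o\<^sub>L b o\<^sub>L B i) - (B i o\<^sub>L b o\<^sub>L A i))) \<le> incr_const\<^sup>2 * norm b * (2 ^ L / 2 ^ n)" .
    qed (auto simp: I_def)
    then show ?thesis by (simp add: power_one_over field_simps)
  qed
  have "e \<longlonglongrightarrow> 0"
  proof (rule Lim_null_comparison)
    show "\<forall>\<^sub>F n in sequentially. norm (e n) \<le> (incr_const\<^sup>2 * norm b * 2 ^ L) * (1/2) ^ n" using bound by simp
    show "(\<lambda>n. (incr_const\<^sup>2 * norm b * 2 ^ L) * (1/2) ^ n) \<longlonglongrightarrow> 0"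
      by (intro tendsto_mult_right_zero LIMSEQ_power_zero) simp
  qed
  moreover have "e \<longlonglongrightarrow> levy s w b + levy w t b + ((bm w - bm s) o\<^sub>L b o\<^sub>L (bm t - bm w)) - levy s t b"
  proof -
    have "b \<in> closure (wick_polys w)" using b closure_mono[OF wick_polys_mono[OF st(2)]] by blast
    then show ?thesis unfolding e_def using st b
      by (intro tendsto_intros trap_tendsto_levy) auto
  qed
  ultimately have "levy s w b + levy w t b + ((bm w - bm s) o\<^sub>L b o\<^sub>L (bm t - bm w)) - levy s t b = 0"
    using LIMSEQ_unique by blast
  then show ?thesis by simp
qed

subsection \<open>The filtration\<close>

lemma generated_algebra_filtration: "generated_algebra (bm ` {0..t}) \<subseteq> filtration bm t"
  by (simp add: filtration_def closure_subset)

lemma filtration_sequences: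
  assumes "T \<in> filtration bm t"
  shows "\<exists>f. (\<forall>n. f n \<in> generated_algebra (bm ` {0..t})) \<and> f \<longlonglongrightarrow> T"
  using assms unfolding filtration_def closure_sequential .

lemma filtration_sequenceI: "(\<And>n. f n \<in> generated_algebra (bm ` {0..t})) \<Longrightarrow> f \<longlonglongrightarrow> T \<Longrightarrow> T \<in> filtration bm t"
  unfolding filtration_def by (rule closure_sequenceI)

lemma filtration_ops:
  assumes "T \<in> filtration bm t" "R \<in> filtration bm t"
  shows "T + R \<in> filtration bm t" "T o\<^sub>L R \<in> filtration bm t" "op_scaleC c T \<in> filtration bm t"
proof -
  obtain f where f: "\<forall>n. f n \<in> generated_algebra (bm ` {0..t})" "f \<longlonglongrightarrow> T" using filtration_sequences assms by blast
  obtain g where g: "\<forall>n. g n \<in> generated_algebra (bm ` {0..t})" "g \<longlonglongrightarrow> R" using filtration_sequences assms by blast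
  show "T + R \<in> filtration bm t"
    by (rule filtration_sequenceI[OF _ tendsto_add[OF f(2) g(2)]]) (use f g in \<open>simp add: generated_algebra.add\<close>)
  show "T o\<^sub>L R \<in> filtration bm t"
    by (rule filtration_sequenceI[OF _ bounded_bilinear.tendsto[OF bounded_bilinear_blinfun_compose f(2) g(2)]])
      (use f g in \<open>simp add: generated_algebra.comp\<close>)
  show "op_scaleC c T \<in> filtration bm t"
    by (rule filtration_sequenceI[OF _ bounded_linear.tendsto[OF bounded_linear_op_scaleC f(2)]])
      (use f in \<open>simp add: generated_algebra.scale\<close>)
qed

lemma filtration_bm: "0 \<le> r \<Longrightarrow> r \<le> t \<Longrightarrow> bm r \<in> filtration bm t"
  using generated_algebra_filtration by (intro subsetD[OF generated_algebra_filtration] generated_algebra.gen) auto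

lemma filtration_id: "id_blinfun \<in> filtration bm t"
  by (intro subsetD[OF generated_algebra_filtration] generated_algebra.unit)

lemma filtration_scaleR: "T \<in> filtration bm t \<Longrightarrow> r *\<^sub>R T \<in> filtration bm t"
  using filtration_ops(3)[of T t T "complex_of_real r"] by (simp add: op_scaleC_simps)

lemma filtration_zero: "0 \<in> filtration bm t"
  using filtration_scaleR[OF filtration_id, of 0] by simp

lemma filtration_diff: "T \<in> filtration bm t \<Longrightarrow> R \<in> filtration bm t \<Longrightarrow> T - R \<in> filtration bm t"
  using filtration_ops(1)[OF _ filtration_scaleR[of R t "- 1"]] by fastforce

lemma filtration_sum: "(\<And>i. i \<in> I \<Longrightarrow> f i \<in> filtration bm t) \<Longrightarrow> (\<Sum>i\<in>I. f i) \<in> filtration bm t"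
  by (induction I rule: infinite_finite_induct) (auto intro: filtration_zero filtration_ops(1))

lemma closed_filtration: "closed (filtration bm t)"
  by (simp add: filtration_def)

lemma generated_algebra_mono: "T \<in> generated_algebra S \<Longrightarrow> S \<subseteq> S' \<Longrightarrow> T \<in> generated_algebra S'"
  by (induction rule: generated_algebra.induct) (auto intro: generated_algebra.intros)

lemma filtration_mono: "s \<le> t \<Longrightarrow> filtration bm s \<subseteq> filtration bm t"
  unfolding filtration_def by (intro closure_mono subsetI) (erule generated_algebra_mono, auto)

lemma indicator_past: "r \<le> t \<Longrightarrow> indicator {0..r} \<in> past t"
  using L2_indicator(1)[of r] by (auto simp: past_def conj_fun_def indicator_def fun_eq_iff)

lemma generated_algebra_polys: "generated_algebra (bm ` {0..t}) \<subseteq> wick_polys t"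
proof
  fix T assume "T \<in> generated_algebra (bm ` {0..t})"
  moreover have "bm ` {0..t} \<subseteq> gauss ` past t" unfolding bm_def by (auto intro!: imageI indicator_past)
  ultimately show "T \<in> wick_polys t" by (rule generated_algebra_wick_polys)
qed

lemma filtration_polys: "filtration bm t \<subseteq> closure (wick_polys t)"
  unfolding filtration_def by (intro closure_mono generated_algebra_polys)

lemma filtration_cops: "T \<in> filtration bm t \<Longrightarrow> T \<in> cops"
  using filtration_polys closure_wick_polys_cops by blast

lemma adj_bm: "adj (bm t) = bm t"
  unfolding bm_def by (rule adj_gauss[OF L2_indicator(1)])

lemma generated_algebra_adj:
  assumes "T \<in> generated_algebra (bm ` {0..t})" shows "adj T \<in> generated_algebra (bm ` {0..t})"
proof -
  have "T \<in> cops \<and> adj T \<in> generated_algebra (bm ` {0..t})"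
    using assms
  proof (induction rule: generated_algebra.induct)
    case (gen T)
    then show ?case using adj_bm bm_cops by (auto intro: generated_algebra.gen)
  qed (auto simp: adj_simps intro: generated_algebra.intros)
  then show ?thesis by simp
qed

lemma filtration_adj:
  assumes T: "T \<in> filtration bm t" shows "adj T \<in> filtration bm t"
proof -
  obtain f where f: "\<forall>n. f n \<in> generated_algebra (bm ` {0..t})" "f \<longlonglongrightarrow> T" using filtration_sequences[OF T] by blast
  have "f n \<in> cops" for n using f(1) generated_algebra_filtration filtration_cops by blast
  then have "(\<lambda>n. adj (f n)) \<longlonglongrightarrow> adj T" by (intro tendsto_adj f filtration_cops[OF T])
  then show ?thesis by (rule filtration_sequenceI[rotated]) (use f(1) generated_algebra_adj in blast)
qed

lemma levy_filtration:
  assumes st: "0 \<le> s" "s \<le> t" "t \<le> 2 ^ L" and b: "b \<in> filtration bm s"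
  shows "levy s t b \<in> filtration bm t"
proof -
  have bt: "b \<in> filtration bm t" using b filtration_mono[OF st(2)] by blast
  have g: "bm (grid s t n i) \<in> filtration bm t" "bm s \<in> filtration bm t" for n i
    using grid_bounds[OF st(2), of n i] st by (auto intro!: filtration_bm)
  have tr: "trap s t n b \<in> filtration bm t" for n
    unfolding trap_def by (intro filtration_sum filtration_ops(2) filtration_diff filtration_scaleR filtration_ops(1) g bt)
  have "levy s t b \<in> closure (filtration bm t)"
    by (rule closure_sequenceI[OF tr trap_tendsto_levy[OF st subsetD[OF filtration_polys b]]])
  then show ?thesis by (simp add: closed_filtration)
qed

lemma past_space_filtration:
  assumes T: "T \<in> filtration bm u" and v: "v \<in> past_space u"
  shows "blinfun_apply T v \<in> past_space u"
proof -
  have alg: "\<forall>v\<in>past_space u. blinfun_apply R v \<in> past_space u" if "R \<in> generated_algebra (bm ` {0..u})" for R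
    using that
  proof (induction rule: generated_algebra.induct)
    case (gen R)
    then obtain r where r: "r \<le> u" "R = bm r" by auto
    then show ?case using past_space_an_past[OF indicator_past[OF r(1)]] past_space_cr_past[OF indicator_past[OF r(1)]]
      by (auto simp: bm_def gauss_def blinfun.bilinear_simps intro!: past_space_add)
  qed (auto simp: blinfun.bilinear_simps op_scaleC_apply past_space_add past_space_scaleC)
  obtain f where f: "\<forall>n. f n \<in> generated_algebra (bm ` {0..u})" "f \<longlonglongrightarrow> T" using filtration_sequences[OF T] by blast
  have "(\<lambda>n. blinfun_apply (f n) v) \<longlonglongrightarrow> blinfun_apply T v" by (intro tendsto_intros f)
  then have "blinfun_apply T v \<in> closure (past_space u)"
    by (rule closure_sequenceI[rotated]) (use f(1) alg v in blast)
  then show ?thesis by (simp add: past_space_def)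
qed

lemma past_space_mono: "u \<le> v \<Longrightarrow> past_space u \<subseteq> past_space v"
proof -
  assume "u \<le> v"
  then have "lists (past u) \<subseteq> lists (past v)" by (intro lists_mono) (auto simp: past_def)
  then show ?thesis unfolding past_space_def by (intro closure_mono) blast
qed

lemma vacuum_past_space: "tens [] \<in> past_space u"
  using past_spaceI[of "[(1, [])]" u] by simp

end

context q_brownian_motion
begin

subsection \<open>Area of the dyadic interpolations\<close>

abbreviation "interp m \<equiv> dyadic_interpolation bm m"

text \<open>At the right endpoint the floor already selects the next cell; both affine formulas have
  the same value there, so the formula holds on the closed cell.\<close>

lemma interp_cell:
  assumes u: "real i / 2 ^ m \<le> u" "u \<le> real (Suc i) / 2 ^ m"
  shows "interp m u = bm (real i / 2 ^ m) + (2 ^ m * u - real i) *\<^sub>R (bm (real (Suc i) / 2 ^ m) - bm (real i / 2 ^ m))"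
proof (cases "u = real (Suc i) / 2 ^ m")
  case True
  have "\<lfloor>2 ^ m * u\<rfloor> = int (Suc i)" using True by simp
  then have "interp m u = bm (real (Suc i) / 2 ^ m)" using True by (simp add: dyadic_interpolation_def Let_def)
  then show ?thesis using True by simp
next
  case False
  have "real i \<le> 2 ^ m * u" using u(1) by (simp add: field_simps)
  moreover have "2 ^ m * u < real i + 1"
  proof -
    have "u < real (Suc i) / 2 ^ m" using u(2) False by simp
    then show ?thesis by (simp add: field_simps)
  qed
  ultimately have "\<lfloor>2 ^ m * u\<rfloor> = int i" by (intro floor_unique) auto
  then show ?thesis by (simp add: dyadic_interpolation_def Let_def add.commute)
qed

lemma interp_grid: "interp m (real i / 2 ^ m) = bm (real i / 2 ^ m)"
  using interp_cell[of i m "real i / 2 ^ m"] by (simp add: divide_right_mono)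

lemma norm_interp_diff_le:
  assumes "0 \<le> u"
  shows "norm (interp m u - bm u) \<le> 2 * (incr_const * sqrt (1 / 2 ^ m))"
proof -
  define i where "i = nat \<lfloor>2 ^ m * u\<rfloor>"
  have i: "real i \<le> 2 ^ m * u" "2 ^ m * u < real i + 1"
    using assms by (simp_all add: i_def)
  then have u: "real i / 2 ^ m \<le> u" "u \<le> real (Suc i) / 2 ^ m" by (auto simp: field_simps)
  have w: "real (Suc i) / 2 ^ m - real i / 2 ^ m = 1 / 2 ^ m" by (simp add: field_simps)
  have 1: "norm ((2 ^ m * u - real i) *\<^sub>R (bm (real (Suc i) / 2 ^ m) - bm (real i / 2 ^ m))) \<le> 1 * (incr_const * sqrt (1 / 2 ^ m))"
    unfolding norm_scaleR
  proof (rule mult_mono)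
    show "norm (bm (real (Suc i) / 2 ^ m) - bm (real i / 2 ^ m)) \<le> incr_const * sqrt (1 / 2 ^ m)"
      using norm_bm_diff_le[of "real i / 2 ^ m" "real (Suc i) / 2 ^ m"] u unfolding w by simp
  qed (use i in auto)
  have "norm (bm u - bm (real i / 2 ^ m)) \<le> incr_const * sqrt (u - real i / 2 ^ m)"
    using u by (intro norm_bm_diff_le) auto
  also have "\<dots> \<le> incr_const * sqrt (1 / 2 ^ m)"
    using incr_const_pos u w by (intro mult_left_mono real_sqrt_le_mono) auto
  finally have 2: "norm (bm u - bm (real i / 2 ^ m)) \<le> incr_const * sqrt (1 / 2 ^ m)" .
  have "interp m u - bm u = (2 ^ m * u - real i) *\<^sub>R (bm (real (Suc i) / 2 ^ m) - bm (real i / 2 ^ m)) - (bm u - bm (real i / 2 ^ m))"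
    unfolding interp_cell[OF u] by simp
  then show ?thesis using norm_triangle_le_diff[OF add_mono[OF 1 2]] by (simp only: mult_1 mult_2)
qed

text \<open>The grid divides [0, 2^L], so that the spacing 2^(-m) of the interpolation
  \<open>interp m\<close> occurs at level m + L.\<close>

lemma grid_dyadic: "grid s t (m + L) i = clamp_to s t (real i / 2 ^ m)"
  by (simp add: grid_def power_add)

lemma grid_in_cell:
  assumes "s \<le> t" "grid s t (m + L) i < grid s t (m + L) (Suc i)"
  shows "real i / 2 ^ m \<le> grid s t (m + L) i" "grid s t (m + L) (Suc i) \<le> real (Suc i) / 2 ^ m"
  using assms unfolding grid_dyadic clamp_to_def by (auto simp: max_def min_def split: if_splits)

definition interp_trap :: "real \<Rightarrow> real \<Rightarrow> nat \<Rightarrow> 'a oper \<Rightarrow> 'a oper" where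
  "interp_trap s t m b = (\<Sum>i<2 ^ (m + L). trapezoid (interp m) b s (grid s t (m + L) i) (grid s t (m + L) (Suc i)))"

text \<open>On a dyadic cell the integrand is affine in the local coordinate \<open>\<theta>\<close>
  and has the quadratic antiderivative \<open>F\<close>. The derivative of the interpolation exists
  in the interior of the cell, which suffices for the fundamental theorem.\<close>

lemma integral_cell:
  fixes a b :: "'a oper"
  assumes ab: "real i / 2 ^ m \<le> \<alpha>" "\<alpha> \<le> \<beta>" "\<beta> \<le> real (Suc i) / 2 ^ m"
  shows "((\<lambda>u. (a o\<^sub>L (interp m u - interp m s) o\<^sub>L b) o\<^sub>L vector_derivative (interp m) (at u)) has_integral
    a o\<^sub>L trapezoid (interp m) b s \<alpha> \<beta>) {\<alpha>..\<beta>}"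
proof -
  define D where "D = bm (real (Suc i) / 2 ^ m) - bm (real i / 2 ^ m)"
  define P where "P = bm (real i / 2 ^ m) - interp m s"
  define \<theta> where "\<theta> u = 2 ^ m * u - real i" for u :: real
  have cell: "interp m u = bm (real i / 2 ^ m) + \<theta> u *\<^sub>R D" if "\<alpha> \<le> u" "u \<le> \<beta>" for u
    unfolding D_def \<theta>_def using that ab by (intro interp_cell) auto
  define F where "F u = a o\<^sub>L (\<theta> u *\<^sub>R (P o\<^sub>L b o\<^sub>L D) + ((\<theta> u)\<^sup>2 / 2) *\<^sub>R (D o\<^sub>L b o\<^sub>L D))" for u
  have d1: "(\<theta> has_real_derivative 2 ^ m) (at u)" for u
    unfolding \<theta>_def[abs_def] by (auto intro!: derivative_eq_intros)
  have deriv: "(F has_vector_derivative a o\<^sub>L ((2 ^ m) *\<^sub>R (P o\<^sub>L b o\<^sub>L D) + (2 ^ m * \<theta> u) *\<^sub>R (D o\<^sub>L b o\<^sub>L D))) (at u)" for u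
    unfolding F_def
  proof (rule bounded_linear.has_vector_derivative[OF bounded_bilinear.bounded_linear_right[OF bounded_bilinear_blinfun_compose]])
    have d2: "((\<lambda>u. (\<theta> u)\<^sup>2 / 2) has_real_derivative 2 ^ m * \<theta> u) (at u)"
      using DERIV_cdivide[OF DERIV_power[OF d1[of u], of 2], of 2] by (simp add: mult.commute)
    show "((\<lambda>u. \<theta> u *\<^sub>R (P o\<^sub>L b o\<^sub>L D) + ((\<theta> u)\<^sup>2 / 2) *\<^sub>R (D o\<^sub>L b o\<^sub>L D)) has_vector_derivative
        (2 ^ m) *\<^sub>R (P o\<^sub>L b o\<^sub>L D) + (2 ^ m * \<theta> u) *\<^sub>R (D o\<^sub>L b o\<^sub>L D)) (at u)"
      using has_vector_derivative_add[OF has_vector_derivative_scaleR[OF d1 has_vector_derivative_const]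
        has_vector_derivative_scaleR[OF d2 has_vector_derivative_const]] by simp
  qed
  have "((\<lambda>u. (a o\<^sub>L (interp m u - interp m s) o\<^sub>L b) o\<^sub>L vector_derivative (interp m) (at u)) has_integral (F \<beta> - F \<alpha>)) {\<alpha>..\<beta>}"
  proof (rule fundamental_theorem_of_calculus_interior[OF ab(2)])
    show "continuous_on {\<alpha>..\<beta>} F"
      by (rule continuous_at_imp_continuous_on) (use deriv has_vector_derivative_continuous in blast)
    fix u assume u: "u \<in> {\<alpha><..<\<beta>}"
    have "((\<lambda>u. bm (real i / 2 ^ m) + \<theta> u *\<^sub>R D) has_vector_derivative (2 ^ m) *\<^sub>R D) (at u)"
      using has_vector_derivative_add[OF has_vector_derivative_const has_vector_derivative_scaleR[OF d1 has_vector_derivative_const]]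
      by simp
    then have "(interp m has_vector_derivative (2 ^ m) *\<^sub>R D) (at u)"
    proof (rule has_vector_derivative_transform_within_open[OF _ open_greaterThanLessThan u])
      fix v assume "v \<in> {\<alpha><..<\<beta>}"
      then show "bm (real i / 2 ^ m) + \<theta> v *\<^sub>R D = interp m v" using cell[of v] by simp
    qed
    then have vd: "vector_derivative (interp m) (at u) = (2 ^ m) *\<^sub>R D" by (rule vector_derivative_at)
    have "interp m u - interp m s = P + \<theta> u *\<^sub>R D" using cell[of u] u by (simp add: P_def)
    then have "(a o\<^sub>L (interp m u - interp m s) o\<^sub>L b) o\<^sub>L vector_derivative (interp m) (at u) =
        a o\<^sub>L ((2 ^ m) *\<^sub>R (P o\<^sub>L b o\<^sub>L D) + (2 ^ m * \<theta> u) *\<^sub>R (D o\<^sub>L b o\<^sub>L D))"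
      unfolding vd by (simp add: blinfun_compose_simps blinfun_compose_assoc' scaleR_add_right)
    then show "(F has_vector_derivative (a o\<^sub>L (interp m u - interp m s) o\<^sub>L b) o\<^sub>L vector_derivative (interp m) (at u)) (at u)"
      using deriv[of u] by simp
  qed
  also have "F \<beta> - F \<alpha> = a o\<^sub>L trapezoid (interp m) b s \<alpha> \<beta>"
  proof -
    define r where "r = \<theta> \<beta> - \<theta> \<alpha>"
    have "interp m \<beta> - interp m \<alpha> = r *\<^sub>R D"
      using cell[of \<alpha>] cell[of \<beta>] ab(2) by (simp add: r_def scaleR_diff_left)
    moreover have "(1/2) *\<^sub>R (interp m \<alpha> + interp m \<beta>) - interp m s = P + ((\<theta> \<alpha> + \<theta> \<beta>) / 2) *\<^sub>R D"
    proof -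
      have "interp m \<alpha> + interp m \<beta> = 2 *\<^sub>R bm (real i / 2 ^ m) + (\<theta> \<alpha> + \<theta> \<beta>) *\<^sub>R D"
        using cell[of \<alpha>] cell[of \<beta>] ab(2) by (simp add: scaleR_add_left scaleR_2)
      then show ?thesis by (simp add: P_def scaleR_add_right)
    qed
    ultimately have "trapezoid (interp m) b s \<alpha> \<beta> = (P + ((\<theta> \<alpha> + \<theta> \<beta>) / 2) *\<^sub>R D) o\<^sub>L b o\<^sub>L (r *\<^sub>R D)"
      by (simp add: trapezoid_def)
    also have "\<dots> = r *\<^sub>R (P o\<^sub>L b o\<^sub>L D) + (r * ((\<theta> \<alpha> + \<theta> \<beta>) / 2)) *\<^sub>R (D o\<^sub>L b o\<^sub>L D)"
      by (simp add: blinfun_compose_simps scaleR_add_right)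
    also have "r * ((\<theta> \<alpha> + \<theta> \<beta>) / 2) = (\<theta> \<beta>)\<^sup>2 / 2 - (\<theta> \<alpha>)\<^sup>2 / 2"
      by (simp add: r_def power2_eq_square algebra_simps diff_divide_distrib)
    finally have tz: "trapezoid (interp m) b s \<alpha> \<beta> = (\<theta> \<beta> *\<^sub>R (P o\<^sub>L b o\<^sub>L D) + ((\<theta> \<beta>)\<^sup>2 / 2) *\<^sub>R (D o\<^sub>L b o\<^sub>L D)) -
        (\<theta> \<alpha> *\<^sub>R (P o\<^sub>L b o\<^sub>L D) + ((\<theta> \<alpha>)\<^sup>2 / 2) *\<^sub>R (D o\<^sub>L b o\<^sub>L D))"
      by (simp add: r_def scaleR_diff_left)
    show ?thesis unfolding tz F_def by (rule blinfun_compose_simps(4)[symmetric])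
  qed
  finally show ?thesis .
qed

lemma integral_interp:
  fixes a b :: "'a oper"
  assumes st: "0 \<le> s" "s \<le> t" "t \<le> 2 ^ L"
  shows "integral {s..t} (\<lambda>u. (a o\<^sub>L (interp m u - interp m s) o\<^sub>L b) o\<^sub>L vector_derivative (interp m) (at u)) =
    a o\<^sub>L interp_trap s t m b"
proof -
  let ?f = "\<lambda>u. (a o\<^sub>L (interp m u - interp m s) o\<^sub>L b) o\<^sub>L vector_derivative (interp m) (at u)"
  define p where "p = grid s t (m + L)"
  have p0: "p 0 = s" and pN: "p (2 ^ (m + L)) = t" using grid_ends[OF st, of "m + L"] by (simp_all add: p_def)
  have step: "(?f has_integral a o\<^sub>L trapezoid (interp m) b s (p i) (p (Suc i))) {p i..p (Suc i)}" for i
  proof (cases "p i < p (Suc i)")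
    case True
    then show ?thesis using grid_in_cell[OF st(2), of m i] by (intro integral_cell) (auto simp: p_def)
  next
    case False
    then have "p (Suc i) = p i" using grid_mono[of i "Suc i" s t "m + L"] by (simp add: p_def)
    then show ?thesis by (simp add: blinfun_compose_simps has_integral_refl)
  qed
  have "(?f has_integral (\<Sum>i<k. a o\<^sub>L trapezoid (interp m) b s (p i) (p (Suc i)))) {s..p k}" for k
  proof (induction k)
    case 0
    then show ?case using p0 has_integral_refl(2)[of ?f s] by simp
  next
    case (Suc k)
    have "s \<le> p k" "p k \<le> p (Suc k)" unfolding p_def using grid_bounds[OF st(2)] by (auto intro: grid_mono)
    then show ?case using has_integral_combine[OF _ _ Suc step[of k]] by simp
  qed
  from this[of "2 ^ (m + L)"] show ?thesis
    unfolding pN by (intro integral_unique) (simp add: interp_trap_def blinfun_compose_sum p_def)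
qed

text \<open>The dependence on the base point is split off because \<open>interp m s\<close> and
  \<open>bm s\<close> differ; the two parts converge for different reasons.\<close>

lemma trap_interp_split:
  assumes st: "0 \<le> s" "s \<le> t" "t \<le> 2 ^ L"
  shows "(\<Sum>i<2 ^ n. trapezoid X b s (grid s t n i) (grid s t n (Suc i))) =
    (\<Sum>i<2 ^ n. (1/2) *\<^sub>R ((X (grid s t n i) + X (grid s t n (Suc i))) o\<^sub>L b o\<^sub>L (X (grid s t n (Suc i)) - X (grid s t n i)))) -
    (X s o\<^sub>L b o\<^sub>L (X t - X s))"
proof -
  have "(X s o\<^sub>L b o\<^sub>L (X t - X s)) = (\<Sum>i<2 ^ n. X s o\<^sub>L b o\<^sub>L (X (grid s t n (Suc i)) - X (grid s t n i)))"
    unfolding blinfun_compose_sum(2)[symmetric] using sum_lessThan_telescope[of "\<lambda>i. X (grid s t n i)" "2 ^ n"] grid_ends[OF st]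
    by simp
  then show ?thesis
    by (simp add: trapezoid_def blinfun_compose_simps(3,5) sum_subtractf)
qed

text \<open>The interpolation agrees with the process at dyadic points, so at most two cells, those
  at \<open>s\<close> and at \<open>t\<close>, distinguish the two sums. On each of them the
  increments are at most \<open>\<delta> m\<close> for the process and 5 times this for the
  interpolation, which is within \<open>2 * \<delta> m\<close> of the process everywhere.\<close>

lemma interp_trap_tendsto:
  assumes st: "0 \<le> s" "s \<le> t" "t \<le> 2 ^ L"
  shows "(\<lambda>m. interp_trap s t m b - trap s t (m + L) b) \<longlonglongrightarrow> 0"
proof -
  define \<delta> where "\<delta> m = incr_const * sqrt (1 / 2 ^ m)" for m :: nat
  have \<delta>0: "0 \<le> \<delta> m" for m using incr_const_pos by (simp add: \<delta>_def)
  have \<delta>1: "\<delta> m \<le> incr_const" for m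
    using incr_const_pos unfolding \<delta>_def by (intro mult_left_le) (auto simp: real_sqrt_divide)
  have \<delta>lim: "\<delta> \<longlonglongrightarrow> 0"
  proof -
    have "(\<lambda>m. incr_const * sqrt ((1/2) ^ m)) \<longlonglongrightarrow> incr_const * sqrt 0"
      by (intro tendsto_intros LIMSEQ_power_zero) simp
    then show ?thesis by (simp add: \<delta>_def[abs_def] power_one_over)
  qed
  have Yd: "norm (interp m u - bm u) \<le> 2 * \<delta> m" if "0 \<le> u" for m u
    using norm_interp_diff_le[OF that] by (simp add: \<delta>_def)
  define K where "K = norm (bm 0) + incr_const * sqrt (2 ^ L) + 2 * incr_const"
  have XK: "norm (bm u) \<le> K" and YK: "norm (interp m u) \<le> K" if "0 \<le> u" "u \<le> 2 ^ L" for u m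
  proof -
    have "norm (bm u - bm 0) \<le> incr_const * sqrt (u - 0)" using that by (intro norm_bm_diff_le) auto
    also have "\<dots> \<le> incr_const * sqrt (2 ^ L)" using that incr_const_pos by (intro mult_left_mono real_sqrt_le_mono) auto
    finally have 1: "norm (bm u) \<le> norm (bm 0) + incr_const * sqrt (2 ^ L)"
      using norm_triangle_ineq[of "bm u - bm 0" "bm 0"] by simp
    then show "norm (bm u) \<le> K" using incr_const_pos by (simp add: K_def)
    show "norm (interp m u) \<le> K"
      using norm_triangle_ineq[of "interp m u - bm u" "bm u"] Yd[OF that(1), of m] \<delta>1[of m] 1 by (simp add: K_def)
  qed
  have K0: "0 \<le> K" using order_trans[OF norm_ge_zero XK[of 0]] by simp
  define W where "W X n = (\<Sum>i<2 ^ n. (1/2) *\<^sub>R ((X (grid s t n i) + X (grid s t n (Suc i))) o\<^sub>L b o\<^sub>L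
      (X (grid s t n (Suc i)) - X (grid s t n i))))" for X :: "real \<Rightarrow> 'a oper" and n
  have Wdiff: "norm (W (interp m) (m + L) - W bm (m + L)) \<le> 12 * K * norm b * \<delta> m" for m
  proof -
    define p where "p = grid s t (m + L)"
    define w where "w X i = (X (p i) + X (p (Suc i))) o\<^sub>L b o\<^sub>L (X (p (Suc i)) - X (p i))" for X :: "real \<Rightarrow> 'a oper" and i
    \<comment> \<open>A nonempty cell outside this set has two dyadic endpoints and contributes
      equally to both sums. Nonemptiness matters: infinitely fine collapsed cells may accumulate at
      \<open>s\<close> or \<open>t\<close>, but they contribute zero.\<close>
    define I where "I = {i \<in> {..<2 ^ (m + L)}. p i < p (Suc i) \<and> (p i = s \<or> p (Suc i) = t)}"
    have pb: "0 \<le> p i" "p i \<le> 2 ^ L" for i using grid_bounds[OF st(2), of "m + L" i] st by (auto simp: p_def)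
    have eq: "W (interp m) (m + L) - W bm (m + L) = (\<Sum>i<2 ^ (m + L). (1/2) *\<^sub>R (w (interp m) i - w bm i))"
      by (simp add: W_def w_def p_def sum_subtractf scaleR_diff_right)
    have "norm (W (interp m) (m + L) - W bm (m + L)) \<le> real 2 * (6 * K * norm b * \<delta> m)"
      unfolding eq
    proof (rule norm_sum_sparse_le[where I=I])
      show "card I \<le> 2"
      proof -
        have I: "I = {i \<in> I. p i = s} \<union> {i \<in> I. p (Suc i) = t}" by (auto simp: I_def)
        have no: False if "i \<in> I" "j \<in> I" "i < j" "p i = s \<and> p j = s \<or> p (Suc i) = t \<and> p (Suc j) = t" for i j
          using that grid_mono[of "Suc i" j s t "m + L"] by (auto simp: I_def p_def)
        have "card {i \<in> I. p i = s} \<le> 1"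
        proof (rule card_le_1I)
          fix i j assume "i \<in> {i \<in> I. p i = s}" "j \<in> {i \<in> I. p i = s}"
          then show "i = j" using no[of i j] no[of j i] by (cases i j rule: linorder_cases) simp_all
        qed
        moreover have "card {i \<in> I. p (Suc i) = t} \<le> 1"
        proof (rule card_le_1I)
          fix i j assume "i \<in> {i \<in> I. p (Suc i) = t}" "j \<in> {i \<in> I. p (Suc i) = t}"
          then show "i = j" using no[of i j] no[of j i] by (cases i j rule: linorder_cases) simp_all
        qed
        ultimately show ?thesis using card_Un_le[of "{i \<in> I. p i = s}" "{i \<in> I. p (Suc i) = t}"] arg_cong[OF I, of card] by linarith
      qed
      show "(1/2) *\<^sub>R (w (interp m) i - w bm i) = 0" if i: "i \<in> {..<2 ^ (m + L)}" "i \<notin> I" for i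
      proof (cases "p i < p (Suc i)")
        case False
        then have "p (Suc i) = p i" using grid_mono[of i "Suc i" s t "m + L"] by (simp add: p_def)
        then show ?thesis by (simp add: w_def blinfun_compose_simps)
      next
        case True
        then have "p i \<noteq> s" "p (Suc i) \<noteq> t" using i by (auto simp: I_def)
        then have "p i = real i / 2 ^ m" "p (Suc i) = real (Suc i) / 2 ^ m"
          using True st(2) unfolding p_def grid_dyadic clamp_to_def by (auto simp: max_def min_def split: if_splits)
        then show ?thesis by (simp add: w_def interp_grid del: of_nat_Suc)
      qed
      fix i assume "i \<in> I"
      have ple: "p i \<le> p (Suc i)" by (simp add: p_def grid_mono)
      have ph: "p (Suc i) - p i \<le> 1 / 2 ^ m"
        using grid_step[of s t "m + L" i] by (simp add: p_def power_add)
      have dX: "norm (bm (p (Suc i)) - bm (p i)) \<le> \<delta> m"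
      proof -
        have "norm (bm (p (Suc i)) - bm (p i)) \<le> incr_const * sqrt (p (Suc i) - p i)" by (rule norm_bm_diff_le[OF pb(1) ple])
        also have "\<dots> \<le> \<delta> m" unfolding \<delta>_def using incr_const_pos ph by (intro mult_left_mono real_sqrt_le_mono) auto
        finally show ?thesis .
      qed
      have dY: "norm (interp m (p (Suc i)) - interp m (p i)) \<le> 5 * \<delta> m"
      proof -
        have "interp m (p (Suc i)) - interp m (p i) = (interp m (p (Suc i)) - bm (p (Suc i))) + (bm (p (Suc i)) - bm (p i)) - (interp m (p i) - bm (p i))"
          by simp
        then have "norm (interp m (p (Suc i)) - interp m (p i)) \<le> norm (interp m (p (Suc i)) - bm (p (Suc i))) + norm (bm (p (Suc i)) - bm (p i)) + norm (interp m (p i) - bm (p i))"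
          using norm_triangle_ineq norm_triangle_ineq4 by (smt (verit, best))
        then show ?thesis using Yd[OF pb(1)[of i], of m] Yd[OF pb(1)[of "Suc i"], of m] dX by simp
      qed
      have "norm (w X i) \<le> (2 * K) * norm b * e" if "\<And>j. norm (X (p j)) \<le> K" "norm (X (p (Suc i)) - X (p i)) \<le> e" for X e
        unfolding w_def
      proof (rule order_trans[OF norm_sandwich_le mult_mono[OF mult_right_mono that(2)]])
        show "norm (X (p i) + X (p (Suc i))) \<le> 2 * K"
          using norm_triangle_ineq[of "X (p i)" "X (p (Suc i))"] that(1)[of i] that(1)[of "Suc i"] by simp
      qed (use K0 in auto)
      from this[of "interp m", OF YK[OF pb] dY] this[of bm, OF XK[OF pb] dX]
      have "norm (w (interp m) i - w bm i) \<le> (2 * K) * norm b * (5 * \<delta> m) + (2 * K) * norm b * \<delta> m"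
        by (intro order_trans[OF norm_triangle_ineq4] add_mono)
      then show "norm ((1/2) *\<^sub>R (w (interp m) i - w bm i)) \<le> 6 * K * norm b * \<delta> m" by simp
    qed (use K0 \<delta>0 in \<open>auto simp: I_def\<close>)
    then show ?thesis by simp
  qed
  have "(\<lambda>m. W (interp m) (m + L) - W bm (m + L)) \<longlonglongrightarrow> 0"
  proof (rule Lim_null_comparison)
    show "\<forall>\<^sub>F m in sequentially. norm (W (interp m) (m + L) - W bm (m + L)) \<le> 12 * K * norm b * \<delta> m" using Wdiff by simp
    show "(\<lambda>m. 12 * K * norm b * \<delta> m) \<longlonglongrightarrow> 0" by (rule tendsto_mult_right_zero[OF \<delta>lim])
  qed
  moreover have "(\<lambda>m. (interp m s o\<^sub>L b o\<^sub>L (interp m t - interp m s)) - (bm s o\<^sub>L b o\<^sub>L (bm t - bm s))) \<longlonglongrightarrow> 0"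
  proof -
    have lim: "(\<lambda>m. interp m u) \<longlonglongrightarrow> bm u" if "0 \<le> u" for u
    proof (rule LIM_zero_cancel, rule Lim_null_comparison)
      show "\<forall>\<^sub>F m in sequentially. norm (interp m u - bm u) \<le> 2 * \<delta> m" using Yd[OF that] by simp
      show "(\<lambda>m. 2 * \<delta> m) \<longlonglongrightarrow> 0" by (rule tendsto_mult_right_zero[OF \<delta>lim])
    qed
    have "(\<lambda>m. interp m s o\<^sub>L b o\<^sub>L (interp m t - interp m s)) \<longlonglongrightarrow> (bm s o\<^sub>L b o\<^sub>L (bm t - bm s))"
      using st by (intro bounded_bilinear.tendsto[OF bounded_bilinear_blinfun_compose] tendsto_diff lim tendsto_const) auto
    then show ?thesis by (rule LIM_zero)
  qed
  ultimately have "(\<lambda>m. (W (interp m) (m + L) - W bm (m + L)) - ((interp m s o\<^sub>L b o\<^sub>L (interp m t - interp m s)) - (bm s o\<^sub>L b o\<^sub>L (bm t - bm s)))) \<longlonglongrightarrow> 0 - 0"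
    by (rule tendsto_diff)
  moreover have "interp_trap s t m b - trap s t (m + L) b =
      (W (interp m) (m + L) - W bm (m + L)) - ((interp m s o\<^sub>L b o\<^sub>L (interp m t - interp m s)) - (bm s o\<^sub>L b o\<^sub>L (bm t - bm s)))" for m
    unfolding interp_trap_def trap_eq trap_interp_split[OF st] W_def by simp
  ultimately show ?thesis by simp
qed

lemma interp_trap_levy:
  assumes st: "0 \<le> s" "s \<le> t" "t \<le> 2 ^ L" and b: "b \<in> filtration bm s"
  shows "(\<lambda>m. interp_trap s t m b) \<longlonglongrightarrow> levy s t b"
proof -
  have "(\<lambda>m. trap s t (m + L) b) \<longlonglongrightarrow> levy s t b"
    using trap_tendsto_levy[OF st subsetD[OF filtration_polys b]] by (rule LIMSEQ_ignore_initial_segment)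
  from tendsto_add[OF interp_trap_tendsto[OF st, of b] this] show ?thesis by simp
qed

end

subsection \<open>Continuous extensions to projective tensor powers\<close>

lemma tendsto_fun_iff: "(f \<longlongrightarrow> l) F \<longleftrightarrow> (\<forall>i. ((\<lambda>x. f x i) \<longlongrightarrow> l i) F)"
  for f :: "'a \<Rightarrow> 'b \<Rightarrow> 'c::topological_space"
  using limitin_componentwise[of "\<lambda>_. euclidean" UNIV f l F]
  by (simp add: euclidean_product_topology)

lemma sum_fun_apply: "(\<Sum>i\<in>I. f i) x = (\<Sum>i\<in>I. f i x)"
  for f :: "'a \<Rightarrow> 'b \<Rightarrow> 'c::comm_monoid_add"
  by (induction I rule: infinite_finite_induct) simp_all

lemma sums_fun_iff: "f sums l \<longleftrightarrow> (\<forall>i. (\<lambda>n. f n i) sums l i)"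
  for f :: "nat \<Rightarrow> 'b \<Rightarrow> 'c::{topological_space, comm_monoid_add}"
  unfolding sums_def tendsto_fun_iff sum_fun_apply ..

text \<open>Interleaving two representing series gives a representing series of the sum of the two
  tensors.\<close>

definition interleave :: "(nat \<Rightarrow> 'a) \<Rightarrow> (nat \<Rightarrow> 'a) \<Rightarrow> nat \<Rightarrow> 'a" where
  "interleave f g k = (if even k then f (k div 2) else g (k div 2))"

lemma sums_interleave:
  fixes f g :: "nat \<Rightarrow> 'a::real_normed_vector"
  assumes "f sums x" "g sums y"
  shows "interleave f g sums (x + y)"
proof -
  let ?f = "\<lambda>k. if even k then f (k div 2) else 0" and ?g = "\<lambda>k. if even k then 0 else g (k div 2)"
  have "strict_mono ((*) (2::nat))" "strict_mono (\<lambda>k::nat. 2 * k + 1)" by (auto simp: strict_mono_def)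
  note r = this
  have "k \<notin> range ((*) 2) \<Longrightarrow> ?f k = 0" "k \<notin> range (\<lambda>k. 2 * k + 1) \<Longrightarrow> ?g k = 0" for k :: nat
    by (auto elim!: evenE oddE)
  then have "?f sums x" "?g sums y"
    using sums_mono_reindex[OF r(1), of ?f x] sums_mono_reindex[OF r(2), of ?g y] assms by simp_all
  from sums_add[OF this] show ?thesis by (rule sums_cong[THEN iffD1, rotated]) (simp add: interleave_def)
qed

lemma summable_interleave: "summable f \<Longrightarrow> summable g \<Longrightarrow> summable (interleave f g)"
  for f g :: "nat \<Rightarrow> 'a::real_normed_vector"
  using sums_interleave summable_def by blast

abbreviation list_norm :: "'h::real_normed_vector list \<Rightarrow> real" where
  "list_norm as \<equiv> prod_list (map norm as)"

lemma list_norm_nonneg: "0 \<le> list_norm as"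
  by (induction as) simp_all

definition multilinear_map ::
    "'h::complex_hilbert_space oper set \<Rightarrow> nat \<Rightarrow> real \<Rightarrow> ('h oper list \<Rightarrow> 'h oper) \<Rightarrow> bool" where
  "multilinear_map A n K m \<longleftrightarrow>
     (\<forall>as bs. \<forall>a\<in>A. \<forall>b\<in>A. \<forall>c.
        set as \<subseteq> A \<and> set bs \<subseteq> A \<and> length as + 1 + length bs = n \<longrightarrow>
        m (as @ (a + op_scaleC c b) # bs) = m (as @ a # bs) + op_scaleC c (m (as @ b # bs))) \<and>
     (\<forall>as. set as \<subseteq> A \<and> length as = n \<longrightarrow> norm (m as) \<le> K * list_norm as)"

lemma multilinear_map_bound:
  "multilinear_map A n K m \<Longrightarrow> set as \<subseteq> A \<Longrightarrow> length as = n \<Longrightarrow> norm (m as) \<le> K * list_norm as"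
  unfolding multilinear_map_def by blast

lemma multilinear_map_linear:
  "multilinear_map A n K m \<Longrightarrow> a \<in> A \<Longrightarrow> b \<in> A \<Longrightarrow> set as \<subseteq> A \<Longrightarrow> set bs \<subseteq> A \<Longrightarrow> length as + 1 + length bs = n \<Longrightarrow>
    m (as @ (a + op_scaleC c b) # bs) = m (as @ a # bs) + op_scaleC c (m (as @ b # bs))"
  unfolding multilinear_map_def by blast

lemma multilinear_form_cinner:
  assumes m: "multilinear_map A n K m"
  shows "multilinear_form A n (\<lambda>as. cinner x (blinfun_apply (m as) y))"
  unfolding multilinear_form_def
proof (intro conjI exI allI ballI impI)
  fix as bs a b c assume "a \<in> A" "b \<in> A" "set as \<subseteq> A \<and> set bs \<subseteq> A \<and> length as + 1 + length bs = n"
  then have "m (as @ (a + op_scaleC c b) # bs) = m (as @ a # bs) + op_scaleC c (m (as @ b # bs))"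
    using m unfolding multilinear_map_def by blast
  then show "cinner x (blinfun_apply (m (as @ (a + op_scaleC c b) # bs)) y) =
      cinner x (blinfun_apply (m (as @ a # bs)) y) + c * cinner x (blinfun_apply (m (as @ b # bs)) y)"
    by (simp add: blinfun.bilinear_simps op_scaleC_apply cinner_add_right cinner_scaleC_right)
next
  fix as assume "set as \<subseteq> A \<and> length as = n"
  then have "norm (m as) \<le> K * list_norm as" using m by (blast intro: multilinear_map_bound)
  then have "norm x * (norm (m as) * norm y) \<le> norm x * ((K * list_norm as) * norm y)"
    by (intro mult_left_mono mult_right_mono) auto
  moreover have "cmod (cinner x (blinfun_apply (m as) y)) \<le> norm x * (norm (m as) * norm y)"
    by (rule order_trans[OF cmod_cinner_le mult_left_mono[OF norm_blinfun norm_ge_zero]])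
  ultimately show "cmod (cinner x (blinfun_apply (m as) y)) \<le> (norm x * K * norm y) * list_norm as"
    by (simp add: mult_ac)
qed

lemma tensor_series_subset: "tensor_series B n a \<Longrightarrow> B \<subseteq> A \<Longrightarrow> tensor_series A n a"
  unfolding tensor_series_def by blast

lemma tensor_seriesD:
  assumes "tensor_series B n a"
  shows "length (a k) = n" "set (a k) \<subseteq> B" "summable (\<lambda>k. list_norm (a k))"
  using assms unfolding tensor_series_def by auto

lemma multilinear_map_sums:
  assumes m: "multilinear_map A n K m" and a: "tensor_series A n a"
  shows "summable (\<lambda>k. m (a k))" "norm (\<Sum>k. m (a k)) \<le> K * (\<Sum>k. list_norm (a k))"
proof -
  note aD = tensor_seriesD[OF a]
  have le: "norm (m (a k)) \<le> K * list_norm (a k)" for k by (rule multilinear_map_bound[OF m aD(2,1)])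
  have s: "summable (\<lambda>k. K * list_norm (a k))" by (rule summable_mult[OF aD(3)])
  show "summable (\<lambda>k. m (a k))" by (rule summable_comparison_test'[OF s]) (rule le)
  show "norm (\<Sum>k. m (a k)) \<le> K * (\<Sum>k. list_norm (a k))"
    unfolding suminf_mult[OF aD(3), symmetric] by (rule norm_suminf_le[OF le s])
qed

lemma multilinear_form_summable:
  assumes \<beta>: "multilinear_form A n \<beta>" and a: "tensor_series A n a"
  shows "summable (\<lambda>k. \<beta> (a k))"
proof -
  note aD = tensor_seriesD[OF a]
  obtain C where "\<And>as. set as \<subseteq> A \<Longrightarrow> length as = n \<Longrightarrow> cmod (\<beta> as) \<le> C * list_norm as"
    using \<beta> unfolding multilinear_form_def by blast
  then have "norm (\<beta> (a k)) \<le> C * list_norm (a k)" for k using aD(1,2) by blast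
  then show ?thesis by (intro summable_comparison_test'[OF summable_mult[OF aD(3)]])
qed

lemma elementary_sums:
  assumes a: "tensor_series A n a"
  shows "(\<lambda>k. elementary A (a k)) sums series_tensor A a"
  unfolding sums_fun_iff
proof
  fix \<beta>
  have "summable (\<lambda>k. elementary A (a k) \<beta>)"
    using multilinear_form_summable[OF _ a] tensor_seriesD(1)[OF a]
    by (cases "multilinear_form A n \<beta>") (simp_all add: elementary_def)
  then show "(\<lambda>k. elementary A (a k) \<beta>) sums series_tensor A a \<beta>"
    unfolding series_tensor_def by (rule summable_sums)
qed

lemma series_tensor_form:
  assumes "tensor_series A n a" "multilinear_form A n \<beta>"
  shows "series_tensor A a \<beta> = (\<Sum>k. \<beta> (a k))"
  using assms tensor_seriesD(1)[OF assms(1)] by (simp add: series_tensor_def elementary_def)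

lemma series_tensor_not_form:
  assumes "tensor_series A n a" "\<not> multilinear_form A n \<beta>"
  shows "series_tensor A a \<beta> = 0"
  using assms tensor_seriesD(1)[OF assms(1)] by (simp add: series_tensor_def elementary_def)

text \<open>The matrix coefficients of a bounded multilinear map are bounded forms, so tensors see them.\<close>

lemma series_tensor_eq:
  assumes m: "multilinear_map A n K m" and a: "tensor_series A n a" and a': "tensor_series A n a'"
    and eq: "series_tensor A a = series_tensor A a'"
  shows "(\<Sum>k. m (a k)) = (\<Sum>k. m (a' k))"
proof (rule blinfun_eqI, rule cinner_ext)
  fix y x
  have *: "cinner x (blinfun_apply (\<Sum>k. m (a k)) y) = series_tensor A a (\<lambda>as. cinner x (blinfun_apply (m as) y))"
    if a: "tensor_series A n a" for a
  proof -
    have "bounded_linear (\<lambda>T. cinner x (blinfun_apply T y))"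
      by (rule bounded_linear_compose[OF bounded_bilinear.bounded_linear_right[OF bounded_bilinear_cinner] blinfun.bounded_linear_left])
    from bounded_linear.suminf[OF this multilinear_map_sums(1)[OF m a]] show ?thesis
      unfolding series_tensor_form[OF a multilinear_form_cinner[OF m]] .
  qed
  show "cinner x (blinfun_apply (\<Sum>k. m (a k)) y) = cinner x (blinfun_apply (\<Sum>k. m (a' k)) y)"
    unfolding *[OF a] *[OF a'] eq ..
qed

abbreviation ext :: "'h::complex_hilbert_space oper set \<Rightarrow> nat \<Rightarrow> ('h oper list \<Rightarrow> 'h oper) \<Rightarrow> 'h tensor \<Rightarrow> 'h oper" where
  "ext A \<equiv> extend_linearly A A"

text \<open>The value \<open>m'\<close> matters only on \<open>B\<close>, but a tensor determines a
  series only as far as forms on the whole of \<open>A\<close> can tell. Independence of the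
  representation therefore comes from a bounded multilinear map \<open>m\<close> on \<open>A\<close>
  that agrees with \<open>m'\<close> on \<open>B\<close>.\<close>

lemma extend_linearly_eq:
  assumes m: "multilinear_map A n K m" and B: "B \<subseteq> A" and a: "tensor_series B n a"
    and agree: "\<And>as. set as \<subseteq> B \<Longrightarrow> length as = n \<Longrightarrow> m' as = m as"
  shows "extend_linearly A B n m' (series_tensor A a) = (\<Sum>k. m (a k))"
proof -
  have *: "(\<lambda>k. m' (a' k)) sums (\<Sum>k. m (a k))" if a': "tensor_series B n a'" and eq: "series_tensor A a' = series_tensor A a" for a'
  proof -
    have "m' (a' k) = m (a' k)" for k using tensor_seriesD(1,2)[OF a'] by (rule agree[rotated])
    moreover have "(\<lambda>k. m (a' k)) sums (\<Sum>k. m (a' k))"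
      by (rule summable_sums[OF multilinear_map_sums(1)[OF m tensor_series_subset[OF a' B]]])
    ultimately show ?thesis
      using series_tensor_eq[OF m tensor_series_subset[OF a' B] tensor_series_subset[OF a B] eq] by simp
  qed
  show ?thesis unfolding extend_linearly_def
  proof (rule the_equality)
    show "\<forall>a'. tensor_series B n a' \<and> series_tensor A a' = series_tensor A a \<longrightarrow> (\<lambda>k. m' (a' k)) sums (\<Sum>k. m (a k))"
      using * by blast
    fix y assume "\<forall>a'. tensor_series B n a' \<and> series_tensor A a' = series_tensor A a \<longrightarrow> (\<lambda>k. m' (a' k)) sums y"
    then have "(\<lambda>k. m' (a k)) sums y" using a by blast
    then show "y = (\<Sum>k. m (a k))" using *[OF a refl] by (rule sums_unique2)
  qed
qed

lemma ext_series:
  "multilinear_map A n K m \<Longrightarrow> tensor_series A n a \<Longrightarrow> ext A n m (series_tensor A a) = (\<Sum>k. m (a k))"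
  by (rule extend_linearly_eq[where B=A]) auto

lemma tensor_powerE:
  assumes "z \<in> tensor_power_of A B n"
  obtains a where "tensor_series B n a" "z = series_tensor A a"
  using assms unfolding tensor_power_of_def by blast

lemma extend_linearly_restrict:
  assumes m: "multilinear_map A n K m" and B: "B \<subseteq> A" and z: "z \<in> tensor_power_of A B n"
    and agree: "\<And>as. set as \<subseteq> B \<Longrightarrow> length as = n \<Longrightarrow> m' as = m as"
  shows "extend_linearly A B n m' z = ext A n m z"
proof -
  obtain a where a: "tensor_series B n a" "z = series_tensor A a" using z by (rule tensor_powerE)
  have "extend_linearly A B n m' z = (\<Sum>k. m (a k))" unfolding a(2) by (rule extend_linearly_eq[OF m B a(1) agree])
  then show ?thesis unfolding a(2) ext_series[OF m tensor_series_subset[OF a(1) B]] .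
qed

lemma ext_cong:
  assumes "z \<in> tensor_power_of A B n" "B \<subseteq> A" "multilinear_map A n K m" "multilinear_map A n K' m'"
    and "\<And>as. set as \<subseteq> B \<Longrightarrow> length as = n \<Longrightarrow> m as = m' as"
  shows "ext A n m z = ext A n m' z"
proof -
  have "extend_linearly A B n m z = ext A n m' z" by (rule extend_linearly_restrict[OF assms(4,2,1,5)])
  moreover have "extend_linearly A B n m z = ext A n m z" by (rule extend_linearly_restrict[OF assms(3,2,1)]) auto
  ultimately show ?thesis by simp
qed

lemma tensor_power_mono: "B \<subseteq> B' \<Longrightarrow> tensor_power_of A B n \<subseteq> tensor_power_of A B' n"
  unfolding tensor_power_of_def using tensor_series_subset by blast

lemma norm_ext_le:
  assumes m: "multilinear_map A n K m" and K: "0 \<le> K" and z: "z \<in> tensor_power_of A A n"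
  shows "norm (ext A n m z) \<le> K * proj_norm A n z"
proof -
  let ?S = "{\<Sum>k. list_norm (a k) | a. tensor_series A n a \<and> series_tensor A a = z}"
  have le: "norm (ext A n m z) \<le> K * r" if "r \<in> ?S" for r
    using that ext_series[OF m] multilinear_map_sums(2)[OF m] by auto
  have ne: "?S \<noteq> {}" using z by (auto elim: tensor_powerE)
  show ?thesis
  proof (cases "K = 0")
    case True
    then show ?thesis using le ne by auto
  next
    case False
    then have "norm (ext A n m z) / K \<le> Inf ?S"
      using K le by (intro cInf_greatest[OF ne]) (simp add: field_simps)
    then show ?thesis using K False by (simp add: proj_norm_def field_simps)
  qed
qed

lemma proj_norm_nonneg:
  assumes z: "z \<in> tensor_power_of A A n" shows "0 \<le> proj_norm A n z"
  unfolding proj_norm_def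
  by (rule cInf_greatest) (use z in \<open>auto elim!: tensor_powerE intro!: suminf_nonneg list_norm_nonneg dest: tensor_seriesD(3)\<close>)

lemma ext_add:
  assumes m: "multilinear_map A n K m" and z: "z \<in> tensor_power_of A A n" "z' \<in> tensor_power_of A A n"
  shows "z + z' \<in> tensor_power_of A A n" "ext A n m (z + z') = ext A n m z + ext A n m z'"
proof -
  obtain a a' where a: "tensor_series A n a" "z = series_tensor A a" and a': "tensor_series A n a'" "z' = series_tensor A a'"
    using z by (elim tensor_powerE)
  note aD = tensor_seriesD[OF a(1)] and aD' = tensor_seriesD[OF a'(1)]
  have c: "tensor_series A n (interleave a a')"
    unfolding tensor_series_def
    using aD(1,2) aD'(1,2) summable_interleave[OF aD(3) aD'(3)]
    by (simp add: interleave_def[abs_def] if_distrib cong: if_cong)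
  have "(\<lambda>k. elementary A (interleave a a' k) \<beta>) sums (z \<beta> + z' \<beta>)" for \<beta>
  proof -
    have "(\<lambda>k. elementary A (a k) \<beta>) sums z \<beta>" "(\<lambda>k. elementary A (a' k) \<beta>) sums z' \<beta>"
      using elementary_sums[OF a(1)] elementary_sums[OF a'(1)] unfolding sums_fun_iff a(2) a'(2) by auto
    from sums_interleave[OF this] show ?thesis
      by (simp add: interleave_def[abs_def] if_distrib[of "\<lambda>x. elementary A x \<beta>"] cong: if_cong)
  qed
  then have eq: "z + z' = series_tensor A (interleave a a')"
    unfolding series_tensor_def by (intro ext) (simp add: sums_unique)
  then show "z + z' \<in> tensor_power_of A A n" using c unfolding tensor_power_of_def by blast
  have "(\<lambda>k. m (interleave a a' k)) sums ((\<Sum>k. m (a k)) + (\<Sum>k. m (a' k)))"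
    using sums_interleave[OF summable_sums summable_sums, OF multilinear_map_sums(1)[OF m a(1)] multilinear_map_sums(1)[OF m a'(1)]]
    by (simp add: interleave_def[abs_def] if_distrib[of m] cong: if_cong)
  then show "ext A n m (z + z') = ext A n m z + ext A n m z'"
    unfolding eq ext_series[OF m c] unfolding a(2) a'(2) ext_series[OF m a(1)] ext_series[OF m a'(1)] by (rule sums_unique[symmetric])
qed


text \<open>The sign is put on the first factor of every elementary tensor, which exists because the
  degree is positive. That this negates forms and maps follows from linearity in this slot.\<close>

lemma ext_uminus:
  assumes m: "multilinear_map A n K m" and z: "z \<in> tensor_power_of A A n"
    and n: "0 < n" and A: "\<And>a c. a \<in> A \<Longrightarrow> op_scaleC c a \<in> A"
  shows "- z \<in> tensor_power_of A A n" "ext A n m (- z) = - ext A n m z"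
proof -
  obtain a where a: "tensor_series A n a" "z = series_tensor A a" using z by (rule tensor_powerE)
  note aD = tensor_seriesD[OF a(1)]
  define a' where "a' k = op_scaleC (- 1) (hd (a k)) # tl (a k)" for k
  have hd: "hd (a k) \<in> A" "set (tl (a k)) \<subseteq> A" "Suc (length (tl (a k))) = n" for k
    using aD(1,2)[of k] n by (cases "a k"; simp)+
  have cons: "hd (a k) # tl (a k) = a k" for k
    using aD(1)[of k] n by (cases "a k") simp_all
  have neg: "op_scaleC (- 1) b = - b" for b :: "'a oper"
    by (simp add: op_scaleC_simps)
  have list_norm: "list_norm (a' k) = list_norm (a k)" for k
    using aD(1)[of k] n unfolding a'_def neg by (cases "a k") simp_all
  have a'_len: "length (a' k) = n" "set (a' k) \<subseteq> A" for k
    using hd[of k] A[OF hd(1)[of k], of "- 1"] by (simp_all add: a'_def)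
  then have a': "tensor_series A n a'" using aD(3) unfolding tensor_series_def by (simp add: list_norm)
  have A0: "0 \<in> A" using A[OF hd(1), of 0] by (simp add: op_scaleC_simps)
  have m': "m (a' k) = - m (a k)" for k
  proof -
    have "m (0 # tl (a k)) = 0"
      using multilinear_map_bound[OF m, of "0 # tl (a k)"] hd(2,3)[of k] A0 by simp
    then show ?thesis
      using multilinear_map_linear[OF m A0 hd(1)[of k] _ hd(2)[of k], of "[]" "- 1"] hd(3)[of k] by (simp add: a'_def neg cons)
  qed
  have f': "\<beta> (a' k) = - \<beta> (a k)" if \<beta>: "multilinear_form A n \<beta>" for \<beta> k
  proof -
    have lin: "\<beta> (as @ (a + op_scaleC c b) # bs) = \<beta> (as @ a # bs) + c * \<beta> (as @ b # bs)"
      if "a \<in> A" "b \<in> A" "set as \<subseteq> A" "set bs \<subseteq> A" "length as + 1 + length bs = n" for a b as bs c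
      using \<beta> that unfolding multilinear_form_def by blast
    have "\<beta> (0 # tl (a k)) = 0"
      using lin[OF hd(1)[of k] hd(1)[of k] _ hd(2)[of k], of "[]" "- 1"] hd(3)[of k] by (simp add: neg)
    then show ?thesis
      using lin[OF A0 hd(1)[of k] _ hd(2)[of k], of "[]" "- 1"] hd(3)[of k] by (simp add: a'_def neg cons)
  qed
  have eq: "- z = series_tensor A a'"
  proof (rule HOL.ext)
    fix \<beta> show "(- z) \<beta> = series_tensor A a' \<beta>"
    proof (cases "multilinear_form A n \<beta>")
      case True
      then show ?thesis unfolding a(2) fun_Compl_def series_tensor_form[OF a(1) True] series_tensor_form[OF a' True]
        by (simp add: f' suminf_minus[OF multilinear_form_summable[OF True a(1)]])
    next
      case False
      then show ?thesis unfolding a(2) by (simp add: series_tensor_not_form[OF a(1)] series_tensor_not_form[OF a'])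
    qed
  qed
  then show "- z \<in> tensor_power_of A A n" using a' unfolding tensor_power_of_def by blast
  show "ext A n m (- z) = - ext A n m z"
    unfolding eq ext_series[OF m a'] unfolding a(2) ext_series[OF m a(1)]
    by (simp add: m' suminf_minus[OF multilinear_map_sums(1)[OF m a(1)]])
qed

lemma ext_diff:
  assumes m: "multilinear_map A n K m" and z: "z \<in> tensor_power_of A A n" "z' \<in> tensor_power_of A A n"
    and n: "0 < n" and A: "\<And>a c. a \<in> A \<Longrightarrow> op_scaleC c a \<in> A"
  shows "z - z' \<in> tensor_power_of A A n" "ext A n m (z - z') = ext A n m z - ext A n m z'"
  using ext_add[OF m z(1) ext_uminus(1)[OF m z(2) n A]] ext_uminus(2)[OF m z(2) n A] by simp_all

lemma multilinear_map_add:
  assumes "multilinear_map A n K m" "multilinear_map A n K' m'"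
  shows "multilinear_map A n (K + K') (\<lambda>as. m as + m' as)"
  unfolding multilinear_map_def
proof (intro conjI allI ballI impI)
  fix as bs a b c assume *: "a \<in> A" "b \<in> A" "set as \<subseteq> A \<and> set bs \<subseteq> A \<and> length as + 1 + length bs = n"
  have "m (as @ (a + op_scaleC c b) # bs) = m (as @ a # bs) + op_scaleC c (m (as @ b # bs))"
    "m' (as @ (a + op_scaleC c b) # bs) = m' (as @ a # bs) + op_scaleC c (m' (as @ b # bs))"
    using assms * unfolding multilinear_map_def by blast+
  then show "m (as @ (a + op_scaleC c b) # bs) + m' (as @ (a + op_scaleC c b) # bs) =
      m (as @ a # bs) + m' (as @ a # bs) + op_scaleC c (m (as @ b # bs) + m' (as @ b # bs))"
    by (simp add: op_scaleC_simps)
next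
  fix as assume "set as \<subseteq> A \<and> length as = n"
  then have "norm (m as) \<le> K * list_norm as" "norm (m' as) \<le> K' * list_norm as"
    using assms by (auto intro: multilinear_map_bound)
  then show "norm (m as + m' as) \<le> (K + K') * list_norm as"
    unfolding distrib_right by (rule norm_triangle_mono)
qed

lemma multilinear_map_scaleR:
  assumes "multilinear_map A n K m"
  shows "multilinear_map A n (\<bar>r\<bar> * K) (\<lambda>as. r *\<^sub>R m as)"
  unfolding multilinear_map_def
proof (intro conjI allI ballI impI)
  fix as bs a b c assume *: "a \<in> A" "b \<in> A" "set as \<subseteq> A \<and> set bs \<subseteq> A \<and> length as + 1 + length bs = n"
  have "m (as @ (a + op_scaleC c b) # bs) = m (as @ a # bs) + op_scaleC c (m (as @ b # bs))"
    using assms * unfolding multilinear_map_def by blast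
  then show "r *\<^sub>R m (as @ (a + op_scaleC c b) # bs) = r *\<^sub>R m (as @ a # bs) + op_scaleC c (r *\<^sub>R m (as @ b # bs))"
    by (simp add: op_scaleC_simps scaleR_add_right)
next
  fix as assume "set as \<subseteq> A \<and> length as = n"
  then have "norm (m as) \<le> K * list_norm as" using assms by (auto intro: multilinear_map_bound)
  then show "norm (r *\<^sub>R m as) \<le> \<bar>r\<bar> * K * list_norm as"
    by (simp add: mult.assoc mult_left_mono)
qed

lemma ext_add_map:
  assumes "multilinear_map A n K m" "multilinear_map A n K' m'" "z \<in> tensor_power_of A A n"
  shows "ext A n (\<lambda>as. m as + m' as) z = ext A n m z + ext A n m' z"
proof -
  obtain a where a: "tensor_series A n a" "z = series_tensor A a" using assms(3) by (rule tensor_powerE)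
  show ?thesis
    unfolding a(2) ext_series[OF assms(1) a(1)] ext_series[OF assms(2) a(1)]
      ext_series[OF multilinear_map_add[OF assms(1,2)] a(1)]
    by (rule suminf_add[symmetric]) (rule multilinear_map_sums[OF assms(1) a(1)] multilinear_map_sums[OF assms(2) a(1)])+
qed

lemma ext_scaleR_map:
  assumes "multilinear_map A n K m" "z \<in> tensor_power_of A A n"
  shows "ext A n (\<lambda>as. r *\<^sub>R m as) z = r *\<^sub>R ext A n m z"
proof -
  obtain a where a: "tensor_series A n a" "z = series_tensor A a" using assms(2) by (rule tensor_powerE)
  show ?thesis
    unfolding a(2) ext_series[OF assms(1) a(1)] ext_series[OF multilinear_map_scaleR[OF assms(1)] a(1)]
    by (rule suminf_scaleR_right[symmetric]) (rule multilinear_map_sums[OF assms(1) a(1)])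
qed

lemma ext_closed:
  assumes m: "multilinear_map A n K m" and z: "z \<in> tensor_power_of A B n" and B: "B \<subseteq> A"
    and S: "closed S" "0 \<in> S" "\<And>x y. x \<in> S \<Longrightarrow> y \<in> S \<Longrightarrow> x + y \<in> S"
    and val: "\<And>as. set as \<subseteq> B \<Longrightarrow> length as = n \<Longrightarrow> m as \<in> S"
  shows "ext A n m z \<in> S"
proof -
  obtain a where a: "tensor_series B n a" "z = series_tensor A a" using z by (rule tensor_powerE)
  note aA = tensor_series_subset[OF a(1) B]
  have "(\<lambda>N. \<Sum>k<N. m (a k)) \<longlonglongrightarrow> ext A n m z"
    unfolding a(2) ext_series[OF m aA] by (rule summable_LIMSEQ[OF multilinear_map_sums(1)[OF m aA]])
  moreover have "(\<Sum>k<N. m (a k)) \<in> S" for N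
    using S(2,3) val[OF tensor_seriesD(2,1)[OF a(1)]] by (induction N) simp_all
  ultimately show ?thesis by (rule closed_sequentially[OF S(1), rotated])
qed

lemma ext_cinner_zero:
  assumes m: "multilinear_map A n K m" and z: "z \<in> tensor_power_of A B n" and B: "B \<subseteq> A"
    and val: "\<And>as. set as \<subseteq> B \<Longrightarrow> length as = n \<Longrightarrow> cinner x (blinfun_apply (m as) y) = 0"
  shows "cinner x (blinfun_apply (ext A n m z) y) = 0"
proof -
  have "closed {T :: 'a oper. cinner x (blinfun_apply T y) = 0}"
  proof -
    have "bounded_linear (\<lambda>T :: 'a oper. cinner x (blinfun_apply T y))"
      by (rule bounded_linear_compose[OF bounded_bilinear.bounded_linear_right[OF bounded_bilinear_cinner] blinfun.bounded_linear_left])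
    from closed_vimage[OF closed_singleton linear_continuous_on[OF this], of 0]
    show ?thesis by (simp add: vimage_def)
  qed
  from ext_closed[OF m z B this] val show ?thesis
    by (auto simp: blinfun.bilinear_simps cinner_zero cinner_add_right)
qed

subsection \<open>Contraction of tensors with an increment\<close>

lemma list_norm_contract: "list_norm (as @ (b o\<^sub>L Y o\<^sub>L c) # bs) \<le> norm Y * list_norm (as @ b # c # bs)"
proof -
  have "list_norm as * (norm (b o\<^sub>L Y o\<^sub>L c) * list_norm bs) \<le> list_norm as * ((norm b * norm Y * norm c) * list_norm bs)"
    by (intro mult_left_mono mult_right_mono norm_sandwich_le list_norm_nonneg)
  then show ?thesis by (simp add: mult_ac)
qed

definition contract :: "nat \<Rightarrow> 'h::complex_hilbert_space oper \<Rightarrow> 'h oper list \<Rightarrow> 'h oper list" where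
  "contract i Y as = (if i = 0 then [(as ! 0) o\<^sub>L Y o\<^sub>L (as ! 1), as ! 2] else [as ! 0, (as ! 1) o\<^sub>L Y o\<^sub>L (as ! 2)])"

lemma length_3E:
  assumes "length as = 3" obtains x y z where "as = [x, y, z]"
  using assms by (auto simp: numeral_3_eq_3 length_Suc_conv)

lemma list_norm_contract_le: "length as = 3 \<Longrightarrow> list_norm (contract i Y as) \<le> norm Y * list_norm as"
proof -
  assume "length as = 3"
  then obtain x y z where "as = [x, y, z]" by (rule length_3E)
  then show ?thesis
    using list_norm_contract[of "[]" x Y y "[z]"] list_norm_contract[of "[x]" y Y z "[]"]
    by (auto simp: contract_def)
qed

locale operator_algebra =
  fixes A :: "'h::complex_hilbert_space oper set"
  assumes sub_cops: "A \<subseteq> cops"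
    and add_closed: "a \<in> A \<Longrightarrow> b \<in> A \<Longrightarrow> a + b \<in> A"
    and scale_closed: "a \<in> A \<Longrightarrow> op_scaleC c a \<in> A"
    and comp_closed: "a \<in> A \<Longrightarrow> b \<in> A \<Longrightarrow> (a o\<^sub>L b) \<in> A"
    and adj_closed: "a \<in> A \<Longrightarrow> adj a \<in> A"
begin

lemma contract_in: "Y \<in> A \<Longrightarrow> set as \<subseteq> A \<Longrightarrow> length as = 3 \<Longrightarrow> set (contract i Y as) \<subseteq> A"
  by (elim length_3E) (simp add: contract_def comp_closed)

lemma length_contract: "length (contract i Y as) = 2"
  by (simp add: contract_def)

lemma tensor_series_contract:
  assumes Y: "Y \<in> A" and a: "tensor_series A 3 a"
  shows "tensor_series A 2 (\<lambda>k. contract i Y (a k))"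
proof -
  note aD = tensor_seriesD[OF a]
  have "summable (\<lambda>k. list_norm (contract i Y (a k)))"
    by (rule summable_comparison_test'[OF summable_mult[OF aD(3)]])
       (use list_norm_contract_le[OF aD(1), of i Y] in \<open>simp add: abs_of_nonneg[OF list_norm_nonneg]\<close>)
  then show ?thesis unfolding tensor_series_def using contract_in[OF Y aD(2,1)] length_contract by auto
qed

text \<open>Reduces linearity in an arbitrary slot to the three possible positions. The predicate
  \<open>P\<close> relates the list with the sum, the scalar and the two lists of the expansion, so
  that it serves scalar forms and operator-valued maps alike.\<close>

lemma multilinear_3I:
  assumes "\<And>a b c d e. a \<in> A \<Longrightarrow> b \<in> A \<Longrightarrow> d \<in> A \<Longrightarrow> e \<in> A \<Longrightarrow>
      P [a + op_scaleC c b, d, e] c [a, d, e] [b, d, e] \<and> P [d, a + op_scaleC c b, e] c [d, a, e] [d, b, e] \<and>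
      P [d, e, a + op_scaleC c b] c [d, e, a] [d, e, b]"
    and "a \<in> A" "b \<in> A" "set as \<subseteq> A \<and> set bs \<subseteq> A \<and> length as + 1 + length bs = 3"
  shows "P (as @ (a + op_scaleC c b) # bs) c (as @ a # bs) (as @ b # bs)"
proof -
  consider "as = []" "length bs = 2" | "length as = 1" "length bs = 1" | "length as = 2" "bs = []"
  proof -
    have "length as = 0 \<and> length bs = 2 \<or> length as = 1 \<and> length bs = 1 \<or> length as = 2 \<and> length bs = 0"
      using assms(4) by arith
    then show thesis using that by auto
  qed
  then show ?thesis
    using assms by cases (auto simp: numeral_2_eq_2 length_Suc_conv)
qed

lemma multilinear_form_contract:
  assumes Y: "Y \<in> A" and \<beta>: "multilinear_form A 2 \<beta>"
  shows "multilinear_form A 3 (\<lambda>as. \<beta> (contract i Y as))"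
proof -
  have lin: "\<beta> (as @ (a + op_scaleC c b) # bs) = \<beta> (as @ a # bs) + c * \<beta> (as @ b # bs)"
    if "a \<in> A" "b \<in> A" "set as \<subseteq> A" "set bs \<subseteq> A" "length as + 1 + length bs = 2" for as a b bs c
    using \<beta> that unfolding multilinear_form_def by blast
  have lin1: "\<beta> [a + op_scaleC c b, d] = \<beta> [a, d] + c * \<beta> [b, d]"
    and lin2: "\<beta> [d, a + op_scaleC c b] = \<beta> [d, a] + c * \<beta> [d, b]"
    if "a \<in> A" "b \<in> A" "d \<in> A" for a b c d
    using lin[of a b "[]" "[d]"] lin[of a b "[d]" "[]"] that by simp_all
  have comp: "((a + op_scaleC c b) o\<^sub>L T) = (a o\<^sub>L T) + op_scaleC c (b o\<^sub>L T)"
    "((d o\<^sub>L Y) o\<^sub>L (a + op_scaleC c b)) = (d o\<^sub>L Y o\<^sub>L a) + op_scaleC c (d o\<^sub>L Y o\<^sub>L b)"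
    if "a \<in> A" "b \<in> A" "d \<in> A" for a b c d T
    using that Y sub_cops by (auto simp: blinfun_compose_simps op_scaleC_comp cops_intros subset_iff)
  obtain C where C: "\<And>as. set as \<subseteq> A \<Longrightarrow> length as = 2 \<Longrightarrow> cmod (\<beta> as) \<le> C * list_norm as"
    using \<beta> unfolding multilinear_form_def by blast
  have bound: "cmod (\<beta> (contract i Y as)) \<le> (\<bar>C\<bar> * norm Y) * list_norm as"
    if as: "set as \<subseteq> A" "length as = 3" for as
  proof -
    have "cmod (\<beta> (contract i Y as)) \<le> C * list_norm (contract i Y as)"
      using as Y by (intro C contract_in length_contract) auto
    also have "\<dots> \<le> \<bar>C\<bar> * list_norm (contract i Y as)" by (intro mult_right_mono list_norm_nonneg) simp
    also have "\<dots> \<le> \<bar>C\<bar> * (norm Y * list_norm as)" by (intro mult_left_mono list_norm_contract_le as) simp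
    finally show ?thesis by (simp add: mult_ac)
  qed
  have "\<beta> (contract i Y (as @ (a + op_scaleC c b) # bs)) = \<beta> (contract i Y (as @ a # bs)) + c * \<beta> (contract i Y (as @ b # bs))"
    if "a \<in> A" "b \<in> A" "set as \<subseteq> A \<and> set bs \<subseteq> A \<and> length as + 1 + length bs = 3" for as a b bs c
    by (rule multilinear_3I[where P="\<lambda>x c y z. \<beta> (contract i Y x) = \<beta> (contract i Y y) + c * \<beta> (contract i Y z)", OF _ that])
       (use Y in \<open>auto simp: contract_def comp lin1 lin2 comp_closed blinfun_compose_assoc'[symmetric]\<close>)
  with bound show ?thesis unfolding multilinear_form_def by blast
qed

definition contraction :: "nat \<Rightarrow> 'h oper \<Rightarrow> 'h tensor \<Rightarrow> 'h tensor" where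
  "contraction i Y z = extend_linearly A A 3 (\<lambda>as. elementary A (contract i Y as)) z"

lemma sharp_contraction: "sharp_left A Y z = contraction 0 Y z" "sharp_right A z Y = contraction (Suc 0) Y z"
  by (simp_all add: sharp_left_def sharp_right_def contraction_def contract_def[abs_def])

text \<open>Contraction is well defined on tensors because it pulls bounded bilinear forms back to
  bounded trilinear forms.\<close>

lemma contraction_series:
  assumes Y: "Y \<in> A" and a: "tensor_series A 3 a"
  shows "contraction i Y (series_tensor A a) = series_tensor A (\<lambda>k. contract i Y (a k))"
proof -
  have eq: "series_tensor A (\<lambda>k. contract i Y (a' k)) = series_tensor A (\<lambda>k. contract i Y (a k))"
    if a': "tensor_series A 3 a'" and e: "series_tensor A a' = series_tensor A a" for a'
  proof (rule HOL.ext)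
    fix \<beta>
    show "series_tensor A (\<lambda>k. contract i Y (a' k)) \<beta> = series_tensor A (\<lambda>k. contract i Y (a k)) \<beta>"
    proof (cases "multilinear_form A 2 \<beta>")
      case True
      note f = multilinear_form_contract[OF Y True, of i]
      show ?thesis
        using fun_cong[OF e, of "\<lambda>as. \<beta> (contract i Y as)"]
        unfolding series_tensor_form[OF a f] series_tensor_form[OF a' f]
          series_tensor_form[OF tensor_series_contract[OF Y a] True] series_tensor_form[OF tensor_series_contract[OF Y a'] True] .
    next
      case False
      show ?thesis
        unfolding series_tensor_not_form[OF tensor_series_contract[OF Y a] False] series_tensor_not_form[OF tensor_series_contract[OF Y a'] False] ..
    qed
  qed
  let ?y = "series_tensor A (\<lambda>k. contract i Y (a k))"
  show ?thesis unfolding contraction_def extend_linearly_def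
  proof (rule the_equality)
    show "\<forall>a'. tensor_series A 3 a' \<and> series_tensor A a' = series_tensor A a \<longrightarrow> (\<lambda>k. elementary A (contract i Y (a' k))) sums ?y"
      using elementary_sums[OF tensor_series_contract[OF Y]] eq by metis
    fix y assume "\<forall>a'. tensor_series A 3 a' \<and> series_tensor A a' = series_tensor A a \<longrightarrow> (\<lambda>k. elementary A (contract i Y (a' k))) sums y"
    then have "(\<lambda>k. elementary A (contract i Y (a k))) sums y" using a by blast
    with elementary_sums[OF tensor_series_contract[OF Y a], of i]
    show "y = ?y" unfolding sums_fun_iff using sums_unique2 by (intro HOL.ext) blast
  qed
qed

lemma contraction_tensor_power:
  assumes Y: "Y \<in> A" and z: "z \<in> tensor_power_of A A 3"
  shows "contraction i Y z \<in> tensor_power_of A A 2"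
  using z by (rule tensor_powerE) (use contraction_series[OF Y] tensor_series_contract[OF Y] in \<open>auto simp: tensor_power_of_def\<close>)

lemma ext_contraction:
  assumes Y: "Y \<in> A" and z: "z \<in> tensor_power_of A A 3"
    and m: "multilinear_map A 2 K m" and m': "multilinear_map A 3 K' (\<lambda>as. m (contract i Y as))"
  shows "ext A 2 m (contraction i Y z) = ext A 3 (\<lambda>as. m (contract i Y as)) z"
proof -
  obtain a where a: "tensor_series A 3 a" "z = series_tensor A a" using z by (rule tensor_powerE)
  show ?thesis
    unfolding a(2) contraction_series[OF Y a(1)] ext_series[OF m tensor_series_contract[OF Y a(1)]] ext_series[OF m' a(1)] ..
qed

definition sandwich2 :: "'h oper \<Rightarrow> 'h oper list \<Rightarrow> 'h oper" where
  "sandwich2 Y as = (as ! 0) o\<^sub>L Y o\<^sub>L (as ! 1)"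

text \<open>The common shape of all second-order terms: the outer factors multiply from the two
  sides, and a map acts on the middle factor. For \<open>\<phi>\<close> the area, its adjoint
  version and the products with two increments will be used.\<close>

definition sandwich3 :: "('h oper \<Rightarrow> 'h oper) \<Rightarrow> 'h oper list \<Rightarrow> 'h oper" where
  "sandwich3 \<phi> as = (as ! 0) o\<^sub>L \<phi> (as ! 1) o\<^sub>L (as ! 2)"

lemma sharp_ext: "sharp A z Y = ext A 2 (sandwich2 Y) z"
  by (simp add: sharp_def sandwich2_def[abs_def])

lemma multilinear_sandwich3:
  assumes \<phi>: "\<And>a. a \<in> A \<Longrightarrow> \<phi> a \<in> cops" "\<And>a b c. a \<in> A \<Longrightarrow> b \<in> A \<Longrightarrow> \<phi> (a + op_scaleC c b) = \<phi> a + op_scaleC c (\<phi> b)"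
    and K: "\<And>a. a \<in> A \<Longrightarrow> norm (\<phi> a) \<le> K * norm a"
  shows "multilinear_map A 3 K (sandwich3 \<phi>)"
  unfolding multilinear_map_def
proof (intro conjI allI ballI impI)
  fix as bs a b c assume *: "a \<in> A" "b \<in> A" "set as \<subseteq> A \<and> set bs \<subseteq> A \<and> length as + 1 + length bs = 3"
  show "sandwich3 \<phi> (as @ (a + op_scaleC c b) # bs) = sandwich3 \<phi> (as @ a # bs) + op_scaleC c (sandwich3 \<phi> (as @ b # bs))"
    by (rule multilinear_3I[where P="\<lambda>x c y z. sandwich3 \<phi> x = sandwich3 \<phi> y + op_scaleC c (sandwich3 \<phi> z)", OF _ *])
       (use \<phi> sub_cops in \<open>auto simp: sandwich3_def blinfun_compose_simps op_scaleC_comp op_scaleC_simps cops_intros subset_iff\<close>)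
next
  fix as assume *: "set as \<subseteq> A \<and> length as = 3"
  then obtain x y z where as: "as = [x, y, z]" by (auto elim: length_3E)
  have "norm (sandwich3 \<phi> as) \<le> norm x * norm (\<phi> y) * norm z"
    unfolding sandwich3_def as by (simp add: norm_sandwich_le)
  also have "\<dots> \<le> norm x * (K * norm y) * norm z"
    using * as by (intro mult_right_mono mult_left_mono K) auto
  finally show "norm (sandwich3 \<phi> as) \<le> K * list_norm as" by (simp add: as mult_ac)
qed

lemma multilinear_sandwich2:
  assumes Y: "Y \<in> cops"
  shows "multilinear_map A 2 (norm Y) (sandwich2 Y)"
  unfolding multilinear_map_def
proof (intro conjI allI ballI impI)
  fix as bs a b c assume *: "a \<in> A" "b \<in> A" "set as \<subseteq> A \<and> set bs \<subseteq> A \<and> length as + 1 + length bs = 2"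
  then consider "as = []" "length bs = 1" | "length as = 1" "bs = []"
    by (cases "length as"; cases "length bs") auto
  then show "sandwich2 Y (as @ (a + op_scaleC c b) # bs) = sandwich2 Y (as @ a # bs) + op_scaleC c (sandwich2 Y (as @ b # bs))"
    by cases (use * Y sub_cops in \<open>auto simp: length_Suc_conv sandwich2_def blinfun_compose_simps op_scaleC_comp op_scaleC_simps cops_intros subset_iff\<close>)
next
  fix as assume *: "set as \<subseteq> A \<and> length as = 2"
  then obtain x y where as: "as = [x, y]" by (auto simp: numeral_2_eq_2 length_Suc_conv)
  show "norm (sandwich2 Y as) \<le> norm Y * list_norm as"
    using norm_sandwich_le[of x Y y] by (simp add: as sandwich2_def mult_ac)
qed

lemma sharp_elementary:
  assumes Y: "Y \<in> cops" and ab: "a \<in> A" "b \<in> A"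
  shows "sharp A (elementary A [a, b]) Y = a o\<^sub>L Y o\<^sub>L b"
proof -
  \<comment> \<open>An elementary tensor as a series; all terms after the first are the tensor of
    zeros.\<close>
  define w where "w k = (if k = (0::nat) then [a, b] else [0, 0])" for k
  have A0: "0 \<in> A" using scale_closed[OF ab(1), of 0] by (simp add: op_scaleC_simps)
  have w0: "list_norm (w k) = 0" "sandwich2 Y (w k) = 0" if "k \<notin> {0}" for k
    using that by (simp_all add: w_def sandwich2_def blinfun_compose_simps)
  have "summable (\<lambda>k. list_norm (w k))" by (rule summable_finite[of "{0}"]) (simp_all add: w0)
  then have w: "tensor_series A 2 w" unfolding tensor_series_def using ab A0 by (simp add: w_def)
  have "elementary A [a, b] \<beta> = series_tensor A w \<beta>" for \<beta>
  proof (cases "multilinear_form A 2 \<beta>")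
    case True
    then have z: "\<beta> (w k) = 0" if "k \<notin> {0}" for k
    proof -
      obtain C where "\<And>as. set as \<subseteq> A \<Longrightarrow> length as = 2 \<Longrightarrow> cmod (\<beta> as) \<le> C * list_norm as"
        using True unfolding multilinear_form_def by blast
      then have "cmod (\<beta> (w k)) \<le> C * list_norm (w k)" using tensor_seriesD[OF w] by blast
      then show ?thesis using w0[OF that] by simp
    qed
    then have "(\<Sum>k. \<beta> (w k)) = \<beta> (w 0)" using suminf_finite[of "{0}" "\<lambda>k. \<beta> (w k)"] by simp
    then show ?thesis unfolding series_tensor_form[OF w True] using True by (simp add: elementary_def w_def numeral_2_eq_2)
  next
    case False
    then show ?thesis unfolding series_tensor_not_form[OF w False] by (simp add: elementary_def numeral_2_eq_2)
  qed
  then have eq: "elementary A [a, b] = series_tensor A w" by (rule HOL.ext)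
  have "(\<Sum>k. sandwich2 Y (w k)) = sandwich2 Y (w 0)" using suminf_finite[of "{0}" "\<lambda>k. sandwich2 Y (w k)"] w0 by simp
  then show ?thesis unfolding sharp_ext eq ext_series[OF multilinear_sandwich2[OF Y] w] by (simp add: w_def sandwich2_def)
qed

end


subsection \<open>The algebra generated by the process\<close>

lemma commutant_ops:
  fixes M :: "'h::complex_hilbert_space oper set"
  assumes M: "M \<subseteq> cops" and T: "T \<in> commutant M" "S \<in> commutant M"
  shows "T + S \<in> commutant M" "op_scaleC c T \<in> commutant M" "(T o\<^sub>L S) \<in> commutant M"
proof -
  have TS: "T o\<^sub>L R = R o\<^sub>L T" "S o\<^sub>L R = R o\<^sub>L S" if "R \<in> M" for R
    using T that unfolding commutant_def by auto
  have c: "T \<in> cops" "S \<in> cops" using T unfolding commutant_def by auto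
  show "T + S \<in> commutant M"
    using c TS unfolding commutant_def by (simp add: cops_intros blinfun_compose_simps(1,2))
  show "op_scaleC c T \<in> commutant M"
    using c TS M unfolding commutant_def by (auto simp: cops_intros op_scaleC_comp)
  have "(T o\<^sub>L S) o\<^sub>L R = R o\<^sub>L (T o\<^sub>L S)" if "R \<in> M" for R
    using TS[OF that] by (metis blinfun_compose_assoc')
  then show "(T o\<^sub>L S) \<in> commutant M"
    using c unfolding commutant_def by (simp add: cops_intros)
qed

lemma closed_commutant: "closed (commutant M)"
proof -
  have "closed {T. T o\<^sub>L S = S o\<^sub>L T}" for S :: "'h::complex_hilbert_space oper"
  proof -
    have "bounded_linear (\<lambda>T. (T o\<^sub>L S) - (S o\<^sub>L T))"
      by (intro bounded_linear_sub bounded_bilinear.bounded_linear_left[OF bounded_bilinear_blinfun_compose]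
          bounded_bilinear.bounded_linear_right[OF bounded_bilinear_blinfun_compose])
    from closed_vimage[OF closed_singleton linear_continuous_on[OF this], of 0]
    show ?thesis by (simp add: vimage_def)
  qed
  then have "closed (cops \<inter> (\<Inter>S\<in>M. {T. T o\<^sub>L S = S o\<^sub>L T}))"
    by (intro closed_Int closed_cops closed_INT) auto
  moreover have "commutant M = cops \<inter> (\<Inter>S\<in>M. {T. T o\<^sub>L S = S o\<^sub>L T})"
    unfolding commutant_def by auto
  ultimately show ?thesis by simp
qed

lemma commutant_cops: "commutant M \<subseteq> cops"
  unfolding commutant_def by blast

lemma von_neumann_algebra_cops: "von_neumann_algebra (cops :: 'h::complex_hilbert_space oper set)"
proof -
  have "cops \<subseteq> commutant (commutant (cops :: 'h oper set))"
    unfolding commutant_def by auto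
  then show ?thesis unfolding von_neumann_algebra_def using commutant_cops adj_cops by blast
qed

text \<open>A von Neumann algebra is the commutant of its commutant, and commutants of
  complex-linear operators are algebras.\<close>

lemma von_neumann_algebra_ops:
  assumes "von_neumann_algebra M" "T \<in> M" "S \<in> M"
  shows "T + S \<in> M" "op_scaleC c T \<in> M" "(T o\<^sub>L S) \<in> M"
proof -
  have "M = commutant (commutant M)" using assms(1) unfolding von_neumann_algebra_def by simp
  then show "T + S \<in> M" "op_scaleC c T \<in> M" "(T o\<^sub>L S) \<in> M"
    using commutant_ops[OF commutant_cops[of "commutant M"], of T S] commutant_ops[OF commutant_cops, of T M S] assms(2,3)
    by metis+
qed

context q_brownian_motion
begin

abbreviation "\<A> \<equiv> algebra_of bm"

lemma algebra_ofI: "(\<And>M. von_neumann_algebra M \<Longrightarrow> bm ` {0..} \<subseteq> M \<Longrightarrow> T \<in> M) \<Longrightarrow> T \<in> \<A>"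
  unfolding algebra_of_def generated_von_neumann_algebra_def by blast

lemma algebra_ofD: "T \<in> \<A> \<Longrightarrow> von_neumann_algebra M \<Longrightarrow> bm ` {0..} \<subseteq> M \<Longrightarrow> T \<in> M"
  unfolding algebra_of_def generated_von_neumann_algebra_def by blast

sublocale operator_algebra \<A>
proof
  show "\<A> \<subseteq> cops"
    by (rule subsetI, rule algebra_ofD[OF _ von_neumann_algebra_cops]) (auto simp: bm_cops)
  fix a b c assume "a \<in> \<A>"
  then show "op_scaleC c a \<in> \<A>"
    using von_neumann_algebra_ops(2) by (intro algebra_ofI) (blast dest: algebra_ofD)
  from \<open>a \<in> \<A>\<close> show "adj a \<in> \<A>"
    unfolding algebra_of_def generated_von_neumann_algebra_def von_neumann_algebra_def by blast
  assume "b \<in> \<A>"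
  with \<open>a \<in> \<A>\<close> show "a + b \<in> \<A>" "(a o\<^sub>L b) \<in> \<A>"
    using von_neumann_algebra_ops(1,3) by (intro algebra_ofI, blast dest: algebra_ofD)+
qed

lemma bm_algebra: "0 \<le> r \<Longrightarrow> bm r \<in> \<A>"
  by (rule algebra_ofI) auto

lemma algebra_diff: "a \<in> \<A> \<Longrightarrow> b \<in> \<A> \<Longrightarrow> a - b \<in> \<A>"
  using add_closed[of a "op_scaleC (- 1) b"] scale_closed[of b "- 1"] by (simp add: op_scaleC_simps)

lemma filtration_algebra: "filtration bm t \<subseteq> \<A>"
proof
  fix T assume T: "T \<in> filtration bm t"
  show "T \<in> \<A>"
  proof (rule algebra_ofI)
    fix M assume M: "von_neumann_algebra M" "bm ` {0..} \<subseteq> M"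
    have "id_blinfun \<in> commutant (commutant M)" unfolding commutant_def by (simp add: cops_intros)
    then have id: "id_blinfun \<in> M" using M(1) unfolding von_neumann_algebra_def by simp
    have "S \<in> M" if "S \<in> generated_algebra (bm ` {0..t})" for S
      using that by induction (use id M(2) von_neumann_algebra_ops[OF M(1)] in auto)
    moreover have "closed M"
      using M(1) closed_commutant[of "commutant M"] unfolding von_neumann_algebra_def by simp
    ultimately show "T \<in> M"
      using T closure_minimal[of "generated_algebra (bm ` {0..t})" M] unfolding filtration_def by blast
  qed
qed

text \<open>The areas of the interpolations are exactly \<open>a\<close> times their trapezoidal
  sums, whose limit is known for \<open>b\<close> in the filtration at \<open>s\<close>. The left
  factor is a constant of the integration.\<close>

lemma strat_area_elementary:
  assumes st: "0 \<le> s" "s \<le> t" "t \<le> 2 ^ L" and ab: "a \<in> filtration bm s" "b \<in> filtration bm s"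
  shows "strat_area bm s t (elementary \<A> [a, b]) = a o\<^sub>L levy s t b"
proof -
  have A: "a \<in> \<A>" "b \<in> \<A>" using ab filtration_algebra by auto
  have Y: "interp m u \<in> cops" for m u
    unfolding dyadic_interpolation_def Let_def by (intro cops_intros bm_cops)
  have "approx_area bm m s t (elementary \<A> [a, b]) = a o\<^sub>L interp_trap s t m b" for m
    unfolding approx_area_def Let_def integral_interp[OF st, symmetric]
    by (subst sharp_elementary) (use A Y in \<open>auto simp: cops_intros\<close>)
  moreover have "(\<lambda>m. a o\<^sub>L interp_trap s t m b) \<longlonglongrightarrow> (a o\<^sub>L levy s t b)"
    by (intro bounded_bilinear.tendsto[OF bounded_bilinear_blinfun_compose] tendsto_const interp_trap_levy st ab)
  ultimately show ?thesis unfolding strat_area_def by (simp add: limI)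
qed

end

subsection \<open>Sewing along subdivisions\<close>

definition sub_sum :: "(real \<Rightarrow> real \<Rightarrow> 'b::comm_monoid_add) \<Rightarrow> real list \<Rightarrow> 'b" where
  "sub_sum A \<Delta> = (\<Sum>i | Suc i < length \<Delta>. A (\<Delta> ! i) (\<Delta> ! Suc i))"

lemma sub_sum_simps [simp]:
  "sub_sum A [] = 0" "sub_sum A [x] = 0" "sub_sum A (x # y # r) = A x y + sub_sum A (y # r)"
proof -
  have "{i. Suc i < length (x # y # r)} = insert 0 (Suc ` {i. Suc i < length (y # r)})"
    by (auto simp: image_iff less_Suc_eq_0_disj)
  then show "sub_sum A (x # y # r) = A x y + sub_sum A (y # r)"
    unfolding sub_sum_def by (simp add: sum.reindex)
qed (simp_all add: sub_sum_def)

lemma sub_sum_append: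
  "P \<noteq> [] \<Longrightarrow> Q \<noteq> [] \<Longrightarrow> sub_sum A (P @ Q) = sub_sum A P + A (last P) (hd Q) + sub_sum A Q"
proof (induction P)
  case (Cons x P)
  then show ?case
    by (cases P; cases Q) (simp_all add: add.assoc)
qed simp

lemma sub_sum_split: "sub_sum A (xs @ y # ys) = sub_sum A (xs @ [y]) + sub_sum A (y # ys)"
  using sub_sum_append[of "xs @ [y]" ys A] by (cases ys) (simp_all add: add.assoc)

lemma sub_sum_pointwise:
  assumes "\<And>i. Suc i < length \<Delta> \<Longrightarrow> A (\<Delta> ! i) (\<Delta> ! Suc i) = B (\<Delta> ! i) (\<Delta> ! Suc i)"
  shows "sub_sum A \<Delta> = sub_sum B \<Delta>"
  unfolding sub_sum_def using assms by (intro sum.cong) auto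

lemma norm_sub_sum_le:
  assumes "\<And>i. Suc i < length \<Delta> \<Longrightarrow> norm (A (\<Delta> ! i) (\<Delta> ! Suc i)) \<le> g (\<Delta> ! i) (\<Delta> ! Suc i)"
  shows "norm (sub_sum A \<Delta>) \<le> sub_sum g \<Delta>"
  unfolding sub_sum_def using assms by (intro sum_norm_le) auto

lemma sub_sum_telescope: "\<Delta> \<noteq> [] \<Longrightarrow> sub_sum (\<lambda>u v. v - u) \<Delta> = last \<Delta> - hd \<Delta>" for \<Delta> :: "real list"
proof (induction \<Delta>)
  case (Cons x \<Delta>)
  then show ?case by (cases \<Delta>) simp_all
qed simp

lemma sub_sum_mult_left: "sub_sum (\<lambda>u v. c * g u v) \<Delta> = c * sub_sum g \<Delta>" for c :: real
  by (simp add: sub_sum_def sum_distrib_left)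

lemma sub_sum_mono:
  fixes f g :: "real \<Rightarrow> real \<Rightarrow> real"
  assumes "\<And>i. Suc i < length \<Delta> \<Longrightarrow> f (\<Delta> ! i) (\<Delta> ! Suc i) \<le> g (\<Delta> ! i) (\<Delta> ! Suc i)"
  shows "sub_sum f \<Delta> \<le> sub_sum g \<Delta>"
  unfolding sub_sum_def using assms by (intro sum_mono) auto

lemma strict_sorted_bounds:
  "sorted_wrt (<) \<Delta> \<Longrightarrow> x \<in> set \<Delta> \<Longrightarrow> hd \<Delta> \<le> x \<and> x \<le> last \<Delta>" for \<Delta> :: "real list"
proof (induction \<Delta>)
  case (Cons y \<Delta>)
  then show ?case by (cases "\<Delta> = []") (use last_in_set[of \<Delta>] in \<open>auto intro: less_imp_le\<close>)
qed simp

lemma strict_sorted_head_last: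
  fixes \<Delta> :: "real list"
  assumes "sorted_wrt (<) \<Delta>" "s \<in> set \<Delta>" "t \<in> set \<Delta>" "set \<Delta> \<subseteq> {s..t}"
  shows "hd \<Delta> = s" "last \<Delta> = t"
proof -
  have ne: "\<Delta> \<noteq> []" using assms(2) by auto
  show "hd \<Delta> = s" "last \<Delta> = t"
    using strict_sorted_bounds[OF assms(1,2)] strict_sorted_bounds[OF assms(1,3)] assms(4)
      hd_in_set[OF ne] last_in_set[OF ne] by (simp_all add: antisym subset_iff)
qed

lemma subdivisionsD:
  assumes "\<Delta> \<in> subdivisions s t"
  shows "\<Delta> \<noteq> []" "sorted_wrt (<) \<Delta>" "hd \<Delta> = s" "last \<Delta> = t" "set \<Delta> \<subseteq> {s..t}" "s \<in> set \<Delta>" "t \<in> set \<Delta>"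
proof -
  show *: "\<Delta> \<noteq> []" "sorted_wrt (<) \<Delta>" "hd \<Delta> = s" "last \<Delta> = t"
    using assms unfolding subdivisions_def by auto
  then show "s \<in> set \<Delta>" "t \<in> set \<Delta>" by auto
  show "set \<Delta> \<subseteq> {s..t}" using strict_sorted_bounds[OF *(2)] *(3,4) by auto
qed

lemma subdivision_cell:
  assumes "\<Delta> \<in> subdivisions s t" "Suc i < length \<Delta>"
  shows "s \<le> \<Delta> ! i" "\<Delta> ! i < \<Delta> ! Suc i" "\<Delta> ! Suc i \<le> t" "\<Delta> ! Suc i - \<Delta> ! i \<le> mesh \<Delta>"
proof -
  note D = subdivisionsD[OF assms(1)]
  show "\<Delta> ! i < \<Delta> ! Suc i" using sorted_wrt_nth_less[OF D(2), of i "Suc i"] assms(2) by simp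
  have "\<Delta> ! i \<in> set \<Delta>" "\<Delta> ! Suc i \<in> set \<Delta>" using assms(2) by auto
  then show "s \<le> \<Delta> ! i" "\<Delta> ! Suc i \<le> t" using D(5) by auto
  have "{\<Delta> ! Suc i - \<Delta> ! i | i. Suc i < length \<Delta>} = (\<lambda>i. \<Delta> ! Suc i - \<Delta> ! i) ` {i. Suc i < length \<Delta>}" by auto
  moreover have "finite {i. Suc i < length \<Delta>}" by (rule finite_subset[of _ "{..<length \<Delta>}"]) auto
  ultimately show "\<Delta> ! Suc i - \<Delta> ! i \<le> mesh \<Delta>"
    unfolding mesh_def using assms(2) by (intro Max_ge) auto
qed

lemma sub_sum_powr_le:
  assumes \<Delta>: "\<Delta> \<in> subdivisions s t" and \<mu>: "1 \<le> \<mu>"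
  shows "sub_sum (\<lambda>u v. (v - u) powr \<mu>) \<Delta> \<le> (t - s) * mesh \<Delta> powr (\<mu> - 1)"
proof -
  have "sub_sum (\<lambda>u v. (v - u) powr \<mu>) \<Delta> \<le> sub_sum (\<lambda>u v. mesh \<Delta> powr (\<mu> - 1) * (v - u)) \<Delta>"
  proof (rule sub_sum_mono)
    fix i assume i: "Suc i < length \<Delta>"
    define d where "d = \<Delta> ! Suc i - \<Delta> ! i"
    have d: "0 < d" "d \<le> mesh \<Delta>" using subdivision_cell[OF \<Delta> i] by (simp_all add: d_def)
    have "d powr \<mu> = d powr (\<mu> - 1) * d" using d(1) by (simp add: powr_diff)
    also have "\<dots> \<le> mesh \<Delta> powr (\<mu> - 1) * d" using d \<mu> by (intro mult_right_mono powr_mono2) auto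
    finally show "(\<Delta> ! Suc i - \<Delta> ! i) powr \<mu> \<le> mesh \<Delta> powr (\<mu> - 1) * (\<Delta> ! Suc i - \<Delta> ! i)" by (simp add: d_def)
  qed
  also have "\<dots> = mesh \<Delta> powr (\<mu> - 1) * (t - s)"
    unfolding sub_sum_mult_left using sub_sum_telescope subdivisionsD[OF \<Delta>] by simp
  finally show ?thesis by (simp add: mult.commute)
qed

text \<open>Bisection at the midpoint: two defects of the whole interval split off two parts of at most half
  its length, and \<open>2 * (1/2) powr \<mu> < 1\<close>.\<close>

lemma sewing_bound:
  fixes A :: "real \<Rightarrow> real \<Rightarrow> 'b::real_normed_vector"
  assumes \<mu>: "1 < \<mu>" and K: "0 \<le> K" and A0: "\<And>u. A u u = 0"
    and defect: "\<And>u w v. s \<le> u \<Longrightarrow> u < w \<Longrightarrow> w < v \<Longrightarrow> v \<le> t \<Longrightarrow> norm (A u v - A u w - A w v) \<le> K * (v - u) powr \<mu>"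
    and \<Delta>: "\<Delta> \<noteq> []" "sorted_wrt (<) \<Delta>" "set \<Delta> \<subseteq> {s..t}"
  shows "norm (A (hd \<Delta>) (last \<Delta>) - sub_sum A \<Delta>) \<le> 2 * K / (1 - 2 powr (1 - \<mu>)) * (last \<Delta> - hd \<Delta>) powr \<mu>"
  using \<Delta>
proof (induction \<Delta> rule: length_induct)
  case (1 \<Delta>)
  define C where "C = 2 * K / (1 - 2 powr (1 - \<mu>))"
  define u v where "u = hd \<Delta>" and "v = last \<Delta>"
  have half: "2 powr (1 - \<mu>) < 1" using \<mu> by (simp add: powr_less_one)
  then have C0: "0 \<le> C" using K by (simp add: C_def)
  show ?case
  proof (cases "tl \<Delta> = []")
    case True
    then show ?thesis using 1(2) A0 by (cases \<Delta>) simp_all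
  next
    case False
    have uv: "u < v" using 1(2,3) False unfolding u_def v_def by (cases \<Delta>) auto
    define m where "m = (u + v) / 2"
    define P Q where "P = takeWhile (\<lambda>x. x \<le> m) \<Delta>" and "Q = dropWhile (\<lambda>x. x \<le> m) \<Delta>"
    have PQ: "\<Delta> = P @ Q" by (simp add: P_def Q_def)
    have P: "P \<noteq> []" "hd P = u" using 1(2) uv unfolding P_def m_def u_def by (cases \<Delta>; simp)+
    have "v \<in> set \<Delta>" "\<not> v \<le> m" using 1(2) uv by (simp_all add: v_def m_def)
    then have Q: "Q \<noteq> []" unfolding Q_def by (auto simp: dropWhile_eq_Nil_conv)
    define a b where "a = last P" and "b = hd Q"
    have am: "a \<le> m" using last_in_set[OF P(1)] set_takeWhileD unfolding a_def P_def by fastforce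
    have bm: "m < b" using hd_dropWhile[of "\<lambda>x. x \<le> m" \<Delta>] Q unfolding b_def Q_def by simp
    have sorted: "sorted_wrt (<) P" "sorted_wrt (<) Q" using 1(3) unfolding PQ sorted_wrt_append by auto
    have Qv: "last Q = v" using Q unfolding v_def PQ by simp
    have in_st: "a \<in> {s..t}" "b \<in> {s..t}" "u \<in> {s..t}" "v \<in> {s..t}"
      using 1(4) last_in_set[OF P(1)] hd_in_set[OF Q] hd_in_set[OF 1(2)] last_in_set[OF 1(2)]
      unfolding a_def b_def u_def v_def by (auto simp: PQ)
    have ua: "u \<le> a" using strict_sorted_bounds[OF sorted(1) last_in_set[OF P(1)]] P(2) unfolding a_def by simp
    have bv: "b \<le> v" using strict_sorted_bounds[OF sorted(2) hd_in_set[OF Q]] Qv unfolding b_def by simp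
    define D where "D = (v - u) powr \<mu>"
    have IH: "norm (A (hd R) (last R) - sub_sum A R) \<le> C * ((v - u) / 2) powr \<mu>"
      if "R \<noteq> []" "sorted_wrt (<) R" "set R \<subseteq> set \<Delta>" "length R < length \<Delta>" "last R - hd R \<le> (v - u) / 2" "hd R \<le> last R" for R
    proof -
      have "norm (A (hd R) (last R) - sub_sum A R) \<le> C * (last R - hd R) powr \<mu>"
        using 1(1) that 1(4) unfolding C_def by blast
      also have "\<dots> \<le> C * ((v - u) / 2) powr \<mu>" using C0 that \<mu> by (intro mult_left_mono powr_mono2) auto
      finally show ?thesis .
    qed
    have eP: "norm (A u a - sub_sum A P) \<le> C * ((v - u) / 2) powr \<mu>"
      using IH[of P] P sorted(1) am ua Q unfolding m_def by (auto simp: a_def PQ)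
    have eQ: "norm (A b v - sub_sum A Q) \<le> C * ((v - u) / 2) powr \<mu>"
      using IH[of Q] Q Qv sorted(2) bm bv P unfolding m_def by (auto simp: b_def PQ)
    have defect': "norm (A x z - A x y - A y z) \<le> K * D" if "u \<le> x" "x \<le> y" "y \<le> z" "z \<le> v" for x y z
    proof (cases "x < y \<and> y < z")
      case True
      then have "norm (A x z - A x y - A y z) \<le> K * (z - x) powr \<mu>"
        using that in_st by (intro defect) auto
      also have "\<dots> \<le> K * D" unfolding D_def using that \<mu> K by (intro mult_left_mono powr_mono2) auto
      finally show ?thesis .
    next
      case False
      then have "x = y \<or> y = z" using that by auto
      then show ?thesis using A0 K by (auto simp: D_def)
    qed
    have "norm (A u v - sub_sum A \<Delta>) = norm (((A u v - A u a - A a v) + (A a v - A a b - A b v)) +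
        ((A u a - sub_sum A P) + (A b v - sub_sum A Q)))"
      unfolding PQ sub_sum_append[OF P(1) Q] a_def[symmetric] b_def[symmetric] by (rule arg_cong[where f=norm]) simp
    also have "\<dots> \<le> (K * D + K * D) + (C * ((v - u) / 2) powr \<mu> + C * ((v - u) / 2) powr \<mu>)"
      using ua bv am bm by (intro norm_triangle_mono defect' eP eQ) auto
    also have "((v - u) / 2) powr \<mu> = D * 2 powr (- \<mu>)" using uv by (simp add: D_def powr_divide powr_minus_divide)
    also have "(K * D + K * D) + (C * (D * 2 powr (- \<mu>)) + C * (D * 2 powr (- \<mu>))) = (2 * K + C * (2 * 2 powr (- \<mu>))) * D"
      by (simp add: algebra_simps)
    also have "2 * (2::real) powr (- \<mu>) = 2 powr (1 - \<mu>)" by (simp add: powr_diff powr_minus_divide)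
    also have "2 * K + C * 2 powr (1 - \<mu>) = C"
    proof -
      have "C * (1 - 2 powr (1 - \<mu>)) = 2 * K" using half \<mu> by (simp add: C_def)
      then show ?thesis by (simp add: algebra_simps)
    qed
    finally show ?thesis by (simp add: C_def D_def u_def v_def)
  qed
qed

text \<open>Peels off the first cell of the coarse subdivision: the points of the fine one inside
  this cell form a subdivision to which \<open>bound\<close> applies, and the points from
  \<open>y\<close> on are left to the induction.\<close>

lemma sewing_refinement:
  fixes A :: "real \<Rightarrow> real \<Rightarrow> 'b::real_normed_vector"
  assumes bound: "\<And>\<Delta>. \<Delta> \<noteq> [] \<Longrightarrow> sorted_wrt (<) \<Delta> \<Longrightarrow> set \<Delta> \<subseteq> {s..t} \<Longrightarrow>
      norm (A (hd \<Delta>) (last \<Delta>) - sub_sum A \<Delta>) \<le> g (hd \<Delta>) (last \<Delta>)"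
    and "\<Delta> \<noteq> []" "sorted_wrt (<) \<Delta>" "sorted_wrt (<) \<Delta>'" "set \<Delta> \<subseteq> set \<Delta>'" "set \<Delta>' \<subseteq> {s..t}"
    "hd \<Delta>' = hd \<Delta>" "last \<Delta>' = last \<Delta>"
  shows "norm (sub_sum A \<Delta> - sub_sum A \<Delta>') \<le> sub_sum g \<Delta>"
  using assms(2-)
proof (induction \<Delta> arbitrary: \<Delta>')
  case (Cons x \<Delta>)
  show ?case
  proof (cases \<Delta>)
    case Nil
    then have "tl \<Delta>' = []" using Cons.prems by (cases \<Delta>') (auto split: if_splits)
    then show ?thesis using Nil by (cases \<Delta>') simp_all
  next
    case (Cons y r)
    have "y \<in> set \<Delta>'" using Cons.prems(4) Cons by simp
    then obtain xs ys where \<Delta>': "\<Delta>' = xs @ y # ys" by (auto dest: split_list)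
    have xy: "x < y" using Cons.prems(2) Cons by simp
    then have xs: "xs \<noteq> []" "hd xs = x" using Cons.prems(6) \<Delta>' by (cases xs; simp)+
    have sor: "sorted_wrt (<) (xs @ [y])" "sorted_wrt (<) (y # ys)" "\<And>z. z \<in> set xs \<Longrightarrow> z < y"
      using Cons.prems(3) unfolding \<Delta>' sorted_wrt_append by auto
    have "set \<Delta> \<subseteq> set (y # ys)"
    proof
      fix z assume "z \<in> set \<Delta>"
      then have "y \<le> z" "z \<in> set \<Delta>'" using Cons.prems(2,4) Cons by auto
      then show "z \<in> set (y # ys)" using sor(3) unfolding \<Delta>' by fastforce
    qed
    then have "norm (sub_sum A \<Delta> - sub_sum A (y # ys)) \<le> sub_sum g \<Delta>"
      using Cons.prems Cons sor \<Delta>' by (intro Cons.IH) auto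
    moreover have "norm (A x y - sub_sum A (xs @ [y])) \<le> g x y"
      using bound[of "xs @ [y]"] sor(1) xs Cons.prems(5) \<Delta>' by simp
    ultimately have "norm ((A x y - sub_sum A (xs @ [y])) + (sub_sum A \<Delta> - sub_sum A (y # ys))) \<le> g x y + sub_sum g \<Delta>"
      by (intro norm_triangle_mono)
    moreover have "sub_sum A (x # \<Delta>) - sub_sum A \<Delta>' = (A x y - sub_sum A (xs @ [y])) + (sub_sum A \<Delta> - sub_sum A (y # ys))"
      using sub_sum_split[of A xs y ys] by (simp add: Cons \<Delta>')
    moreover have "sub_sum g (x # \<Delta>) = g x y + sub_sum g \<Delta>" by (simp add: Cons)
    ultimately show ?thesis by (simp only:)
  qed
qed simp

section \<open>Subdivisions of vanishing mesh and the sewing limit\<close>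

definition uniform_subdivision :: "real \<Rightarrow> real \<Rightarrow> nat \<Rightarrow> real list" where
  "uniform_subdivision s t n = map (\<lambda>i. s + (t - s) * real i / real (Suc n)) [0..<Suc (Suc n)]"

lemma uniform_subdivision:
  assumes "s < t"
  shows "uniform_subdivision s t n \<in> subdivisions s t" "mesh (uniform_subdivision s t n) = (t - s) / real (Suc n)"
proof -
  have less: "s + (t - s) * real i / real (Suc n) < s + (t - s) * real j / real (Suc n)" if "i < j" for i j
    using assms that by (simp add: divide_strict_right_mono)
  have "sorted_wrt (<) (uniform_subdivision s t n)"
    unfolding uniform_subdivision_def sorted_wrt_map
    by (rule sorted_wrt_mono_rel[OF _ sorted_wrt_upt]) (rule less)
  then show "uniform_subdivision s t n \<in> subdivisions s t"
    unfolding subdivisions_def uniform_subdivision_def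
    by (simp add: hd_map last_map del: upt_Suc)
  have "uniform_subdivision s t n ! Suc i - uniform_subdivision s t n ! i = (t - s) / real (Suc n)"
    if "Suc i < length (uniform_subdivision s t n)" for i
    using that unfolding uniform_subdivision_def
    by (simp del: upt_Suc add: algebra_simps add_divide_distrib diff_divide_distrib)
  then have "{uniform_subdivision s t n ! Suc i - uniform_subdivision s t n ! i | i. Suc i < length (uniform_subdivision s t n)}
      = {(t - s) / real (Suc n)}"
    by (auto intro!: exI[of _ 0] simp: uniform_subdivision_def simp del: upt_Suc)
  then show "mesh (uniform_subdivision s t n) = (t - s) / real (Suc n)" unfolding mesh_def by simp
qed

lemma uniform_mesh_tendsto:
  assumes "s < t" shows "(\<lambda>n. mesh (uniform_subdivision s t n)) \<longlonglongrightarrow> 0"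
  unfolding uniform_subdivision(2)[OF assms]
  by (rule tendsto_divide_0[OF tendsto_const]) (rule filterlim_at_top_imp_at_infinity, rule filterlim_compose[OF filterlim_real_sequentially filterlim_Suc])

text \<open>Makes limits along this filter unique, so that the \<open>Lim\<close> in the definition
  of the rough integral is the limit found by sewing.\<close>

lemma mesh_to_0_neq_bot:
  assumes st: "s < t" shows "mesh_to_0 s t \<noteq> bot"
proof
  assume bot: "mesh_to_0 s t = bot"
  have "filterlim (uniform_subdivision s t) (mesh_to_0 s t) sequentially"
    unfolding mesh_to_0_def filterlim_inf filterlim_filtercomap_iff
    using uniform_mesh_tendsto[OF st] uniform_subdivision[OF st] st
    by (auto simp: filterlim_at filterlim_principal o_def)
  then show False unfolding bot filterlim_def by (simp add: filtermap_bot_iff bot_unique)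
qed

lemma tendsto_mesh_to_0:
  fixes f :: "real list \<Rightarrow> 'b::real_normed_vector"
  assumes "\<And>\<Delta>. \<Delta> \<in> subdivisions s t \<Longrightarrow> norm (f \<Delta> - l) \<le> g (mesh \<Delta>)" and g: "(g \<longlongrightarrow> 0) (at_right 0)"
  shows "(f \<longlongrightarrow> l) (mesh_to_0 s t)"
proof (rule LIM_zero_cancel, rule Lim_null_comparison)
  have "eventually (\<lambda>\<Delta>. \<Delta> \<in> subdivisions s t) (mesh_to_0 s t)"
    unfolding mesh_to_0_def by (simp add: eventually_inf_principal)
  then show "\<forall>\<^sub>F \<Delta> in mesh_to_0 s t. norm (f \<Delta> - l) \<le> g (mesh \<Delta>)"
    by (rule eventually_mono) (rule assms(1))
  have "filterlim mesh (at_right 0) (mesh_to_0 s t)"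
    unfolding mesh_to_0_def by (rule filterlim_mono[OF filterlim_filtercomap order_refl inf_le1])
  from filterlim_compose[OF g this] show "((\<lambda>\<Delta>. g (mesh \<Delta>)) \<longlongrightarrow> 0) (mesh_to_0 s t)" .
qed

lemma tendsto_powr_at_right_0: "0 < a \<Longrightarrow> ((\<lambda>x. c * x powr a) \<longlongrightarrow> 0) (at_right 0)" for a c :: real
  by (intro tendsto_mult_right_zero tendsto_zero_powrI[of _ _ _ a] tendsto_ident_at tendsto_const)
    (auto simp: eventually_at_right_less eventually_at_filter)

text \<open>Passing to a refinement changes the sum by at most a constant times the mesh to the
  power \<mu> - 1. Two subdivisions are compared through their common refinement.\<close>

lemma sewing:
  fixes A :: "real \<Rightarrow> real \<Rightarrow> 'b::banach"
  assumes st: "s < t" and \<mu>: "1 < \<mu>" and K: "0 \<le> K" and A0: "\<And>u. A u u = 0"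
    and defect: "\<And>u w v. s \<le> u \<Longrightarrow> u < w \<Longrightarrow> w < v \<Longrightarrow> v \<le> t \<Longrightarrow> norm (A u v - A u w - A w v) \<le> K * (v - u) powr \<mu>"
  obtains I where "(sub_sum A \<longlongrightarrow> I) (mesh_to_0 s t)"
proof -
  define C where "C = 2 * K / (1 - 2 powr (1 - \<mu>))"
  have C0: "0 \<le> C" using K \<mu> by (simp add: C_def powr_less_one less_imp_le)
  define h where "h x = C * (t - s) * x powr (\<mu> - 1)" for x
  have refine: "norm (sub_sum A \<Delta> - sub_sum A \<Delta>') \<le> h (mesh \<Delta>)"
    if "\<Delta> \<in> subdivisions s t" "\<Delta>' \<in> subdivisions s t" "set \<Delta> \<subseteq> set \<Delta>'" for \<Delta> \<Delta>'
  proof -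
    have "norm (sub_sum A \<Delta> - sub_sum A \<Delta>') \<le> sub_sum (\<lambda>u v. C * (v - u) powr \<mu>) \<Delta>"
      using that subdivisionsD sewing_bound[OF \<mu> K A0 defect, folded C_def]
      by (intro sewing_refinement[where s=s and t=t]) simp_all
    also have "\<dots> \<le> C * ((t - s) * mesh \<Delta> powr (\<mu> - 1))"
      unfolding sub_sum_mult_left using \<mu> by (intro mult_left_mono sub_sum_powr_le that C0) simp
    finally show ?thesis by (simp add: h_def)
  qed
  have close: "norm (sub_sum A \<Delta> - sub_sum A \<Delta>') \<le> h (mesh \<Delta>) + h (mesh \<Delta>')"
    if \<Delta>: "\<Delta> \<in> subdivisions s t" and \<Delta>': "\<Delta>' \<in> subdivisions s t" for \<Delta> \<Delta>'
  proof -
    define R where "R = sorted_list_of_set (set \<Delta> \<union> set \<Delta>')"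
    have R: "sorted_wrt (<) R" "set R = set \<Delta> \<union> set \<Delta>'" by (simp_all add: R_def)
    then have "hd R = s" "last R = t" "R \<noteq> []"
      using strict_sorted_head_last[OF R(1), of s t] subdivisionsD[OF \<Delta>] subdivisionsD[OF \<Delta>'] by auto
    then have Rs: "R \<in> subdivisions s t" using R by (simp add: subdivisions_def)
    have "norm (sub_sum A \<Delta> - sub_sum A R) \<le> h (mesh \<Delta>)" "norm (sub_sum A \<Delta>' - sub_sum A R) \<le> h (mesh \<Delta>')"
      using refine[OF \<Delta> Rs] refine[OF \<Delta>' Rs] R(2) by auto
    then show ?thesis
      using norm_triangle_ineq4[of "sub_sum A \<Delta> - sub_sum A R" "sub_sum A \<Delta>' - sub_sum A R"] by simp
  qed
  \<comment> \<open>The uniform subdivisions provide a Cauchy sequence and thereby the limit; the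
    comparison of two subdivisions then carries the convergence over to all subdivisions.\<close>
  define S where "S n = sub_sum A (uniform_subdivision s t n)" for n
  define e where "e n = h (mesh (uniform_subdivision s t n))" for n
  have hlim: "(h \<longlongrightarrow> 0) (at_right 0)" unfolding h_def[abs_def] using \<mu> by (intro tendsto_powr_at_right_0) simp
  have e: "e \<longlonglongrightarrow> 0" unfolding e_def
    by (rule filterlim_compose[OF hlim])
       (use uniform_mesh_tendsto[OF st] uniform_subdivision(2)[OF st] st in \<open>auto simp: filterlim_at\<close>)
  have "Cauchy S"
  proof (rule metric_CauchyI)
    fix \<epsilon> :: real assume "0 < \<epsilon>"
    then obtain N where N: "\<And>n. n \<ge> N \<Longrightarrow> \<bar>e n\<bar> < \<epsilon> / 2"
      using LIMSEQ_D[OF e, of "\<epsilon> / 2"] by auto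
    have "dist (S m) (S n) < \<epsilon>" if "m \<ge> N" "n \<ge> N" for m n
      using close[OF uniform_subdivision(1)[OF st, of m] uniform_subdivision(1)[OF st, of n]] N[OF that(1)] N[OF that(2)]
      by (simp add: dist_norm S_def e_def)
    then show "\<exists>M. \<forall>m\<ge>M. \<forall>n\<ge>M. dist (S m) (S n) < \<epsilon>" by blast
  qed
  then obtain I where I: "S \<longlonglongrightarrow> I" using Cauchy_convergent convergent_def by blast
  have "norm (sub_sum A \<Delta> - I) \<le> h (mesh \<Delta>)" if \<Delta>: "\<Delta> \<in> subdivisions s t" for \<Delta>
  proof (rule LIMSEQ_le)
    show "(\<lambda>n. norm (sub_sum A \<Delta> - S n)) \<longlonglongrightarrow> norm (sub_sum A \<Delta> - I)" by (intro tendsto_intros I)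
    show "(\<lambda>n. h (mesh \<Delta>) + e n) \<longlonglongrightarrow> h (mesh \<Delta>)" using tendsto_add[OF tendsto_const e] by simp
    show "\<exists>N. \<forall>n\<ge>N. norm (sub_sum A \<Delta> - S n) \<le> h (mesh \<Delta>) + e n"
      using close[OF \<Delta> uniform_subdivision(1)[OF st]] unfolding S_def e_def by blast
  qed
  from that[OF tendsto_mesh_to_0[OF this hlim]] show thesis .
qed

subsection \<open>Insertion of a linear map into the middle slot\<close>

context operator_algebra
begin

text \<open>The constant is carried along because it holds the power of the interval length in all
  later estimates.\<close>

definition slot_map :: "real \<Rightarrow> ('h oper \<Rightarrow> 'h oper) \<Rightarrow> bool" where
  "slot_map K \<phi> \<longleftrightarrow> 0 \<le> K \<and> (\<forall>a\<in>A. \<phi> a \<in> cops \<and> norm (\<phi> a) \<le> K * norm a) \<and>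
     (\<forall>a\<in>A. \<forall>b\<in>A. \<forall>c. \<phi> (a + op_scaleC c b) = \<phi> a + op_scaleC c (\<phi> b))"

abbreviation insert_slot :: "('h oper \<Rightarrow> 'h oper) \<Rightarrow> 'h tensor \<Rightarrow> 'h oper" where
  "insert_slot \<phi> \<equiv> ext A 3 (sandwich3 \<phi>)"

lemma slot_mapD:
  assumes "slot_map K \<phi>"
  shows "0 \<le> K" "a \<in> A \<Longrightarrow> \<phi> a \<in> cops" "a \<in> A \<Longrightarrow> norm (\<phi> a) \<le> K * norm a"
    "a \<in> A \<Longrightarrow> b \<in> A \<Longrightarrow> \<phi> (a + op_scaleC c b) = \<phi> a + op_scaleC c (\<phi> b)"
  using assms unfolding slot_map_def by auto

lemma slot_map_multilinear: "slot_map K \<phi> \<Longrightarrow> multilinear_map A 3 K (sandwich3 \<phi>)"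
  unfolding slot_map_def by (intro multilinear_sandwich3) auto

lemma slot_map_add:
  assumes "slot_map K \<phi>" "slot_map K' \<psi>"
  shows "slot_map (K + K') (\<lambda>b. \<phi> b + \<psi> b)"
  using assms unfolding slot_map_def
  by (auto simp: cops_intros op_scaleC_simps distrib_right intro!: norm_triangle_mono)

lemma slot_map_scaleR:
  assumes "slot_map K \<phi>"
  shows "slot_map (\<bar>r\<bar> * K) (\<lambda>b. r *\<^sub>R \<phi> b)"
  using assms unfolding slot_map_def
  by (auto simp: cops_intros op_scaleC_simps scaleR_add_right mult.assoc intro!: mult_left_mono)

lemma slot_map_sandwich:
  assumes "Y \<in> cops" "Z \<in> cops"
  shows "slot_map (norm Y * norm Z) (\<lambda>b. Y o\<^sub>L b o\<^sub>L Z)"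
  unfolding slot_map_def
proof (intro conjI ballI allI)
  fix a b c assume a: "a \<in> A" "b \<in> A"
  then have c: "a \<in> cops" "b \<in> cops" using sub_cops by auto
  then show "(Y o\<^sub>L a o\<^sub>L Z) \<in> cops" using assms by (intro cops_intros)
  show "norm (Y o\<^sub>L a o\<^sub>L Z) \<le> norm Y * norm Z * norm a"
    using norm_sandwich_le[of Y a Z] by (simp add: mult_ac)
  show "(Y o\<^sub>L (a + op_scaleC c b) o\<^sub>L Z) = (Y o\<^sub>L a o\<^sub>L Z) + op_scaleC c (Y o\<^sub>L b o\<^sub>L Z)"
    using assms by (simp add: blinfun_compose_simps op_scaleC_comp)
qed simp

text \<open>The two adjoints are antilinear and isometric, so the composition is linear with the
  same bound.\<close>

lemma slot_map_adj:
  assumes \<phi>: "slot_map K \<phi>"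
  shows "slot_map K (\<lambda>b. adj (\<phi> (adj b)))"
  unfolding slot_map_def
proof (intro conjI ballI allI)
  note D = slot_mapD[OF \<phi>]
  show "0 \<le> K" by (rule D(1))
  fix a b c assume a: "a \<in> A" "b \<in> A"
  then have c: "a \<in> cops" "b \<in> cops" "adj a \<in> A" "adj b \<in> A" using sub_cops adj_closed by auto
  show "adj (\<phi> (adj a)) \<in> cops" by (intro adj_cops D c)
  show "norm (adj (\<phi> (adj a))) \<le> K * norm a"
    using D(2,3)[OF c(3)] c by (simp add: norm_adj)
  have "adj (a + op_scaleC c b) = adj a + op_scaleC (cnj c) (adj b)" using c by (simp add: adj_simps cops_intros)
  then show "adj (\<phi> (adj (a + op_scaleC c b))) = adj (\<phi> (adj a)) + op_scaleC c (adj (\<phi> (adj b)))"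
    using D(2,4) c by (simp add: adj_simps cops_intros)
qed

lemma insert_slot_add:
  assumes "slot_map K \<phi>" "slot_map K' \<psi>" "z \<in> tensor_power_of A A 3"
  shows "insert_slot (\<lambda>b. \<phi> b + \<psi> b) z = insert_slot \<phi> z + insert_slot \<psi> z"
proof -
  have "sandwich3 (\<lambda>b. \<phi> b + \<psi> b) = (\<lambda>as. sandwich3 \<phi> as + sandwich3 \<psi> as)"
    by (simp add: sandwich3_def[abs_def] blinfun_compose_simps(1,2))
  then show ?thesis using ext_add_map[OF slot_map_multilinear[OF assms(1)] slot_map_multilinear[OF assms(2)] assms(3)] by simp
qed

lemma insert_slot_scaleR:
  assumes "slot_map K \<phi>" "z \<in> tensor_power_of A A 3"
  shows "insert_slot (\<lambda>b. r *\<^sub>R \<phi> b) z = r *\<^sub>R insert_slot \<phi> z"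
proof -
  have "sandwich3 (\<lambda>b. r *\<^sub>R \<phi> b) = (\<lambda>as. r *\<^sub>R sandwich3 \<phi> as)"
    by (simp add: sandwich3_def[abs_def] blinfun_compose_simps(5,6))
  then show ?thesis using ext_scaleR_map[OF slot_map_multilinear[OF assms(1)] assms(2)] by simp
qed

lemma insert_slot_cong:
  assumes "slot_map K \<phi>" "slot_map K' \<psi>" "z \<in> tensor_power_of A B 3" "B \<subseteq> A" "\<And>b. b \<in> B \<Longrightarrow> \<phi> b = \<psi> b"
  shows "insert_slot \<phi> z = insert_slot \<psi> z"
proof (rule ext_cong[OF assms(3,4) slot_map_multilinear[OF assms(1)] slot_map_multilinear[OF assms(2)]])
  fix as :: "'h oper list" assume "set as \<subseteq> B" "length as = 3"
  then show "sandwich3 \<phi> as = sandwich3 \<psi> as"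
    by (elim length_3E) (simp add: sandwich3_def assms(5))
qed

lemma insert_slot_diff:
  assumes "slot_map K \<phi>" "z \<in> tensor_power_of A A 3" "z' \<in> tensor_power_of A A 3"
  shows "insert_slot \<phi> (z - z') = insert_slot \<phi> z - insert_slot \<phi> z'"
  by (rule ext_diff(2)[OF slot_map_multilinear[OF assms(1)] assms(2,3)]) (simp_all add: scale_closed)

lemma tensor_power_diff:
  assumes "z \<in> tensor_power_of A A 3" "z' \<in> tensor_power_of A A 3"
  shows "z - z' \<in> tensor_power_of A A 3"
  using slot_map_sandwich[of 0 0] assms
  by (intro ext_diff(1)[OF slot_map_multilinear]) (auto simp: scale_closed cops_intros)

lemma norm_insert_slot_le:
  assumes "slot_map K \<phi>" "z \<in> tensor_power_of A A 3"
  shows "norm (insert_slot \<phi> z) \<le> K * proj_norm A 3 z"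
  by (rule norm_ext_le[OF slot_map_multilinear[OF assms(1)] slot_mapD(1)[OF assms(1)] assms(2)])

lemma sharp_add_right:
  assumes "Y \<in> cops" "Z \<in> cops" "z \<in> tensor_power_of A A 2"
  shows "sharp A z (Y + Z) = sharp A z Y + sharp A z Z"
proof -
  have "sandwich2 (Y + Z) = (\<lambda>as. sandwich2 Y as + sandwich2 Z as)"
    by (simp add: sandwich2_def[abs_def] blinfun_compose_simps(1,2))
  then show ?thesis unfolding sharp_ext
    using ext_add_map[OF multilinear_sandwich2[OF assms(1)] multilinear_sandwich2[OF assms(2)] assms(3)] by simp
qed

lemma sharp_tensor_add:
  assumes "Y \<in> cops" "z \<in> tensor_power_of A A 2" "z' \<in> tensor_power_of A A 2"
  shows "z + z' \<in> tensor_power_of A A 2" "sharp A (z + z') Y = sharp A z Y + sharp A z' Y"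
  using ext_add[OF multilinear_sandwich2[OF assms(1)] assms(2,3)] by (simp_all add: sharp_ext)

lemma norm_sharp_le:
  assumes "Y \<in> cops" "z \<in> tensor_power_of A A 2"
  shows "norm (sharp A z Y) \<le> norm Y * proj_norm A 2 z"
  unfolding sharp_ext by (rule norm_ext_le[OF multilinear_sandwich2[OF assms(1)] norm_ge_zero assms(2)])

text \<open>The first-order terms of the increment of the integrand, multiplied by a further
  increment, become insertions into the middle slot. They thus take the form of the product term in
  Chen's relation.\<close>

lemma sharp_contract:
  assumes Y: "Y \<in> A" and Z: "Z \<in> cops" and z: "z \<in> tensor_power_of A A 3"
  shows "sharp A (sharp_left A Y z) Z = insert_slot (\<lambda>b. Y o\<^sub>L b o\<^sub>L Z) z"
    "sharp A (sharp_right A z Y) Z = insert_slot (\<lambda>b. Z o\<^sub>L b o\<^sub>L Y) z"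
proof -
  have Yc: "Y \<in> cops" using Y sub_cops by auto
  have 0: "(\<lambda>as. sandwich2 Z (contract 0 Y as)) = sandwich3 (\<lambda>b. Y o\<^sub>L b o\<^sub>L Z)"
    "(\<lambda>as. sandwich2 Z (contract (Suc 0) Y as)) = sandwich3 (\<lambda>b. Z o\<^sub>L b o\<^sub>L Y)"
    by (auto simp: sandwich2_def sandwich3_def contract_def blinfun_compose_assoc')
  have m: "multilinear_map A 3 (norm Y * norm Z) (\<lambda>as. sandwich2 Z (contract 0 Y as))"
    "multilinear_map A 3 (norm Z * norm Y) (\<lambda>as. sandwich2 Z (contract (Suc 0) Y as))"
    unfolding 0 by (intro slot_map_multilinear slot_map_sandwich Yc Z)+
  show "sharp A (sharp_left A Y z) Z = insert_slot (\<lambda>b. Y o\<^sub>L b o\<^sub>L Z) z"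
    "sharp A (sharp_right A z Y) Z = insert_slot (\<lambda>b. Z o\<^sub>L b o\<^sub>L Y) z"
    unfolding sharp_contraction sharp_ext
    using ext_contraction[OF Y z multilinear_sandwich2[OF Z] m(1)] ext_contraction[OF Y z multilinear_sandwich2[OF Z] m(2)]
    by (simp_all only: 0)
qed

lemma sharp_left_right_tensor:
  assumes "Y \<in> A" "z \<in> tensor_power_of A A 3"
  shows "sharp_left A Y z \<in> tensor_power_of A A 2" "sharp_right A z Y \<in> tensor_power_of A A 2"
  unfolding sharp_contraction by (rule contraction_tensor_power[OF assms])+

lemma insert_slot_cops:
  assumes "slot_map K \<phi>" "z \<in> tensor_power_of A A 3"
  shows "insert_slot \<phi> z \<in> cops"
proof (rule ext_closed[OF slot_map_multilinear[OF assms(1)] assms(2) order_refl closed_cops])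
  fix as assume "set as \<subseteq> A" "length as = 3"
  then show "sandwich3 \<phi> as \<in> cops"
    by (elim length_3E) (use slot_mapD(2)[OF assms(1)] sub_cops in \<open>auto simp: sandwich3_def cops_intros\<close>)
qed (auto simp: cops_intros)

lemma sharp_cops:
  assumes "Y \<in> cops" "z \<in> tensor_power_of A A 2"
  shows "sharp A z Y \<in> cops"
  unfolding sharp_ext
proof (rule ext_closed[OF multilinear_sandwich2[OF assms(1)] assms(2) order_refl closed_cops])
  fix as assume "set as \<subseteq> A" "length as = 2"
  then have "as ! 0 \<in> cops" "as ! 1 \<in> cops" using sub_cops nth_mem[of _ as] by (auto simp: subset_iff)
  then show "sandwich2 Y as \<in> cops"
    using assms(1) unfolding sandwich2_def by (intro cops_intros)
qed (auto simp: cops_intros)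

end

subsection \<open>The corrected Riemann sums\<close>

lemma holder_bound:
  fixes f :: "real \<Rightarrow> real \<Rightarrow> real"
  assumes "bdd_above {f u v / \<bar>v - u\<bar> powr \<alpha> | u v. u \<in> I \<and> v \<in> I \<and> u < v}"
  obtains H where "0 \<le> H" "\<And>u v. u \<in> I \<Longrightarrow> v \<in> I \<Longrightarrow> u < v \<Longrightarrow> f u v \<le> H * (v - u) powr \<alpha>"
proof -
  obtain H where H: "\<And>x. x \<in> {f u v / \<bar>v - u\<bar> powr \<alpha> | u v. u \<in> I \<and> v \<in> I \<and> u < v} \<Longrightarrow> x \<le> H"
    using assms unfolding bdd_above_def by blast
  have "f u v \<le> max 0 H * (v - u) powr \<alpha>" if uv: "u \<in> I" "v \<in> I" "u < v" for u v
  proof -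
    have "f u v / \<bar>v - u\<bar> powr \<alpha> \<le> H" by (rule H) (use uv in blast)
    then have "f u v / (v - u) powr \<alpha> \<le> H" using uv(3) by simp
    then have "f u v \<le> H * (v - u) powr \<alpha>" using uv(3) by (simp add: divide_le_eq)
    also have "\<dots> \<le> max 0 H * (v - u) powr \<alpha>" by (intro mult_right_mono) auto
    finally show ?thesis .
  qed
  then show thesis by (intro that[of "max 0 H"]) auto
qed

lemma powr_le_powr:
  fixes d T :: real
  assumes "0 < d" "d \<le> T" "b \<le> a"
  shows "d powr a \<le> T powr (a - b) * d powr b"
proof -
  have "d powr a = d powr (a - b) * d powr b" by (simp flip: powr_add)
  also have "\<dots> \<le> T powr (a - b) * d powr b" using assms by (intro mult_right_mono powr_mono2) auto
  finally show ?thesis .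
qed

locale controlled_integrand = q_brownian_motion +
  fixes \<gamma> s t :: real and U U1 U2 :: "real \<Rightarrow> 'a tensor" and Ub :: "real \<times> real \<Rightarrow> 'a tensor"
  assumes \<gamma>: "1 / 3 < \<gamma>" and s_nonneg: "0 \<le> s" and s_less_t: "s < t" and t_le: "t \<le> 2 ^ L"
    and controlled: "controlled_biprocess bm \<gamma> {s..t} U U1 U2 Ub"
begin

abbreviation "incr u v \<equiv> bm v - bm u"
abbreviation "area_star u v \<equiv> (\<lambda>b. adj (levy u v (adj b)))"

lemma incr_cops: "incr u v \<in> cops"
  by (intro cops_intros bm_cops)

lemma incr_algebra: "s \<le> u \<Longrightarrow> s \<le> v \<Longrightarrow> incr u v \<in> \<A>"
  using s_nonneg by (intro algebra_diff bm_algebra) auto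

lemma adapted_tensors:
  assumes "u \<in> {s..t}"
  shows "U u \<in> tensor_power_of \<A> (filtration bm u) 2" "U1 u \<in> tensor_power_of \<A> (filtration bm u) 3"
    "U2 u \<in> tensor_power_of \<A> (filtration bm u) 3"
  using controlled assms unfolding controlled_biprocess_def adapted_def by auto

lemma tensors:
  assumes "u \<in> {s..t}"
  shows "U u \<in> tensor_power_of \<A> \<A> 2" "U1 u \<in> tensor_power_of \<A> \<A> 3" "U2 u \<in> tensor_power_of \<A> \<A> 3"
  using adapted_tensors[OF assms] tensor_power_mono[OF filtration_algebra] by auto

lemma remainder_tensor: "u \<in> {s..t} \<Longrightarrow> v \<in> {s..t} \<Longrightarrow> u \<le> v \<Longrightarrow> Ub (u, v) \<in> tensor_power_of \<A> \<A> 2"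
  using controlled unfolding controlled_biprocess_def holder2_def Let_def by auto

lemma slot_map_levy:
  assumes "s \<le> u" "u \<le> v" "v \<le> t"
  shows "slot_map (levy_const' * (v - u) powr (3/4)) (levy u v)"
proof -
  have uv: "0 \<le> u" "u \<le> v" "v \<le> 2 ^ L" using assms s_nonneg t_le by auto
  show ?thesis unfolding slot_map_def
    using levy_const'_nonneg sub_cops levy_cops[OF uv] norm_levy_le[OF uv] levy_linear[OF uv]
    by (auto simp: subset_iff)
qed

definition holder_const :: real where
  "holder_const = (SOME H. 0 \<le> H \<and> (\<forall>u\<in>{s..t}. \<forall>v\<in>{s..t}. u < v \<longrightarrow>
     proj_norm \<A> 2 (Ub (u, v)) \<le> H * (v - u) powr (2 * \<gamma>) \<and>
     proj_norm \<A> 3 (U1 v - U1 u) \<le> H * (v - u) powr \<gamma> \<and> proj_norm \<A> 3 (U2 v - U2 u) \<le> H * (v - u) powr \<gamma>))"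

lemma holder_const:
  shows "0 \<le> holder_const"
    and "u \<in> {s..t} \<Longrightarrow> v \<in> {s..t} \<Longrightarrow> u < v \<Longrightarrow> proj_norm \<A> 2 (Ub (u, v)) \<le> holder_const * (v - u) powr (2 * \<gamma>)"
    and "u \<in> {s..t} \<Longrightarrow> v \<in> {s..t} \<Longrightarrow> u < v \<Longrightarrow> proj_norm \<A> 3 (U1 v - U1 u) \<le> holder_const * (v - u) powr \<gamma>"
    and "u \<in> {s..t} \<Longrightarrow> v \<in> {s..t} \<Longrightarrow> u < v \<Longrightarrow> proj_norm \<A> 3 (U2 v - U2 u) \<le> holder_const * (v - u) powr \<gamma>"
proof -
  have b: "bdd_above {proj_norm \<A> 2 (Ub (u, v)) / \<bar>v - u\<bar> powr (2 * \<gamma>) | u v. u \<in> {s..t} \<and> v \<in> {s..t} \<and> u < v}"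
    "bdd_above {proj_norm \<A> 3 (U1 v - U1 u) / \<bar>v - u\<bar> powr \<gamma> | u v. u \<in> {s..t} \<and> v \<in> {s..t} \<and> u < v}"
    "bdd_above {proj_norm \<A> 3 (U2 v - U2 u) / \<bar>v - u\<bar> powr \<gamma> | u v. u \<in> {s..t} \<and> v \<in> {s..t} \<and> u < v}"
    using controlled unfolding controlled_biprocess_def holder1_def holder2_def Let_def by auto
  obtain H0 where H0: "0 \<le> H0" "\<And>u v. u \<in> {s..t} \<Longrightarrow> v \<in> {s..t} \<Longrightarrow> u < v \<Longrightarrow> proj_norm \<A> 2 (Ub (u, v)) \<le> H0 * (v - u) powr (2 * \<gamma>)"
    using holder_bound[OF b(1)] by blast
  obtain H1 where H1: "0 \<le> H1" "\<And>u v. u \<in> {s..t} \<Longrightarrow> v \<in> {s..t} \<Longrightarrow> u < v \<Longrightarrow> proj_norm \<A> 3 (U1 v - U1 u) \<le> H1 * (v - u) powr \<gamma>"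
    using holder_bound[OF b(2)] by blast
  obtain H2 where H2: "0 \<le> H2" "\<And>u v. u \<in> {s..t} \<Longrightarrow> v \<in> {s..t} \<Longrightarrow> u < v \<Longrightarrow> proj_norm \<A> 3 (U2 v - U2 u) \<le> H2 * (v - u) powr \<gamma>"
    using holder_bound[OF b(3)] by blast
  have le: "x \<le> (H0 + H1 + H2) * y" if "x \<le> H * y" "H \<in> {H0, H1, H2}" "0 \<le> y" for x y H :: real
    using that H0(1) H1(1) H2(1) mult_right_mono[of H "H0 + H1 + H2" y] by auto
  have "0 \<le> holder_const \<and> (\<forall>u\<in>{s..t}. \<forall>v\<in>{s..t}. u < v \<longrightarrow>
     proj_norm \<A> 2 (Ub (u, v)) \<le> holder_const * (v - u) powr (2 * \<gamma>) \<and>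
     proj_norm \<A> 3 (U1 v - U1 u) \<le> holder_const * (v - u) powr \<gamma> \<and> proj_norm \<A> 3 (U2 v - U2 u) \<le> holder_const * (v - u) powr \<gamma>)"
    unfolding holder_const_def
  proof (rule someI[of _ "H0 + H1 + H2"], intro conjI ballI impI)
    fix u v assume uv: "u \<in> {s..t}" "v \<in> {s..t}" "u < v"
    show "proj_norm \<A> 2 (Ub (u, v)) \<le> (H0 + H1 + H2) * (v - u) powr (2 * \<gamma>)" by (rule le[OF H0(2)[OF uv]]) simp_all
    show "proj_norm \<A> 3 (U1 v - U1 u) \<le> (H0 + H1 + H2) * (v - u) powr \<gamma>" by (rule le[OF H1(2)[OF uv]]) simp_all
    show "proj_norm \<A> 3 (U2 v - U2 u) \<le> (H0 + H1 + H2) * (v - u) powr \<gamma>" by (rule le[OF H2(2)[OF uv]]) simp_all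
  qed (use H0(1) H1(1) H2(1) in simp)
  then show "0 \<le> holder_const"
    "u \<in> {s..t} \<Longrightarrow> v \<in> {s..t} \<Longrightarrow> u < v \<Longrightarrow> proj_norm \<A> 2 (Ub (u, v)) \<le> holder_const * (v - u) powr (2 * \<gamma>)"
    "u \<in> {s..t} \<Longrightarrow> v \<in> {s..t} \<Longrightarrow> u < v \<Longrightarrow> proj_norm \<A> 3 (U1 v - U1 u) \<le> holder_const * (v - u) powr \<gamma>"
    "u \<in> {s..t} \<Longrightarrow> v \<in> {s..t} \<Longrightarrow> u < v \<Longrightarrow> proj_norm \<A> 3 (U2 v - U2 u) \<le> holder_const * (v - u) powr \<gamma>"
    by blast+
qed

definition cell :: "real \<Rightarrow> real \<Rightarrow> 'a oper" where
  "cell u v = sharp \<A> (U u) (incr u v) + insert_slot (levy u v) (U1 u) + insert_slot (area_star u v) (U2 u)"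

text \<open>The corrections of the Riemann sums are defined by extension from the filtration at time
  \<open>u\<close>, where the Levy area is \<open>levy\<close> with a factor on the left. Since
  \<open>levy\<close> is bounded and linear on the whole algebra, they are values of
  \<open>insert_slot\<close>. In the adjoint version that factor reappears, unstarred, on the
  right.\<close>

lemma corrected_cell:
  assumes "s \<le> u" "u \<le> v" "v \<le> t"
  shows "area_times_id bm u v (U1 u) = insert_slot (levy u v) (U1 u)"
    "id_times_area_star bm u v (U2 u) = insert_slot (area_star u v) (U2 u)"
proof -
  have uv: "0 \<le> u" "u \<le> v" "v \<le> 2 ^ L" and u: "u \<in> {s..t}" using assms s_nonneg t_le by auto
  note l = slot_map_levy[OF assms]
  show "area_times_id bm u v (U1 u) = insert_slot (levy u v) (U1 u)"
    unfolding area_times_id_def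
  proof (rule extend_linearly_restrict[OF slot_map_multilinear[OF l] filtration_algebra adapted_tensors(2)[OF u]])
    fix as assume as: "set as \<subseteq> filtration bm u" "length as = 3"
    then obtain x y z where "as = [x, y, z]" by (auto elim: length_3E)
    with as show "strat_area bm u v (elementary \<A> [as ! 0, as ! 1]) o\<^sub>L as ! 2 = sandwich3 (levy u v) as"
      by (simp add: strat_area_elementary[OF uv] sandwich3_def)
  qed
  show "id_times_area_star bm u v (U2 u) = insert_slot (area_star u v) (U2 u)"
    unfolding id_times_area_star_def
  proof (rule extend_linearly_restrict[OF slot_map_multilinear[OF slot_map_adj[OF l]] filtration_algebra adapted_tensors(3)[OF u]])
    fix as assume as: "set as \<subseteq> filtration bm u" "length as = 3"
    then obtain x y z where xyz: "as = [x, y, z]" by (auto elim: length_3E)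
    with as have f: "adj y \<in> filtration bm u" "adj z \<in> filtration bm u" by (auto intro: filtration_adj)
    have c: "z \<in> cops" "adj z \<in> cops" "levy u v (adj y) \<in> cops"
      using as xyz f filtration_cops levy_cops[OF uv] by auto
    show "as ! 0 o\<^sub>L adj (strat_area bm u v (elementary \<A> [adj (as ! 2), adj (as ! 1)])) = sandwich3 (area_star u v) as"
      using strat_area_elementary[OF uv f(2,1)] adj_simps(5)[OF c(2,3)] c(1)
      by (simp add: xyz sandwich3_def adj_adj blinfun_compose_assoc')
  qed
qed

lemma corrected_sum_eq:
  assumes "\<Delta> \<in> subdivisions s t"
  shows "corrected_sum bm U U1 U2 \<Delta> = sub_sum cell \<Delta>"
  unfolding corrected_sum_def sub_sum_def Let_def
  by (intro sum.cong refl) (use subdivision_cell[OF assms] in \<open>simp add: corrected_cell cell_def less_imp_le\<close>)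

lemma levy_star_chen:
  assumes uwv: "0 \<le> u" "u \<le> w" "w \<le> v" "v \<le> 2 ^ L" and b: "b \<in> filtration bm u"
  shows "area_star u v b = area_star u w b + area_star w v b + (incr w v o\<^sub>L b o\<^sub>L incr u w)"
proof -
  have b': "adj b \<in> filtration bm u" "b \<in> cops" by (rule filtration_adj[OF b]) (rule filtration_cops[OF b])
  have c: "levy u w (adj b) \<in> cops" "levy w v (adj b) \<in> cops" "(incr u w o\<^sub>L adj b o\<^sub>L incr w v) \<in> cops"
    "(incr u w o\<^sub>L adj b) \<in> cops"
    using uwv b'(2) by (auto intro!: levy_cops adj_cops cops_intros bm_cops)
  have "adj (incr u w o\<^sub>L adj b o\<^sub>L incr w v) = incr w v o\<^sub>L b o\<^sub>L incr u w"
    using b' c by (simp add: adj_simps incr_cops adj_cops adj_adj bm_cops adj_bm blinfun_compose_assoc')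
  then show ?thesis
    unfolding levy_chen[OF uwv subsetD[OF filtration_polys b'(1)]]
    using c by (simp add: adj_simps cops_intros)
qed

text \<open>The product terms of Chen's relation for the two areas cancel against the first-order
  part of \<open>U w - U u\<close>. What is left is the remainder \<open>Ub\<close> and the areas
  over [w, v] of the increments of the coefficients.\<close>

lemma cell_defect:
  assumes uwv: "s \<le> u" "u < w" "w < v" "v \<le> t"
  shows "cell u v - cell u w - cell w v = - (sharp \<A> (Ub (u, w)) (incr w v) +
    insert_slot (levy w v) (U1 w - U1 u) + insert_slot (area_star w v) (U2 w - U2 u))"
proof -
  have I: "u \<in> {s..t}" "w \<in> {s..t}" "v \<in> {s..t}" and le: "0 \<le> u" "u \<le> w" "w \<le> v" "v \<le> 2 ^ L"
    using uwv s_nonneg t_le by auto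
  note tu = tensors[OF I(1)] and tw = tensors[OF I(2)]
  have l: "slot_map (levy_const' * (v - u) powr (3/4)) (levy u v)" "slot_map (levy_const' * (w - u) powr (3/4)) (levy u w)"
    "slot_map (levy_const' * (v - w) powr (3/4)) (levy w v)" using uwv by (auto intro!: slot_map_levy)
  note l' = l[THEN slot_map_adj]
  note sw = slot_map_sandwich[OF incr_cops[where u=u and v=w] incr_cops[where u=w and v=v]] slot_map_sandwich[OF incr_cops[where u=w and v=v] incr_cops[where u=u and v=w]]
  have a: "insert_slot (levy u v) (U1 u) = insert_slot (levy u w) (U1 u) + insert_slot (levy w v) (U1 u) +
      insert_slot (\<lambda>b. incr u w o\<^sub>L b o\<^sub>L incr w v) (U1 u)"
  proof -
    have "insert_slot (levy u v) (U1 u) = insert_slot (\<lambda>b. levy u w b + levy w v b + (incr u w o\<^sub>L b o\<^sub>L incr w v)) (U1 u)"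
      by (rule insert_slot_cong[OF l(1) slot_map_add[OF slot_map_add[OF l(2,3)] sw(1)] adapted_tensors(2)[OF I(1)] filtration_algebra])
         (rule levy_chen[OF le subsetD[OF filtration_polys]])
    then show ?thesis
      unfolding insert_slot_add[OF slot_map_add[OF l(2,3)] sw(1) tu(2)] insert_slot_add[OF l(2,3) tu(2)] .
  qed
  have a': "insert_slot (area_star u v) (U2 u) = insert_slot (area_star u w) (U2 u) + insert_slot (area_star w v) (U2 u) +
      insert_slot (\<lambda>b. incr w v o\<^sub>L b o\<^sub>L incr u w) (U2 u)"
  proof -
    have "insert_slot (area_star u v) (U2 u) = insert_slot (\<lambda>b. area_star u w b + area_star w v b + (incr w v o\<^sub>L b o\<^sub>L incr u w)) (U2 u)"
      by (rule insert_slot_cong[OF l'(1) slot_map_add[OF slot_map_add[OF l'(2,3)] sw(2)] adapted_tensors(3)[OF I(1)] filtration_algebra])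
         (rule levy_star_chen[OF le])
    then show ?thesis
      unfolding insert_slot_add[OF slot_map_add[OF l'(2,3)] sw(2) tu(3)] insert_slot_add[OF l'(2,3) tu(3)] .
  qed
  have first: "sharp \<A> (U u) (incr u v) = sharp \<A> (U u) (incr u w) + sharp \<A> (U u) (incr w v)"
    using sharp_add_right[OF incr_cops[where u=u and v=w] incr_cops[where u=w and v=v] tu(1)] by simp
  have "U w - U u = sharp_left \<A> (incr u w) (U1 u) + sharp_right \<A> (U2 u) (incr u w) + Ub (u, w)"
    using controlled I uwv unfolding controlled_biprocess_def by blast
  then have Uw: "U w = U u + (sharp_left \<A> (incr u w) (U1 u) + sharp_right \<A> (U2 u) (incr u w) + Ub (u, w))"
    by (simp add: algebra_simps)
  have iA: "incr u w \<in> \<A>" using uwv by (intro incr_algebra) auto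
  note lr = sharp_left_right_tensor(1)[OF iA tu(2)] sharp_left_right_tensor(2)[OF iA tu(3)]
  note ub = remainder_tensor[OF I(1,2) le(2)]
  note add = sharp_tensor_add[OF incr_cops[where u=w and v=v]]
  have second: "sharp \<A> (U w) (incr w v) = sharp \<A> (U u) (incr w v) + (insert_slot (\<lambda>b. incr u w o\<^sub>L b o\<^sub>L incr w v) (U1 u) +
      insert_slot (\<lambda>b. incr w v o\<^sub>L b o\<^sub>L incr u w) (U2 u) + sharp \<A> (Ub (u, w)) (incr w v))"
    unfolding Uw add(2)[OF tu(1) add(1)[OF add(1)[OF lr] ub]] add(2)[OF add(1)[OF lr] ub] add(2)[OF lr]
      sharp_contract(1)[OF iA incr_cops tu(2)] sharp_contract(2)[OF iA incr_cops tu(3)] ..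
  show ?thesis
    unfolding cell_def first second a a' insert_slot_diff[OF l(3) tw(2) tu(2)] insert_slot_diff[OF l'(3) tw(3) tu(3)]
    by (simp add: algebra_simps)
qed

text \<open>The defect has orders 2 \<gamma> + 1/2 and \<gamma> + 3/4. As \<gamma> > 1/3, both
  exceed 13/12 = 1/3 + 3/4, which serves as the sewing exponent; the excess is absorbed in powers of
  t - s.\<close>

definition sewing_const :: real where
  "sewing_const = incr_const * holder_const * (t - s) powr (2 * \<gamma> + 1/2 - 13/12) +
     2 * (levy_const' * holder_const * (t - s) powr (\<gamma> + 3/4 - 13/12))"

lemma norm_cell_defect_le:
  assumes uwv: "s \<le> u" "u < w" "w < v" "v \<le> t"
  shows "norm (cell u v - cell u w - cell w v) \<le> sewing_const * (v - u) powr (13/12)"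
proof -
  have I: "u \<in> {s..t}" "w \<in> {s..t}" "v \<in> {s..t}" and uw: "u \<le> w" using uwv by auto
  have l: "slot_map (levy_const' * (v - w) powr (3/4)) (levy w v)" using uwv by (auto intro!: slot_map_levy)
  define d where "d = v - u"
  have d: "0 < d" "d \<le> t - s" "w - u \<le> d" "v - w \<le> d" "0 < w - u" "0 < v - w" using uwv by (auto simp: d_def)
  have pw: "d powr (2 * \<gamma> + 1/2) \<le> (t - s) powr (2 * \<gamma> + 1/2 - 13/12) * d powr (13/12)"
    "d powr (\<gamma> + 3/4) \<le> (t - s) powr (\<gamma> + 3/4 - 13/12) * d powr (13/12)"
    using \<gamma> d by (intro powr_le_powr; simp)+
  have "norm (sharp \<A> (Ub (u, w)) (incr w v)) \<le> norm (incr w v) * proj_norm \<A> 2 (Ub (u, w))"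
    by (rule norm_sharp_le[OF incr_cops remainder_tensor[OF I(1,2) uw]])
  also have "\<dots> \<le> (incr_const * d powr (1/2)) * (holder_const * d powr (2 * \<gamma>))"
  proof (rule mult_mono)
    have "norm (incr w v) \<le> incr_const * sqrt (v - w)" using uwv s_nonneg by (intro norm_bm_diff_le) auto
    also have "\<dots> \<le> incr_const * d powr (1/2)"
      using d incr_const_pos by (simp add: powr_half_sqrt)
    finally show "norm (incr w v) \<le> incr_const * d powr (1/2)" .
    have "proj_norm \<A> 2 (Ub (u, w)) \<le> holder_const * (w - u) powr (2 * \<gamma>)" by (rule holder_const(2)[OF I(1,2) uwv(2)])
    also have "\<dots> \<le> holder_const * d powr (2 * \<gamma>)" using d \<gamma> by (intro mult_left_mono powr_mono2 holder_const(1)) auto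
    finally show "proj_norm \<A> 2 (Ub (u, w)) \<le> holder_const * d powr (2 * \<gamma>)" .
  qed (use incr_const_pos proj_norm_nonneg[OF remainder_tensor[OF I(1,2) uw]] in auto)
  also have "\<dots> = incr_const * holder_const * d powr (2 * \<gamma> + 1/2)" by (simp add: powr_add)
  also have "\<dots> \<le> incr_const * holder_const * ((t - s) powr (2 * \<gamma> + 1/2 - 13/12) * d powr (13/12))"
    using incr_const_pos holder_const(1) by (intro mult_left_mono pw) auto
  finally have 1: "norm (sharp \<A> (Ub (u, w)) (incr w v)) \<le> incr_const * holder_const * ((t - s) powr (2 * \<gamma> + 1/2 - 13/12) * d powr (13/12))" .
  have 2: "norm (insert_slot \<phi> (V w - V u)) \<le> levy_const' * holder_const * ((t - s) powr (\<gamma> + 3/4 - 13/12) * d powr (13/12))"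
    if \<phi>: "slot_map (levy_const' * (v - w) powr (3/4)) \<phi>" and V: "V w - V u \<in> tensor_power_of \<A> \<A> 3"
      "proj_norm \<A> 3 (V w - V u) \<le> holder_const * (w - u) powr \<gamma>" for \<phi> V
  proof -
    have "norm (insert_slot \<phi> (V w - V u)) \<le> (levy_const' * (v - w) powr (3/4)) * proj_norm \<A> 3 (V w - V u)"
      by (rule norm_insert_slot_le[OF \<phi> V(1)])
    also have "\<dots> \<le> (levy_const' * d powr (3/4)) * (holder_const * d powr \<gamma>)"
    proof (rule mult_mono)
      show "levy_const' * (v - w) powr (3/4) \<le> levy_const' * d powr (3/4)"
        using d levy_const'_nonneg by (intro mult_left_mono powr_mono2) auto
      have "holder_const * (w - u) powr \<gamma> \<le> holder_const * d powr \<gamma>" using d \<gamma> by (intro mult_left_mono powr_mono2 holder_const(1)) auto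
      then show "proj_norm \<A> 3 (V w - V u) \<le> holder_const * d powr \<gamma>" using V(2) by (rule order_trans[rotated])
    qed (use levy_const'_nonneg proj_norm_nonneg[OF V(1)] in auto)
    also have "\<dots> = levy_const' * holder_const * d powr (\<gamma> + 3/4)" by (simp add: powr_add)
    also have "\<dots> \<le> levy_const' * holder_const * ((t - s) powr (\<gamma> + 3/4 - 13/12) * d powr (13/12))"
      using levy_const'_nonneg holder_const(1) by (intro mult_left_mono pw) auto
    finally show ?thesis .
  qed
  note t1 = tensor_power_diff[OF tensors(2)[OF I(2)] tensors(2)[OF I(1)]]
    and t2 = tensor_power_diff[OF tensors(3)[OF I(2)] tensors(3)[OF I(1)]]
  have "norm (cell u v - cell u w - cell w v) \<le> incr_const * holder_const * ((t - s) powr (2 * \<gamma> + 1/2 - 13/12) * d powr (13/12)) +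
      levy_const' * holder_const * ((t - s) powr (\<gamma> + 3/4 - 13/12) * d powr (13/12)) +
      levy_const' * holder_const * ((t - s) powr (\<gamma> + 3/4 - 13/12) * d powr (13/12))"
    unfolding cell_defect[OF uwv] norm_minus_cancel
    by (intro norm_triangle_mono 1 2 l slot_map_adj t1 t2 holder_const I uwv)
  then show ?thesis by (simp add: sewing_const_def d_def algebra_simps)
qed

lemma corrected_sum_converges: "(corrected_sum bm U U1 U2 \<longlongrightarrow> rough_integral bm s t U U1 U2) (mesh_to_0 s t)"
proof -
  \<comment> \<open>Sewing asks for zero on the diagonal. The modification is invisible to the sums
    because subdivisions are strictly increasing.\<close>
  define A where "A u v = (if u = v then 0 else cell u v)" for u v
  have K0: "0 \<le> sewing_const"
    using incr_const_pos holder_const(1) levy_const'_nonneg by (simp add: sewing_const_def)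
  obtain I where I: "(sub_sum A \<longlongrightarrow> I) (mesh_to_0 s t)"
    by (rule sewing[of s t "13/12" sewing_const A])
       (use s_less_t K0 norm_cell_defect_le in \<open>auto simp: A_def\<close>)
  have "eventually (\<lambda>\<Delta>. \<Delta> \<in> subdivisions s t) (mesh_to_0 s t)"
    unfolding mesh_to_0_def by (simp add: eventually_inf_principal)
  then have "eventually (\<lambda>\<Delta>. sub_sum A \<Delta> = corrected_sum bm U U1 U2 \<Delta>) (mesh_to_0 s t)"
  proof (rule eventually_mono)
    fix \<Delta> assume \<Delta>: "\<Delta> \<in> subdivisions s t"
    have "sub_sum A \<Delta> = sub_sum cell \<Delta>"
      by (rule sub_sum_pointwise) (use subdivision_cell(2)[OF \<Delta>] in \<open>simp add: A_def less_imp_neq\<close>)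
    then show "sub_sum A \<Delta> = corrected_sum bm U U1 U2 \<Delta>" using corrected_sum_eq[OF \<Delta>] by simp
  qed
  from Lim_transform_eventually[OF I this] have lim: "(corrected_sum bm U U1 U2 \<longlongrightarrow> I) (mesh_to_0 s t)" .
  moreover have "rough_integral bm s t U U1 U2 = I"
    unfolding rough_integral_def by (rule tendsto_Lim[OF mesh_to_0_neq_bot[OF s_less_t] lim])
  ultimately show ?thesis by simp
qed

end

subsection \<open>The trapezoidal sums\<close>

context controlled_integrand
begin

text \<open>The symmetric part of the area minus the area. It is written as a sum with the scalar -1
  so that the rules for sums and real multiples of slot maps apply.\<close>

definition levy_rest :: "real \<Rightarrow> real \<Rightarrow> 'a oper \<Rightarrow> 'a oper" where
  "levy_rest u v b = (1/2) *\<^sub>R (incr u v o\<^sub>L b o\<^sub>L incr u v) + (- 1) *\<^sub>R levy u v b"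

abbreviation "levy_rest_star u v \<equiv> (\<lambda>b. adj (levy_rest u v (adj b)))"

definition trap_rest :: "real \<Rightarrow> real \<Rightarrow> 'a oper" where
  "trap_rest u v = insert_slot (levy_rest u v) (U1 u) + insert_slot (levy_rest_star u v) (U2 u)"

lemma levy_rest_eq: "levy_rest u v b = - (levy u v b - (1/2) *\<^sub>R (incr u v o\<^sub>L b o\<^sub>L incr u v))"
  by (simp add: levy_rest_def)

lemma slot_map_sandwich_incr: "slot_map (\<bar>1/2\<bar> * (norm (incr u v) * norm (incr u v))) (\<lambda>b. (1/2) *\<^sub>R (incr u v o\<^sub>L b o\<^sub>L incr u v))"
  by (intro slot_map_scaleR slot_map_sandwich incr_cops)

lemma slot_map_levy_rest:
  assumes uv: "s \<le> u" "u \<le> v" "v \<le> t"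
  shows "slot_map (levy_const * (v - u) powr (3/4)) (levy_rest u v)"
proof -
  have "slot_map (\<bar>1/2\<bar> * (norm (incr u v) * norm (incr u v)) + \<bar>- 1\<bar> * (levy_const' * (v - u) powr (3/4))) (levy_rest u v)"
    unfolding levy_rest_def[abs_def] by (intro slot_map_add slot_map_sandwich_incr slot_map_scaleR[OF slot_map_levy[OF uv]])
  from slot_mapD[OF this] show ?thesis
    unfolding slot_map_def
    using norm_levy_diff_le[of u v] uv s_nonneg t_le sub_cops levy_const_nonneg
    by (auto simp: levy_rest_eq norm_minus_commute subset_iff)
qed

lemma levy_rest_star_eq:
  assumes "u \<in> {s..t}" "v \<in> {s..t}" "u \<le> v" "b \<in> \<A>"
  shows "levy_rest_star u v b = (1/2) *\<^sub>R (incr u v o\<^sub>L b o\<^sub>L incr u v) + (- 1) *\<^sub>R area_star u v b"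
proof -
  have c: "b \<in> cops" "adj b \<in> cops" using assms(4) sub_cops adj_cops by auto
  then have c': "levy u v (adj b) \<in> cops" "(incr u v o\<^sub>L adj b) \<in> cops" "(incr u v o\<^sub>L adj b o\<^sub>L incr u v) \<in> cops"
    using assms s_nonneg t_le by (auto intro!: levy_cops cops_intros bm_cops)
  have "adj (incr u v o\<^sub>L adj b o\<^sub>L incr u v) = incr u v o\<^sub>L b o\<^sub>L incr u v"
    using c c' by (simp add: adj_simps incr_cops adj_adj bm_cops adj_bm blinfun_compose_assoc')
  then show ?thesis
    unfolding levy_rest_def using c' by (simp add: adj_simps cops_intros)
qed

text \<open>The trapezoid is the left-point term plus half of the increment of \<open>U\<close>
  contracted with \<delta>X. By the controlled expansion this half is the symmetric part of the
  second-order correction, for both coefficients, plus half of the remainder.\<close>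

lemma trapezoid_cell:
  assumes uv: "s \<le> u" "u < v" "v \<le> t"
  shows "(1/2) *\<^sub>R sharp \<A> (U u + U v) (incr u v) - cell u v =
    (1/2) *\<^sub>R sharp \<A> (Ub (u, v)) (incr u v) + trap_rest u v"
proof -
  have I: "u \<in> {s..t}" "v \<in> {s..t}" and le: "u \<le> v" using uv by auto
  note tu = tensors[OF I(1)] and tv = tensors[OF I(2)]
  have l: "slot_map (levy_const' * (v - u) powr (3/4)) (levy u v)" using uv by (auto intro!: slot_map_levy)
  note lr = slot_map_levy_rest[OF uv(1) le uv(3)]
  have iA: "incr u v \<in> \<A>" using uv by (intro incr_algebra) auto
  have sand: "insert_slot (\<lambda>b. (1/2) *\<^sub>R (incr u v o\<^sub>L b o\<^sub>L incr u v)) z = (1/2) *\<^sub>R insert_slot (\<lambda>b. incr u v o\<^sub>L b o\<^sub>L incr u v) z"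
    if "z \<in> tensor_power_of \<A> \<A> 3" for z
    by (rule insert_slot_scaleR[OF slot_map_sandwich[OF incr_cops incr_cops] that])
  have 1: "insert_slot (levy_rest u v) (U1 u) =
      (1/2) *\<^sub>R insert_slot (\<lambda>b. incr u v o\<^sub>L b o\<^sub>L incr u v) (U1 u) - insert_slot (levy u v) (U1 u)"
    unfolding levy_rest_def[abs_def] insert_slot_add[OF slot_map_sandwich_incr slot_map_scaleR[OF l] tu(2)]
      insert_slot_scaleR[OF l tu(2)] sand[OF tu(2)] by simp
  have 2: "insert_slot (levy_rest_star u v) (U2 u) =
      (1/2) *\<^sub>R insert_slot (\<lambda>b. incr u v o\<^sub>L b o\<^sub>L incr u v) (U2 u) - insert_slot (area_star u v) (U2 u)"
  proof -
    have "insert_slot (levy_rest_star u v) (U2 u) =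
        insert_slot (\<lambda>b. (1/2) *\<^sub>R (incr u v o\<^sub>L b o\<^sub>L incr u v) + (- 1) *\<^sub>R area_star u v b) (U2 u)"
      by (rule insert_slot_cong[OF slot_map_adj[OF lr] slot_map_add[OF slot_map_sandwich_incr slot_map_scaleR[OF slot_map_adj[OF l]]] tu(3) order_refl])
         (rule levy_rest_star_eq[OF I le])
    then show ?thesis
      unfolding insert_slot_add[OF slot_map_sandwich_incr slot_map_scaleR[OF slot_map_adj[OF l]] tu(3)]
        insert_slot_scaleR[OF slot_map_adj[OF l] tu(3)] sand[OF tu(3)] by simp
  qed
  have "U v - U u = sharp_left \<A> (incr u v) (U1 u) + sharp_right \<A> (U2 u) (incr u v) + Ub (u, v)"
    using controlled I uv unfolding controlled_biprocess_def by blast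
  then have Uv: "U v = U u + (sharp_left \<A> (incr u v) (U1 u) + sharp_right \<A> (U2 u) (incr u v) + Ub (u, v))"
    by (simp add: algebra_simps)
  note lr = sharp_left_right_tensor(1)[OF iA tu(2)] sharp_left_right_tensor(2)[OF iA tu(3)]
  note ub = remainder_tensor[OF I le]
  note add = sharp_tensor_add[OF incr_cops[where u=u and v=v]]
  have "sharp \<A> (U v) (incr u v) = sharp \<A> (U u) (incr u v) + (insert_slot (\<lambda>b. incr u v o\<^sub>L b o\<^sub>L incr u v) (U1 u) +
      insert_slot (\<lambda>b. incr u v o\<^sub>L b o\<^sub>L incr u v) (U2 u) + sharp \<A> (Ub (u, v)) (incr u v))"
    unfolding Uv add(2)[OF tu(1) add(1)[OF add(1)[OF lr] ub]] add(2)[OF add(1)[OF lr] ub] add(2)[OF lr]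
      sharp_contract(1)[OF iA incr_cops tu(2)] sharp_contract(2)[OF iA incr_cops tu(3)] ..
  then show ?thesis
    unfolding add(2)[OF tu(1) tv(1)] cell_def trap_rest_def 1 2
    by (simp add: scaleR_add_right algebra_simps flip: scaleR_add_left)
qed

lemma trapezoidal_sum_eq:
  assumes \<Delta>: "\<Delta> \<in> subdivisions s t"
  shows "trapezoidal_sum bm U \<Delta> - corrected_sum bm U U1 U2 \<Delta> =
    sub_sum (\<lambda>u v. (1/2) *\<^sub>R sharp \<A> (Ub (u, v)) (incr u v)) \<Delta> + sub_sum trap_rest \<Delta>"
proof -
  have "trapezoidal_sum bm U \<Delta> - corrected_sum bm U U1 U2 \<Delta> = sub_sum (\<lambda>u v. (1/2) *\<^sub>R sharp \<A> (U u + U v) (incr u v) - cell u v) \<Delta>"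
    unfolding corrected_sum_eq[OF \<Delta>] by (simp add: trapezoidal_sum_def sub_sum_def Let_def sum_subtractf)
  also have "\<dots> = sub_sum (\<lambda>u v. (1/2) *\<^sub>R sharp \<A> (Ub (u, v)) (incr u v) + trap_rest u v) \<Delta>"
    by (rule sub_sum_pointwise, rule trapezoid_cell) (use subdivision_cell[OF \<Delta>] in auto)
  finally show ?thesis by (simp add: sub_sum_def sum.distrib)
qed

text \<open>Bounds the coefficients uniformly on [s, t]: the norm at \<open>s\<close> plus the
  largest possible increment.\<close>

definition slot_bound :: real where
  "slot_bound = (proj_norm \<A> 3 (U1 s) + holder_const * (t - s) powr \<gamma>) + (proj_norm \<A> 3 (U2 s) + holder_const * (t - s) powr \<gamma>)"

lemma norm_trap_rest_le:
  assumes uv: "s \<le> u" "u \<le> v" "v \<le> t"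
  shows "norm (trap_rest u v) \<le> levy_const * (v - u) powr (3/4) * slot_bound"
proof -
  have I: "s \<in> {s..t}" "u \<in> {s..t}" using uv by auto
  have K: "0 \<le> levy_const * (v - u) powr (3/4)" using levy_const_nonneg by simp
  have *: "norm (insert_slot \<phi> (V u)) \<le> levy_const * (v - u) powr (3/4) * (proj_norm \<A> 3 (V s) + holder_const * (t - s) powr \<gamma>)"
    if \<phi>: "slot_map (levy_const * (v - u) powr (3/4)) \<phi>" and V: "\<And>r. r \<in> {s..t} \<Longrightarrow> V r \<in> tensor_power_of \<A> \<A> 3"
      and H: "\<And>r. r \<in> {s..t} \<Longrightarrow> s < r \<Longrightarrow> proj_norm \<A> 3 (V r - V s) \<le> holder_const * (r - s) powr \<gamma>" for \<phi> V
  proof (cases "u = s")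
    case True
    have "norm (insert_slot \<phi> (V u)) \<le> levy_const * (v - u) powr (3/4) * proj_norm \<A> 3 (V s)"
      using norm_insert_slot_le[OF \<phi> V[OF I(1)]] True by simp
    also have "\<dots> \<le> levy_const * (v - u) powr (3/4) * (proj_norm \<A> 3 (V s) + holder_const * (t - s) powr \<gamma>)"
      using K holder_const(1) by (intro mult_left_mono) auto
    finally show ?thesis .
  next
    case False
    \<comment> \<open>The coefficient is split before estimating, so that linearity of the insertion
      takes the place of a triangle inequality for the projective norm.\<close>
    have "insert_slot \<phi> (V u) = insert_slot \<phi> (V s) + insert_slot \<phi> (V u - V s)"
      unfolding insert_slot_diff[OF \<phi> V[OF I(2)] V[OF I(1)]] by simp
    also have "norm \<dots> \<le> levy_const * (v - u) powr (3/4) * proj_norm \<A> 3 (V s) + levy_const * (v - u) powr (3/4) * (holder_const * (t - s) powr \<gamma>)"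
    proof (rule norm_triangle_mono[OF norm_insert_slot_le[OF \<phi> V[OF I(1)]] order_trans[OF norm_insert_slot_le[OF \<phi> tensor_power_diff[OF V[OF I(2)] V[OF I(1)]]]]])
      have "proj_norm \<A> 3 (V u - V s) \<le> holder_const * (u - s) powr \<gamma>" using H[OF I(2)] False uv by simp
      also have "\<dots> \<le> holder_const * (t - s) powr \<gamma>" using uv \<gamma> by (intro mult_left_mono powr_mono2 holder_const(1)) auto
      finally show "levy_const * (v - u) powr (3/4) * proj_norm \<A> 3 (V u - V s) \<le> levy_const * (v - u) powr (3/4) * (holder_const * (t - s) powr \<gamma>)"
        by (rule mult_left_mono[OF _ K])
    qed
    finally show ?thesis by (simp add: distrib_left)
  qed
  note l = slot_map_levy_rest[OF uv]
  have "norm (trap_rest u v) \<le> levy_const * (v - u) powr (3/4) * (proj_norm \<A> 3 (U1 s) + holder_const * (t - s) powr \<gamma>) +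
      levy_const * (v - u) powr (3/4) * (proj_norm \<A> 3 (U2 s) + holder_const * (t - s) powr \<gamma>)"
    unfolding trap_rest_def
    by (intro norm_triangle_mono *[of _ U1] *[of _ U2] l slot_map_adj tensors holder_const(3,4)[OF I(1)])
  then show ?thesis unfolding slot_bound_def distrib_left[symmetric] .
qed

lemma trap_rest_filtration:
  assumes uv: "s \<le> u" "u \<le> v" "v \<le> t"
  shows "trap_rest u v \<in> filtration bm v"
proof -
  have u: "u \<in> {s..t}" and le: "0 \<le> u" "u \<le> v" "v \<le> 2 ^ L" using uv s_nonneg t_le by auto
  note l = slot_map_levy_rest[OF uv]
  have R: "levy_rest u v b \<in> filtration bm v" if "b \<in> filtration bm u" for b
    using that levy_filtration[OF le] filtration_mono[OF uv(2)] filtration_bm[of u v] filtration_bm[of v v] le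
    unfolding levy_rest_def by (intro filtration_ops filtration_scaleR filtration_diff) auto
  have "insert_slot \<phi> z \<in> filtration bm v"
    if "slot_map K \<phi>" "z \<in> tensor_power_of \<A> (filtration bm u) 3" "\<And>b. b \<in> filtration bm u \<Longrightarrow> \<phi> b \<in> filtration bm v" for K \<phi> z
  proof (rule ext_closed[OF slot_map_multilinear[OF that(1)] that(2) filtration_algebra closed_filtration filtration_zero filtration_ops(1)])
    fix as assume "set as \<subseteq> filtration bm u" "length as = 3"
    then show "sandwich3 \<phi> as \<in> filtration bm v"
      using that(3) filtration_mono[OF uv(2)]
      by (elim length_3E) (auto simp: sandwich3_def intro!: filtration_ops)
  qed
  then show ?thesis
    unfolding trap_rest_def
    using adapted_tensors[OF u] l slot_map_adj[OF l] R filtration_adj by (intro filtration_ops(1)) blast+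
qed

text \<open>The discarded part of the Levy area has conditional mean zero given the past.\<close>

lemma trap_rest_orthogonal:
  assumes uv: "s \<le> u" "u \<le> v" "v \<le> t" and w: "w \<in> past_space u" "w' \<in> past_space u"
  shows "cinner w' (blinfun_apply (trap_rest u v) w) = 0"
proof -
  have u: "u \<in> {s..t}" and le: "0 \<le> u" "u \<le> v" "v \<le> 2 ^ L" using uv s_nonneg t_le by auto
  note l = slot_map_levy_rest[OF uv]
  have R: "cinner x' (blinfun_apply (levy_rest u v b) x) = 0"
    if "b \<in> filtration bm u" "x \<in> past_space u" "x' \<in> past_space u" for b x x'
    using levy_orthogonal[OF le subsetD[OF filtration_polys that(1)] that(2,3)]
    unfolding levy_rest_eq blinfun.minus_left by (simp add: cinner_minus)
  have R': "cinner x' (blinfun_apply (levy_rest_star u v b) x) = 0"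
    if "b \<in> filtration bm u" "x \<in> past_space u" "x' \<in> past_space u" for b x x'
  proof -
    have "levy_rest u v (adj b) \<in> cops"
      using slot_mapD(2)[OF l] that(1) filtration_algebra adj_closed by blast
    then have "cinner x' (blinfun_apply (levy_rest_star u v b) x) = cinner (blinfun_apply (levy_rest u v (adj b)) x') x"
      by (rule adj_cinner[symmetric])
    also have "\<dots> = cnj (cinner x (blinfun_apply (levy_rest u v (adj b)) x'))" by (rule cinner_cnj)
    finally show ?thesis using R[OF filtration_adj[OF that(1)] that(3,2)] by simp
  qed
  have "cinner w' (blinfun_apply (insert_slot \<phi> z) w) = 0"
    if "slot_map K \<phi>" "z \<in> tensor_power_of \<A> (filtration bm u) 3"
      "\<And>b x x'. b \<in> filtration bm u \<Longrightarrow> x \<in> past_space u \<Longrightarrow> x' \<in> past_space u \<Longrightarrow> cinner x' (blinfun_apply (\<phi> b) x) = 0" for K \<phi> z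
  proof (rule ext_cinner_zero[OF slot_map_multilinear[OF that(1)] that(2) filtration_algebra])
    fix as assume as: "set as \<subseteq> filtration bm u" "length as = 3"
    then obtain x y z where xyz: "as = [x, y, z]" by (auto elim: length_3E)
    then have f: "x \<in> filtration bm u" "y \<in> filtration bm u" "z \<in> filtration bm u" using as by auto
    have "cinner w' (blinfun_apply (sandwich3 \<phi> as) w) = cinner (blinfun_apply (adj x) w') (blinfun_apply (\<phi> y) (blinfun_apply z w))"
      using adj_cinner'[OF filtration_cops[OF f(1)]] by (simp add: sandwich3_def xyz)
    also have "\<dots> = 0"
      by (intro that(3) f past_space_filtration w filtration_adj)
    finally show "cinner w' (blinfun_apply (sandwich3 \<phi> as) w) = 0" .
  qed
  from this[OF l adapted_tensors(2)[OF u] R] this[OF slot_map_adj[OF l] adapted_tensors(3)[OF u] R']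
  show ?thesis by (simp add: trap_rest_def blinfun.bilinear_simps cinner_add_right)
qed

text \<open>A martingale difference argument: for i < j the vector \<open>y i\<close> belongs to the
  past of cell j, and its inner product with \<open>y j\<close> is that of \<open>D j\<close>
  between vectors of the past. By Pythagoras the squares of the individual bounds add up, and the
  exponent 3/2 leaves the mesh to the power 1/2.\<close>

lemma norm_sum_trap_rest_le:
  assumes \<Delta>: "\<Delta> \<in> subdivisions s t"
  shows "(norm (blinfun_apply (adj (sub_sum trap_rest \<Delta>)) vacuum))\<^sup>2 \<le> (levy_const * slot_bound)\<^sup>2 * ((t - s) * mesh \<Delta> powr (1/2))"
proof -
  define I where "I = {i. Suc i < length \<Delta>}"
  define D where "D i = trap_rest (\<Delta> ! i) (\<Delta> ! Suc i)" for i
  define y where "y i = blinfun_apply (adj (D i)) vacuum" for i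
  have fin: "finite I" unfolding I_def by (rule finite_subset[of _ "{..<length \<Delta>}"]) auto
  note cell = subdivision_cell[OF \<Delta>]
  have f: "D i \<in> filtration bm (\<Delta> ! Suc i)" if "i \<in> I" for i
    using that cell unfolding D_def I_def by (intro trap_rest_filtration) (auto intro: less_imp_le)
  have c: "D i \<in> cops" if "i \<in> I" for i using f[OF that] by (rule filtration_cops)
  have past: "y i \<in> past_space (\<Delta> ! Suc i)" if "i \<in> I" for i
    unfolding y_def by (intro past_space_filtration[OF filtration_adj[OF f[OF that]]] vacuum_past_space)
  have orth: "cinner (y i) (y j) = 0" if "i \<in> I" "j \<in> I" "i < j" for i j
  proof -
    have "\<Delta> ! Suc i \<le> \<Delta> ! j"
      using sorted_wrt_nth_less[OF subdivisionsD(2)[OF \<Delta>], of "Suc i" j] that by (cases "Suc i = j") (auto simp: I_def)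
    then have p: "y i \<in> past_space (\<Delta> ! j)" using past[OF that(1)] past_space_mono by blast
    have "cinner vacuum (blinfun_apply (D j) (y i)) = 0"
      using that cell unfolding D_def I_def by (intro trap_rest_orthogonal p vacuum_past_space) (auto intro: less_imp_le)
    then have "cinner (blinfun_apply (D j) (y i)) vacuum = 0" by (subst cinner_cnj) simp
    then show ?thesis unfolding y_def[of j] adj_cinner[OF c[OF that(2)], symmetric] .
  qed
  have "(norm (\<Sum>i\<in>I. y i))\<^sup>2 = (\<Sum>i\<in>I. (norm (y i))\<^sup>2)"
  proof (rule norm_sum_Pythagorean[OF fin], rule pairwiseI)
    fix i j assume ij: "i \<in> I" "j \<in> I" "i \<noteq> j"
    then have "cinner (y i) (y j) = 0 \<or> cinner (y j) (y i) = 0" using orth by (cases i j rule: linorder_cases) auto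
    then have "inner (y i) (y j) = 0 \<or> inner (y j) (y i) = 0" by (auto simp flip: Re_cinner)
    then show "orthogonal (y i) (y j)" by (auto simp: orthogonal_def inner_commute)
  qed
  also have "(\<Sum>i\<in>I. y i) = blinfun_apply (adj (sub_sum trap_rest \<Delta>)) vacuum"
    using adj_sum[of I D] c unfolding sub_sum_def y_def I_def[symmetric] D_def[symmetric] by (simp add: blinfun.sum_left)
  also have "(\<Sum>i\<in>I. (norm (y i))\<^sup>2) \<le> (\<Sum>i\<in>I. (levy_const * slot_bound)\<^sup>2 * (\<Delta> ! Suc i - \<Delta> ! i) powr (3/2))"
  proof (rule sum_mono)
    fix i assume i: "i \<in> I"
    define d where "d = \<Delta> ! Suc i - \<Delta> ! i"
    have d: "0 < d" using i cell unfolding I_def d_def by auto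
    have "norm (y i) \<le> norm (adj (D i)) * norm vacuum" unfolding y_def by (rule norm_blinfun)
    also have "\<dots> = norm (D i)" using norm_adj[OF c[OF i]] norm_vacuum by simp
    also have "\<dots> \<le> levy_const * d powr (3/4) * slot_bound"
      using i cell unfolding D_def d_def I_def by (intro norm_trap_rest_le) (auto intro: less_imp_le)
    finally have "(norm (y i))\<^sup>2 \<le> (levy_const * d powr (3/4) * slot_bound)\<^sup>2" by (intro power_mono) auto
    also have "\<dots> = (levy_const * slot_bound)\<^sup>2 * (d powr (3/4))\<^sup>2" by (simp add: power_mult_distrib)
    also have "(d powr (3/4))\<^sup>2 = d powr (3/2)" by (simp add: power2_eq_square flip: powr_add)
    finally show "(norm (y i))\<^sup>2 \<le> (levy_const * slot_bound)\<^sup>2 * (\<Delta> ! Suc i - \<Delta> ! i) powr (3/2)" by (simp add: d_def)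
  qed
  also have "\<dots> = (levy_const * slot_bound)\<^sup>2 * sub_sum (\<lambda>u v. (v - u) powr (3/2)) \<Delta>"
    unfolding sub_sum_def I_def by (simp add: sum_distrib_left)
  also have "\<dots> \<le> (levy_const * slot_bound)\<^sup>2 * ((t - s) * mesh \<Delta> powr (3/2 - 1))"
    by (intro mult_left_mono sub_sum_powr_le[OF \<Delta>]) auto
  finally show ?thesis by simp
qed

text \<open>The order 2 \<gamma> + 1/2 of a single term exceeds 1, so here the operator norm
  suffices and no cancellation is required.\<close>

lemma norm_sum_remainder_le:
  assumes \<Delta>: "\<Delta> \<in> subdivisions s t"
  shows "norm (sub_sum (\<lambda>u v. (1/2) *\<^sub>R sharp \<A> (Ub (u, v)) (incr u v)) \<Delta>) \<le>
    incr_const * holder_const * ((t - s) * mesh \<Delta> powr (2 * \<gamma> - 1/2))"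
proof -
  have "norm (sub_sum (\<lambda>u v. (1/2) *\<^sub>R sharp \<A> (Ub (u, v)) (incr u v)) \<Delta>) \<le>
      sub_sum (\<lambda>u v. incr_const * holder_const * (v - u) powr (2 * \<gamma> + 1/2)) \<Delta>"
  proof (rule norm_sub_sum_le)
    fix i assume "Suc i < length \<Delta>"
    note cell = subdivision_cell[OF \<Delta> this]
    define u v where "u = \<Delta> ! i" and "v = \<Delta> ! Suc i"
    have uv: "u \<in> {s..t}" "v \<in> {s..t}" "u < v" using cell by (auto simp: u_def v_def)
    note r = remainder_tensor[OF uv(1,2) less_imp_le[OF uv(3)]]
    have "norm (sharp \<A> (Ub (u, v)) (incr u v)) \<le> norm (incr u v) * proj_norm \<A> 2 (Ub (u, v))"
      by (rule norm_sharp_le[OF incr_cops r])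
    also have "\<dots> \<le> (incr_const * (v - u) powr (1/2)) * (holder_const * (v - u) powr (2 * \<gamma>))"
    proof (rule mult_mono)
      show "norm (incr u v) \<le> incr_const * (v - u) powr (1/2)"
        using norm_bm_diff_le[of u v] uv s_nonneg by (simp add: powr_half_sqrt)
    qed (use holder_const(2)[OF uv] incr_const_pos proj_norm_nonneg[OF r] in auto)
    also have "\<dots> = incr_const * holder_const * (v - u) powr (2 * \<gamma> + 1/2)" by (simp add: powr_add)
    finally have "norm (sharp \<A> (Ub (u, v)) (incr u v)) \<le> incr_const * holder_const * (v - u) powr (2 * \<gamma> + 1/2)" .
    moreover have "norm ((1/2) *\<^sub>R sharp \<A> (Ub (u, v)) (incr u v)) \<le> norm (sharp \<A> (Ub (u, v)) (incr u v))"
      by simp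
    ultimately have "norm ((1/2) *\<^sub>R sharp \<A> (Ub (u, v)) (incr u v)) \<le> incr_const * holder_const * (v - u) powr (2 * \<gamma> + 1/2)"
      by (rule order_trans[rotated])
    then show "norm ((1/2) *\<^sub>R sharp \<A> (Ub (\<Delta> ! i, \<Delta> ! Suc i)) (incr (\<Delta> ! i) (\<Delta> ! Suc i))) \<le>
        incr_const * holder_const * (\<Delta> ! Suc i - \<Delta> ! i) powr (2 * \<gamma> + 1/2)" by (simp add: u_def v_def)
  qed
  also have "\<dots> \<le> incr_const * holder_const * ((t - s) * mesh \<Delta> powr (2 * \<gamma> + 1/2 - 1))"
    unfolding sub_sum_mult_left using incr_const_pos holder_const(1) \<gamma> by (intro mult_left_mono sub_sum_powr_le[OF \<Delta>]) auto
  finally show ?thesis by (simp add: algebra_simps)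
qed

text \<open>The norm involves T times its adjoint, in this order, so it is the adjoint that acts on
  the vacuum.\<close>

lemma L2_state_norm_eq:
  assumes "T \<in> cops"
  shows "L2_state_norm (vacuum_state tens) T = norm (blinfun_apply (adj T) vacuum)"
proof -
  have "cinner vacuum (blinfun_apply T (blinfun_apply (adj T) vacuum)) = cinner (blinfun_apply (adj T) vacuum) (blinfun_apply (adj T) vacuum)"
    by (rule adj_cinner'[OF assms, symmetric])
  then show ?thesis by (simp add: L2_state_norm_def vacuum_state_def cinner_self)
qed

lemma sum_cops:
  assumes \<Delta>: "\<Delta> \<in> subdivisions s t"
  shows "trapezoidal_sum bm U \<Delta> \<in> cops" "corrected_sum bm U U1 U2 \<Delta> \<in> cops" "sub_sum trap_rest \<Delta> \<in> cops"
    "sub_sum (\<lambda>u v. (1/2) *\<^sub>R sharp \<A> (Ub (u, v)) (incr u v)) \<Delta> \<in> cops"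
proof -
  have in_st: "\<Delta> ! i \<in> {s..t}" "\<Delta> ! Suc i \<in> {s..t}" "s \<le> \<Delta> ! i" "\<Delta> ! i \<le> \<Delta> ! Suc i" "\<Delta> ! Suc i \<le> t" if "Suc i < length \<Delta>" for i
    using subdivision_cell[OF \<Delta> that] by auto
  show "trapezoidal_sum bm U \<Delta> \<in> cops"
    unfolding trapezoidal_sum_def Let_def
    using in_st by (intro cops_sum cops_intros(6) sharp_cops incr_cops sharp_tensor_add(1)[OF incr_cops] tensors) auto
  show "corrected_sum bm U U1 U2 \<Delta> \<in> cops"
    unfolding corrected_sum_eq[OF \<Delta>] sub_sum_def cell_def
    by (intro cops_sum cops_intros(3) sharp_cops incr_cops insert_slot_cops[OF slot_map_levy]
        insert_slot_cops[OF slot_map_adj[OF slot_map_levy]] tensors) (use in_st in auto)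
  show "sub_sum trap_rest \<Delta> \<in> cops"
    unfolding sub_sum_def using in_st by (intro cops_sum filtration_cops[OF trap_rest_filtration]) auto
  show "sub_sum (\<lambda>u v. (1/2) *\<^sub>R sharp \<A> (Ub (u, v)) (incr u v)) \<Delta> \<in> cops"
    unfolding sub_sum_def using in_st by (intro cops_sum cops_intros(6) sharp_cops incr_cops remainder_tensor) auto
qed

theorem trapezoidal_sum_tendsto:
  "((\<lambda>\<Delta>. L2_state_norm (vacuum_state tens) (trapezoidal_sum bm U \<Delta> - rough_integral bm s t U U1 U2)) \<longlongrightarrow> 0) (mesh_to_0 s t)"
proof -
  define I where "I = rough_integral bm s t U U1 U2"
  note conv = corrected_sum_converges[folded I_def]
  have ev: "eventually (\<lambda>\<Delta>. \<Delta> \<in> subdivisions s t) (mesh_to_0 s t)"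
    unfolding mesh_to_0_def by (simp add: eventually_inf_principal)
  have Ic: "I \<in> cops"
    by (rule Lim_in_closed_set[OF closed_cops eventually_mono[OF ev sum_cops(2)] mesh_to_0_neq_bot[OF s_less_t] conv])
  \<comment> \<open>The first summand bounds the operator norm of the remainder sum; the second is
    the square root of the bound obtained from orthogonality. Their exponents are positive because
    \<gamma> > 1/4.\<close>
  define g where "g h = incr_const * holder_const * (t - s) * h powr (2 * \<gamma> - 1/2) + sqrt ((levy_const * slot_bound)\<^sup>2 * (t - s) * h powr (1/2))" for h
  have g: "(g \<longlongrightarrow> 0) (at_right 0)"
  proof -
    have "(g \<longlongrightarrow> 0 + sqrt 0) (at_right 0)"
      unfolding g_def[abs_def] using \<gamma> by (intro tendsto_add tendsto_real_sqrt tendsto_powr_at_right_0) auto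
    then show ?thesis by simp
  qed
  have bound: "norm (blinfun_apply (adj (trapezoidal_sum bm U \<Delta> - corrected_sum bm U U1 U2 \<Delta>)) vacuum) \<le> g (mesh \<Delta>)"
    if \<Delta>: "\<Delta> \<in> subdivisions s t" for \<Delta>
  proof -
    let ?E = "sub_sum (\<lambda>u v. (1/2) *\<^sub>R sharp \<A> (Ub (u, v)) (incr u v)) \<Delta>" and ?D = "sub_sum trap_rest \<Delta>"
    note c = sum_cops(4,3)[OF \<Delta>]
    have "norm (blinfun_apply (adj ?E) vacuum) \<le> norm (adj ?E) * norm vacuum" by (rule norm_blinfun)
    also have "\<dots> \<le> incr_const * holder_const * ((t - s) * mesh \<Delta> powr (2 * \<gamma> - 1/2))"
      using norm_sum_remainder_le[OF \<Delta>] norm_adj[OF c(1)] norm_vacuum by simp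
    finally have 1: "norm (blinfun_apply (adj ?E) vacuum) \<le> incr_const * holder_const * (t - s) * mesh \<Delta> powr (2 * \<gamma> - 1/2)"
      by (simp only: mult.assoc)
    have 2: "norm (blinfun_apply (adj ?D) vacuum) \<le> sqrt ((levy_const * slot_bound)\<^sup>2 * (t - s) * mesh \<Delta> powr (1/2))"
      using norm_sum_trap_rest_le[OF \<Delta>] by (intro real_le_rsqrt) (simp only: mult.assoc)
    show ?thesis
      unfolding trapezoidal_sum_eq[OF \<Delta>] adj_simps(1)[OF c] blinfun.add_left g_def by (rule norm_triangle_mono[OF 1 2])
  qed
  have l1: "((\<lambda>\<Delta>. blinfun_apply (adj (trapezoidal_sum bm U \<Delta> - corrected_sum bm U U1 U2 \<Delta>)) vacuum) \<longlongrightarrow> 0) (mesh_to_0 s t)"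
    by (rule tendsto_mesh_to_0[OF _ g]) (use bound in simp)
  have l2: "((\<lambda>\<Delta>. norm (corrected_sum bm U U1 U2 \<Delta> - I)) \<longlongrightarrow> 0) (mesh_to_0 s t)"
    using tendsto_norm[OF LIM_zero[OF conv]] by simp
  have "((\<lambda>\<Delta>. norm (blinfun_apply (adj (trapezoidal_sum bm U \<Delta> - corrected_sum bm U U1 U2 \<Delta>)) vacuum) + norm (corrected_sum bm U U1 U2 \<Delta> - I))
      \<longlongrightarrow> 0) (mesh_to_0 s t)"
    using tendsto_add[OF tendsto_norm[OF l1] l2] by simp
  then show ?thesis unfolding I_def[symmetric]
  proof (rule Lim_null_comparison[rotated], intro eventually_mono[OF ev])
    fix \<Delta> assume \<Delta>: "\<Delta> \<in> subdivisions s t"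
    define T S where "T = trapezoidal_sum bm U \<Delta>" and "S = corrected_sum bm U U1 U2 \<Delta>"
    have c: "T \<in> cops" "S \<in> cops" using sum_cops[OF \<Delta>] by (simp_all add: T_def S_def)
    then have c': "T - S \<in> cops" "S - I \<in> cops" "T - I \<in> cops" using Ic by (auto intro: cops_intros)
    have "adj (T - I) = adj (T - S) + adj (S - I)" using adj_simps(1)[OF c'(1,2)] by simp
    then have "norm (blinfun_apply (adj (T - I)) vacuum) \<le> norm (blinfun_apply (adj (T - S)) vacuum) + norm (blinfun_apply (adj (S - I)) vacuum)"
      by (simp add: blinfun.add_left norm_triangle_ineq)
    also have "norm (blinfun_apply (adj (S - I)) vacuum) \<le> norm (S - I)"
      using norm_blinfun[of "adj (S - I)" vacuum] norm_adj[OF c'(2)] norm_vacuum by simp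
    finally show "norm (L2_state_norm (vacuum_state tens) (T - I)) \<le> norm (blinfun_apply (adj (T - S)) vacuum) + norm (S - I)"
      unfolding L2_state_norm_eq[OF c'(3)] by simp
  qed
qed

end

theorem corollary4p10:
  fixes q \<gamma> s t :: real
    and tens :: "(real \<Rightarrow> complex) list \<Rightarrow> 'h::complex_hilbert_space"
    and X :: "real \<Rightarrow> 'h oper"
    and U U1 U2 :: "real \<Rightarrow> 'h tensor"
    and Ub :: "real \<times> real \<Rightarrow> 'h tensor"
  assumes "0 \<le> q" "q < 1"
    and "q_fock_space q tens"
    and "X = q_brownian tens"
    and "1 / 3 < \<gamma>" "\<gamma> < 1 / 2"
    and "0 \<le> s" "s < t"
    and "controlled_biprocess X \<gamma> {s..t} U U1 U2 Ub"
  shows "((\<lambda>\<Delta>. L2_state_norm (vacuum_state tens)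
              (trapezoidal_sum X U \<Delta> - rough_integral X s t U U1 U2)) \<longlongrightarrow> 0) (mesh_to_0 s t)"
proof -
  \<comment> \<open>The dyadic time horizon depends on \<open>t\<close> only, so it can be fixed
    before the constructions that use it.\<close>
  obtain L where L: "t < 2 ^ L" using real_arch_pow[of 2 t] by auto
  interpret q_brownian_motion q tens L by unfold_locales (use assms in auto)
  have X: "X = bm" using assms(4) q_brownian_eq by simp
  interpret controlled_integrand q tens L \<gamma> s t U U1 U2 Ub
    by unfold_locales (use assms L X in auto)
  show ?thesis unfolding X by (rule trapezoidal_sum_tendsto)
qed

end
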